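(* Let $\alpha\in\mathbb{R}$ and let $\mathcal{L}_{\mathbf{A}}$ be the Aharonov–Bohm type operator on $\mathbb{R}^4$ defined in the context. Then there exists a constant $C$ such that the integral kernel of the heat semigroup satisfies $$\big|e^{-t\mathcal{L}_{\mathbf{A}}}(x,y)\big|\leq C\,t^{-2}e^{-\frac{|x-y|^2}{4t}},\qquad t>0.$$
   Context: For $x=(x_1,x_2,x_3,x_4)\in\mathbb{R}^4$ with $(x_1,x_2)\neq(0,0)$ let $$\mathbf{A}(x)=\alpha\left(-\frac{x_2}{x_1^2+x_2^2},\frac{x_1}{x_1^2+x_2^2},0,0\right),\qquad \mathcal{L}_{\mathbf{A}}=(-i\nabla+\mathbf{A}(x))^2,$$ where $\mathcal{L}_{\mathbf{A}}$ is the nonnegative self-adjoint operator on $L^2(\mathbb{R}^4)$ obtained as the Friedrichs extension from $C_c^\infty(\mathbb{R}^4\setminus\{x_1=x_2=0\})$. The bound holds for (almost) all $x,y\in\mathbb{R}^4$, with $C$ independent of $t,x,y$. *)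

theory Defs
  imports "HOL-Analysis.Analysis"
begin

definition square_integrable :: "('a::euclidean_space \<Rightarrow> complex) \<Rightarrow> bool" where
  "square_integrable f \<longleftrightarrow>
     f \<in> borel_measurable borel \<and> integrable lborel (\<lambda>x. (cmod (f x))\<^sup>2)"

lemma square_integrable_zero: "square_integrable (\<lambda>x. 0)"
  by (simp add: square_integrable_def)

lemma borel_measurable_cnj [measurable (raw)]:
  assumes "f \<in> borel_measurable M"
  shows "(\<lambda>x. cnj (f x)) \<in> borel_measurable M"
  using assms by (rule borel_measurable_continuous_on[rotated]) (intro continuous_intros)

lemma square_integrable_mult_cnj:
  assumes "square_integrable f" "square_integrable g"
  shows "integrable lborel (\<lambda>x. f x * cnj (g x))"
proof (rule Bochner_Integration.integrable_bound)
  show "integrable lborel (\<lambda>x. (cmod (f x))\<^sup>2 + (cmod (g x))\<^sup>2)"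
    using assms by (simp add: square_integrable_def)
  show "(\<lambda>x. f x * cnj (g x)) \<in> borel_measurable lborel"
    using assms by (auto simp: square_integrable_def)
  show "AE x in lborel. cmod (f x * cnj (g x)) \<le> norm ((cmod (f x))\<^sup>2 + (cmod (g x))\<^sup>2)"
  proof (rule AE_I2)
    fix x
    have "2 * cmod (f x) * cmod (g x) \<le> (cmod (f x))\<^sup>2 + (cmod (g x))\<^sup>2"
      by (rule sum_squares_bound)
    moreover have "0 \<le> cmod (f x) * cmod (g x)"
      by simp
    ultimately have "cmod (f x) * cmod (g x) \<le> (cmod (f x))\<^sup>2 + (cmod (g x))\<^sup>2"
      by linarith
    then show "cmod (f x * cnj (g x)) \<le> norm ((cmod (f x))\<^sup>2 + (cmod (g x))\<^sup>2)"
      by (simp add: norm_mult)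
  qed
qed

lemma square_integrable_cmult:
  assumes "square_integrable f"
  shows "square_integrable (\<lambda>x. c * f x)"
  using assms by (auto simp: square_integrable_def norm_mult power_mult_distrib)

lemma square_integrable_add:
  assumes "square_integrable f" "square_integrable g"
  shows "square_integrable (\<lambda>x. f x + g x)"
  unfolding square_integrable_def
proof
  show "(\<lambda>x. f x + g x) \<in> borel_measurable borel"
    using assms by (auto simp: square_integrable_def)
  have eq: "(cmod (f x + g x))\<^sup>2
      = (cmod (f x))\<^sup>2 + 2 * Re (f x * cnj (g x)) + (cmod (g x))\<^sup>2" for x
    unfolding cmod_power2 by (simp add: power2_eq_square algebra_simps)
  have "integrable lborel (\<lambda>x. Re (f x * cnj (g x)))"
    using square_integrable_mult_cnj[OF assms] by (rule integrable_Re)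
  then show "integrable lborel (\<lambda>x. (cmod (f x + g x))\<^sup>2)"
    unfolding eq using assms
    by (intro Bochner_Integration.integrable_add integrable_mult_right)
      (simp_all add: square_integrable_def)
qed

quotient_type (overloaded) 'a L2 = "'a::euclidean_space \<Rightarrow> complex" / partial:
  "\<lambda>f g. square_integrable f \<and> square_integrable g \<and> (AE x in lborel. f x = g x)"
proof (rule part_equivpI)
  show "\<exists>f::'a \<Rightarrow> complex.
      square_integrable f \<and> square_integrable f \<and> (AE x in lborel. f x = f x)"
    using square_integrable_zero by auto
next
  show "symp (\<lambda>(f::'a \<Rightarrow> complex) g.
      square_integrable f \<and> square_integrable g \<and> (AE x in lborel. f x = g x))"
    by (auto intro!: sympI)
next
  show "transp (\<lambda>(f::'a \<Rightarrow> complex) g.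
      square_integrable f \<and> square_integrable g \<and> (AE x in lborel. f x = g x))"
    by (rule transpI) (auto elim: AE_mp[OF AE_conjI])
qed

lift_definition cscale_L2 :: "complex \<Rightarrow> 'a::euclidean_space L2 \<Rightarrow> 'a L2"
  is "\<lambda>c f x. c * f x"
  by (auto intro: square_integrable_cmult)

text \<open>The inner product is linear in its first argument.\<close>

lift_definition cinner_L2 :: "'a::euclidean_space L2 \<Rightarrow> 'a L2 \<Rightarrow> complex"
  is "\<lambda>f g. \<integral>x. f x * cnj (g x) \<partial>lborel"
proof -
  fix f f' g g' :: "'a \<Rightarrow> complex"
  assume 1: "square_integrable f \<and> square_integrable f' \<and> (AE x in lborel. f x = f' x)"
    and 2: "square_integrable g \<and> square_integrable g' \<and> (AE x in lborel. g x = g' x)"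
  show "(\<integral>x. f x * cnj (g x) \<partial>lborel) = (\<integral>x. f' x * cnj (g' x) \<partial>lborel)"
  proof (rule integral_cong_AE)
    show "AE x in lborel. f x * cnj (g x) = f' x * cnj (g' x)"
      using 1[THEN conjunct2, THEN conjunct2] 2[THEN conjunct2, THEN conjunct2] by eventually_elim simp
  qed (use 1 2 in \<open>auto simp: square_integrable_def\<close>)
qed

instantiation L2 :: (euclidean_space) real_vector
begin

lift_definition zero_L2 :: "'a L2" is "\<lambda>x. 0"
  by (auto intro: square_integrable_zero)

lift_definition plus_L2 :: "'a L2 \<Rightarrow> 'a L2 \<Rightarrow> 'a L2" is "\<lambda>f g x. f x + g x"
  by (auto intro: square_integrable_add elim!: AE_mp)

definition uminus_L2 :: "'a L2 \<Rightarrow> 'a L2" where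
  "- f = cscale_L2 (-1) f"

definition minus_L2 :: "'a L2 \<Rightarrow> 'a L2 \<Rightarrow> 'a L2" where
  "f - g = f + (- g :: 'a L2)"

definition scaleR_L2 :: "real \<Rightarrow> 'a L2 \<Rightarrow> 'a L2" where
  "r *\<^sub>R f = cscale_L2 (of_real r) f"

instance
proof
  fix f g h :: "'a L2" and r s :: real
  show "f + g + h = f + (g + h)"
    by transfer (auto intro: square_integrable_add simp: add.assoc)
  show "f + g = g + f"
    by transfer (auto intro: square_integrable_add simp: add.commute)
  show "0 + f = f"
    by transfer auto
  show "- f + f = 0"
    unfolding uminus_L2_def
    by transfer (auto intro: square_integrable_add square_integrable_cmult square_integrable_zero
                   simp del: mult_minus_left)
  show "f - g = f + - g"
    by (rule minus_L2_def)
  show "r *\<^sub>R (f + g) = r *\<^sub>R f + r *\<^sub>R g"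
    unfolding scaleR_L2_def
    by transfer (auto intro!: square_integrable_add square_integrable_cmult simp: distrib_left)
  show "(r + s) *\<^sub>R f = r *\<^sub>R f + s *\<^sub>R f"
    unfolding scaleR_L2_def
    by transfer (auto simp: distrib_right intro!: square_integrable_add square_integrable_cmult)
  show "r *\<^sub>R s *\<^sub>R f = (r * s) *\<^sub>R f"
    unfolding scaleR_L2_def
    by transfer (auto simp: mult.assoc intro!: square_integrable_cmult)
  show "1 *\<^sub>R f = f"
    unfolding scaleR_L2_def by transfer auto
qed

end

instantiation L2 :: (euclidean_space) real_inner
begin

definition inner_L2 :: "'a L2 \<Rightarrow> 'a L2 \<Rightarrow> real" where
  "f \<bullet> g = Re (cinner_L2 f g)"

definition norm_L2 :: "'a L2 \<Rightarrow> real" where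
  "norm f = sqrt (f \<bullet> (f :: 'a L2))"

definition dist_L2 :: "'a L2 \<Rightarrow> 'a L2 \<Rightarrow> real" where
  "dist f g = norm (f - g :: 'a L2)"

definition sgn_L2 :: "'a L2 \<Rightarrow> 'a L2" where
  "sgn f = f /\<^sub>R norm (f :: 'a L2)"

definition uniformity_L2 :: "('a L2 \<times> 'a L2) filter" where
  "uniformity_L2 = (INF e\<in>{0<..}. principal {(f, g). dist f g < e})"

definition open_L2 :: "'a L2 set \<Rightarrow> bool" where
  "open_L2 U = (\<forall>f\<in>U. eventually (\<lambda>(f', g). f' = f \<longrightarrow> g \<in> U) uniformity)"

instance
proof
  fix f g h :: "'a L2" and r s :: real and U :: "'a L2 set"
  show "dist f g = norm (f - g)"
    by (rule dist_L2_def)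
  show "sgn f = f /\<^sub>R norm f"
    by (rule sgn_L2_def)
  show "uniformity = (INF e\<in>{0<..}. principal {(f :: 'a L2, g). dist f g < e})"
    by (rule uniformity_L2_def)
  show "open U = (\<forall>f\<in>U. eventually (\<lambda>(f', g). f' = f \<longrightarrow> g \<in> U) uniformity)"
    by (rule open_L2_def)
  show "norm f = sqrt (f \<bullet> f)"
    by (rule norm_L2_def)
  show "f \<bullet> g = g \<bullet> f"
    unfolding inner_L2_def
  proof transfer
    fix f g :: "'a \<Rightarrow> complex"
    assume *: "square_integrable f \<and> square_integrable f \<and> (AE x in lborel. f x = f x)"
      "square_integrable g \<and> square_integrable g \<and> (AE x in lborel. g x = g x)"
    have "Re (\<integral>x. f x * cnj (g x) \<partial>lborel) = (\<integral>x. Re (f x * cnj (g x)) \<partial>lborel)"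
      using * by (intro integral_Re[symmetric] square_integrable_mult_cnj) auto
    also have "\<dots> = (\<integral>x. Re (g x * cnj (f x)) \<partial>lborel)"
      by (simp add: algebra_simps)
    also have "\<dots> = Re (\<integral>x. g x * cnj (f x) \<partial>lborel)"
      using * by (intro integral_Re square_integrable_mult_cnj) auto
    finally show "Re (\<integral>x. f x * cnj (g x) \<partial>lborel) = Re (\<integral>x. g x * cnj (f x) \<partial>lborel)" .
  qed
  show "(f + g) \<bullet> h = f \<bullet> h + g \<bullet> h"
    unfolding inner_L2_def
    by transfer (simp add: distrib_right square_integrable_mult_cnj)
  show "(r *\<^sub>R f) \<bullet> g = r * (f \<bullet> g)"
    unfolding inner_L2_def scaleR_L2_def
    by transfer (simp add: mult.assoc)
  have sq: "Re (cinner_L2 f f) \<ge> 0 \<and> (Re (cinner_L2 f f) = 0 \<longleftrightarrow> f = 0)"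
  proof transfer
    fix f :: "'a \<Rightarrow> complex"
    assume *: "square_integrable f \<and> square_integrable f \<and> (AE x in lborel. f x = f x)"
    have eq: "f x * cnj (f x) = of_real ((cmod (f x))\<^sup>2)" for x
      by (simp add: complex_norm_square[symmetric])
    have i: "Re (\<integral>x. f x * cnj (f x) \<partial>lborel) = (\<integral>x. (cmod (f x))\<^sup>2 \<partial>lborel)"
      unfolding eq integral_complex_of_real by simp
    have "(\<integral>x. (cmod (f x))\<^sup>2 \<partial>lborel) = 0 \<longleftrightarrow> (AE x in lborel. (cmod (f x))\<^sup>2 = 0)"
      using * by (intro integral_nonneg_eq_0_iff_AE) (auto simp: square_integrable_def)
    then show "Re (\<integral>x. f x * cnj (f x) \<partial>lborel) \<ge> 0 \<and>
      (Re (\<integral>x. f x * cnj (f x) \<partial>lborel) = 0 \<longleftrightarrow>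
        (square_integrable f \<and> square_integrable (\<lambda>x::'a. 0) \<and> (AE x in lborel. f x = 0)))"
      using * by (simp add: i square_integrable_zero)
  qed
  show "0 \<le> f \<bullet> f" "(f \<bullet> f = 0) = (f = 0)"
    using sq by (auto simp: inner_L2_def)
qed

end

text \<open>Unbounded operators are represented by their graphs.\<close>

type_synonym 'a operator = "('a L2 \<times> 'a L2) set"

definition quadratic_form :: "'a::euclidean_space operator \<Rightarrow> 'a L2 \<Rightarrow> 'a L2 \<Rightarrow> complex" where
  "quadratic_form S u v = cinner_L2 (THE f. (u, f) \<in> S) v"

definition form_converges ::
    "'a::euclidean_space operator \<Rightarrow> (nat \<Rightarrow> 'a L2) \<Rightarrow> 'a L2 \<Rightarrow> bool" where
  "form_converges S \<phi> u \<longleftrightarrow>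
     (\<forall>n. \<phi> n \<in> Domain S) \<and> \<phi> \<longlonglongrightarrow> u \<and>
     (\<forall>\<epsilon>>0. \<exists>N. \<forall>m\<ge>N. \<forall>n\<ge>N. cmod (quadratic_form S (\<phi> m - \<phi> n) (\<phi> m - \<phi> n)) < \<epsilon>)"

definition form_domain :: "'a::euclidean_space operator \<Rightarrow> 'a L2 set" where
  "form_domain S = {u. \<exists>\<phi>. form_converges S \<phi> u}"

definition closed_form :: "'a::euclidean_space operator \<Rightarrow> 'a L2 \<Rightarrow> 'a L2 \<Rightarrow> complex" where
  "closed_form S u v =
     (THE z. \<forall>\<phi> \<psi>. form_converges S \<phi> u \<longrightarrow> form_converges S \<psi> v \<longrightarrow>
        (\<lambda>n. quadratic_form S (\<phi> n) (\<psi> n)) \<longlonglongrightarrow> z)"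

text \<open>For a densely defined, symmetric, nonnegative operator \<open>S\<close> the form
  \<open>(u, v) \<mapsto> \<langle>S u, v\<rangle>\<close> is closable. Its Friedrichs extension is the operator associated
  with the closure of that form; closability makes the limit in \<open>closed_form\<close> independent
  of the approximating sequences.\<close>

definition friedrichs_extension :: "'a::euclidean_space operator \<Rightarrow> 'a operator" where
  "friedrichs_extension S =
     {(u, f). u \<in> form_domain S \<and> (\<forall>v\<in>form_domain S. closed_form S u v = cinner_L2 f v)}"

definition C0_semigroup ::
    "(real \<Rightarrow> 'a::euclidean_space L2 \<Rightarrow> 'a L2) \<Rightarrow> bool" where
  "C0_semigroup T \<longleftrightarrow>
     (\<forall>t\<ge>0. bounded_linear (T t) \<and> (\<forall>c f. T t (cscale_L2 c f) = cscale_L2 c (T t f))) \<and>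
     (\<forall>f. T 0 f = f) \<and>
     (\<forall>s\<ge>0. \<forall>t\<ge>0. \<forall>f. T (s + t) f = T s (T t f)) \<and>
     (\<forall>f. ((\<lambda>t. T t f) \<longlongrightarrow> f) (at_right 0))"

definition generator ::
    "(real \<Rightarrow> 'a::euclidean_space L2 \<Rightarrow> 'a L2) \<Rightarrow> 'a operator" where
  "generator T = {(f, g). ((\<lambda>h. (T h f - f) /\<^sub>R h) \<longlongrightarrow> g) (at_right 0)}"

text \<open>\<open>exp_semigroup L t\<close> is \<open>e\<^sup>-\<^sup>t\<^sup>L\<close> for \<open>t \<ge> 0\<close>: a strongly continuous semigroup is
  determined on \<open>[0, \<infinity>)\<close> by its generator, here \<open>-L\<close>. The description is of the value at
  \<open>t\<close> because \<open>C0_semigroup\<close> leaves negative times unconstrained.\<close>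

definition exp_semigroup ::
    "'a::euclidean_space operator \<Rightarrow> real \<Rightarrow> 'a L2 \<Rightarrow> 'a L2" where
  "exp_semigroup L t f =
     (THE g. \<exists>T. C0_semigroup T \<and> generator T = (\<lambda>(u, w). (u, - w)) ` L \<and> g = T t f)"

text \<open>The choice of representatives made by \<open>rep_L2\<close> is immaterial: changing them on a null
  set alters neither the integrals nor the almost-everywhere equality.\<close>

definition is_integral_kernel ::
    "('a::euclidean_space L2 \<Rightarrow> 'a L2) \<Rightarrow> ('a \<Rightarrow> 'a \<Rightarrow> complex) \<Rightarrow> bool" where
  "is_integral_kernel T k \<longleftrightarrow>
     (\<lambda>(x, y). k x y) \<in> borel_measurable (borel \<Otimes>\<^sub>M borel) \<and>
     (\<forall>f. AE x in lborel.
        integrable lborel (\<lambda>y. k x y * rep_L2 f y) \<and>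
        rep_L2 (T f) x = (\<integral>y. k x y * rep_L2 f y \<partial>lborel))"

text \<open>\<open>smooth\<close> asks every iterated partial derivative to be Frechet differentiable everywhere,
  hence continuous, which is \<open>C\<^sup>\<infinity>\<close>. On \<open>x\<^sub>1 = x\<^sub>2 = 0\<close> the potential takes the junk value
  \<open>0\<close>, but it only ever acts on functions vanishing near that set.\<close>

definition partial_deriv :: "4 \<Rightarrow> (real^4 \<Rightarrow> complex) \<Rightarrow> real^4 \<Rightarrow> complex" where
  "partial_deriv j f x = frechet_derivative f (at x) (axis j 1)"

definition smooth :: "(real^4 \<Rightarrow> complex) \<Rightarrow> bool" where
  "smooth f \<longleftrightarrow> (\<forall>js x. foldr partial_deriv js f differentiable (at x))"

definition test_functions :: "(real^4 \<Rightarrow> complex) set" where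
  "test_functions =
     {\<phi>. smooth \<phi> \<and> compact (closure {x. \<phi> x \<noteq> 0}) \<and>
         closure {x. \<phi> x \<noteq> 0} \<subseteq> - {x. x $ 1 = 0 \<and> x $ 2 = 0}}"

definition vector_potential :: "real \<Rightarrow> real^4 \<Rightarrow> real^4" where
  "vector_potential \<alpha> x =
     \<alpha> *\<^sub>R (\<chi> j. if j = 1 then - (x $ 2 / ((x $ 1)\<^sup>2 + (x $ 2)\<^sup>2))
               else if j = 2 then x $ 1 / ((x $ 1)\<^sup>2 + (x $ 2)\<^sup>2)
               else 0)"

definition magnetic_deriv :: "real \<Rightarrow> 4 \<Rightarrow> (real^4 \<Rightarrow> complex) \<Rightarrow> real^4 \<Rightarrow> complex" where
  "magnetic_deriv \<alpha> j \<phi> x = - \<i> * partial_deriv j \<phi> x + of_real (vector_potential \<alpha> x $ j) * \<phi> x"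

definition minimal_AB_operator :: "real \<Rightarrow> (real^4) operator" where
  "minimal_AB_operator \<alpha> =
     {(abs_L2 \<phi>, abs_L2 (\<lambda>x. \<Sum>j\<in>UNIV. magnetic_deriv \<alpha> j (magnetic_deriv \<alpha> j \<phi>) x)) | \<phi>.
        \<phi> \<in> test_functions}"

definition AB_operator :: "real \<Rightarrow> (real^4) operator" where
  "AB_operator \<alpha> = friedrichs_extension (minimal_AB_operator \<alpha>)"

end

theory Submission
  imports Defs "HOL-Real_Asymp.Real_Asymp"
begin

text \<open>The kernel bound follows from the diamagnetic domination of the resolvents. The resolvent
  \<open>(1 + \<tau> L)\<^sup>-\<^sup>1 f\<close> of the Friedrichs extension is the limit of every minimizing sequence, in
  the space of test functions, of \<open>\<tau> q(\<phi>) + \<parallel>\<phi> - f\<parallel>\<^sup>2\<close>. If \<open>w > 0\<close> is smooth and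
  \<open>\<bar>f\<bar> \<le> w - \<tau> \<Delta> w\<close>, then writing \<open>\<phi> = w \<psi>\<close> and truncating \<open>\<psi>\<close> smoothly to the unit disc
  increases the functional by an arbitrarily small amount only, whence
  \<open>\<bar>(1 + \<tau> L)\<^sup>-\<^sup>1 f\<bar> \<le> w\<close>. With \<open>G\<^sub>s(x) = s ^ - 2 exp (- \<bar>x\<bar>\<^sup>2 / 4s)\<close> the functions
  \<open>G\<^sub>\<delta>\<^sub>+\<^sub>n\<^sub>\<tau>(x - y) + n \<kappa> \<tau>\<^sup>2\<close> can serve as successive weights, since the constant absorbs the
  Taylor error of the implicit Euler step; letting \<open>\<tau> \<rightarrow> 0\<close>, \<open>\<bar>f\<bar> \<le> G\<^sub>\<delta>(x - y)\<close> implies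
  \<open>\<bar>exp (- t L) f\<bar> \<le> G\<^sub>\<delta>\<^sub>+\<^sub>t(x - y)\<close>. Applied to indicator functions of dyadic cells of side
  \<open>\<surd>\<delta>\<close> this bounds the kernel averaged over cells; these averages form a martingale, whose limit
  is the kernel.\<close>

section \<open>The Hilbert space of square integrable functions\<close>

text \<open>The Friedrichs domain is accessible only through limits, so all calculus stays on test
  functions; the singular potential enters solely by being real and smooth off the flux plane. The
  order of limits matters: the Euler error constant \<open>\<kappa> = 4 / \<delta>^4\<close> blows
  up as \<delta> tends to 0, so \<tau> tends to 0 with \<delta> fixed, where
  \<open>n * \<tau>\<close> stays near t and \<open>n * \<kappa> * \<tau>^2\<close> vanishes; only
  the resulting semigroup estimate, free of \<kappa>, is used for small \<delta>. The constant C is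
  \<open>exp (1/4)\<close>: in dimension four a cell of side \<open>sqrt \<delta>\<close> has half
  diagonal \<open>sqrt \<delta>\<close>, hence its indicator lies below
  \<open>exp (1/4) * \<delta>^2 * gauss \<delta>\<close> centred at its midpoint. Because
  \<open>exp_semigroup\<close> is a definite description over all C0 semigroups, the constructed
  contraction semigroup must be shown to be the only one with its generator, against competitors
  that come without any norm bound. The claim concerns every representing kernel, so the
  construction of one good kernel is complemented by uniqueness almost everywhere.\<close>

lemma square_integrable_rep_L2: "square_integrable (rep_L2 f)"
  using Quotient_rep_reflp[OF Quotient_L2] by blast

lemma abs_rep_L2: "abs_L2 (rep_L2 f) = f"
  by (rule Quotient_abs_rep[OF Quotient_L2])

lemma rep_abs_L2:
  assumes "square_integrable f"
  shows "AE x in lborel. rep_L2 (abs_L2 f) x = f x"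
  using Quotient_rep_abs[OF Quotient_L2, of f] assms by auto

lemma abs_L2_cong_AE:
  assumes "square_integrable f" "square_integrable g" "AE x in lborel. f x = g x"
  shows "abs_L2 f = abs_L2 g"
  using Quotient_rel_abs[OF Quotient_L2, of f g] assms by auto

lemma L2_eqI_AE:
  assumes "AE x in lborel. rep_L2 f x = rep_L2 g x"
  shows "f = g"
  using abs_L2_cong_AE[OF square_integrable_rep_L2 square_integrable_rep_L2 assms]
  by (simp add: abs_rep_L2)

lemma borel_measurable_rep_L2 [measurable]: "rep_L2 f \<in> borel_measurable borel"
  using square_integrable_rep_L2[of f] by (simp add: square_integrable_def)

lemma abs_L2_add:
  assumes "square_integrable f" "square_integrable g"
  shows "abs_L2 f + abs_L2 g = abs_L2 (\<lambda>x. f x + g x)"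
  using assms by (intro plus_L2.abs_eq) auto

lemma abs_L2_cscale:
  assumes "square_integrable f"
  shows "cscale_L2 c (abs_L2 f) = abs_L2 (\<lambda>x. c * f x)"
  using assms by (intro cscale_L2.abs_eq) auto

lemma abs_L2_zero: "abs_L2 (\<lambda>x. 0) = 0"
  by (simp add: zero_L2.abs_eq)

lemma abs_L2_scaleR:
  assumes "square_integrable f"
  shows "r *\<^sub>R abs_L2 f = abs_L2 (\<lambda>x. of_real r * f x)"
  by (simp add: scaleR_L2_def abs_L2_cscale[OF assms])

lemma square_integrable_diff:
  assumes "square_integrable f" "square_integrable g"
  shows "square_integrable (\<lambda>x. f x - g x)"
  using square_integrable_add[OF assms(1) square_integrable_cmult[OF assms(2), of "-1"]] by simp

lemma abs_L2_diff:
  assumes "square_integrable f" "square_integrable g"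
  shows "abs_L2 f - abs_L2 g = abs_L2 (\<lambda>x. f x - g x)"
  unfolding minus_L2_def uminus_L2_def abs_L2_cscale[OF assms(2)]
  using abs_L2_add[OF assms(1) square_integrable_cmult[OF assms(2), of "-1"]] by simp

lemma cinner_abs_L2:
  assumes "square_integrable f" "square_integrable g"
  shows "cinner_L2 (abs_L2 f) (abs_L2 g) = (\<integral>x. f x * cnj (g x) \<partial>lborel)"
  using assms by (intro cinner_L2.abs_eq) auto

lemma cinner_rep_L2: "cinner_L2 f g = (\<integral>x. rep_L2 f x * cnj (rep_L2 g x) \<partial>lborel)"
  using cinner_abs_L2[OF square_integrable_rep_L2 square_integrable_rep_L2, of f g]
  by (simp add: abs_rep_L2)

lemma rep_L2_add: "AE x in lborel. rep_L2 (f + g) x = rep_L2 f x + rep_L2 g x"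
proof -
  have "f + g = abs_L2 (\<lambda>x. rep_L2 f x + rep_L2 g x)"
    using abs_L2_add[OF square_integrable_rep_L2 square_integrable_rep_L2, of f g] by (simp add: abs_rep_L2)
  then show ?thesis
    using rep_abs_L2[OF square_integrable_add[OF square_integrable_rep_L2 square_integrable_rep_L2], of f g] by simp
qed

lemma rep_L2_diff: "AE x in lborel. rep_L2 (f - g) x = rep_L2 f x - rep_L2 g x"
proof -
  have "f - g = abs_L2 (\<lambda>x. rep_L2 f x - rep_L2 g x)"
    using abs_L2_diff[OF square_integrable_rep_L2 square_integrable_rep_L2, of f g] by (simp add: abs_rep_L2)
  then show ?thesis
    using rep_abs_L2[OF square_integrable_diff[OF square_integrable_rep_L2 square_integrable_rep_L2], of f g] by simp
qed

lemma rep_L2_cscale: "AE x in lborel. rep_L2 (cscale_L2 c f) x = c * rep_L2 f x"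
proof -
  have "cscale_L2 c f = abs_L2 (\<lambda>x. c * rep_L2 f x)"
    using abs_L2_cscale[OF square_integrable_rep_L2, of c f] by (simp add: abs_rep_L2)
  then show ?thesis
    using rep_abs_L2[OF square_integrable_cmult[OF square_integrable_rep_L2], of c f] by simp
qed

lemma rep_L2_zero: "AE x in lborel. rep_L2 0 x = 0"
  using rep_abs_L2[OF square_integrable_zero] by (simp add: abs_L2_zero)

lemma integrable_rep_L2_sq: "integrable lborel (\<lambda>x. (cmod (rep_L2 f x))\<^sup>2)"
  using square_integrable_rep_L2[of f] by (simp add: square_integrable_def)

lemma norm_L2_sq: "(norm f)\<^sup>2 = (\<integral>x. (cmod (rep_L2 f x))\<^sup>2 \<partial>lborel)"
proof -
  have eq: "z * cnj z = of_real ((cmod z)\<^sup>2)" for z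
    by (simp add: complex_norm_square[symmetric])
  have "(norm f)\<^sup>2 = inner f f"
    by (simp add: norm_eq_sqrt_inner)
  also have "\<dots> = Re (\<integral>x. rep_L2 f x * cnj (rep_L2 f x) \<partial>lborel)"
    by (simp add: inner_L2_def cinner_rep_L2)
  also have "\<dots> = (\<integral>x. (cmod (rep_L2 f x))\<^sup>2 \<partial>lborel)"
    unfolding eq integral_complex_of_real by simp
  finally show ?thesis .
qed

lemma norm_abs_L2_sq:
  assumes "square_integrable f"
  shows "(norm (abs_L2 f))\<^sup>2 = (\<integral>x. (cmod (f x))\<^sup>2 \<partial>lborel)"
  unfolding norm_L2_sq
proof (rule integral_cong_AE)
  show "AE x in lborel. (cmod (rep_L2 (abs_L2 f) x))\<^sup>2 = (cmod (f x))\<^sup>2"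
    using rep_abs_L2[OF assms] by eventually_elim simp
qed (use assms in \<open>auto simp: square_integrable_def\<close>)

section \<open>The complex inner product\<close>

lemma cscale_add_right: "cscale_L2 c (f + g) = cscale_L2 c f + cscale_L2 c g"
  by transfer (auto intro!: square_integrable_add square_integrable_cmult simp: distrib_left)

lemma cscale_cscale: "cscale_L2 c (cscale_L2 d f) = cscale_L2 (c * d) f"
  by transfer (auto simp: mult.assoc intro!: square_integrable_cmult)

lemma cscale_one [simp]: "cscale_L2 1 f = f"
  by transfer auto

lemma cscale_of_real: "cscale_L2 (of_real r) f = r *\<^sub>R f"
  by (simp add: scaleR_L2_def)

lemma cscale_diff_right: "cscale_L2 c (f - g) = cscale_L2 c f - cscale_L2 c g"
  by (simp add: minus_L2_def uminus_L2_def cscale_add_right cscale_cscale mult.commute)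

lemma cinner_add_left: "cinner_L2 (f + g) h = cinner_L2 f h + cinner_L2 g h"
  by transfer (simp add: distrib_right square_integrable_mult_cnj)

lemma cinner_cscale_left: "cinner_L2 (cscale_L2 c f) h = c * cinner_L2 f h"
  by transfer (simp add: mult.assoc)

lemma cinner_commute: "cinner_L2 f g = cnj (cinner_L2 g f)"
  unfolding cinner_rep_L2 by (subst Bochner_Integration.integral_cnj[symmetric]) (simp add: mult.commute)

lemma cinner_add_right: "cinner_L2 f (g + h) = cinner_L2 f g + cinner_L2 f h"
  by (metis cinner_add_left cinner_commute complex_cnj_add)

lemma cinner_cscale_right: "cinner_L2 f (cscale_L2 c h) = cnj c * cinner_L2 f h"
  by (metis cinner_cscale_left cinner_commute complex_cnj_mult)

lemma cinner_scaleR_left: "cinner_L2 (r *\<^sub>R f) h = of_real r * cinner_L2 f h"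
  by (simp add: scaleR_L2_def cinner_cscale_left)

lemma cinner_scaleR_right: "cinner_L2 f (r *\<^sub>R h) = of_real r * cinner_L2 f h"
  by (simp add: scaleR_L2_def cinner_cscale_right)

lemma cinner_minus_left: "cinner_L2 (- f) h = - cinner_L2 f h"
  using cinner_scaleR_left[of "-1" f h] by simp

lemma cinner_minus_right: "cinner_L2 f (- h) = - cinner_L2 f h"
  using cinner_scaleR_right[of f "-1" h] by simp

lemma cinner_diff_left: "cinner_L2 (f - g) h = cinner_L2 f h - cinner_L2 g h"
  using cinner_add_left[of f "- g" h] by (simp add: cinner_minus_left)

lemma cinner_diff_right: "cinner_L2 f (g - h) = cinner_L2 f g - cinner_L2 f h"
  using cinner_add_right[of f g "- h"] by (simp add: cinner_minus_right)

lemma norm_cscale: "norm (cscale_L2 c f) = cmod c * norm (f :: 'a::euclidean_space L2)"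
proof -
  have "inner (cscale_L2 c f) (cscale_L2 c f) = (cmod c)\<^sup>2 * inner f f"
  proof -
    have "cinner_L2 (cscale_L2 c f) (cscale_L2 c f) = of_real ((cmod c)\<^sup>2) * cinner_L2 f f"
      unfolding cinner_cscale_left cinner_cscale_right complex_norm_square by (simp only: mult_ac)
    then show ?thesis unfolding inner_L2_def by simp
  qed
  then show ?thesis
    by (simp add: norm_eq_sqrt_inner real_sqrt_mult)
qed

lemma cinner_self: "cinner_L2 f f = of_real ((norm f)\<^sup>2)"
proof -
  have "Im (cinner_L2 f f) = 0"
    using cinner_commute[of f f] by (metis Im_complex_of_real Reals_cnj_iff complex_is_Real_iff)
  moreover have "Re (cinner_L2 f f) = (norm f)\<^sup>2"
    by (simp add: power2_norm_eq_inner inner_L2_def)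
  ultimately show ?thesis
    by (simp add: complex_eq_iff)
qed

text \<open>Rotating one argument of a sesquilinear form by such a \<open>c\<close> makes its value
  real and nonnegative, so a Cauchy-Schwarz inequality for real parts yields one for moduli.\<close>

lemma unit_phase: "\<exists>c. cmod c = 1 \<and> c * z = of_real (cmod z)"
proof (cases "z = 0")
  case False
  have "cnj z / of_real (cmod z) * z = of_real (cmod z)"
    using False complex_norm_square[of z] by (simp add: field_simps power2_eq_square)
  moreover have "cmod (cnj z / of_real (cmod z)) = 1"
    using False by (simp add: norm_divide)
  ultimately show ?thesis by blast
qed (auto intro: exI[of _ 1])

text \<open>Reduces to continuity of the real inner product: the imaginary part of
  \<open>cinner_L2 a b\<close> is the real inner product of \<open>a\<close> with
  \<open>cscale_L2 \<i> b\<close>.\<close>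

lemma cinner_tendsto:
  assumes "f \<longlonglongrightarrow> F" "g \<longlonglongrightarrow> (G :: 'a::euclidean_space L2)"
  shows "(\<lambda>n. cinner_L2 (f n) (g n)) \<longlonglongrightarrow> cinner_L2 F G"
proof -
  have *: "cinner_L2 a b = of_real (inner a b) + \<i> * of_real (inner a (cscale_L2 \<i> b))" for a b :: "'a L2"
    by (simp add: inner_L2_def cinner_cscale_right complex_eq_iff)
  have "(\<lambda>n. cscale_L2 \<i> (g n)) \<longlonglongrightarrow> cscale_L2 \<i> G"
    using assms(2) unfolding LIMSEQ_iff by (simp add: cscale_diff_right[symmetric] norm_cscale)
  then show ?thesis
    unfolding * by (intro tendsto_intros assms)
qed

section \<open>Almost everywhere convergent subsequences and completeness\<close>

lemma AE_geometric_sq_summable: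
  fixes d :: "nat \<Rightarrow> 'a \<Rightarrow> complex"
  assumes [measurable]: "\<And>k. d k \<in> borel_measurable M"
    and int: "\<And>k. integrable M (\<lambda>x. (cmod (d k x))\<^sup>2)"
    and le: "\<And>k. (\<integral>x. (cmod (d k x))\<^sup>2 \<partial>M) \<le> (1/4)^k"
  shows "AE x in M. summable (\<lambda>k. d k x)"
proof -
  \<comment> \<open>The weight \<open>2^k\<close> spends half of the decay \<open>(1/4)^k\<close>:
    the weighted sum is still integrable, hence finite almost everywhere, and finiteness forces
    \<open>d k x\<close> to decay like \<open>(1 / sqrt 2)^k\<close>.\<close>
  have 1: "(\<integral>\<^sup>+x. ennreal (2^k * (cmod (d k x))\<^sup>2) \<partial>M) \<le> ennreal ((1/2)^k)" for k
  proof -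
    have "(\<integral>\<^sup>+x. ennreal (2^k * (cmod (d k x))\<^sup>2) \<partial>M) = ennreal (2^k * (\<integral>x. (cmod (d k x))\<^sup>2 \<partial>M))"
      using int by (subst nn_integral_eq_integral) auto
    also have "\<dots> \<le> ennreal (2^k * (1/4)^k)"
      by (intro ennreal_leI mult_left_mono le) auto
    also have "2^k * (1/4)^k = (1/2::real)^k"
      by (simp flip: power_mult_distrib)
    finally show ?thesis .
  qed
  have "(\<integral>\<^sup>+x. (\<Sum>k. ennreal (2^k * (cmod (d k x))\<^sup>2)) \<partial>M) = (\<Sum>k. \<integral>\<^sup>+x. ennreal (2^k * (cmod (d k x))\<^sup>2) \<partial>M)"
    by (rule nn_integral_suminf) measurable
  also have "\<dots> \<le> (\<Sum>k. ennreal ((1/2)^k))"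
    by (intro suminf_le 1) auto
  also have "\<dots> = ennreal (\<Sum>k. (1/2)^k)"
    by (rule suminf_ennreal2) (auto intro: summable_geometric)
  also have "\<dots> < \<infinity>" by simp
  finally have "(\<integral>\<^sup>+x. (\<Sum>k. ennreal (2^k * (cmod (d k x))\<^sup>2)) \<partial>M) \<noteq> \<infinity>" by simp
  then have "AE x in M. (\<Sum>k. ennreal (2^k * (cmod (d k x))\<^sup>2)) \<noteq> \<infinity>"
    by (intro nn_integral_noteq_infinite) auto
  then show ?thesis
  proof eventually_elim
    case (elim x)
    have "summable (\<lambda>k. 2^k * (cmod (d k x))\<^sup>2)"
      using elim by (intro summable_suminf_not_top) auto
    then have "Bseq (\<lambda>k. 2^k * (cmod (d k x))\<^sup>2)"
      by (intro convergent_imp_Bseq) (auto dest: summable_LIMSEQ_zero simp: convergent_def)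
    then obtain B where B: "B > 0" "\<And>k. norm (2^k * (cmod (d k x))\<^sup>2) \<le> B"
      by (auto simp: Bseq_def)
    have "cmod (d k x) \<le> sqrt B * (1 / sqrt 2)^k" for k
    proof -
      have "(cmod (d k x))\<^sup>2 \<le> B * (1/2)^k"
        using B(2)[of k] by (simp add: field_simps power_divide)
      also have "\<dots> = (sqrt B * (1 / sqrt 2)^k)\<^sup>2"
        using B(1) by (simp add: power_mult_distrib power_divide flip: power_mult)
          (simp add: power_mult mult.commute[of k 2])
      finally show ?thesis
        using B(1) by (auto intro: power2_le_imp_le)
    qed
    moreover have "summable (\<lambda>k. sqrt B * (1 / sqrt 2)^k)"
      by (intro summable_mult summable_geometric) (simp add: divide_simps)
    ultimately show ?case
      by (blast intro: summable_comparison_test')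
  qed
qed

lemma Cauchy_geometric_subseq:
  fixes X :: "nat \<Rightarrow> 'a::real_normed_vector"
  assumes "Cauchy X"
  shows "\<exists>r. strict_mono r \<and> (\<forall>k. norm (X (r (Suc k)) - X (r k)) \<le> (1/2)^k)"
proof -
  have N: "\<exists>N. \<forall>m\<ge>N. \<forall>n\<ge>N. norm (X m - X n) < (1/2)^k" for k
    using CauchyD[OF assms, of "(1/2)^k"] by auto
  then obtain N where N: "\<And>k m n. m \<ge> N k \<Longrightarrow> n \<ge> N k \<Longrightarrow> norm (X m - X n) < (1/2)^k"
    by metis
  have "\<exists>r. \<forall>k. r k \<ge> N k \<and> r (Suc k) > r k"
  proof (rule dependent_nat_choice)
    show "\<exists>y. y \<ge> N (Suc n) \<and> y > x" for x n :: nat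
      by (rule exI[of _ "max (Suc x) (N (Suc n))"]) auto
  qed auto
  then obtain r where r: "\<And>k. r k \<ge> N k" "\<And>k. r (Suc k) > r k" by auto
  have "norm (X (r (Suc k)) - X (r k)) \<le> (1/2)^k" for k
    using N[of k "r (Suc k)" "r k"] r(1)[of k] r(2)[of k] by auto
  with r(2) show ?thesis by (auto simp: strict_mono_Suc_iff)
qed

text \<open>Kept apart from completeness because the construction of the kernel wants this pointwise
  convergence rather than the limit in the Hilbert space.\<close>

lemma Cauchy_L2_AE_subseq:
  fixes X :: "nat \<Rightarrow> 'a::euclidean_space L2"
  assumes "Cauchy X"
  shows "\<exists>r. strict_mono r \<and> (AE x in lborel. convergent (\<lambda>k. rep_L2 (X (r k)) x))"
proof -
  obtain r where r: "strict_mono r" "\<And>k. norm (X (r (Suc k)) - X (r k)) \<le> (1/2)^k"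
    using Cauchy_geometric_subseq[OF assms] by auto
  define d where "d k = rep_L2 (X (r (Suc k)) - X (r k))" for k
  have "AE x in lborel. summable (\<lambda>k. d k x)"
  proof (rule AE_geometric_sq_summable)
    show "d k \<in> borel_measurable lborel" for k
      by (simp add: d_def)
    show "integrable lborel (\<lambda>x. (cmod (d k x))\<^sup>2)" for k
      by (simp add: d_def integrable_rep_L2_sq)
    show "(\<integral>x. (cmod (d k x))\<^sup>2 \<partial>lborel) \<le> (1/4)^k" for k
    proof -
      have "(norm (X (r (Suc k)) - X (r k)))\<^sup>2 \<le> ((1/2)^k)\<^sup>2"
        by (intro power_mono r) auto
      also have "\<dots> = (1/4)^k"
        by (simp add: power2_eq_square flip: power_mult_distrib)
      finally show ?thesis
        by (simp add: d_def flip: norm_L2_sq)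
    qed
  qed
  moreover have "AE x in lborel. \<forall>k. d k x = rep_L2 (X (r (Suc k))) x - rep_L2 (X (r k)) x"
    unfolding AE_all_countable d_def by (intro allI rep_L2_diff)
  ultimately have "AE x in lborel. convergent (\<lambda>k. rep_L2 (X (r k)) x)"
  proof eventually_elim
    case (elim x)
    then have "summable (\<lambda>k. rep_L2 (X (r (Suc k))) x - rep_L2 (X (r k)) x)" by simp
    then have "convergent (\<lambda>n. \<Sum>k<n. rep_L2 (X (r (Suc k))) x - rep_L2 (X (r k)) x)"
      by (simp add: summable_iff_convergent)
    then have "convergent (\<lambda>n. rep_L2 (X (r n)) x - rep_L2 (X (r 0)) x)"
      using sum_lessThan_telescope[of "\<lambda>n. rep_L2 (X (r n)) x"] by simp
    then show ?case
      using convergent_diff_const_right_iff[of "\<lambda>n. rep_L2 (X (r n)) x" "rep_L2 (X (r 0)) x"] by simp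
  qed
  then show ?thesis using r(1) by blast
qed

text \<open>Riesz-Fischer: the pointwise limit \<open>F\<close> of a subsequence is the candidate,
  and Fatou's lemma turns the Cauchy bounds into bounds for its distance to each
  \<open>X n\<close>.\<close>

instance L2 :: (euclidean_space) banach
proof
  fix X :: "nat \<Rightarrow> 'a L2"
  assume X: "Cauchy X"
  obtain r where r: "strict_mono r" and ae: "AE x in lborel. convergent (\<lambda>k. rep_L2 (X (r k)) x)"
    using Cauchy_L2_AE_subseq[OF X] by auto
  define F where "F x = lim (\<lambda>k. rep_L2 (X (r k)) x)" for x
  have [measurable]: "F \<in> borel_measurable borel"
    unfolding F_def by measurable
  have F: "AE x in lborel. (\<lambda>k. rep_L2 (X (r k)) x) \<longlonglongrightarrow> F x"
    using ae by eventually_elim (simp add: F_def convergent_LIMSEQ_iff)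
  \<comment> \<open>\<open>F\<close> is not yet known to be square integrable, so the estimate is
    made with the nonnegative integral; square integrability of \<open>F - X n\<close>, and with it
    that of \<open>F\<close>, is read off afterwards.\<close>
  have fatou: "(\<integral>\<^sup>+x. ennreal ((cmod (F x - rep_L2 (X n) x))\<^sup>2) \<partial>lborel) \<le> ennreal (e\<^sup>2)"
    if e: "\<And>m. m \<ge> N \<Longrightarrow> norm (X m - X n) \<le> e" "e \<ge> 0" for n N e
  proof -
    have "(\<integral>\<^sup>+x. ennreal ((cmod (F x - rep_L2 (X n) x))\<^sup>2) \<partial>lborel)
        = (\<integral>\<^sup>+x. liminf (\<lambda>k. ennreal ((cmod (rep_L2 (X (r k)) x - rep_L2 (X n) x))\<^sup>2)) \<partial>lborel)"
    proof (rule nn_integral_cong_AE, use F in eventually_elim)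
      case (elim x)
      have "(\<lambda>k. ennreal ((cmod (rep_L2 (X (r k)) x - rep_L2 (X n) x))\<^sup>2)) \<longlonglongrightarrow> ennreal ((cmod (F x - rep_L2 (X n) x))\<^sup>2)"
        by (intro tendsto_intros elim)
      from lim_imp_Liminf[OF _ this] show ?case by simp
    qed
    also have "\<dots> \<le> liminf (\<lambda>k. \<integral>\<^sup>+x. ennreal ((cmod (rep_L2 (X (r k)) x - rep_L2 (X n) x))\<^sup>2) \<partial>lborel)"
      by (rule nn_integral_liminf) measurable
    also have "\<dots> \<le> ennreal (e\<^sup>2)"
    proof -
      have "(\<integral>\<^sup>+x. ennreal ((cmod (rep_L2 (X (r k)) x - rep_L2 (X n) x))\<^sup>2) \<partial>lborel) \<le> ennreal (e\<^sup>2)" if "k \<ge> N" for k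
      proof -
        have "(\<integral>\<^sup>+x. ennreal ((cmod (rep_L2 (X (r k)) x - rep_L2 (X n) x))\<^sup>2) \<partial>lborel)
           = (\<integral>\<^sup>+x. ennreal ((cmod (rep_L2 (X (r k) - X n) x))\<^sup>2) \<partial>lborel)"
          by (rule nn_integral_cong_AE, use rep_L2_diff[of "X (r k)" "X n"] in eventually_elim) simp
        also have "\<dots> = ennreal ((norm (X (r k) - X n))\<^sup>2)"
          by (subst nn_integral_eq_integral) (auto simp: integrable_rep_L2_sq norm_L2_sq)
        also have "\<dots> \<le> ennreal (e\<^sup>2)"
          using e(1)[of "r k"] seq_suble[OF r, of k] that by (intro ennreal_leI power_mono) auto
        finally show ?thesis .
      qed
      then show ?thesis
        by (intro Liminf_le[THEN order_trans] ) (auto simp: eventually_sequentially)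
    qed
    finally show ?thesis .
  qed
  have sqi: "square_integrable (\<lambda>x. F x - rep_L2 (X n) x) \<and> norm (abs_L2 (\<lambda>x. F x - rep_L2 (X n) x)) \<le> e"
    if e: "\<And>m. m \<ge> N \<Longrightarrow> norm (X m - X n) \<le> e" "e \<ge> 0" for n N e
  proof -
    have i: "integrable lborel (\<lambda>x. (cmod (F x - rep_L2 (X n) x))\<^sup>2)"
      using fatou[OF e] by (intro integrableI_nonneg) (auto simp: less_top[symmetric] top_unique)
    then have s: "square_integrable (\<lambda>x. F x - rep_L2 (X n) x)"
      by (simp add: square_integrable_def)
    have "ennreal ((norm (abs_L2 (\<lambda>x. F x - rep_L2 (X n) x)))\<^sup>2) \<le> ennreal (e\<^sup>2)"
      using fatou[OF e] i by (subst norm_abs_L2_sq[OF s]) (simp add: nn_integral_eq_integral)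
    then have "(norm (abs_L2 (\<lambda>x. F x - rep_L2 (X n) x)))\<^sup>2 \<le> e\<^sup>2" by simp
    then show ?thesis using s e(2) by (auto intro: power2_le_imp_le)
  qed
  obtain N0 where N0: "\<And>m n. m \<ge> N0 \<Longrightarrow> n \<ge> N0 \<Longrightarrow> norm (X m - X n) < 1"
    using CauchyD[OF X, of 1] by auto
  have "square_integrable (\<lambda>x. F x - rep_L2 (X N0) x)"
    using sqi[of N0 N0 1] N0 by (auto intro: less_imp_le)
  then have sF: "square_integrable F"
    using square_integrable_add[OF _ square_integrable_rep_L2[of "X N0"]] by fastforce
  have "X \<longlonglongrightarrow> abs_L2 F"
  proof (rule LIMSEQ_I)
    fix e :: real assume "e > 0"
    then obtain N where N: "\<And>m n. m \<ge> N \<Longrightarrow> n \<ge> N \<Longrightarrow> norm (X m - X n) < e/2"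
      using CauchyD[OF X, of "e/2"] by auto
    have "norm (X n - abs_L2 F) < e" if "n \<ge> N" for n
    proof -
      have "abs_L2 F - X n = abs_L2 (\<lambda>x. F x - rep_L2 (X n) x)"
        using abs_L2_diff[OF sF square_integrable_rep_L2[of "X n"]] by (simp add: abs_rep_L2)
      moreover have "norm (abs_L2 (\<lambda>x. F x - rep_L2 (X n) x)) \<le> e/2"
        using sqi[of N n "e/2"] N that \<open>e > 0\<close> by (auto intro: less_imp_le)
      ultimately show ?thesis using \<open>e > 0\<close> by (simp add: norm_minus_commute)
    qed
    then show "\<exists>no. \<forall>n\<ge>no. norm (X n - abs_L2 F) < e" by blast
  qed
  then show "convergent X" by (auto simp: convergent_def)
qed

lemma L2_tendsto_AE_subseq:
  fixes u :: "nat \<Rightarrow> 'a::euclidean_space L2"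
  assumes "u \<longlonglongrightarrow> U"
  shows "\<exists>r::nat \<Rightarrow> nat. strict_mono r \<and> (AE x in lborel. (\<lambda>n. rep_L2 (u (r n)) x) \<longlonglongrightarrow> rep_L2 U x)"
proof -
  have "(\<lambda>n. (norm (u n - U))\<^sup>2) \<longlonglongrightarrow> 0\<^sup>2"
    using assms by (intro tendsto_power) (simp add: LIM_zero tendsto_norm_zero)
  then have "(\<lambda>n. \<integral>x. norm ((cmod (rep_L2 (u n - U) x))\<^sup>2) \<partial>lborel) \<longlonglongrightarrow> 0"
    by (simp add: norm_L2_sq)
  then obtain r :: "nat \<Rightarrow> nat" where r: "strict_mono r"
    "AE x in lborel. (\<lambda>n. (cmod (rep_L2 (u (r n) - U) x))\<^sup>2) \<longlonglongrightarrow> 0"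
    using tendsto_L1_AE_subseq[of lborel "\<lambda>n x. (cmod (rep_L2 (u n - U) x))\<^sup>2"] integrable_rep_L2_sq
    by blast
  have "AE x in lborel. \<forall>n. rep_L2 (u (r n) - U) x = rep_L2 (u (r n)) x - rep_L2 U x"
    unfolding AE_all_countable by (intro allI rep_L2_diff)
  with r(2) have "AE x in lborel. (\<lambda>n. rep_L2 (u (r n)) x) \<longlonglongrightarrow> rep_L2 U x"
  proof eventually_elim
    case (elim x)
    have "(\<lambda>n. sqrt ((cmod (rep_L2 (u (r n) - U) x))\<^sup>2)) \<longlonglongrightarrow> sqrt 0"
      using elim(1) by (rule tendsto_real_sqrt)
    then have "(\<lambda>n. rep_L2 (u (r n)) x - rep_L2 U x) \<longlonglongrightarrow> 0"
      using elim(2) by (simp add: tendsto_norm_zero_iff)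
    then show ?case by (rule LIM_zero_cancel)
  qed
  with r(1) show ?thesis by blast
qed

text \<open>The majorants may vary with \<open>n\<close> since the bounds for the Euler iterates
  contain an error that disappears only in the limit.\<close>

lemma AE_bound_L2_limit:
  fixes u :: "nat \<Rightarrow> 'a::euclidean_space L2"
  assumes "u \<longlonglongrightarrow> U" "\<And>n. AE x in lborel. cmod (rep_L2 (u n) x) \<le> w n x"
    and "AE x in lborel. (\<lambda>n. w n x) \<longlonglongrightarrow> W x"
  shows "AE x in lborel. cmod (rep_L2 U x) \<le> W x"
proof -
  obtain r :: "nat \<Rightarrow> nat" where r: "strict_mono r"
    "AE x in lborel. (\<lambda>n. rep_L2 (u (r n)) x) \<longlonglongrightarrow> rep_L2 U x"
    using L2_tendsto_AE_subseq[OF assms(1)] by auto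
  have "AE x in lborel. \<forall>n. cmod (rep_L2 (u n) x) \<le> w n x"
    unfolding AE_all_countable using assms(2) by blast
  with r(2) assms(3) show ?thesis
  proof eventually_elim
    case (elim x)
    have "(\<lambda>n. w (r n) x) \<longlonglongrightarrow> W x"
      using LIMSEQ_subseq_LIMSEQ[OF elim(2) r(1)] by (simp add: o_def)
    moreover have "(\<lambda>n. cmod (rep_L2 (u (r n)) x)) \<longlonglongrightarrow> cmod (rep_L2 U x)"
      by (intro tendsto_norm elim)
    ultimately show ?case
      by (rule tendsto_le[OF sequentially_bot]) (use elim in auto)
  qed
qed

section \<open>Minimization of quadratic functionals\<close>

text \<open>When \<open>c = 0\<close> the polynomial is affine and would take the value
  \<open>-1\<close> at \<open>t = - (a + 1) / (2 * b)\<close> if \<open>b\<close> were nonzero;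
  otherwise its minimum, at \<open>t = - b / c\<close>, is \<open>a - b^2 / c\<close>.\<close>

lemma nonneg_quadratic_discriminant:
  fixes a b c :: real
  assumes "\<And>t. a + 2 * t * b + t\<^sup>2 * c \<ge> 0" "c \<ge> 0"
  shows "b\<^sup>2 \<le> a * c"
proof (cases "c = 0")
  case True
  have "b = 0"
  proof (rule ccontr)
    assume "b \<noteq> 0"
    then show False
      using assms(1)[of "- (a + 1) / (2 * b)"] True by (simp add: field_simps)
  qed
  then show ?thesis using True by simp
next
  case False
  then have "c > 0" using assms by simp
  have "a + 2 * (- b / c) * b + (- b / c)\<^sup>2 * c = a - b\<^sup>2 / c"
    using False by (simp add: field_simps power2_eq_square)
  then have "a - b\<^sup>2 / c \<ge> 0" using assms(1)[of "- b / c"] by simp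
  then show ?thesis using \<open>c > 0\<close> by (simp add: field_simps)
qed

text \<open>Neither \<open>D\<close> nor \<open>b\<close> is assumed closed. The minimizer of
  \<open>J f\<close> lies in general outside \<open>D\<close>, which is why the statements are about
  \<open>J_inf\<close> and minimizing sequences.\<close>

locale psd_form =
  fixes D :: "'a::real_inner set" and b :: "'a \<Rightarrow> 'a \<Rightarrow> real"
  assumes D: "subspace D"
    and sym: "u \<in> D \<Longrightarrow> v \<in> D \<Longrightarrow> b u v = b v u"
    and add: "u \<in> D \<Longrightarrow> v \<in> D \<Longrightarrow> w \<in> D \<Longrightarrow> b (u + v) w = b u w + b v w"
    and scale: "u \<in> D \<Longrightarrow> v \<in> D \<Longrightarrow> b (r *\<^sub>R u) v = r * b u v"
    and nonneg: "u \<in> D \<Longrightarrow> b u u \<ge> 0"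
begin

lemma in_D: "u \<in> D \<Longrightarrow> v \<in> D \<Longrightarrow> u + v \<in> D" "u \<in> D \<Longrightarrow> r *\<^sub>R u \<in> D" "u \<in> D \<Longrightarrow> v \<in> D \<Longrightarrow> u - v \<in> D" "0 \<in> D"
  using D by (auto simp: subspace_add subspace_scale subspace_diff subspace_0)

lemma expand:
  assumes "u \<in> D" "v \<in> D"
  shows "b (u + t *\<^sub>R v) (u + t *\<^sub>R v) = b u u + 2 * t * b u v + t\<^sup>2 * b v v"
proof -
  have "b (u + t *\<^sub>R v) (u + t *\<^sub>R v) = b u (u + t *\<^sub>R v) + t * b v (u + t *\<^sub>R v)"
    using assms in_D by (simp add: add scale)
  also have "b u (u + t *\<^sub>R v) = b u u + t * b u v"
    using assms in_D by (metis (no_types) sym add scale)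
  also have "b v (u + t *\<^sub>R v) = b u v + t * b v v"
    using assms in_D by (metis (no_types) sym add scale)
  finally show ?thesis by (simp add: algebra_simps power2_eq_square)
qed

lemma cauchy_schwarz:
  assumes "u \<in> D" "v \<in> D"
  shows "(b u v)\<^sup>2 \<le> b u u * b v v"
proof (rule nonneg_quadratic_discriminant)
  show "b u u + 2 * t * b u v + t\<^sup>2 * b v v \<ge> 0" for t
    using nonneg[of "u + t *\<^sub>R v"] expand[OF assms, of t] assms in_D by simp
qed (use assms nonneg in auto)

lemma diff_self:
  assumes "u \<in> D" "v \<in> D"
  shows "b (u - v) (u - v) = b u u - 2 * b u v + b v v"
  using expand[OF assms, of "-1"] by simp

text \<open>A formal minimizer \<open>u\<close> satisfies \<open>b u v + inner (u - f) v = 0\<close>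
  for all \<open>v\<close>, the weak form of the resolvent equation for the operator associated with
  \<open>b\<close>.\<close>

definition J :: "'a \<Rightarrow> 'a \<Rightarrow> real" where
  "J f \<phi> = b \<phi> \<phi> + (norm (\<phi> - f))\<^sup>2"

definition J_inf :: "'a \<Rightarrow> real" where
  "J_inf f = (INF \<phi>\<in>D. J f \<phi>)"

lemma J_nonneg: "\<phi> \<in> D \<Longrightarrow> J f \<phi> \<ge> 0"
  by (simp add: J_def nonneg)

lemma J_inf_le: "\<phi> \<in> D \<Longrightarrow> J_inf f \<le> J f \<phi>"
  unfolding J_inf_def by (intro cINF_lower bdd_belowI2[of _ 0] J_nonneg)

lemma minimizing_sequence: "\<exists>X. (\<forall>n. X n \<in> D) \<and> (\<lambda>n. J f (X n)) \<longlonglongrightarrow> J_inf f"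
proof -
  have "\<exists>\<phi>\<in>D. J f \<phi> < J_inf f + inverse (real (Suc n))" for n
    unfolding J_inf_def
    by (subst cINF_less_iff[symmetric]) (use in_D(4) in \<open>auto intro!: bdd_belowI2[of _ 0] J_nonneg\<close>)
  then obtain X where X: "\<And>n. X n \<in> D" "\<And>n. J f (X n) < J_inf f + inverse (real (Suc n))"
    by metis
  have "(\<lambda>n. J f (X n)) \<longlonglongrightarrow> J_inf f"
  proof (rule tendsto_sandwich)
    show "\<forall>\<^sub>F n in sequentially. J_inf f \<le> J f (X n)"
      using X J_inf_le by auto
    show "\<forall>\<^sub>F n in sequentially. J f (X n) \<le> J_inf f + inverse (real (Suc n))"
      using X(2) by (intro always_eventually allI less_imp_le)
    show "(\<lambda>n. J_inf f + inverse (real (Suc n))) \<longlonglongrightarrow> J_inf f"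
      using tendsto_add[OF tendsto_const LIMSEQ_inverse_real_of_nat, of "J_inf f"] by simp
  qed simp
  with X(1) show ?thesis by blast
qed

text \<open>The midpoint of \<open>u\<close> and \<open>v\<close> has energy at least
  \<open>J_inf f\<close>, and both \<open>b\<close> and the norm obey the parallelogram law. The
  difference is controlled in the form norm, so minimizing sequences are Cauchy there as well as in
  the Hilbert norm.\<close>

lemma J_parallelogram:
  assumes "u \<in> D" "v \<in> D"
  shows "b (u - v) (u - v) + (norm (u - v))\<^sup>2 \<le> 2 * J f u + 2 * J f v - 4 * J_inf f"
proof -
  define z where "z = (1/2) *\<^sub>R (u + 1 *\<^sub>R v)"
  have "b z z = (1/4) * (b u u + 2 * b u v + b v v)"
  proof -
    have "b z z = (1/2) * b (u + 1 *\<^sub>R v) z"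
      unfolding z_def using assms in_D by (intro scale) auto
    also have "b (u + 1 *\<^sub>R v) z = b z (u + 1 *\<^sub>R v)"
      unfolding z_def using assms in_D by (intro sym) auto
    also have "\<dots> = (1/2) * b (u + 1 *\<^sub>R v) (u + 1 *\<^sub>R v)"
      unfolding z_def using assms in_D by (intro scale) auto
    finally show ?thesis
      by (simp add: expand[OF assms, of 1, simplified])
  qed
  moreover have "4 * (norm (z - f))\<^sup>2 + (norm (u - v))\<^sup>2 = 2 * (norm (u - f))\<^sup>2 + 2 * (norm (v - f))\<^sup>2"
    unfolding z_def power2_norm_eq_inner by (simp add: inner_diff inner_add algebra_simps inner_commute)
  moreover have "J_inf f \<le> J f z"
    unfolding z_def using assms in_D by (intro J_inf_le) auto
  ultimately show ?thesis
    using diff_self[OF assms] unfolding J_def by simp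
qed

text \<open>\<open>J f\<close> is a quadratic polynomial along the line through
  \<open>\<phi>\<close> in direction \<open>\<psi>\<close> and stays above \<open>J_inf f\<close>;
  the discriminant bounds its slope. Thus an almost minimizer solves the weak equation up to the
  square root of its excess energy.\<close>

lemma euler_lagrange:
  assumes "\<phi> \<in> D" "\<psi> \<in> D"
  shows "(b \<phi> \<psi> + inner (\<phi> - f) \<psi>)\<^sup>2 \<le> (J f \<phi> - J_inf f) * (b \<psi> \<psi> + (norm \<psi>)\<^sup>2)"
proof (rule nonneg_quadratic_discriminant)
  fix t
  have "J_inf f \<le> J f (\<phi> + t *\<^sub>R \<psi>)"
    using assms in_D by (intro J_inf_le) auto
  also have "\<dots> = J f \<phi> + 2 * t * (b \<phi> \<psi> + inner (\<phi> - f) \<psi>) + t\<^sup>2 * (b \<psi> \<psi> + (norm \<psi>)\<^sup>2)"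
    unfolding J_def expand[OF assms] power2_norm_eq_inner
    by (simp add: inner_diff inner_add algebra_simps inner_commute power2_eq_square)
  finally show "J f \<phi> - J_inf f + 2 * t * (b \<phi> \<psi> + inner (\<phi> - f) \<psi>) + t\<^sup>2 * (b \<psi> \<psi> + (norm \<psi>)\<^sup>2) \<ge> 0"
    by simp
qed (use assms nonneg in auto)

lemma minimizing_Cauchy:
  assumes "\<And>n. X n \<in> D" "(\<lambda>n. J f (X n)) \<longlonglongrightarrow> J_inf f" "e > 0"
  shows "\<exists>N. \<forall>m\<ge>N. \<forall>n\<ge>N. b (X m - X n) (X m - X n) + (norm (X m - X n))\<^sup>2 < e"
proof -
  have "\<forall>\<^sub>F n in sequentially. J f (X n) < J_inf f + e / 4"
    using assms(3) by (intro order_tendstoD(2)[OF assms(2)]) auto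
  then obtain N where N: "\<And>n. n \<ge> N \<Longrightarrow> J f (X n) < J_inf f + e / 4"
    by (auto simp: eventually_sequentially)
  have "b (X m - X n) (X m - X n) + (norm (X m - X n))\<^sup>2 < e" if "m \<ge> N" "n \<ge> N" for m n
    using J_parallelogram[OF assms(1)[of m] assms(1)[of n], of f] N[OF that(1)] N[OF that(2)] by linarith
  then show ?thesis by blast
qed

lemma minimizing_convergent:
  assumes "\<And>n. X n \<in> D" "(\<lambda>n. J f (X n)) \<longlonglongrightarrow> J_inf f"
  shows "Cauchy X"
proof (rule metric_CauchyI)
  fix e :: real assume "e > 0"
  then obtain N where N: "\<And>m n. m \<ge> N \<Longrightarrow> n \<ge> N \<Longrightarrow> b (X m - X n) (X m - X n) + (norm (X m - X n))\<^sup>2 < e\<^sup>2"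
    using minimizing_Cauchy[OF assms, of "e\<^sup>2"] by auto
  have "dist (X m) (X n) < e" if "m \<ge> N" "n \<ge> N" for m n
  proof (rule power2_less_imp_less)
    show "(dist (X m) (X n))\<^sup>2 < e\<^sup>2"
      using N[OF that] nonneg[OF in_D(3)[OF assms(1)[of m] assms(1)[of n]]] by (simp add: dist_norm)
  qed (use \<open>e > 0\<close> in auto)
  then show "\<exists>M. \<forall>m\<ge>M. \<forall>n\<ge>M. dist (X m) (X n) < e" by blast
qed

end

text \<open>With the zero form \<open>J f\<close> is the squared distance to \<open>f\<close>. A
  minimizing sequence converges to the projection of \<open>f\<close> onto the closure of
  \<open>D\<close>, and the Euler-Lagrange inequality makes the remainder orthogonal to
  \<open>D\<close>.\<close>

lemma dense_if_orthogonal_trivial: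
  fixes D :: "'a::{real_inner, banach} set"
  assumes "subspace D" "\<And>f. (\<And>\<psi>. \<psi> \<in> D \<Longrightarrow> inner f \<psi> = 0) \<Longrightarrow> f = 0"
  shows "closure D = UNIV"
proof -
  interpret psd_form D "\<lambda>_ _. 0"
    by unfold_locales (use assms in auto)
  have "f \<in> closure D" for f
  proof -
    obtain X where X: "\<And>n. X n \<in> D" "(\<lambda>n. J f (X n)) \<longlonglongrightarrow> J_inf f"
      using minimizing_sequence by blast
    obtain u where u: "X \<longlonglongrightarrow> u"
      using minimizing_convergent[OF X] by (auto simp: Cauchy_convergent_iff convergent_def)
    have "u - f = 0"
    proof (rule assms(2))
      fix \<psi> assume \<psi>: "\<psi> \<in> D"
      have 1: "(\<lambda>n. (J f (X n) - J_inf f) * (norm \<psi>)\<^sup>2) \<longlonglongrightarrow> (J_inf f - J_inf f) * (norm \<psi>)\<^sup>2"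
        by (intro tendsto_intros X)
      have 2: "(\<lambda>n. (inner (X n - f) \<psi>)\<^sup>2) \<longlonglongrightarrow> (inner (u - f) \<psi>)\<^sup>2"
        by (intro tendsto_intros u)
      have "(inner (u - f) \<psi>)\<^sup>2 \<le> (J_inf f - J_inf f) * (norm \<psi>)\<^sup>2"
        by (rule LIMSEQ_le[OF 2 1]) (use euler_lagrange[OF X(1) \<psi>] in auto)
      then show "inner (u - f) \<psi> = 0" by simp
    qed
    with u X(1) show ?thesis by (auto simp: closure_sequential)
  qed
  then show ?thesis by auto
qed

section \<open>Semigroups generated by accretive operators\<close>

lemma norm_triangle3: "norm (a + b + c) \<le> norm a + norm b + norm (c :: 'a::real_normed_vector)"
  using norm_triangle_ineq[of "a + b" c] norm_triangle_ineq[of a b] by linarith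

lemma norm_triangle3': "norm (a - b - c) \<le> norm a + norm b + norm (c :: 'a::real_normed_vector)"
  using norm_triangle3[of a "- b" "- c"] by simp

lemma step_bound:
  fixes h e c N :: real
  assumes "h < e / (c * (N + 1))" "c > 0" "N \<ge> 0"
  shows "h * (N + 1) < e / c"
proof -
  have "c * (N + 1) > 0" using assms by simp
  then have "h * (c * (N + 1)) < e" using assms(1) by (simp only: pos_less_divide_eq)
  then show ?thesis using assms(2) by (simp only: pos_less_divide_eq mult_ac)
qed

lemma tendsto_cscale:
  fixes X :: "nat \<Rightarrow> 'b::euclidean_space L2"
  assumes "X \<longlonglongrightarrow> x"
  shows "(\<lambda>n. cscale_L2 c (X n)) \<longlonglongrightarrow> cscale_L2 c x"
proof -
  have "(\<lambda>n. cmod c * norm (X n - x)) \<longlonglongrightarrow> cmod c * 0"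
    using assms by (intro tendsto_mult_left) (simp add: LIM_zero tendsto_norm_zero)
  then have "(\<lambda>n. norm (cscale_L2 c (X n) - cscale_L2 c x)) \<longlonglongrightarrow> 0"
    by (simp add: norm_cscale flip: cscale_diff_right)
  then show ?thesis using LIM_zero_cancel tendsto_norm_zero_iff by blast
qed

text \<open>These are the Lumer-Phillips hypotheses for \<open>- L\<close>. Complex homogeneity is
  included because \<open>C0_semigroup\<close> demands complex linear operators.\<close>

locale accretive =
  fixes L :: "'a::euclidean_space operator"
  assumes zero: "(0, 0) \<in> L"
    and add: "(u, w) \<in> L \<Longrightarrow> (u', w') \<in> L \<Longrightarrow> (u + u', w + w') \<in> L"
    and cscale: "(u, w) \<in> L \<Longrightarrow> (cscale_L2 c u, cscale_L2 c w) \<in> L"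
    and accr: "(u, w) \<in> L \<Longrightarrow> inner w u \<ge> 0"
    and range: "\<tau> > 0 \<Longrightarrow> \<exists>u w. (u, w) \<in> L \<and> u + \<tau> *\<^sub>R w = f"
    and dense: "closure (Domain L) = UNIV"
begin

section \<open>Resolvents as contractions\<close>

lemma scale: "(u, w) \<in> L \<Longrightarrow> (r *\<^sub>R u, r *\<^sub>R w) \<in> L"
  using cscale[of u w "of_real r"] by (simp add: cscale_of_real)

lemma diff: "(u, w) \<in> L \<Longrightarrow> (u', w') \<in> L \<Longrightarrow> (u - u', w - w') \<in> L"
  using add[of u w "- u'" "- w'"] scale[of u' w' "-1"] by simp

definition J :: "real \<Rightarrow> 'a L2 \<Rightarrow> 'a L2" where
  "J \<tau> f = (SOME u. \<exists>w. (u, w) \<in> L \<and> u + \<tau> *\<^sub>R w = f)"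

lemma norm_resolvent:
  assumes "(u, w) \<in> L" "\<tau> \<ge> 0"
  shows "norm u \<le> norm (u + \<tau> *\<^sub>R w)"
proof (rule power2_le_imp_le)
  have "(norm (u + \<tau> *\<^sub>R w))\<^sup>2 = (norm u)\<^sup>2 + 2 * \<tau> * inner w u + \<tau>\<^sup>2 * (norm w)\<^sup>2"
    unfolding power2_norm_eq_inner by (simp add: inner_add algebra_simps inner_commute power2_eq_square)
  then show "(norm u)\<^sup>2 \<le> (norm (u + \<tau> *\<^sub>R w))\<^sup>2"
    using accr[OF assms(1)] assms(2) by simp
qed simp

lemma resolvent_unique:
  assumes "(u, w) \<in> L" "(u', w') \<in> L" "\<tau> > 0" "u + \<tau> *\<^sub>R w = u' + \<tau> *\<^sub>R w'"
  shows "u = u'"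
proof -
  have "norm (u - u') \<le> norm ((u - u') + \<tau> *\<^sub>R (w - w'))"
    using assms by (intro norm_resolvent diff) auto
  also have "(u - u') + \<tau> *\<^sub>R (w - w') = 0"
    using assms(4) by (simp add: algebra_simps)
  finally show ?thesis by simp
qed

lemma J_eqI:
  assumes "\<tau> > 0" "(u, w) \<in> L" "u + \<tau> *\<^sub>R w = f"
  shows "J \<tau> f = u"
  unfolding J_def
proof (rule some_equality)
  show "v = u" if "\<exists>w. (v, w) \<in> L \<and> v + \<tau> *\<^sub>R w = f" for v
    using that resolvent_unique[OF _ assms(2) assms(1)] assms(3) by metis
qed (use assms in blast)

lemma J_L:
  assumes "\<tau> > 0"
  shows "(J \<tau> f, (f - J \<tau> f) /\<^sub>R \<tau>) \<in> L"
proof -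
  obtain u w where uw: "(u, w) \<in> L" "u + \<tau> *\<^sub>R w = f" using range[OF assms] by blast
  then have "(f - u) /\<^sub>R \<tau> = w" using assms by (auto simp: algebra_simps)
  with J_eqI[OF assms uw] uw(1) show ?thesis by simp
qed

lemma J_add: "\<tau> > 0 \<Longrightarrow> J \<tau> (f + g) = J \<tau> f + J \<tau> g"
  by (rule J_eqI[OF _ add[OF J_L J_L]]) (auto simp: algebra_simps)

lemma J_cscale: "\<tau> > 0 \<Longrightarrow> J \<tau> (cscale_L2 c f) = cscale_L2 c (J \<tau> f)"
  by (rule J_eqI[OF _ cscale[OF J_L]]) 
    (auto simp: cscale_of_real[symmetric] cscale_cscale cscale_diff_right mult_ac simp flip: of_real_mult)

lemma J_scale: "\<tau> > 0 \<Longrightarrow> J \<tau> (r *\<^sub>R f) = r *\<^sub>R J \<tau> f"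
  using J_cscale[of \<tau> "of_real r" f] by (simp add: cscale_of_real)

lemma J_diff: "\<tau> > 0 \<Longrightarrow> J \<tau> (f - g) = J \<tau> f - J \<tau> g"
  using J_add[of \<tau> f "- g"] J_scale[of \<tau> "-1" g] by simp

lemma J_norm: "\<tau> > 0 \<Longrightarrow> norm (J \<tau> f) \<le> norm f"
  using norm_resolvent[OF J_L[of \<tau> f], of \<tau>] by simp

text \<open>The defect of the resolvent from the identity is of size \<open>\<tau>\<close> on the
  domain; the error estimates for the Euler scheme rest on iterating this identity.\<close>

lemma J_of_L: "\<tau> > 0 \<Longrightarrow> (u, w) \<in> L \<Longrightarrow> J \<tau> u = u - \<tau> *\<^sub>R J \<tau> w"
  using J_eqI[of \<tau> u w "u + \<tau> *\<^sub>R w"] by (simp add: J_add J_scale eq_diff_eq)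

lemma J_preserves: 
  assumes "\<tau> > 0" "(u, w) \<in> L"
  shows "(J \<tau> u, J \<tau> w) \<in> L"
proof -
  have "(u - J \<tau> u) /\<^sub>R \<tau> = J \<tau> w"
    using J_of_L[OF assms] assms(1) by simp
  then show ?thesis using J_L[OF assms(1), of u] by simp
qed

section \<open>Iterated resolvents\<close>

definition Jn :: "real \<Rightarrow> nat \<Rightarrow> 'a L2 \<Rightarrow> 'a L2" where
  "Jn h n = J h ^^ n"

lemma Jn_0 [simp]: "Jn h 0 f = f" and Jn_Suc: "Jn h (Suc n) f = J h (Jn h n f)"
  and Jn_add: "Jn h (m + n) f = Jn h m (Jn h n f)"
  by (auto simp: Jn_def funpow_add)

lemma Jn_Suc': "Jn h (Suc n) f = Jn h n (J h f)"
  using Jn_add[of h n 1 f] by (simp add: Jn_Suc)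

lemma Jn_plus: "h > 0 \<Longrightarrow> Jn h n (f + g) = Jn h n f + Jn h n g"
  by (induction n) (auto simp: Jn_Suc J_add)

lemma Jn_cscale: "h > 0 \<Longrightarrow> Jn h n (cscale_L2 c f) = cscale_L2 c (Jn h n f)"
  by (induction n) (auto simp: Jn_Suc J_cscale)

lemma Jn_diff: "h > 0 \<Longrightarrow> Jn h n (f - g) = Jn h n f - Jn h n g"
  by (induction n) (auto simp: Jn_Suc J_diff)

lemma Jn_norm: "h > 0 \<Longrightarrow> norm (Jn h n f) \<le> norm f"
proof (induction n)
  case (Suc n)
  then show ?case using J_norm[of h "Jn h n f"] by (simp add: Jn_Suc)
qed simp

lemma Jn_preserves: "h > 0 \<Longrightarrow> (u, w) \<in> L \<Longrightarrow> (Jn h n u, Jn h n w) \<in> L"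
  by (induction n) (auto simp: Jn_Suc J_preserves)

lemma J_near: "h > 0 \<Longrightarrow> (u, w) \<in> L \<Longrightarrow> norm (J h u - u) \<le> h * norm w"
  using J_of_L[of h u w] J_norm[of h w] by simp

lemma Jn_near: 
  assumes "h > 0" "(u, w) \<in> L"
  shows "norm (Jn h n u - u) \<le> real n * h * norm w"
proof (induction n)
  case (Suc n)
  have "norm (Jn h (Suc n) u - u) \<le> norm (J h (Jn h n u - u)) + norm (J h u - u)"
    using norm_triangle_ineq[of "J h (Jn h n u - u)" "J h u - u"] assms by (simp add: Jn_Suc J_diff)
  also have "\<dots> \<le> real n * h * norm w + h * norm w"
    using J_norm[OF assms(1)] Suc J_near[OF assms] by (meson add_mono order_trans)
  finally show ?case by (simp add: algebra_simps)
qed simp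

text \<open>Each step changes the iterate by \<open>- h *\<^sub>R Jn h j w\<close>, so the defect is
  a sum of terms \<open>w - Jn h j w\<close>. As \<open>w\<close> need not lie in the domain,
  \<open>v\<close> stands in for it: the exchange costs \<open>2 * norm (w - v)\<close>, and
  \<open>v\<close> itself moves by at most \<open>n * h * norm z\<close>.\<close>

lemma Jn_derivative:
  assumes "h > 0" "(u, w) \<in> L" "(v, z) \<in> L"
  shows "norm (Jn h n u - u + (real n * h) *\<^sub>R w) \<le> (real n * h) * (2 * norm (w - v) + real n * h * norm z)"
proof -
  define B where "B = 2 * norm (w - v) + real n * h * norm z"
  have step: "norm (w - Jn h j w) \<le> B" if "j \<le> n" for j
  proof -
    have "w - Jn h j w = (w - v) - Jn h j (w - v) - (Jn h j v - v)"
      using assms by (simp add: Jn_diff)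
    also have "norm \<dots> \<le> norm (w - v) + norm (Jn h j (w - v)) + norm (Jn h j v - v)"
      by (rule norm_triangle3')
    also have "\<dots> \<le> norm (w - v) + norm (w - v) + real j * h * norm z"
      using Jn_norm[OF assms(1)] Jn_near[OF assms(1,3)] by (intro add_mono) auto
    also have "real j * h * norm z \<le> real n * h * norm z"
      using that assms(1) by (intro mult_right_mono) auto
    finally show ?thesis by (simp add: B_def)
  qed
  have "norm (Jn h m u - u + (real m * h) *\<^sub>R w) \<le> (real m * h) * B" if "m \<le> n" for m
    using that
  proof (induction m)
    case (Suc m)
    have "Jn h (Suc m) u = Jn h m u - h *\<^sub>R Jn h (Suc m) w"
      using J_of_L[OF assms(1) Jn_preserves[OF assms(1,2), of m]] by (simp add: Jn_Suc)
    then have "Jn h (Suc m) u - u + (real (Suc m) * h) *\<^sub>R w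
       = (Jn h m u - u + (real m * h) *\<^sub>R w) + h *\<^sub>R (w - Jn h (Suc m) w)"
      by (simp add: algebra_simps)
    also have "norm \<dots> \<le> norm (Jn h m u - u + (real m * h) *\<^sub>R w) + norm (h *\<^sub>R (w - Jn h (Suc m) w))"
      by (rule norm_triangle_ineq)
    also have "\<dots> \<le> real m * h * B + h * B"
      using Suc step[of "Suc m"] assms(1) by (intro add_mono) auto
    finally show ?case by (simp add: algebra_simps)
  qed simp
  from this[of n] show ?thesis by (simp add: B_def)
qed

lemma J_tendsto: "((\<lambda>h. J h f) \<longlongrightarrow> f) (at_right 0)"
proof (rule tendstoI)
  fix e :: real assume "e > 0"
  obtain u where "u \<in> Domain L" and uf: "dist u f < e / 3"
    using dense \<open>e > 0\<close> by (metis UNIV_I closure_approachable divide_pos_pos zero_less_numeral)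
  then obtain w where uw: "(u, w) \<in> L" by auto
  have "dist (J h f) f < e" if h: "h > 0" "h < e / (3 * (norm w + 1))" for h
  proof -
    have "J h f - f = J h (f - u) + (J h u - u) + (u - f)"
      using h by (simp add: J_diff)
    then have "dist (J h f) f \<le> norm (J h (f - u)) + norm (J h u - u) + norm (u - f)"
      unfolding dist_norm by (simp only: norm_triangle3)
    also have "norm (J h (f - u)) < e / 3"
      using J_norm[OF h(1), of "f - u"] uf by (simp add: dist_norm norm_minus_commute)
    also have "norm (u - f) < e / 3" using uf by (simp add: dist_norm)
    also have "norm (J h u - u) < e / 3"
    proof -
      have "norm (J h u - u) \<le> h * norm w" by (rule J_near[OF h(1) uw])
      also have "\<dots> \<le> h * (norm w + 1)" using h by (intro mult_left_mono) auto
      also have "\<dots> < e / 3" using step_bound[OF h(2)] by simp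
      finally show ?thesis .
    qed
    finally show ?thesis by simp
  qed
  moreover have "e / (3 * (norm w + 1)) > 0" using \<open>e > 0\<close> by (simp add: add_nonneg_pos)
  ultimately show "\<forall>\<^sub>F h in at_right 0. dist (J h f) f < e"
    unfolding eventually_at_right_field by blast
qed

text \<open>Density of the domain of the square of \<open>L\<close>: \<open>J h (J h f)\<close>
  belongs to it and tends to \<open>f\<close> as \<open>h\<close> tends to 0.\<close>

lemma dense_L2: 
  assumes "e > 0"
  shows "\<exists>u w v. (u, w) \<in> L \<and> (w, v) \<in> L \<and> norm (u - f) < e"
proof -
  have "\<forall>\<^sub>F h in at_right 0. dist (J h f) f < e / 2"
    using tendstoD[OF J_tendsto, of "e/2" f] assms by simp
  moreover have "\<forall>\<^sub>F h in at_right (0::real). h > 0" by (rule eventually_at_right_less)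
  ultimately have "\<forall>\<^sub>F h in at_right 0. norm (J h (J h f) - f) < e"
  proof eventually_elim
    case (elim h)
    have "norm (J h (J h f) - f) \<le> norm (J h (J h f - f)) + norm (J h f - f)"
      using norm_triangle_ineq[of "J h (J h f - f)" "J h f - f"] elim by (simp add: J_diff)
    also have "\<dots> < e" using J_norm[of h "J h f - f"] elim by (simp add: dist_norm)
    finally show ?case .
  qed
  with eventually_at_right_less[of "0::real"]
  have "\<forall>\<^sub>F h in at_right (0::real). h > 0 \<and> norm (J h (J h f) - f) < e"
    by eventually_elim auto
  then obtain h where h: "h > 0" "norm (J h (J h f) - f) < e"
    using eventually_happens trivial_limit_at_right_real by blast
  have "(J h f, (f - J h f) /\<^sub>R h) \<in> L" by (rule J_L[OF h(1)])
  from J_preserves[OF h(1) this] 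
  have 1: "(J h (J h f), J h ((f - J h f) /\<^sub>R h)) \<in> L" .
  have "(J h ((f - J h f) /\<^sub>R h), ((f - J h f) /\<^sub>R h - J h ((f - J h f) /\<^sub>R h)) /\<^sub>R h) \<in> L"
    by (rule J_L[OF h(1)])
  with 1 h(2) show ?thesis by blast
qed

text \<open>Both results agree with \<open>u - (2 * k) *\<^sub>R w\<close> up to resolvents of
  \<open>v\<close> with coefficients \<open>4 * k^2\<close>, \<open>2 * k^2\<close> and
  \<open>k^2\<close>, whose sum is below \<open>8 * k^2\<close>.\<close>

lemma J_halve:
  assumes "k > 0" "(u, w) \<in> L" "(w, v) \<in> L"
  shows "norm (J (2 * k) u - J k (J k u)) \<le> 8 * k\<^sup>2 * norm v"
proof -
  have k2: "2 * k > 0" using assms(1) by simp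
  have 1: "J (2 * k) u = u - (2 * k) *\<^sub>R w + (4 * k\<^sup>2) *\<^sub>R J (2 * k) v"
    unfolding J_of_L[OF k2 assms(2)] J_of_L[OF k2 assms(3)] by (simp add: algebra_simps power2_eq_square)
  have a: "J k w = w - k *\<^sub>R J k v" by (rule J_of_L[OF assms(1,3)])
  have b: "J k u = u - k *\<^sub>R w + k\<^sup>2 *\<^sub>R J k v"
    unfolding J_of_L[OF assms(1,2)] a by (simp add: algebra_simps power2_eq_square)
  have c: "J k (J k w) = w - k *\<^sub>R J k v - k *\<^sub>R J k (J k v)"
    using a by (simp add: J_diff[OF assms(1)] J_scale[OF assms(1)])
  have 2: "J k (J k u) = u - (2 * k) *\<^sub>R w + (2 * k\<^sup>2) *\<^sub>R J k v + k\<^sup>2 *\<^sub>R J k (J k v)"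
  proof -
    have "J k (J k u) = J k u - k *\<^sub>R J k (J k w)"
      by (rule J_of_L[OF assms(1) J_preserves[OF assms(1,2)]])
    also have "\<dots> = u - (2 * k) *\<^sub>R w + (2 * k\<^sup>2) *\<^sub>R J k v + k\<^sup>2 *\<^sub>R J k (J k v)"
      unfolding b c by (simp add: algebra_simps power2_eq_square scaleR_2[symmetric])
    finally show ?thesis .
  qed
  have "J (2 * k) u - J k (J k u) = (4 * k\<^sup>2) *\<^sub>R J (2 * k) v - (2 * k\<^sup>2) *\<^sub>R J k v - k\<^sup>2 *\<^sub>R J k (J k v)"
    unfolding 1 2 by simp
  also have "norm \<dots> \<le> norm ((4 * k\<^sup>2) *\<^sub>R J (2 * k) v) + norm ((2 * k\<^sup>2) *\<^sub>R J k v) + norm (k\<^sup>2 *\<^sub>R J k (J k v))"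
    by (rule norm_triangle3')
  also have "\<dots> \<le> (4 * k\<^sup>2) * norm v + (2 * k\<^sup>2) * norm v + k\<^sup>2 * norm v"
    using J_norm[OF k2, of v] J_norm[OF assms(1), of v] J_norm[OF assms(1), of "J k v"]
    by (intro add_mono) (auto intro!: mult_left_mono)
  also have "\<dots> \<le> 8 * k\<^sup>2 * norm v" by (simp add: algebra_simps)
  finally show ?thesis .
qed

text \<open>Stability of the scheme: the local errors of \<open>J_halve\<close> are propagated by
  contractions and merely add up, and the norm of \<open>v\<close> does not grow along the
  iteration.\<close>

lemma Jn_halve:
  assumes "k > 0" "(u, w) \<in> L" "(w, v) \<in> L"
  shows "norm (Jn (2 * k) n u - Jn k (2 * n) u) \<le> real n * 8 * k\<^sup>2 * norm v"
  using assms(2,3)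
proof (induction n arbitrary: u w v)
  case (Suc n)
  have k2: "2 * k > 0" using assms(1) by simp
  have p: "(J k (J k u), J k (J k w)) \<in> L" "(J k (J k w), J k (J k v)) \<in> L"
    using J_preserves assms(1) Suc by auto
  have a: "norm (Jn (2 * k) n (J (2 * k) u - J k (J k u))) \<le> 8 * k\<^sup>2 * norm v"
    using Jn_norm[OF k2, of n "J (2 * k) u - J k (J k u)"] J_halve[OF assms(1) Suc(2,3)] by linarith
  have "norm (Jn (2 * k) n (J k (J k u)) - Jn k (2 * n) (J k (J k u))) \<le> real n * 8 * k\<^sup>2 * norm (J k (J k v))"
    by (rule Suc(1)[OF p])
  also have "\<dots> \<le> real n * 8 * k\<^sup>2 * norm v"
    using J_norm[OF assms(1), of v] J_norm[OF assms(1), of "J k v"] by (intro mult_left_mono) auto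
  finally have b: "norm (Jn (2 * k) n (J k (J k u)) - Jn k (2 * n) (J k (J k u))) \<le> real n * 8 * k\<^sup>2 * norm v" .
  have "Jn (2 * k) (Suc n) u - Jn k (2 * Suc n) u
     = Jn (2 * k) n (J (2 * k) u - J k (J k u)) + (Jn (2 * k) n (J k (J k u)) - Jn k (2 * n) (J k (J k u)))"
    using k2 by (simp add: Jn_Suc' Jn_diff)
  also have "norm \<dots> \<le> norm (Jn (2 * k) n (J (2 * k) u - J k (J k u))) + norm (Jn (2 * k) n (J k (J k u)) - Jn k (2 * n) (J k (J k u)))"
    by (rule norm_triangle_ineq)
  also have "\<dots> \<le> 8 * k\<^sup>2 * norm v + real n * 8 * k\<^sup>2 * norm v"
    by (rule add_mono[OF a b])
  finally show ?case by (simp add: algebra_simps)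
qed simp

text \<open>Backward Euler with step \<open>2 ^ - k\<close>; halving the step changes the result on the domain
  of the square of the operator by \<open>O(2 ^ - k)\<close>.\<close>

definition E :: "nat \<Rightarrow> real \<Rightarrow> 'a L2 \<Rightarrow> 'a L2" where
  "E k t f = Jn ((1/2)^k) (nat \<lfloor>t * 2^k\<rfloor>) f"

definition T :: "real \<Rightarrow> 'a L2 \<Rightarrow> 'a L2" where
  "T t f = lim (\<lambda>k. E k t f)"

lemma E_norm: "norm (E k t f) \<le> norm f"
  by (simp add: E_def Jn_norm)

lemma E_diff: "E k t (f - g) = E k t f - E k t g"
  by (simp add: E_def Jn_diff)

lemma steps_le: "t \<ge> 0 \<Longrightarrow> real (nat \<lfloor>t * 2^k\<rfloor>) * (1/2)^k \<le> t"
proof -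
  assume "t \<ge> 0"
  then have "real (nat \<lfloor>t * 2^k\<rfloor>) \<le> t * 2^k" by (simp add: of_nat_nat)
  then have "real (nat \<lfloor>t * 2^k\<rfloor>) * (1/2)^k \<le> t * 2^k * (1/2)^k" by (intro mult_right_mono) auto
  also have "\<dots> = t" by (simp add: power_divide)
  finally show ?thesis .
qed

text \<open>On halving the step the number of steps becomes \<open>2 * n\<close> or
  \<open>2 * n + 1\<close>. The term with \<open>v\<close> is the halving error over time
  \<open>t\<close>, and the term with \<open>w\<close> pays for a possible surplus step.\<close>

lemma E_step:
  assumes "t \<ge> 0" "(u, w) \<in> L" "(w, v) \<in> L"
  shows "norm (E k t u - E (Suc k) t u) \<le> (4 * t * norm v + norm w) * (1/2)^k"
proof -
  define n where "n = nat \<lfloor>t * 2^k\<rfloor>"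
  define h :: real where "h = (1/2)^Suc k"
  have h: "h > 0" "2 * h = (1/2)^k" by (auto simp: h_def)
  have N: "nat \<lfloor>t * 2^Suc k\<rfloor> = 2 * n \<or> nat \<lfloor>t * 2^Suc k\<rfloor> = 1 + 2 * n"
  proof -
    have "\<lfloor>t * 2^Suc k\<rfloor> = 2 * \<lfloor>t * 2^k\<rfloor> \<or> \<lfloor>t * 2^Suc k\<rfloor> = 1 + 2 * \<lfloor>t * 2^k\<rfloor>"
    proof -
      have "\<lfloor>2 * (t * 2^k)\<rfloor> = 2 * \<lfloor>t * 2^k\<rfloor> \<or> \<lfloor>2 * (t * 2^k)\<rfloor> = 1 + 2 * \<lfloor>t * 2^k\<rfloor>"
        by linarith
      then show ?thesis by (simp add: mult_ac)
    qed
    moreover have "\<lfloor>t * 2^k\<rfloor> \<ge> 0" using assms(1) by simp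
    ultimately show ?thesis unfolding n_def by linarith
  qed
  have nh: "real n * (2 * h) \<le> t" unfolding n_def h(2) by (rule steps_le[OF assms(1)])
  have 1: "norm (Jn (2 * h) n u - Jn h (2 * n) u) \<le> 4 * t * norm v * (1/2)^k"
  proof -
    have "norm (Jn (2 * h) n u - Jn h (2 * n) u) \<le> real n * 8 * h\<^sup>2 * norm v"
      by (rule Jn_halve[OF h(1) assms(2,3)])
    also have "\<dots> = (real n * (2 * h)) * (4 * h * norm v)" by (simp add: power2_eq_square)
    also have "\<dots> \<le> t * (4 * h * norm v)" using h by (intro mult_right_mono nh) auto
    also have "\<dots> \<le> t * (4 * (2 * h) * norm v)" using h assms(1) by (intro mult_left_mono mult_right_mono) auto
    finally show ?thesis unfolding h(2) by (simp add: mult_ac)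
  qed
  have 2: "norm (Jn h (2 * n) u - E (Suc k) t u) \<le> norm w * (1/2)^k"
    using N
  proof
    assume "nat \<lfloor>t * 2^Suc k\<rfloor> = 2 * n"
    then show ?thesis unfolding E_def h_def[symmetric] by simp
  next
    assume "nat \<lfloor>t * 2^Suc k\<rfloor> = 1 + 2 * n"
    then have "norm (Jn h (2 * n) u - E (Suc k) t u) = norm (Jn h (2 * n) (J h u - u))"
      unfolding E_def h_def[symmetric] using h by (simp add: Jn_Suc' Jn_diff norm_minus_commute)
    also have "\<dots> \<le> h * norm w" by (rule order_trans[OF Jn_norm[OF h(1)] J_near[OF h(1) assms(2)]])
    also have "\<dots> \<le> norm w * (1/2)^k" using h(1) by (simp add: h(2)[symmetric] mult_ac)
    finally show ?thesis .
  qed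
  have "E k t u - E (Suc k) t u = (Jn (2 * h) n u - Jn h (2 * n) u) + (Jn h (2 * n) u - E (Suc k) t u)"
    unfolding E_def n_def h(2) by simp
  also have "norm \<dots> \<le> 4 * t * norm v * (1/2)^k + norm w * (1/2)^k"
    by (rule order_trans[OF norm_triangle_ineq add_mono[OF 1 2]])
  finally show ?thesis by (simp add: algebra_simps)
qed

text \<open>The increments are summable on the domain of the square of \<open>L\<close>; uniform
  contractivity extends the Cauchy property to all \<open>f\<close> by density.\<close>

lemma E_tendsto:
  assumes t: "t \<ge> 0"
  shows "(\<lambda>k. E k t f) \<longlonglongrightarrow> T t f"
proof -
  have conv: "Cauchy (\<lambda>k. E k t u)" if u: "(u, w) \<in> L" "(w, v) \<in> L" for u w v
  proof -
    have "summable (\<lambda>k. E (Suc k) t u - E k t u)"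
    proof (rule summable_comparison_test')
      show "summable (\<lambda>k. (4 * t * norm v + norm w) * (1/2)^k)"
        by (intro summable_mult summable_geometric) simp
      show "norm (E (Suc k) t u - E k t u) \<le> (4 * t * norm v + norm w) * (1/2)^k" for k
        using E_step[OF t u, of k] by (simp add: norm_minus_commute)
    qed
    then have "convergent (\<lambda>n. \<Sum>k<n. E (Suc k) t u - E k t u)"
      by (simp add: summable_iff_convergent)
    then have "convergent (\<lambda>n. E n t u - E 0 t u)"
      by (simp add: sum_lessThan_telescope[of "\<lambda>k. E k t u"])
    then have "convergent (\<lambda>n. E n t u)"
      using convergent_diff_const_right_iff[of "\<lambda>n. E n t u" "E 0 t u"] by simp
    then show ?thesis by (rule convergent_Cauchy)
  qed
  have "Cauchy (\<lambda>k. E k t f)"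
  proof (rule metric_CauchyI)
    fix e :: real assume e: "e > 0"
    obtain u w v where u: "(u, w) \<in> L" "(w, v) \<in> L" and uf: "norm (u - f) < e / 3"
      using dense_L2[of "e/3" f] e by auto
    obtain M where M: "\<And>m n. m \<ge> M \<Longrightarrow> n \<ge> M \<Longrightarrow> dist (E m t u) (E n t u) < e / 3"
      using metric_CauchyD[OF conv[OF u], of "e/3"] e by auto
    have "dist (E m t f) (E n t f) < e" if "m \<ge> M" "n \<ge> M" for m n
    proof -
      have a: "dist (E k t f) (E k t u) < e / 3" for k
        using E_norm[of k t "f - u"] uf by (simp add: dist_norm E_diff norm_minus_commute)
      have "dist (E m t f) (E n t f) \<le> dist (E m t f) (E m t u) + dist (E m t u) (E n t u) + dist (E n t f) (E n t u)"
        using dist_triangle[of "E m t f" "E n t f" "E m t u"] dist_triangle[of "E m t u" "E n t f" "E n t u"]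
        by (simp add: dist_commute)
      also have "\<dots> < e" using a[of m] a[of n] M[OF that] by simp
      finally show ?thesis .
    qed
    then show "\<exists>M. \<forall>m\<ge>M. \<forall>n\<ge>M. dist (E m t f) (E n t f) < e" by blast
  qed
  then show ?thesis
    by (simp add: T_def convergent_LIMSEQ_iff[symmetric] Cauchy_convergent_iff)
qed

section \<open>The limit semigroup\<close>

lemma T_add: assumes "t \<ge> 0" shows "T t (f + g) = T t f + T t g"
proof (rule LIMSEQ_unique[OF E_tendsto[OF assms]])
  show "(\<lambda>k. E k t (f + g)) \<longlonglongrightarrow> T t f + T t g"
    using tendsto_add[OF E_tendsto[OF assms] E_tendsto[OF assms]] by (simp add: E_def Jn_plus)
qed

lemma T_cscale: assumes "t \<ge> 0" shows "T t (cscale_L2 c f) = cscale_L2 c (T t f)"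
proof (rule LIMSEQ_unique[OF E_tendsto[OF assms]])
  show "(\<lambda>k. E k t (cscale_L2 c f)) \<longlonglongrightarrow> cscale_L2 c (T t f)"
    using tendsto_cscale[OF E_tendsto[OF assms], of c f] by (simp add: E_def Jn_cscale)
qed

lemma T_scaleR: "t \<ge> 0 \<Longrightarrow> T t (r *\<^sub>R f) = r *\<^sub>R T t f"
  using T_cscale[of t "of_real r" f] by (simp add: cscale_of_real)

lemma T_diff: "t \<ge> 0 \<Longrightarrow> T t (f - g) = T t f - T t g"
  using T_add[of t f "- g"] T_scaleR[of t "-1" g] by simp

lemma T_norm: "t \<ge> 0 \<Longrightarrow> norm (T t f) \<le> norm f"
  by (rule LIMSEQ_le_const2[OF tendsto_norm[OF E_tendsto]]) (use E_norm in blast)+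

lemma T_linear: "t \<ge> 0 \<Longrightarrow> bounded_linear (T t)"
  by (rule bounded_linear_intro[of _ 1]) (auto simp: T_add T_scaleR T_norm)

lemma T_0 [simp]: "T 0 f = f"
  by (simp add: T_def E_def)

lemma steps_tendsto:
  assumes "t \<ge> 0"
  shows "(\<lambda>k. real (nat \<lfloor>t * 2^k\<rfloor>) * (1/2)^k) \<longlonglongrightarrow> t"
proof -
  define s where "s k = real (nat \<lfloor>t * 2^k\<rfloor>) * (1/2)^k" for k
  have s: "s \<longlonglongrightarrow> t"
  proof (rule tendsto_sandwich)
    show "\<forall>\<^sub>F k in sequentially. t - (1/2)^k \<le> s k"
    proof (intro always_eventually allI)
      fix k
      have "real (nat \<lfloor>t * 2^k\<rfloor>) \<ge> t * 2^k - 1" 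
      proof -
        have "real (nat \<lfloor>t * 2^k\<rfloor>) = of_int \<lfloor>t * 2^k\<rfloor>" using assms by (simp add: of_nat_nat)
        moreover have "t * 2^k - 1 < of_int \<lfloor>t * 2^k\<rfloor>" using real_of_int_floor_gt_diff_one by blast
        ultimately show ?thesis by simp
      qed
      then have "(t * 2^k - 1) * (1/2)^k \<le> s k" unfolding s_def by (intro mult_right_mono) auto
      then show "t - (1/2)^k \<le> s k" by (simp add: algebra_simps power_divide)
    qed
    show "\<forall>\<^sub>F k in sequentially. s k \<le> t" using steps_le[OF assms] by (simp add: s_def)
    show "(\<lambda>k. t - (1/2)^k) \<longlonglongrightarrow> t"
      using tendsto_diff[OF tendsto_const LIMSEQ_power_zero[of "1/2::real"], of t] by simp
  qed simp
  then show ?thesis by (simp add: s_def[abs_def])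
qed

text \<open>The bound is \<open>t\<close> times an expression in norms of \<open>w - v\<close> and
  \<open>z\<close>. It therefore stays uniform when \<open>u\<close>, \<open>w\<close>,
  \<open>v\<close> and \<open>z\<close> are moved along another locally bounded semigroup, which the
  uniqueness proof exploits.\<close>

lemma T_derivative:
  assumes "t \<ge> 0" "(u, w) \<in> L" "(v, z) \<in> L"
  shows "norm (T t u - u + t *\<^sub>R w) \<le> t * (2 * norm (w - v) + t * norm z)"
proof -
  define s where "s k = real (nat \<lfloor>t * 2^k\<rfloor>) * (1/2)^k" for k
  have s: "s \<longlonglongrightarrow> t" unfolding s_def by (rule steps_tendsto[OF assms(1)])
  have 1: "(\<lambda>k. norm (E k t u - u + s k *\<^sub>R w)) \<longlonglongrightarrow> norm (T t u - u + t *\<^sub>R w)"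
    by (intro tendsto_intros s E_tendsto assms)
  have 2: "(\<lambda>k. s k * (2 * norm (w - v) + s k * norm z)) \<longlonglongrightarrow> t * (2 * norm (w - v) + t * norm z)"
    by (intro tendsto_intros s)
  show ?thesis
    by (rule LIMSEQ_le[OF 1 2]) (use Jn_derivative[OF _ assms(2,3)] in \<open>auto simp: E_def s_def\<close>)
qed

lemma T_near:
  assumes "t \<ge> 0" "(u, w) \<in> L"
  shows "norm (T t u - u) \<le> t * norm w"
proof (rule LIMSEQ_le_const2[OF tendsto_norm[OF tendsto_diff[OF E_tendsto[OF assms(1)] tendsto_const]]])
  have "norm (E k t u - u) \<le> t * norm w" for k
  proof -
    have "norm (E k t u - u) \<le> (real (nat \<lfloor>t * 2^k\<rfloor>) * (1/2)^k) * norm w"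
      using Jn_near[OF _ assms(2)] by (simp add: E_def)
    also have "\<dots> \<le> t * norm w" by (intro mult_right_mono steps_le assms) auto
    finally show ?thesis .
  qed
  then show "\<exists>N. \<forall>n\<ge>N. norm (E n t u - u) \<le> t * norm w" by blast
qed

lemma T_tendsto_0: "((\<lambda>t. T t f) \<longlongrightarrow> f) (at_right 0)"
proof (rule tendstoI)
  fix e :: real assume "e > 0"
  obtain u w v where uw: "(u, w) \<in> L" and uf: "norm (u - f) < e / 3"
    using dense_L2[of "e/3" f] \<open>e > 0\<close> by auto
  have "dist (T h f) f < e" if h: "h > 0" "h < e / (3 * (norm w + 1))" for h
  proof -
    have "T h f - f = T h (f - u) + (T h u - u) + (u - f)"
      using h by (simp add: T_diff)
    then have "dist (T h f) f \<le> norm (T h (f - u)) + norm (T h u - u) + norm (u - f)"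
      unfolding dist_norm by (simp only: norm_triangle3)
    also have "norm (T h (f - u)) < e / 3"
      using T_norm[of h "f - u"] h uf by (simp add: norm_minus_commute)
    also have "norm (u - f) < e / 3" using uf by simp
    also have "norm (T h u - u) < e / 3"
    proof -
      have "norm (T h u - u) \<le> h * norm w" using h by (intro T_near uw) auto
      also have "\<dots> \<le> h * (norm w + 1)" using h by (intro mult_left_mono) auto
      also have "\<dots> < e / 3" using step_bound[OF h(2)] by simp
      finally show ?thesis .
    qed
    finally show ?thesis by simp
  qed
  moreover have "e / (3 * (norm w + 1)) > 0" using \<open>e > 0\<close> by (simp add: add_nonneg_pos)
  ultimately show "\<forall>\<^sub>F h in at_right 0. dist (T h f) f < e"
    unfolding eventually_at_right_field by blast
qed

text \<open>The floors of \<open>s * 2^k\<close> and \<open>t * 2^k\<close> add up to that of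
  \<open>(s + t) * 2^k\<close> or to one less; the missing step changes the iterate by a multiple of
  \<open>(1/2)^k\<close> on the domain.\<close>

lemma T_semigroup_domain:
  assumes "s \<ge> 0" "t \<ge> 0" "(u, w) \<in> L"
  shows "T (s + t) u = T s (T t u)"
proof -
  have 1: "norm (E k (s + t) u - E k s (E k t u)) \<le> (1/2)^k * norm w" for k
  proof -
    define h :: real where "h = (1/2)^k"
    define a b c where "a = nat \<lfloor>s * 2^k\<rfloor>" "b = nat \<lfloor>t * 2^k\<rfloor>" "c = nat \<lfloor>(s + t) * 2^k\<rfloor>"
    have "\<lfloor>s * 2^k + t * 2^k\<rfloor> = \<lfloor>s * 2^k\<rfloor> + \<lfloor>t * 2^k\<rfloor> \<or> \<lfloor>s * 2^k + t * 2^k\<rfloor> = 1 + (\<lfloor>s * 2^k\<rfloor> + \<lfloor>t * 2^k\<rfloor>)"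
      by linarith
    moreover have "\<lfloor>s * 2^k\<rfloor> \<ge> 0" "\<lfloor>t * 2^k\<rfloor> \<ge> 0" using assms by simp_all
    ultimately have c: "c = a + b \<or> c = (a + b) + 1"
      unfolding a_b_c_def distrib_right by linarith
    have h: "h > 0" by (simp add: h_def)
    from c show ?thesis
    proof
      assume "c = a + b"
      then show ?thesis unfolding E_def a_b_c_def[symmetric] by (simp add: Jn_add)
    next
      assume "c = (a + b) + 1"
      then have "norm (E k (s + t) u - E k s (E k t u)) = norm (Jn h (a + b) (J h u - u))"
        unfolding E_def a_b_c_def[symmetric] h_def[symmetric] Jn_add[symmetric]
        using h by (simp add: Jn_Suc' Jn_diff)
      also have "\<dots> \<le> h * norm w" by (rule order_trans[OF Jn_norm[OF h] J_near[OF h assms(3)]])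
      finally show ?thesis by (simp add: h_def)
    qed
  qed
  have "(\<lambda>k. E k (s + t) u - E k s (E k t u)) \<longlonglongrightarrow> 0"
  proof (rule Lim_null_comparison)
    show "\<forall>\<^sub>F k in sequentially. norm (E k (s + t) u - E k s (E k t u)) \<le> (1/2)^k * norm w"
      using 1 by auto
    show "(\<lambda>k. (1/2)^k * norm w) \<longlonglongrightarrow> 0"
      using tendsto_mult_right[OF LIMSEQ_power_zero[of "1/2::real"], of "norm w"] by simp
  qed
  moreover have "(\<lambda>k. E k s (E k t u - T t u)) \<longlonglongrightarrow> 0"
  proof (rule Lim_null_comparison)
    show "\<forall>\<^sub>F k in sequentially. norm (E k s (E k t u - T t u)) \<le> norm (E k t u - T t u)"
      using E_norm by auto
    show "(\<lambda>k. norm (E k t u - T t u)) \<longlonglongrightarrow> 0"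
      using E_tendsto[OF assms(2)] by (simp add: LIM_zero tendsto_norm_zero)
  qed
  ultimately have "(\<lambda>k. (E k (s + t) u - E k s (E k t u)) + E k s (E k t u - T t u) + E k s (T t u)) \<longlonglongrightarrow> 0 + 0 + T s (T t u)"
    by (intro tendsto_intros E_tendsto assms)
  then have "(\<lambda>k. E k (s + t) u) \<longlonglongrightarrow> T s (T t u)"
    by (simp add: E_diff)
  then show ?thesis
    using E_tendsto[of "s + t" u] assms LIMSEQ_unique by fastforce
qed

lemma T_semigroup:
  assumes "s \<ge> 0" "t \<ge> 0"
  shows "T (s + t) f = T s (T t f)"
proof -
  have "f \<in> closure (Domain L)" using dense by simp
  then obtain X where X: "\<And>n. X n \<in> Domain L" "X \<longlonglongrightarrow> f" by (auto simp: closure_sequential)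
  have "(\<lambda>n. T (s + t) (X n)) \<longlonglongrightarrow> T (s + t) f"
    using assms by (intro bounded_linear.tendsto[OF T_linear X(2)]) auto
  moreover have "(\<lambda>n. T s (T t (X n))) \<longlonglongrightarrow> T s (T t f)"
    using assms by (intro bounded_linear.tendsto[OF T_linear] X) auto
  moreover have "T (s + t) (X n) = T s (T t (X n))" for n
    using X(1)[of n] T_semigroup_domain[OF assms] by auto
  ultimately show ?thesis using LIMSEQ_unique by auto
qed

lemma C0_semigroup_T: "C0_semigroup T"
  unfolding C0_semigroup_def using T_linear T_cscale T_semigroup T_tendsto_0 by auto

section \<open>Identification of the generator\<close>

lemma generator_T_supset:
  assumes "(u, w) \<in> L"
  shows "(u, - w) \<in> generator T"
proof -
  have "((\<lambda>h. (T h u - u) /\<^sub>R h) \<longlongrightarrow> - w) (at_right 0)"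
  proof (rule tendstoI)
    fix e :: real assume e: "e > 0"
    obtain v z where vz: "(v, z) \<in> L" and vw: "norm (w - v) < e / 4"
      using dense_L2[of "e/4" w] e by (metis divide_pos_pos norm_minus_commute zero_less_numeral)
    have "dist ((T h u - u) /\<^sub>R h) (- w) < e" if h: "h > 0" "h < e / (2 * (norm z + 1))" for h
    proof -
      have "dist ((T h u - u) /\<^sub>R h) (- w) = norm ((T h u - u + h *\<^sub>R w) /\<^sub>R h)"
        unfolding dist_norm using h by (simp add: scaleR_right_distrib)
      also have "\<dots> = norm (T h u - u + h *\<^sub>R w) / h" using h by (simp add: divide_inverse)
      also have "\<dots> \<le> (h * (2 * norm (w - v) + h * norm z)) / h"
        using h by (intro divide_right_mono T_derivative assms vz) auto
      also have "\<dots> = 2 * norm (w - v) + h * norm z" using h by simp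
      also have "h * norm z \<le> h * (norm z + 1)" using h by simp
      also have "h * (norm z + 1) < e / 2" using step_bound[OF h(2)] by simp
      also have "2 * norm (w - v) + e / 2 < e" using vw by simp
      finally show ?thesis by simp
    qed
    moreover have "e / (2 * (norm z + 1)) > 0" using e by (simp add: add_nonneg_pos)
    ultimately show "\<forall>\<^sub>F h in at_right 0. dist ((T h u - u) /\<^sub>R h) (- w) < e"
      unfolding eventually_at_right_field by blast
  qed
  then show ?thesis by (simp add: generator_def)
qed

lemma generator_diff:
  assumes "C0_semigroup S" "(u, w) \<in> generator S" "(u', w') \<in> generator S"
  shows "(u - u', w - w') \<in> generator S"
proof -
  have "((\<lambda>h. (S h u - u) /\<^sub>R h - (S h u' - u') /\<^sub>R h) \<longlongrightarrow> w - w') (at_right 0)"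
    using assms by (auto simp: generator_def intro: tendsto_diff)
  moreover have "\<forall>\<^sub>F h in at_right 0. (S h u - u) /\<^sub>R h - (S h u' - u') /\<^sub>R h = (S h (u - u') - (u - u')) /\<^sub>R h"
    using eventually_at_right_less[of "0::real"]
  proof eventually_elim
    case (elim h)
    then have "bounded_linear (S h)" using assms(1) by (auto simp: C0_semigroup_def)
    then interpret bounded_linear "S h" .
    show ?case by (simp add: diff algebra_simps)
  qed
  ultimately show ?thesis by (simp add: generator_def tendsto_cong)
qed

text \<open>The inclusion into \<open>- L\<close> is the maximality of an m-dissipative operator:
  the resolvent provides a \<open>v\<close> in the domain of \<open>L\<close> such that
  \<open>u - v\<close> is mapped to itself by the generator, and for a contraction semigroup this
  forces \<open>u = v\<close>.\<close>

lemma generator_T: "generator T = (\<lambda>(u, w). (u, - w)) ` L"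
proof (rule set_eqI)
  fix p :: "'a L2 \<times> 'a L2"
  obtain u g where p: "p = (u, g)" by (cases p)
  show "p \<in> generator T \<longleftrightarrow> p \<in> (\<lambda>(u, w). (u, - w)) ` L"
  proof
    assume "p \<in> (\<lambda>(u, w). (u, - w)) ` L"
    then show "p \<in> generator T" using generator_T_supset by auto
  next
    assume "p \<in> generator T"
    then have ug: "(u, g) \<in> generator T" by (simp add: p)
    define v where "v = J 1 (u - g)"
    have v: "(v, (u - g) - v) \<in> L" using J_L[of 1 "u - g"] by (simp add: v_def)
    have "(u - v, u - v) \<in> generator T"
      using generator_diff[OF C0_semigroup_T ug generator_T_supset[OF v]] by simp
    then have "((\<lambda>h. inner ((T h (u - v) - (u - v)) /\<^sub>R h) (u - v)) \<longlongrightarrow> inner (u - v) (u - v)) (at_right 0)"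
      by (intro tendsto_inner tendsto_const) (simp add: generator_def)
    moreover have "\<forall>\<^sub>F h in at_right 0. inner ((T h (u - v) - (u - v)) /\<^sub>R h) (u - v) \<le> 0"
      using eventually_at_right_less[of "0::real"]
    proof eventually_elim
      case (elim h)
      have "inner (T h (u - v)) (u - v) \<le> norm (T h (u - v)) * norm (u - v)" by (rule norm_cauchy_schwarz)
      also have "\<dots> \<le> norm (u - v) * norm (u - v)" using elim by (intro mult_right_mono T_norm) auto
      also have "\<dots> = inner (u - v) (u - v)" by (simp add: dot_square_norm power2_eq_square)
      finally have "inner (T h (u - v) - (u - v)) (u - v) \<le> 0" by (simp add: inner_diff_left)
      then show ?case using elim by (simp add: mult_nonneg_nonpos)
    qed
    ultimately have "inner (u - v) (u - v) \<le> 0"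
      by (rule tendsto_upperbound) simp
    then have "u = v" using inner_ge_zero[of "u - v"] inner_eq_zero_iff[of "u - v"] by simp
    with v have "(u, - g) \<in> L" by simp
    then have "(u, - (- g)) \<in> (\<lambda>(u, w). (u, - w)) ` L" by (intro image_eqI[of _ _ "(u, - g)"]) auto
    then show "p \<in> (\<lambda>(u, w). (u, - w)) ` L" by (simp add: p)
  qed
qed

end

section \<open>Uniqueness of semigroups\<close>

text \<open>\<open>2 *\<^sub>R A \<eta>\<close> is the difference of the values at
  \<open>x + \<eta>\<close> and \<open>x - \<eta>\<close>, so at one of these points the norm is at
  least that of \<open>A \<eta>\<close>, whatever the centre \<open>x\<close> is.\<close>

lemma norm_increase_in_ball:
  assumes "bounded_linear A" "0 \<le> K" "K < onorm A" "r > 0"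
  shows "\<exists>y. norm (y - x) \<le> r \<and> r * K \<le> norm (A y)"
proof -
  interpret bounded_linear A by fact
  have "\<exists>\<xi>. K * norm \<xi> < norm (A \<xi>)"
    using onorm_bound[OF assms(2), of A] assms(3) by (meson linorder_not_le)
  then obtain \<xi> where \<xi>: "K * norm \<xi> < norm (A \<xi>)" by blast
  then have "\<xi> \<noteq> 0" by (auto simp: zero)
  define \<eta> where "\<eta> = (r / norm \<xi>) *\<^sub>R \<xi>"
  have \<eta>: "norm \<eta> = r" using \<open>\<xi> \<noteq> 0\<close> assms(4) by (simp add: \<eta>_def)
  have "r * K = (r / norm \<xi>) * (K * norm \<xi>)" using \<open>\<xi> \<noteq> 0\<close> by simp
  also have "\<dots> \<le> (r / norm \<xi>) * norm (A \<xi>)" using \<xi> assms(4) by (intro mult_left_mono) auto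
  also have "\<dots> = norm (A \<eta>)" using assms(4) by (simp add: \<eta>_def scaleR)
  finally have le: "r * K \<le> norm (A \<eta>)" .
  have "2 *\<^sub>R A \<eta> = A (x + \<eta>) - A (x - \<eta>)" by (simp add: add diff scaleR_2)
  then have "2 * norm (A \<eta>) \<le> norm (A (x + \<eta>)) + norm (A (x - \<eta>))"
    using norm_triangle_ineq4[of "A (x + \<eta>)" "A (x - \<eta>)"] by (metis norm_scaleR abs_numeral)
  then have "r * K \<le> norm (A (x + \<eta>)) \<or> r * K \<le> norm (A (x - \<eta>))" using le by linarith
  then show ?thesis
    using \<eta> by (metis add_diff_cancel_left' diff_add_cancel diff_diff_eq2 norm_minus_commute order_refl)
qed

text \<open>Sokal's proof of the uniform boundedness principle.\<close>

lemma uniform_boundedness: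
  fixes T :: "nat \<Rightarrow> 'a::banach \<Rightarrow> 'b::real_normed_vector"
  assumes lin: "\<And>n. bounded_linear (T n)" and bd: "\<And>x. \<exists>B. \<forall>n. norm (T n x) \<le> B"
  shows "\<exists>M. \<forall>n x. norm (T n x) \<le> M * norm x"
proof (rule ccontr)
  assume contra: "\<not> ?thesis"
  have "\<exists>n. onorm (T n) > 4^k" for k :: nat
  proof (rule ccontr)
    assume "\<not> ?thesis"
    then have "onorm (T n) \<le> 4^k" for n by (simp add: not_less)
    then have "norm (T n x) \<le> 4^k * norm x" for n x
      using onorm[OF lin[of n], of x] by (meson mult_right_mono norm_ge_zero order_trans)
    with contra show False by blast
  qed
  then obtain n where n: "\<And>k::nat. onorm (T (n k)) > 4^k" by metis
  define c where "c k = onorm (T (n k))" for k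
  have c: "c k > 4^k" "c k > 0" for k 
    using n[of k] zero_less_power[of "4::real" k] by (auto simp: c_def simp del: zero_less_power)
  have "\<exists>y. norm (y - x) \<le> (1/3)^k \<and> (1/3)^k * (3/4 * c k) \<le> norm (T (n k) y)" for k x
    using c[of k] by (intro norm_increase_in_ball lin) (auto simp: c_def)
  then have "\<exists>x. \<forall>k. True \<and> (norm (x (Suc k) - x k) \<le> (1/3)^k \<and> (1/3)^k * (3/4 * c k) \<le> norm (T (n k) (x (Suc k))))"
    by (intro dependent_nat_choice) auto
  then obtain x where x: "\<And>k. norm (x (Suc k) - x k) \<le> (1/3)^k"
    "\<And>k. (1/3)^k * (3/4 * c k) \<le> norm (T (n k) (x (Suc k)))" by blast
  have near: "norm (x (Suc k + d) - x (Suc k)) \<le> 1/2 * (1/3)^k - 1/2 * (1/3)^(k + d)" for k d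
  proof (induction d)
    case (Suc d)
    have "norm (x (Suc k + Suc d) - x (Suc k)) \<le> norm (x (Suc (Suc k + d)) - x (Suc k + d)) + norm (x (Suc k + d) - x (Suc k))"
      using norm_triangle_ineq[of "x (Suc (Suc k + d)) - x (Suc k + d)" "x (Suc k + d) - x (Suc k)"] by simp
    also have "\<dots> \<le> (1/3)^(Suc k + d) + (1/2 * (1/3)^k - 1/2 * (1/3)^(k + d))"
      by (intro add_mono x Suc)
    also have "\<dots> = 1/2 * (1/3)^k - 1/2 * (1/3)^(k + Suc d)" by simp
    finally show ?case .
  qed simp
  have "summable (\<lambda>k. x (Suc k) - x k)"
    by (rule summable_comparison_test'[where g = "\<lambda>k. (1/3)^k"]) (use x in \<open>auto intro: summable_geometric\<close>)
  then have "convergent (\<lambda>k. \<Sum>j<k. x (Suc j) - x j)" by (simp add: summable_iff_convergent)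
  then have "convergent (\<lambda>k. x k - x 0)" by (simp add: sum_lessThan_telescope[of x])
  then have "convergent x" using convergent_diff_const_right_iff[of x "x 0"] by simp
  then obtain y where y: "x \<longlonglongrightarrow> y" by (auto simp: convergent_def)
  have yk: "norm (y - x (Suc k)) \<le> 1/2 * (1/3)^k" for k
  proof (rule LIMSEQ_le_const2)
    show "(\<lambda>d. norm (x (d + Suc k) - x (Suc k))) \<longlonglongrightarrow> norm (y - x (Suc k))"
      by (intro tendsto_intros LIMSEQ_ignore_initial_segment y)
    have "norm (x (d + Suc k) - x (Suc k)) \<le> 1/2 * (1/3)^k" for d
      using order_trans[OF near[of k d], of "1/2 * (1/3)^k"] by (simp add: add.commute)
    then show "\<exists>N. \<forall>d\<ge>N. norm (x (d + Suc k) - x (Suc k)) \<le> 1/2 * (1/3)^k" by blast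
  qed
  \<comment> \<open>All later points stay within \<open>1/2 * (1/3)^k\<close> of
    \<open>x (Suc k)\<close>. Of the \<open>3/4\<close> of \<open>(1/3)^k * c k\<close> attained
    there, at least \<open>3/4 - 1/2 = 1/4\<close> survives at the limit \<open>y\<close>, and
    \<open>c k > 4^k\<close> beats the shrinking radii.\<close>
  have big: "(1/4) * (4/3)^k \<le> norm (T (n k) y)" for k
  proof -
    interpret bounded_linear "T (n k)" by (rule lin)
    have "norm (T (n k) (y - x (Suc k))) \<le> c k * norm (y - x (Suc k))"
      using onorm[OF lin] by (simp add: c_def)
    also have "\<dots> \<le> c k * (1/2 * (1/3)^k)" using yk c(2)[of k] by (intro mult_left_mono) auto
    finally have 1: "norm (T (n k) (y - x (Suc k))) \<le> c k * (1/2 * (1/3)^k)" .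
    have "norm (T (n k) (x (Suc k))) \<le> norm (T (n k) y) + norm (T (n k) (y - x (Suc k)))"
      using norm_triangle_ineq4[of "T (n k) y" "T (n k) (y - x (Suc k))"] by (simp add: diff)
    with 1 x(2)[of k] have "(1/3)^k * (1/4 * c k) \<le> norm (T (n k) y)" by (simp add: algebra_simps)
    moreover have "(1/4) * (4/3)^k \<le> (1/3)^k * (1/4 * c k)"
      using c(1)[of k] by (simp add: power_divide field_simps)
    ultimately show ?thesis by linarith
  qed
  obtain B where B: "\<And>n. norm (T n y) \<le> B" using bd by blast
  obtain k where "(4/3)^k > 4 * B" using real_arch_pow[of "4/3" "4 * B"] by auto
  with big[of k] B[of "n k"] show False by linarith
qed

context
  fixes S :: "real \<Rightarrow> 'a::euclidean_space L2 \<Rightarrow> 'a L2"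
  assumes S: "C0_semigroup S"
begin

lemma C0_linear: "t \<ge> 0 \<Longrightarrow> bounded_linear (S t)"
  and C0_zero: "S 0 f = f"
  and C0_add: "s \<ge> 0 \<Longrightarrow> t \<ge> 0 \<Longrightarrow> S (s + t) f = S s (S t f)"
  and C0_tendsto: "((\<lambda>t. S t f) \<longlongrightarrow> f) (at_right 0)"
  using S by (auto simp: C0_semigroup_def)

lemma C0_bounded_near_0: "\<exists>\<delta>>0. \<exists>M\<ge>1. \<forall>s f. 0 \<le> s \<and> s \<le> \<delta> \<longrightarrow> norm (S s f) \<le> M * norm f"
proof (rule ccontr)
  assume contra: "\<not> ?thesis"
  have "\<exists>s f. (0 \<le> s \<and> s \<le> inverse (real (Suc n))) \<and> norm (S s f) > real (Suc n) * norm f" for n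
  proof (rule ccontr)
    assume "\<not> ?thesis"
    then have "\<forall>s f. 0 \<le> s \<and> s \<le> inverse (real (Suc n)) \<longrightarrow> norm (S s f) \<le> real (Suc n) * norm f"
      by (meson not_le)
    moreover have "inverse (real (Suc n)) > 0" "real (Suc n) \<ge> 1" by auto
    ultimately show False using contra by blast
  qed
  then obtain s f where s: "\<And>n. 0 \<le> s n" "\<And>n. s n \<le> inverse (real (Suc n))"
    and f: "\<And>n. norm (S (s n) (f n)) > real (Suc n) * norm (f n)"
    by metis
  have s0: "s \<longlonglongrightarrow> 0"
    by (rule tendsto_sandwich[OF _ _ tendsto_const LIMSEQ_inverse_real_of_nat]) (use s in auto)
  have "\<exists>M. \<forall>n x. norm (S (s n) x) \<le> M * norm x"
  proof (rule uniform_boundedness)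
    fix x
    have "(\<lambda>n. S (s n) x) \<longlonglongrightarrow> x"
    proof (rule tendstoI)
      fix e :: real assume "e > 0"
      then have "\<forall>\<^sub>F h in at_right 0. dist (S h x) x < e" using C0_tendsto tendstoD by blast
      then obtain d where d: "d > 0" "\<And>h. h > 0 \<Longrightarrow> h < d \<Longrightarrow> dist (S h x) x < e"
        unfolding eventually_at_right_field by blast
      have "\<forall>\<^sub>F n in sequentially. s n < d" using s0 d(1) by (rule order_tendstoD)
      then show "\<forall>\<^sub>F n in sequentially. dist (S (s n) x) x < e"
      proof eventually_elim
        case (elim n)
        show ?case
        proof (cases "s n = 0")
          case True
          then show ?thesis using C0_zero \<open>e > 0\<close> by simp
        next
          case False
          then show ?thesis using d(2)[of "s n"] elim s(1)[of n] by simp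
        qed
      qed
    qed
    then have "Bseq (\<lambda>n. S (s n) x)" by (intro convergent_imp_Bseq) (auto simp: convergent_def)
    then show "\<exists>B. \<forall>n. norm (S (s n) x) \<le> B" by (auto simp: Bseq_def)
  qed (use s C0_linear in auto)
  then obtain M where M: "\<And>n x. norm (S (s n) x) \<le> M * norm x" by blast
  obtain n where n: "real n > M" using reals_Archimedean2 by blast
  have "real (Suc n) * norm (f n) < M * norm (f n)" using f[of n] M[of n "f n"] by linarith
  moreover have "M * norm (f n) \<le> real (Suc n) * norm (f n)" using n by (intro mult_right_mono) auto
  ultimately show False by simp
qed

lemma C0_bounded: "\<exists>M\<ge>1. \<forall>s f. 0 \<le> s \<and> s \<le> R \<longrightarrow> norm (S s f) \<le> M * norm f"
proof -
  obtain \<delta> M where \<delta>: "\<delta> > 0" and M: "M \<ge> 1" "\<And>s f. 0 \<le> s \<Longrightarrow> s \<le> \<delta> \<Longrightarrow> norm (S s f) \<le> M * norm f"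
    using C0_bounded_near_0 by blast
  have *: "norm (S s f) \<le> M^n * norm f" if "0 \<le> s" "s \<le> real n * \<delta>" for n s f
    using that
  proof (induction n arbitrary: s f)
    case 0
    then show ?case using C0_zero by simp
  next
    case (Suc n)
    have "M^n \<ge> 1" using M(1) by simp
    show ?case
    proof (cases "s \<le> \<delta>")
      case True
      have "norm (S s f) \<le> M * norm f" by (rule M(2)[OF Suc(2) True])
      also have "\<dots> \<le> M^Suc n * norm f" using M(1) \<open>M^n \<ge> 1\<close> by (intro mult_right_mono) auto
      finally show ?thesis .
    next
      case False
      have "S s f = S \<delta> (S (s - \<delta>) f)" using C0_add[of \<delta> "s - \<delta>" f] False \<delta> by simp
      then have "norm (S s f) \<le> M * norm (S (s - \<delta>) f)" using M(2)[of \<delta>] \<delta> by simp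
      also have "\<dots> \<le> M * (M^n * norm f)"
        using M(1) False Suc(3) by (intro mult_left_mono Suc(1)) (auto simp: algebra_simps)
      finally show ?thesis by (simp add: mult.assoc)
    qed
  qed
  obtain n where n: "R / \<delta> < real n" using reals_Archimedean2 by blast
  then have "R \<le> real n * \<delta>" using \<delta> by (simp add: pos_divide_less_eq)
  moreover have "M^n \<ge> 1" using M(1) by simp
  ultimately show ?thesis using * by (meson order_trans)
qed

lemma generator_invariant:
  assumes "(u, g) \<in> generator S" "s \<ge> 0"
  shows "(S s u, S s g) \<in> generator S"
proof -
  interpret bounded_linear "S s" by (rule C0_linear[OF assms(2)])
  have "((\<lambda>h. S s ((S h u - u) /\<^sub>R h)) \<longlongrightarrow> S s g) (at_right 0)"
    using assms(1) by (intro tendsto) (simp add: generator_def)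
  moreover have "\<forall>\<^sub>F h in at_right 0. S s ((S h u - u) /\<^sub>R h) = (S h (S s u) - S s u) /\<^sub>R h"
    using eventually_at_right_less[of "0::real"]
  proof eventually_elim
    case (elim h)
    have "S s (S h u) = S h (S s u)"
      using C0_add[of s h u] C0_add[of h s u] elim assms(2) by (simp add: add.commute)
    then show ?case by (simp add: scaleR diff)
  qed
  ultimately show ?thesis by (simp add: generator_def tendsto_cong)
qed

end

context accretive
begin

text \<open>A discrete form of differentiating \<open>T (t - s) (S s u)\<close>: both semigroups
  have derivative \<open>- S s w\<close> at \<open>S s u\<close>, so over a short step
  \<open>h\<close> they differ by a small multiple of \<open>h\<close>, uniformly in
  \<open>s \<le> t\<close>, and contractivity of \<open>T\<close> lets these errors merely add
  up.\<close>

lemma semigroup_unique_domain: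
  assumes S: "C0_semigroup S" "generator S = (\<lambda>(u, w). (u, - w)) ` L"
    and t: "t \<ge> 0" and uw: "(u, w) \<in> L"
  shows "S t u = T t u"
proof -
  have gen: "(u, - w) \<in> generator S \<longleftrightarrow> (u, w) \<in> L" for u w
    unfolding S(2) by force
  obtain M where M: "M \<ge> 1" "\<And>s f. 0 \<le> s \<Longrightarrow> s \<le> t \<Longrightarrow> norm (S s f) \<le> M * norm f"
    using C0_bounded[OF S(1), of t] by blast
  have inv: "(S s u, S s w) \<in> L" if "s \<ge> 0" "(u, w) \<in> L" for s u w
  proof -
    interpret bounded_linear "S s" by (rule C0_linear[OF S(1) that(1)])
    show ?thesis
      using generator_invariant[OF S(1), of u "- w" s] that gen by (simp add: neg)
  qed
  have "norm (S t u - T t u) \<le> e" if "e > 0" for e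
  proof -
    \<comment> \<open>The error per unit of time will be at most \<open>4 * M * \<epsilon>\<close>:
      one \<open>\<epsilon>\<close> from the difference quotient of \<open>S\<close> and three from
      \<open>T_derivative\<close>, each amplified by \<open>M\<close>.\<close>
    define \<epsilon> where "\<epsilon> = e / (4 * M * (t + 1))"
    have \<epsilon>: "\<epsilon> > 0" using that M t by (simp add: \<epsilon>_def)
    obtain v z where vz: "(v, z) \<in> L" and vw: "norm (v - w) < \<epsilon>"
      using dense_L2[OF \<epsilon>, of w] by blast
    have "((\<lambda>h. (S h u - u) /\<^sub>R h) \<longlongrightarrow> - w) (at_right 0)"
      using gen uw by (simp add: generator_def)
    then have "\<forall>\<^sub>F h in at_right 0. dist ((S h u - u) /\<^sub>R h) (- w) < \<epsilon>"
      using \<epsilon> tendstoD by blast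
    then obtain d where d: "d > 0" "\<And>h. h > 0 \<Longrightarrow> h < d \<Longrightarrow> dist ((S h u - u) /\<^sub>R h) (- w) < \<epsilon>"
      unfolding eventually_at_right_field by blast
    define d' where "d' = min d (\<epsilon> / (norm z + 1))"
    have d': "d' > 0" using d(1) \<epsilon> by (simp add: d'_def add_nonneg_pos)
    obtain N where N: "t / d' < real N" using reals_Archimedean2 by blast
    define h where "h = t / real (Suc N)"
    have "t < real N * d'" using N d' by (simp add: pos_divide_less_eq)
    also have "\<dots> \<le> real (Suc N) * d'" using d' by simp
    finally have hd: "h < d'" by (simp add: h_def divide_less_eq mult.commute)
    have h0: "h \<ge> 0" using t by (simp add: h_def)
    define B where "B = M * \<epsilon> + M * (2 * norm (w - v) + h * norm z)"
    have hz: "h * norm z \<le> \<epsilon>"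
    proof -
      have "h * (norm z + 1) \<le> \<epsilon>"
        using hd by (simp add: d'_def pos_less_divide_eq add_nonneg_pos less_imp_le)
      then show ?thesis using h0 by (simp add: algebra_simps)
    qed
    have "B \<le> 4 * M * \<epsilon>"
    proof -
      have "M * (2 * norm (w - v) + h * norm z) \<le> M * (2 * \<epsilon> + \<epsilon>)"
        using M(1) vw hz by (intro mult_left_mono) (auto simp: norm_minus_commute)
      then show ?thesis by (simp add: B_def algebra_simps)
    qed
    have step: "norm (S (real j * h) u - T (real j * h) u) \<le> real j * h * B" if "j \<le> Suc N" for j
      using that
    proof (induction j)
      case 0
      then show ?case using C0_zero[OF S(1)] by simp
    next
      case (Suc j)
      define s where "s = real j * h"
      have s: "s \<ge> 0" "s \<le> t"
      proof -
        show "s \<ge> 0" using h0 by (simp add: s_def)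
        have "s \<le> real (Suc N) * h" unfolding s_def using Suc(2) h0 by (intro mult_right_mono) auto
        then show "s \<le> t" by (simp add: h_def)
      qed
      interpret Ss: bounded_linear "S s" by (rule C0_linear[OF S(1) s(1)])
      have 1: "norm (S h (S s u) - S s u + h *\<^sub>R S s w) \<le> h * (M * \<epsilon>)"
      proof (cases "h = 0")
        case True
        then show ?thesis using C0_zero[OF S(1)] by simp
      next
        case False
        then have hp: "h > 0" using h0 by simp
        \<comment> \<open>Commuting moves the difference quotient back to \<open>u\<close>, so that
          one choice of \<open>d\<close> serves every \<open>s\<close>.\<close>
        have "S h (S s u) = S s (S h u)"
          using C0_add[OF S(1), of s h u] C0_add[OF S(1), of h s u] s h0 by (simp add: add.commute)
        then have "S h (S s u) - S s u + h *\<^sub>R S s w = S s (S h u - u + h *\<^sub>R w)"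
          by (simp add: Ss.add Ss.diff Ss.scaleR)
        also have "norm \<dots> \<le> M * norm (S h u - u + h *\<^sub>R w)" by (rule M(2)[OF s])
        also have "S h u - u + h *\<^sub>R w = h *\<^sub>R ((S h u - u) /\<^sub>R h - - w)" using hp by (simp add: scaleR_right_distrib)
        also have "norm \<dots> = h * dist ((S h u - u) /\<^sub>R h) (- w)" using hp by (simp add: dist_norm)
        also have "M * \<dots> \<le> M * (h * \<epsilon>)"
          using d(2)[OF hp] hd M(1) hp by (intro mult_left_mono) (auto simp: d'_def less_imp_le)
        finally show ?thesis by (simp add: mult_ac)
      qed
      have 2: "norm (T h (S s u) - S s u + h *\<^sub>R S s w) \<le> h * (M * (2 * norm (w - v) + h * norm z))"
      proof -
        have "norm (T h (S s u) - S s u + h *\<^sub>R S s w) \<le> h * (2 * norm (S s w - S s v) + h * norm (S s z))"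
          by (rule T_derivative[OF h0 inv[OF s(1) uw] inv[OF s(1) vz]])
        also have "\<dots> \<le> h * (2 * (M * norm (w - v)) + h * (M * norm z))"
          using M(2)[OF s, of "w - v"] M(2)[OF s, of z] h0
          by (intro mult_left_mono add_mono) (auto simp: Ss.diff)
        finally show ?thesis by (simp add: algebra_simps)
      qed
      have sh: "real (Suc j) * h = h + s" by (simp add: s_def algebra_simps)
      have "S (real (Suc j) * h) u - T (real (Suc j) * h) u
         = (S h (S s u) - S s u + h *\<^sub>R S s w) - (T h (S s u) - S s u + h *\<^sub>R S s w) + T h (S s u - T s u)"
        unfolding sh C0_add[OF S(1) h0 s(1)] T_semigroup[OF h0 s(1)] by (simp add: T_diff[OF h0])
      also have "norm \<dots> \<le> norm (S h (S s u) - S s u + h *\<^sub>R S s w) + norm (T h (S s u) - S s u + h *\<^sub>R S s w)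
          + norm (T h (S s u - T s u))"
        using norm_triangle_ineq[of "(S h (S s u) - S s u + h *\<^sub>R S s w) - (T h (S s u) - S s u + h *\<^sub>R S s w)" "T h (S s u - T s u)"]
          norm_triangle_ineq4[of "S h (S s u) - S s u + h *\<^sub>R S s w" "T h (S s u) - S s u + h *\<^sub>R S s w"] by linarith
      also have "\<dots> \<le> h * (M * \<epsilon>) + h * (M * (2 * norm (w - v) + h * norm z)) + s * B"
      proof -
        have "norm (T h (S s u - T s u)) \<le> s * B"
          using order_trans[OF T_norm[OF h0]] Suc by (simp add: s_def)
        then show ?thesis using 1 2 by linarith
      qed
      also have "\<dots> = real (Suc j) * h * B" unfolding sh B_def by (simp add: algebra_simps)
      finally show ?case .
    qed
    have Nh: "real (Suc N) * h = t" by (simp add: h_def)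
    have "norm (S t u - T t u) \<le> t * B" using step[of "Suc N"] unfolding Nh by simp
    also have "\<dots> \<le> (t + 1) * (4 * M * \<epsilon>)"
    proof -
      have "t * B \<le> t * (4 * M * \<epsilon>)" using t \<open>B \<le> 4 * M * \<epsilon>\<close> by (intro mult_left_mono)
      also have "\<dots> \<le> (t + 1) * (4 * M * \<epsilon>)" using M(1) \<epsilon> by (intro mult_right_mono) auto
      finally show ?thesis .
    qed
    also have "\<dots> = e"
    proof -
      have "M \<noteq> 0" "t + 1 \<noteq> 0" using M(1) t by auto
      then show ?thesis unfolding \<epsilon>_def by simp
    qed
    finally show ?thesis .
  qed
  then have "norm (S t u - T t u) \<le> 0" by (rule field_le_epsilon[where y = 0, simplified])
  then show ?thesis by simp
qed

lemma semigroup_unique: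
  assumes S: "C0_semigroup S" "generator S = (\<lambda>(u, w). (u, - w)) ` L" and t: "t \<ge> 0"
  shows "S t f = T t f"
proof -
  have "f \<in> closure (Domain L)" using dense by simp
  then obtain X where X: "\<And>n. X n \<in> Domain L" "X \<longlonglongrightarrow> f" by (auto simp: closure_sequential)
  have "(\<lambda>n. S t (X n)) \<longlonglongrightarrow> S t f"
    by (rule bounded_linear.tendsto[OF C0_linear[OF S(1) t] X(2)])
  moreover have "(\<lambda>n. T t (X n)) \<longlonglongrightarrow> T t f"
    by (rule bounded_linear.tendsto[OF T_linear[OF t] X(2)])
  moreover have "S t (X n) = T t (X n)" for n
    using X(1)[of n] semigroup_unique_domain[OF S t] by auto
  ultimately show ?thesis using LIMSEQ_unique by auto
qed

lemma exp_semigroup_eq: 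
  assumes "t \<ge> 0"
  shows "exp_semigroup L t f = T t f"
  unfolding exp_semigroup_def
proof (rule the_equality)
  show "\<exists>T'. C0_semigroup T' \<and> generator T' = (\<lambda>(u, w). (u, - w)) ` L \<and> T t f = T' t f"
    using C0_semigroup_T generator_T by blast
qed (use semigroup_unique assms in blast)

end

section \<open>The Friedrichs extension\<close>

locale nonneg_symmetric =
  fixes S :: "'a::euclidean_space operator"
  assumes add: "(u, w) \<in> S \<Longrightarrow> (u', w') \<in> S \<Longrightarrow> (u + u', w + w') \<in> S"
    and cscale: "(u, w) \<in> S \<Longrightarrow> (cscale_L2 c u, cscale_L2 c w) \<in> S"
    and sym: "(u, w) \<in> S \<Longrightarrow> (u', w') \<in> S \<Longrightarrow> cinner_L2 w u' = cinner_L2 u w'"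
    and nonneg: "(u, w) \<in> S \<Longrightarrow> Re (cinner_L2 w u) \<ge> 0"
    and dense: "closure (Domain S) = UNIV"
begin

lemma zero: "(0, 0) \<in> S"
proof -
  have "Domain S \<noteq> {}" using dense closure_empty by (metis empty_not_UNIV)
  then obtain u w where "(u, w) \<in> S" by auto
  from cscale[OF this, of "of_real 0"] show ?thesis unfolding cscale_of_real by simp
qed

lemma scale: "(u, w) \<in> S \<Longrightarrow> (r *\<^sub>R u, r *\<^sub>R w) \<in> S"
  using cscale[of u w "of_real r"] by (simp add: cscale_of_real)

lemma diff: "(u, w) \<in> S \<Longrightarrow> (u', w') \<in> S \<Longrightarrow> (u - u', w - w') \<in> S"
  using add[of u w "- u'" "- w'"] scale[of u' w' "-1"] by simp

lemma orthogonal_domain: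
  assumes "\<And>u. u \<in> Domain S \<Longrightarrow> cinner_L2 f u = 0"
  shows "f = 0"
proof -
  have "f \<in> closure (Domain S)" using dense by simp
  then obtain X where X: "\<And>n. X n \<in> Domain S" "X \<longlonglongrightarrow> f" by (auto simp: closure_sequential)
  have "(\<lambda>n. cinner_L2 f (X n)) \<longlonglongrightarrow> cinner_L2 f f" by (intro cinner_tendsto tendsto_const X)
  then have "cinner_L2 f f = 0" using assms X(1) by (simp add: LIMSEQ_const_iff)
  then show ?thesis by (simp add: cinner_self)
qed

lemma single_valued:
  assumes "(u, w) \<in> S" "(u, w') \<in> S"
  shows "w = w'"
proof -
  have "w - w' = 0"
  proof (rule orthogonal_domain)
    fix v assume "v \<in> Domain S"
    then obtain z where z: "(v, z) \<in> S" by auto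
    show "cinner_L2 (w - w') v = 0"
      using sym[OF assms(1) z] sym[OF assms(2) z] by (simp add: cinner_diff_left)
  qed
  then show ?thesis by simp
qed

abbreviation q :: "'a L2 \<Rightarrow> 'a L2 \<Rightarrow> complex" where
  "q \<equiv> quadratic_form S"

abbreviation D :: "'a L2 set" where
  "D \<equiv> Domain S"

lemma q_eq: "(u, w) \<in> S \<Longrightarrow> q u v = cinner_L2 w v"
  unfolding quadratic_form_def by (subst the_equality[of _ w]) (auto dest: single_valued)

lemma in_D: "u \<in> D \<Longrightarrow> v \<in> D \<Longrightarrow> u + v \<in> D" "u \<in> D \<Longrightarrow> cscale_L2 c u \<in> D" "u \<in> D \<Longrightarrow> r *\<^sub>R u \<in> D"
  "u \<in> D \<Longrightarrow> v \<in> D \<Longrightarrow> u - v \<in> D" "0 \<in> D"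
  using add cscale scale diff zero by blast+

lemma subspace_D: "subspace D"
  using in_D by (auto simp: subspace_def)

lemma q_add_left: "u \<in> D \<Longrightarrow> u' \<in> D \<Longrightarrow> q (u + u') v = q u v + q u' v"
  using q_eq[OF add] by (fastforce simp: q_eq cinner_add_left)

lemma q_diff_left: "u \<in> D \<Longrightarrow> u' \<in> D \<Longrightarrow> q (u - u') v = q u v - q u' v"
  using q_eq[OF diff] by (fastforce simp: q_eq cinner_diff_left)

lemma q_cscale_left: "u \<in> D \<Longrightarrow> q (cscale_L2 c u) v = c * q u v"
  using q_eq[OF cscale] by (fastforce simp: q_eq cinner_cscale_left)

lemma q_right: 
  "u \<in> D \<Longrightarrow> q u (v + v') = q u v + q u v'" "u \<in> D \<Longrightarrow> q u (v - v') = q u v - q u v'" 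
  "u \<in> D \<Longrightarrow> q u (cscale_L2 c v) = cnj c * q u v"
  by (auto simp: q_eq cinner_add_right cinner_diff_right cinner_cscale_right)

lemma q_commute: "u \<in> D \<Longrightarrow> v \<in> D \<Longrightarrow> q u v = cnj (q v u)"
  using sym cinner_commute by (fastforce simp: q_eq)

lemma q_self: 
  assumes "u \<in> D"
  shows "q u u = of_real (Re (q u u))" "Re (q u u) \<ge> 0"
proof -
  have "q u u \<in> \<real>" using q_commute[OF assms assms] by (metis Reals_cnj_iff)
  then show "q u u = of_real (Re (q u u))" by simp
  show "Re (q u u) \<ge> 0" using assms nonneg by (auto simp: q_eq)
qed

lemma psd_form_q: "\<tau> \<ge> 0 \<Longrightarrow> psd_form D (\<lambda>u v. \<tau> * Re (q u v))"
proof
  show "subspace D" by (rule subspace_D)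
  show "\<tau> * Re (q u v) = \<tau> * Re (q v u)" if "u \<in> D" "v \<in> D" for u v
    using q_commute[OF that] by simp
  show "\<tau> * Re (q (r *\<^sub>R u) v) = r * (\<tau> * Re (q u v))" if "u \<in> D" for u v r
    using q_cscale_left[OF that, of "of_real r" v] by (simp add: cscale_of_real)
qed (auto simp: q_add_left q_self(2) algebra_simps)

section \<open>The form seminorm and closability\<close>

definition p :: "'a L2 \<Rightarrow> real" where
  "p u = sqrt (Re (q u u))"

lemma p_nonneg: "u \<in> D \<Longrightarrow> p u \<ge> 0" and p_sq: "u \<in> D \<Longrightarrow> (p u)\<^sup>2 = Re (q u u)"
  and cmod_q_self: "u \<in> D \<Longrightarrow> cmod (q u u) = (p u)\<^sup>2"
proof -
  show "u \<in> D \<Longrightarrow> p u \<ge> 0" "u \<in> D \<Longrightarrow> (p u)\<^sup>2 = Re (q u u)"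
    by (auto simp: p_def q_self(2))
  then show "cmod (q u u) = (p u)\<^sup>2" if "u \<in> D"
    using q_self[OF that] that by (metis abs_of_nonneg norm_of_real)
qed

lemma q_bound:
  assumes "u \<in> D" "v \<in> D"
  shows "cmod (q u v) \<le> p u * p v"
proof -
  obtain c where c: "cmod c = 1" "c * q u v = of_real (cmod (q u v))"
    using unit_phase by blast
  interpret F: psd_form D "\<lambda>u v. 1 * Re (q u v)" by (rule psd_form_q) simp
  have cu: "cscale_L2 c u \<in> D" using assms(1) by (rule in_D(2))
  have "c * cnj c = 1" using c(1) by (simp add: complex_norm_square[symmetric])
  then have "q (cscale_L2 c u) (cscale_L2 c u) = q u u"
    using assms(1) by (simp add: q_cscale_left q_right mult.assoc[symmetric])
  moreover have "Re (q (cscale_L2 c u) v) = cmod (q u v)"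
    using c(2) assms(1) by (simp add: q_cscale_left)
  ultimately have "(cmod (q u v))\<^sup>2 \<le> (p u * p v)\<^sup>2"
    using F.cauchy_schwarz[OF cu assms(2)] assms by (simp add: power_mult_distrib p_sq)
  then show ?thesis using p_nonneg assms by (auto intro: power2_le_imp_le)
qed

lemma p_triangle:
  assumes "u \<in> D" "v \<in> D"
  shows "p (u + v) \<le> p u + p v"
proof (rule power2_le_imp_le)
  have "Re (q u v) \<le> p u * p v" "Re (q v u) \<le> p u * p v"
    using q_bound[OF assms] q_bound[OF assms(2,1)] complex_Re_le_cmod order_trans by (fastforce simp: mult.commute)+
  then show "(p (u + v))\<^sup>2 \<le> (p u + p v)\<^sup>2"
    using assms in_D(1)[OF assms]
    by (simp add: p_sq q_add_left q_right power2_sum)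
qed (use assms p_nonneg in auto)

lemma p_minus: "u \<in> D \<Longrightarrow> v \<in> D \<Longrightarrow> p (u - v) = p (v - u)"
  by (simp add: p_def q_diff_left q_right in_D)

lemma form_converges_iff:
  "form_converges S \<phi> u \<longleftrightarrow> (\<forall>n. \<phi> n \<in> D) \<and> \<phi> \<longlonglongrightarrow> u \<and> (\<forall>e>0. \<exists>N. \<forall>m\<ge>N. \<forall>n\<ge>N. p (\<phi> m - \<phi> n) < e)"
proof (cases "\<forall>n. \<phi> n \<in> D")
  case True
  then have d: "\<phi> m - \<phi> n \<in> D" for m n by (intro in_D) auto
  have "(\<forall>e>0. \<exists>N. \<forall>m\<ge>N. \<forall>n\<ge>N. (p (\<phi> m - \<phi> n))\<^sup>2 < e) \<longleftrightarrow> (\<forall>e>0. \<exists>N. \<forall>m\<ge>N. \<forall>n\<ge>N. p (\<phi> m - \<phi> n) < e)" (is "?l \<longleftrightarrow> ?r")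
  proof
    assume ?l
    show ?r
    proof (intro allI impI)
      fix e :: real assume "e > 0"
      with \<open>?l\<close> obtain N where N: "\<forall>m\<ge>N. \<forall>n\<ge>N. (p (\<phi> m - \<phi> n))\<^sup>2 < e\<^sup>2" by (meson zero_less_power)
      then have "\<forall>m\<ge>N. \<forall>n\<ge>N. p (\<phi> m - \<phi> n) < e" using \<open>e > 0\<close> by (auto intro: power2_less_imp_less)
      then show "\<exists>N. \<forall>m\<ge>N. \<forall>n\<ge>N. p (\<phi> m - \<phi> n) < e" by blast
    qed
  next
    assume ?r
    show ?l
    proof (intro allI impI)
      fix e :: real assume "e > 0"
      with \<open>?r\<close> obtain N where N: "\<forall>m\<ge>N. \<forall>n\<ge>N. p (\<phi> m - \<phi> n) < sqrt e" by (meson real_sqrt_gt_zero)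
      have "(p (\<phi> m - \<phi> n))\<^sup>2 < e" if "m \<ge> N" "n \<ge> N" for m n
      proof -
        have "(p (\<phi> m - \<phi> n))\<^sup>2 < (sqrt e)\<^sup>2"
          using N that p_nonneg[OF d[of m n]] by (intro power_strict_mono) auto
        then show ?thesis using \<open>e > 0\<close> by simp
      qed
      then show "\<exists>N. \<forall>m\<ge>N. \<forall>n\<ge>N. (p (\<phi> m - \<phi> n))\<^sup>2 < e" by blast
    qed
  qed
  then show ?thesis using True unfolding form_converges_def by (simp add: cmod_q_self[OF d])
next
  case False
  then show ?thesis unfolding form_converges_def by meson
qed

lemma form_converges_D: "form_converges S \<phi> u \<Longrightarrow> \<phi> n \<in> D"
  by (simp add: form_converges_iff)

lemma form_converges_Cauchy:
  assumes "form_converges S \<phi> u" "e > 0"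
  shows "\<exists>N. \<forall>m\<ge>N. \<forall>n\<ge>N. p (\<phi> m - \<phi> n) < e"
  using assms by (simp add: form_converges_iff)

lemma form_converges_bounded:
  assumes "form_converges S \<phi> u"
  shows "\<exists>B\<ge>0. \<forall>n. p (\<phi> n) \<le> B"
proof -
  have D: "\<phi> n \<in> D" for n using assms by (rule form_converges_D)
  have le: "p (\<phi> m) - p (\<phi> n) \<le> p (\<phi> m - \<phi> n)" for m n
    using p_triangle[of "\<phi> m - \<phi> n" "\<phi> n"] D in_D(4)[OF D D] by simp
  have "Cauchy (\<lambda>n. p (\<phi> n))"
  proof (rule metric_CauchyI)
    fix e :: real assume "e > 0"
    then obtain N where N: "\<forall>m\<ge>N. \<forall>n\<ge>N. p (\<phi> m - \<phi> n) < e"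
      using form_converges_Cauchy[OF assms] by blast
    have "dist (p (\<phi> m)) (p (\<phi> n)) < e" if "m \<ge> N" "n \<ge> N" for m n
      using le[of m n] le[of n m] N that p_minus[OF D D, of m n] unfolding dist_real_def by fastforce
    then show "\<exists>M. \<forall>m\<ge>M. \<forall>n\<ge>M. dist (p (\<phi> m)) (p (\<phi> n)) < e" by blast
  qed
  then have "Bseq (\<lambda>n. p (\<phi> n))" by (rule Cauchy_Bseq)
  then obtain B where "B > 0" "\<And>n. norm (p (\<phi> n)) \<le> B" by (auto simp: Bseq_def)
  then show ?thesis by (metis abs_le_D1 less_imp_le real_norm_def)
qed

lemma form_converges_diff:
  assumes "form_converges S \<phi> u" "form_converges S \<psi> v"
  shows "form_converges S (\<lambda>n. \<phi> n - \<psi> n) (u - v)"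
  unfolding form_converges_iff
proof (intro conjI allI impI)
  show "\<phi> n - \<psi> n \<in> D" for n using assms by (intro in_D form_converges_D)
  show "(\<lambda>n. \<phi> n - \<psi> n) \<longlonglongrightarrow> u - v" using assms by (intro tendsto_diff) (auto simp: form_converges_iff)
  fix e :: real assume "e > 0"
  then have e2: "e / 2 > 0" by simp
  obtain N where N: "\<forall>m\<ge>N. \<forall>n\<ge>N. p (\<phi> m - \<phi> n) < e / 2"
    using form_converges_Cauchy[OF assms(1) e2] by blast
  obtain M where M: "\<forall>m\<ge>M. \<forall>n\<ge>M. p (\<psi> m - \<psi> n) < e / 2"
    using form_converges_Cauchy[OF assms(2) e2] by blast
  have "p (\<phi> m - \<psi> m - (\<phi> n - \<psi> n)) < e" if "m \<ge> max N M" "n \<ge> max N M" for m n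
  proof -
    have "\<phi> m - \<psi> m - (\<phi> n - \<psi> n) = (\<phi> m - \<phi> n) + (\<psi> n - \<psi> m)" by simp
    then have "p (\<phi> m - \<psi> m - (\<phi> n - \<psi> n)) \<le> p (\<phi> m - \<phi> n) + p (\<psi> n - \<psi> m)"
      using p_triangle assms by (metis form_converges_D in_D(4))
    also have "\<dots> < e" using N[rule_format, of m n] M[rule_format, of n m] that by simp
    finally show ?thesis .
  qed
  then show "\<exists>N. \<forall>m\<ge>N. \<forall>n\<ge>N. p (\<phi> m - \<psi> m - (\<phi> n - \<psi> n)) < e" by blast
qed

lemma p_cscale:
  assumes "u \<in> D" shows "p (cscale_L2 c u) = cmod c * p u"
proof -
  have "q (cscale_L2 c u) (cscale_L2 c u) = of_real ((cmod c)\<^sup>2) * q u u"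
    using assms by (simp add: q_cscale_left q_right complex_norm_square del: of_real_power)
  then show ?thesis by (simp add: p_def real_sqrt_mult)
qed

lemma form_converges_cscale:
  assumes "form_converges S \<phi> u"
  shows "form_converges S (\<lambda>n. cscale_L2 c (\<phi> n)) (cscale_L2 c u)"
  unfolding form_converges_iff
proof (intro conjI allI impI)
  show "cscale_L2 c (\<phi> n) \<in> D" for n using assms by (intro in_D form_converges_D)
  show "(\<lambda>n. cscale_L2 c (\<phi> n)) \<longlonglongrightarrow> cscale_L2 c u"
    using assms by (intro tendsto_cscale) (auto simp: form_converges_iff)
  fix e :: real assume "e > 0"
  then have e2: "e / (cmod c + 1) > 0" by (simp add: add_nonneg_pos)
  obtain N where N: "\<forall>m\<ge>N. \<forall>n\<ge>N. p (\<phi> m - \<phi> n) < e / (cmod c + 1)"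
    using form_converges_Cauchy[OF assms(1) e2] by blast
  have "p (cscale_L2 c (\<phi> m) - cscale_L2 c (\<phi> n)) < e" if "m \<ge> N" "n \<ge> N" for m n
  proof -
    have d: "\<phi> m - \<phi> n \<in> D" using assms by (intro in_D form_converges_D)
    have "p (cscale_L2 c (\<phi> m) - cscale_L2 c (\<phi> n)) = cmod c * p (\<phi> m - \<phi> n)"
      using p_cscale[OF d] by (simp add: cscale_diff_right)
    also have "\<dots> \<le> (cmod c + 1) * p (\<phi> m - \<phi> n)" using p_nonneg[OF d] by (intro mult_right_mono) auto
    also have "\<dots> < (cmod c + 1) * (e / (cmod c + 1))"
      using N that by (intro mult_strict_left_mono) (auto simp: add_nonneg_pos)
    also have "\<dots> = e" using norm_ge_zero[of c] by (simp add: add_nonneg_eq_0_iff)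
    finally show ?thesis .
  qed
  then show "\<exists>N. \<forall>m\<ge>N. \<forall>n\<ge>N. p (cscale_L2 c (\<phi> m) - cscale_L2 c (\<phi> n)) < e" by blast
qed

text \<open>For fixed \<open>n\<close>, \<open>q (\<phi> n) (\<phi> m)\<close> is the inner product
  of a fixed vector with \<open>\<phi> m\<close> and vanishes as \<open>m\<close> grows. So
  \<open>q (\<phi> n) (\<phi> n)\<close> is the limit of
  \<open>q (\<phi> n) (\<phi> n - \<phi> m)\<close>, which is small by the Cauchy property.\<close>

lemma closable:
  assumes "form_converges S \<phi> 0"
  shows "(\<lambda>n. p (\<phi> n)) \<longlonglongrightarrow> 0"
proof -
  have D: "\<phi> n \<in> D" for n using assms by (rule form_converges_D)
  obtain B where B: "B \<ge> 0" "\<And>n. p (\<phi> n) \<le> B" using form_converges_bounded[OF assms] by blast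
  have "(\<lambda>n. (p (\<phi> n))\<^sup>2) \<longlonglongrightarrow> 0"
  proof (rule LIMSEQ_I)
    fix e :: real assume "e > 0"
    then have e2: "e / (B + 1) > 0" using B by (simp add: add_nonneg_pos)
    obtain N where N: "\<forall>m\<ge>N. \<forall>n\<ge>N. p (\<phi> m - \<phi> n) < e / (B + 1)"
      using form_converges_Cauchy[OF assms(1) e2] by blast
    have "(p (\<phi> n))\<^sup>2 < e" if "n \<ge> N" for n
    proof -
      obtain w where w: "(\<phi> n, w) \<in> S" using D[of n] by auto
      have "(\<lambda>m. q (\<phi> n) (\<phi> n - \<phi> m)) \<longlonglongrightarrow> cinner_L2 w (\<phi> n - 0)"
        unfolding q_eq[OF w] using assms by (intro cinner_tendsto tendsto_intros) (auto simp: form_converges_iff)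
      then have "(\<lambda>m. cmod (q (\<phi> n) (\<phi> n - \<phi> m))) \<longlonglongrightarrow> cmod (q (\<phi> n) (\<phi> n))"
        by (intro tendsto_norm) (simp add: q_eq[OF w])
      then have "cmod (q (\<phi> n) (\<phi> n)) \<le> B * (e / (B + 1))"
      proof (rule LIMSEQ_le_const2)
        have "cmod (q (\<phi> n) (\<phi> n - \<phi> m)) \<le> B * (e / (B + 1))" if "m \<ge> N" for m
        proof -
          have "cmod (q (\<phi> n) (\<phi> n - \<phi> m)) \<le> p (\<phi> n) * p (\<phi> n - \<phi> m)"
            by (intro q_bound in_D D)
          also have "\<dots> \<le> B * (e / (B + 1))"
            using B N \<open>n \<ge> N\<close> that p_nonneg[OF in_D(4)[OF D D]] by (intro mult_mono) (auto intro: less_imp_le)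
          finally show ?thesis .
        qed
        then show "\<exists>N. \<forall>m\<ge>N. cmod (q (\<phi> n) (\<phi> n - \<phi> m)) \<le> B * (e / (B + 1))" by blast
      qed
      also have "\<dots> < e" using B(1) \<open>e > 0\<close> by (simp add: pos_divide_less_eq algebra_simps)
      finally show ?thesis by (simp add: cmod_q_self[OF D])
    qed
    then show "\<exists>N. \<forall>n\<ge>N. norm ((p (\<phi> n))\<^sup>2 - 0) < e" by auto
  qed
  then have "(\<lambda>n. sqrt ((p (\<phi> n))\<^sup>2)) \<longlonglongrightarrow> sqrt 0" by (rule tendsto_real_sqrt)
  then show ?thesis using p_nonneg[OF D] by simp
qed

lemma q_tendsto_0:
  assumes "\<And>n. a n \<in> D" "\<And>n. b n \<in> D" "(\<lambda>n. p (a n)) \<longlonglongrightarrow> 0" "\<And>n. p (b n) \<le> B"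
  shows "(\<lambda>n. q (a n) (b n)) \<longlonglongrightarrow> 0" "(\<lambda>n. q (b n) (a n)) \<longlonglongrightarrow> 0"
proof -
  have 0: "(\<lambda>n. p (a n) * B) \<longlonglongrightarrow> 0" using tendsto_mult_left_zero[OF assms(3)] .
  have le: "p (a n) * p (b n) \<le> p (a n) * B" for n
    using assms p_nonneg by (intro mult_left_mono) auto
  show "(\<lambda>n. q (a n) (b n)) \<longlonglongrightarrow> 0"
    by (rule Lim_null_comparison[OF always_eventually 0])
      (use order_trans[OF q_bound[OF assms(1,2)] le] in blast)
  show "(\<lambda>n. q (b n) (a n)) \<longlonglongrightarrow> 0"
    by (rule Lim_null_comparison[OF always_eventually 0])
      (use order_trans[OF q_bound[OF assms(2,1)]] le in \<open>simp add: mult.commute\<close>)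
qed

text \<open>Two approximating sequences of the same vector differ by one that converges to 0 in the
  sense of the form, so closability makes the limit independent of the choice, and the description
  in \<open>closed_form\<close> denotes it.\<close>

lemma closed_form_tendsto:
  assumes "form_converges S \<phi> u" "form_converges S \<psi> v"
  shows "(\<lambda>n. q (\<phi> n) (\<psi> n)) \<longlonglongrightarrow> closed_form S u v"
proof -
  note D = form_converges_D[OF assms(1)] form_converges_D[OF assms(2)]
  obtain B where B: "B \<ge> 0" "\<And>n. p (\<phi> n) \<le> B" using form_converges_bounded[OF assms(1)] by blast
  obtain B' where B': "B' \<ge> 0" "\<And>n. p (\<psi> n) \<le> B'" using form_converges_bounded[OF assms(2)] by blast
  have "Cauchy (\<lambda>n. q (\<phi> n) (\<psi> n))"
  proof (rule metric_CauchyI)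
    fix e :: real assume "e > 0"
    define d where "d = e / (B + B' + 1)"
    have d: "d > 0" using B B' \<open>e > 0\<close> by (simp add: d_def add_nonneg_pos)
    obtain N where N: "\<forall>m\<ge>N. \<forall>n\<ge>N. p (\<phi> m - \<phi> n) < d"
      using form_converges_Cauchy[OF assms(1) d] by blast
    obtain M where M: "\<forall>m\<ge>M. \<forall>n\<ge>M. p (\<psi> m - \<psi> n) < d"
      using form_converges_Cauchy[OF assms(2) d] by blast
    have "dist (q (\<phi> m) (\<psi> m)) (q (\<phi> n) (\<psi> n)) < e" if "m \<ge> max N M" "n \<ge> max N M" for m n
    proof -
      have 1: "cmod (q (\<phi> m - \<phi> n) (\<psi> m)) \<le> d * B'"
        using N that B' D d by (intro order_trans[OF q_bound] mult_mono in_D p_nonneg) (auto intro: less_imp_le)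
      have 2: "cmod (q (\<phi> n) (\<psi> m - \<psi> n)) \<le> B * d"
        using M that B D d by (intro order_trans[OF q_bound] mult_mono in_D p_nonneg) (auto intro: less_imp_le)
      have "q (\<phi> m) (\<psi> m) - q (\<phi> n) (\<psi> n) = q (\<phi> m - \<phi> n) (\<psi> m) + q (\<phi> n) (\<psi> m - \<psi> n)"
        using D by (simp add: q_diff_left q_right)
      then have "dist (q (\<phi> m) (\<psi> m)) (q (\<phi> n) (\<psi> n)) \<le> d * B' + B * d"
        unfolding dist_norm using norm_triangle_ineq[of "q (\<phi> m - \<phi> n) (\<psi> m)" "q (\<phi> n) (\<psi> m - \<psi> n)"] 1 2 by simp
      also have "\<dots> < d * (B + B' + 1)" using d by (simp add: algebra_simps)
      also have "\<dots> = e" using B B' by (simp add: d_def)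
      finally show ?thesis .
    qed
    then show "\<exists>M. \<forall>m\<ge>M. \<forall>n\<ge>M. dist (q (\<phi> m) (\<psi> m)) (q (\<phi> n) (\<psi> n)) < e" by blast
  qed
  then obtain z where z: "(\<lambda>n. q (\<phi> n) (\<psi> n)) \<longlonglongrightarrow> z"
    by (auto simp: Cauchy_convergent_iff convergent_def)
  have indep: "(\<lambda>n. q (\<phi>' n) (\<psi>' n)) \<longlonglongrightarrow> z"
    if \<phi>': "form_converges S \<phi>' u" and \<psi>': "form_converges S \<psi>' v" for \<phi>' \<psi>'
  proof -
    note D' = form_converges_D[OF \<phi>'] form_converges_D[OF \<psi>']
    obtain B'' where B'': "\<And>n. p (\<psi>' n) \<le> B''" using form_converges_bounded[OF \<psi>'] by blast
    have a: "(\<lambda>n. p (\<phi>' n - \<phi> n)) \<longlonglongrightarrow> 0" "(\<lambda>n. p (\<psi>' n - \<psi> n)) \<longlonglongrightarrow> 0"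
      using form_converges_diff[OF \<phi>' assms(1)] form_converges_diff[OF \<psi>' assms(2)] closable by simp_all
    have 1: "(\<lambda>n. q (\<phi>' n - \<phi> n) (\<psi>' n)) \<longlonglongrightarrow> 0"
      by (rule q_tendsto_0(1)[OF in_D(4)[OF D'(1) D(1)] D'(2) a(1) B''])
    have 2: "(\<lambda>n. q (\<phi> n) (\<psi>' n - \<psi> n)) \<longlonglongrightarrow> 0"
      by (rule q_tendsto_0(2)[OF in_D(4)[OF D'(2) D(2)] D(1) a(2) B(2)])
    have "q (\<phi>' n) (\<psi>' n) = q (\<phi>' n - \<phi> n) (\<psi>' n) + q (\<phi> n) (\<psi>' n - \<psi> n) + q (\<phi> n) (\<psi> n)" for n
      using D D' by (simp add: q_diff_left q_right)
    then show ?thesis using tendsto_add[OF tendsto_add[OF 1 2] z] by simp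
  qed
  have "closed_form S u v = z"
    unfolding closed_form_def
  proof (rule the_equality)
    fix z' assume "\<forall>\<phi> \<psi>. form_converges S \<phi> u \<longrightarrow> form_converges S \<psi> v \<longrightarrow> (\<lambda>n. q (\<phi> n) (\<psi> n)) \<longlonglongrightarrow> z'"
    then show "z' = z" using assms z LIMSEQ_unique by blast
  qed (use indep in blast)
  then show ?thesis using z by simp
qed

section \<open>The operator associated with the closed form\<close>

abbreviation L :: "'a operator" where
  "L \<equiv> friedrichs_extension S"

lemma S_subset_L: "(u, w) \<in> S \<Longrightarrow> (u, w) \<in> L"
proof -
  assume uw: "(u, w) \<in> S"
  have "q (u - u) (u - u) = 0" using q_eq[OF zero, of 0] by (simp add: cinner_self)
  then have 1: "form_converges S (\<lambda>_. u) u"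
    unfolding form_converges_def using uw by auto
  have "closed_form S u v = cinner_L2 w v" if v: "v \<in> form_domain S" for v
  proof -
    obtain \<psi> where \<psi>: "form_converges S \<psi> v" using v by (auto simp: form_domain_def)
    have "(\<lambda>n. q u (\<psi> n)) \<longlonglongrightarrow> cinner_L2 w v"
      unfolding q_eq[OF uw] using \<psi> by (intro cinner_tendsto tendsto_const) (simp add: form_converges_iff)
    then show ?thesis using closed_form_tendsto[OF 1 \<psi>] LIMSEQ_unique by blast
  qed
  with 1 show ?thesis by (auto simp: friedrichs_extension_def form_domain_def)
qed

text \<open>Minimizing sequences are Cauchy for the form, so their limit lies in the form domain; in
  the limit the Euler-Lagrange inequality is the weak resolvent equation, which is membership in the
  Friedrichs extension.\<close>

lemma minimizer_in_L:
  assumes \<tau>: "\<tau> > 0"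
    and X: "\<And>n. X n \<in> D" "(\<lambda>n. psd_form.J (\<lambda>u v. \<tau> * Re (q u v)) f (X n)) \<longlonglongrightarrow> psd_form.J_inf D (\<lambda>u v. \<tau> * Re (q u v)) f"
  shows "\<exists>u. X \<longlonglongrightarrow> u \<and> (u, (f - u) /\<^sub>R \<tau>) \<in> L"
proof -
  interpret F: psd_form D "\<lambda>u v. \<tau> * Re (q u v)" using \<tau> by (intro psd_form_q) simp
  obtain u where u: "X \<longlonglongrightarrow> u"
    using F.minimizing_convergent[OF X] by (auto simp: Cauchy_convergent_iff convergent_def)
  have Xu: "form_converges S X u"
    unfolding form_converges_def
  proof (intro conjI allI impI)
    fix e :: real assume "e > 0"
    then obtain N where N: "\<forall>m\<ge>N. \<forall>n\<ge>N. \<tau> * Re (q (X m - X n) (X m - X n)) + (norm (X m - X n))\<^sup>2 < \<tau> * e"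
      using F.minimizing_Cauchy[OF X, of "\<tau> * e"] \<tau> by auto
    have "cmod (q (X m - X n) (X m - X n)) < e" if "m \<ge> N" "n \<ge> N" for m n
    proof -
      have "\<tau> * Re (q (X m - X n) (X m - X n)) < \<tau> * e"
        using N[rule_format, OF that] by (smt (verit) zero_le_power2)
      then show ?thesis
        using \<tau> in_D(4)[OF X(1) X(1), of m n] by (simp add: cmod_q_self p_sq)
    qed
    then show "\<exists>N. \<forall>m\<ge>N. \<forall>n\<ge>N. cmod (q (X m - X n) (X m - X n)) < e" by blast
  qed (use X u in auto)
  \<comment> \<open>Along \<open>X\<close> the excess energy tends to 0 while the factor belonging
    to \<open>\<psi> n\<close> is at most \<open>\<tau> * B^2 + (norm (\<psi> n))^2\<close>, which
    stays bounded; so the squared defect of the weak equation is at most 0 in the limit.\<close>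
  have re: "\<tau> * Re (closed_form S u v) + inner (u - f) v = 0" if v: "v \<in> form_domain S" for v
  proof -
    obtain \<psi> where \<psi>: "form_converges S \<psi> v" using v by (auto simp: form_domain_def)
    obtain B where B: "B \<ge> 0" "\<And>n. p (\<psi> n) \<le> B" using form_converges_bounded[OF \<psi>] by blast
    have \<psi>v: "\<psi> \<longlonglongrightarrow> v" using \<psi> by (simp add: form_converges_iff)
    have "(\<lambda>n. \<tau> * Re (q (X n) (\<psi> n)) + inner (X n - f) (\<psi> n)) \<longlonglongrightarrow> \<tau> * Re (closed_form S u v) + inner (u - f) v"
      by (intro tendsto_intros closed_form_tendsto Xu \<psi> u \<psi>v)
    then have 1: "(\<lambda>n. (\<tau> * Re (q (X n) (\<psi> n)) + inner (X n - f) (\<psi> n))\<^sup>2) \<longlonglongrightarrow> (\<tau> * Re (closed_form S u v) + inner (u - f) v)\<^sup>2"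
      by (rule tendsto_power)
    have 2: "(\<lambda>n. (F.J f (X n) - F.J_inf f) * (\<tau> * B\<^sup>2 + (norm (\<psi> n))\<^sup>2)) \<longlonglongrightarrow> (F.J_inf f - F.J_inf f) * (\<tau> * B\<^sup>2 + (norm v)\<^sup>2)"
      by (intro tendsto_intros X \<psi>v)
    have "(\<tau> * Re (closed_form S u v) + inner (u - f) v)\<^sup>2 \<le> (F.J_inf f - F.J_inf f) * (\<tau> * B\<^sup>2 + (norm v)\<^sup>2)"
    proof (rule LIMSEQ_le[OF 1 2], intro exI allI impI)
      fix n
      have "\<psi> n \<in> D" by (rule form_converges_D[OF \<psi>])
      have "(\<tau> * Re (q (X n) (\<psi> n)) + inner (X n - f) (\<psi> n))\<^sup>2 \<le> (F.J f (X n) - F.J_inf f) * (\<tau> * Re (q (\<psi> n) (\<psi> n)) + (norm (\<psi> n))\<^sup>2)"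
        by (rule F.euler_lagrange[OF X(1) \<open>\<psi> n \<in> D\<close>])
      also have "\<dots> \<le> (F.J f (X n) - F.J_inf f) * (\<tau> * B\<^sup>2 + (norm (\<psi> n))\<^sup>2)"
      proof (intro mult_left_mono add_mono order_refl)
        show "Re (q (\<psi> n) (\<psi> n)) \<le> B\<^sup>2"
          using power_mono[OF B(2)[of n] p_nonneg[OF \<open>\<psi> n \<in> D\<close>], of 2] by (simp add: p_sq[OF \<open>\<psi> n \<in> D\<close>])
      qed (use \<tau> F.J_inf_le[OF X(1)] in auto)
      finally show "(\<tau> * Re (q (X n) (\<psi> n)) + inner (X n - f) (\<psi> n))\<^sup>2 \<le> (F.J f (X n) - F.J_inf f) * (\<tau> * B\<^sup>2 + (norm (\<psi> n))\<^sup>2)" .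
    qed
    then show ?thesis by simp
  qed
  have "closed_form S u v = cinner_L2 ((f - u) /\<^sub>R \<tau>) v" if v: "v \<in> form_domain S" for v
  proof -
    obtain \<psi> where \<psi>: "form_converges S \<psi> v" using v by (auto simp: form_domain_def)
    \<comment> \<open>Only real parts are controlled so far; testing with
      \<open>cscale_L2 \<i> v\<close> supplies the imaginary part of the equation.\<close>
    have iv: "cscale_L2 \<i> v \<in> form_domain S"
      using form_converges_cscale[OF \<psi>] by (auto simp: form_domain_def)
    have "closed_form S u (cscale_L2 \<i> v) = cnj \<i> * closed_form S u v"
    proof (rule LIMSEQ_unique[OF closed_form_tendsto[OF Xu form_converges_cscale[OF \<psi>]]])
      show "(\<lambda>n. q (X n) (cscale_L2 \<i> (\<psi> n))) \<longlonglongrightarrow> cnj \<i> * closed_form S u v"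
        using X(1) by (simp add: q_right) (intro tendsto_intros closed_form_tendsto Xu \<psi>)
    qed
    then have "\<tau> * Im (closed_form S u v) + Im (cinner_L2 (u - f) v) = 0"
      using re[OF iv] by (simp add: inner_L2_def cinner_cscale_right)
    with re[OF v] have "of_real \<tau> * closed_form S u v = - cinner_L2 (u - f) v"
      by (simp add: inner_L2_def complex_eq_iff)
    also have "\<dots> = cinner_L2 (f - u) v" by (simp add: cinner_diff_left)
    finally have "cinner_L2 ((f - u) /\<^sub>R \<tau>) v = of_real (inverse \<tau>) * (of_real \<tau> * closed_form S u v)"
      by (simp only: cinner_scaleR_left)
    also have "\<dots> = closed_form S u v"
      using \<tau> by (simp add: mult.assoc[symmetric] flip: of_real_mult)
    finally show ?thesis ..
  qed
  then have "(u, (f - u) /\<^sub>R \<tau>) \<in> L"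
    using Xu by (auto simp: friedrichs_extension_def form_domain_def)
  with u show ?thesis by blast
qed

text \<open>The range condition is the solvability of the variational problem for every
  \<open>\<tau> > 0\<close>; linearity and accretivity are inherited from the form through
  approximating sequences.\<close>

sublocale accretive L
proof
  show "(0, 0) \<in> L" by (rule S_subset_L[OF zero])
  show cs: "(cscale_L2 c u, cscale_L2 c w) \<in> L" if "(u, w) \<in> L" for u w c
  proof -
    from that obtain \<phi> where \<phi>: "form_converges S \<phi> u"
      and eq: "\<And>v. v \<in> form_domain S \<Longrightarrow> closed_form S u v = cinner_L2 w v"
      by (auto simp: friedrichs_extension_def form_domain_def)
    have "closed_form S (cscale_L2 c u) v = cinner_L2 (cscale_L2 c w) v" if v: "v \<in> form_domain S" for v
    proof -
      obtain \<psi> where \<psi>: "form_converges S \<psi> v" using v by (auto simp: form_domain_def)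
      have "closed_form S (cscale_L2 c u) v = c * closed_form S u v"
      proof (rule LIMSEQ_unique[OF closed_form_tendsto[OF form_converges_cscale[OF \<phi>] \<psi>]])
        show "(\<lambda>n. q (cscale_L2 c (\<phi> n)) (\<psi> n)) \<longlonglongrightarrow> c * closed_form S u v"
          using form_converges_D[OF \<phi>] by (simp add: q_cscale_left) (intro tendsto_intros closed_form_tendsto \<phi> \<psi>)
      qed
      then show ?thesis by (simp add: eq[OF v] cinner_cscale_left)
    qed
    then show ?thesis
      using form_converges_cscale[OF \<phi>] by (auto simp: friedrichs_extension_def form_domain_def)
  qed
  have df: "(u - u', w - w') \<in> L" if "(u, w) \<in> L" "(u', w') \<in> L" for u w u' w'
  proof -
    from that obtain \<phi> \<phi>' where \<phi>: "form_converges S \<phi> u" and \<phi>': "form_converges S \<phi>' u'"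
      and eq: "\<And>v. v \<in> form_domain S \<Longrightarrow> closed_form S u v = cinner_L2 w v"
      and eq': "\<And>v. v \<in> form_domain S \<Longrightarrow> closed_form S u' v = cinner_L2 w' v"
      by (auto simp: friedrichs_extension_def form_domain_def)
    have "closed_form S (u - u') v = cinner_L2 (w - w') v" if v: "v \<in> form_domain S" for v
    proof -
      obtain \<psi> where \<psi>: "form_converges S \<psi> v" using v by (auto simp: form_domain_def)
      have "closed_form S (u - u') v = closed_form S u v - closed_form S u' v"
      proof (rule LIMSEQ_unique[OF closed_form_tendsto[OF form_converges_diff[OF \<phi> \<phi>'] \<psi>]])
        show "(\<lambda>n. q (\<phi> n - \<phi>' n) (\<psi> n)) \<longlonglongrightarrow> closed_form S u v - closed_form S u' v"
          using form_converges_D[OF \<phi>] form_converges_D[OF \<phi>'] 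
          by (simp add: q_diff_left) (intro tendsto_intros closed_form_tendsto \<phi> \<phi>' \<psi>)
      qed
      then show ?thesis by (simp add: eq[OF v] eq'[OF v] cinner_diff_left)
    qed
    then show ?thesis
      using form_converges_diff[OF \<phi> \<phi>'] by (auto simp: friedrichs_extension_def form_domain_def)
  qed
  show "(u + u', w + w') \<in> L" if "(u, w) \<in> L" "(u', w') \<in> L" for u w u' w'
    using df[OF that(1) cs[OF that(2), of "of_real (-1)"]] unfolding cscale_of_real by simp
  show "inner w u \<ge> 0" if "(u, w) \<in> L" for u w
  proof -
    from that obtain \<phi> where \<phi>: "form_converges S \<phi> u" and eq: "closed_form S u u = cinner_L2 w u"
      by (auto simp: friedrichs_extension_def form_domain_def)
    have "(\<lambda>n. Re (q (\<phi> n) (\<phi> n))) \<longlonglongrightarrow> Re (cinner_L2 w u)"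
      using closed_form_tendsto[OF \<phi> \<phi>] unfolding eq by (rule tendsto_Re)
    then have "Re (cinner_L2 w u) \<ge> 0"
      by (rule LIMSEQ_le_const) (use form_converges_D[OF \<phi>] q_self in blast)
    then show ?thesis by (simp add: inner_L2_def)
  qed
  show "\<exists>u w. (u, w) \<in> L \<and> u + \<tau> *\<^sub>R w = f" if \<tau>: "\<tau> > 0" for \<tau> f
  proof -
    interpret F: psd_form D "\<lambda>u v. \<tau> * Re (q u v)" using \<tau> by (intro psd_form_q) simp
    obtain X where X: "\<forall>n. X n \<in> D" "(\<lambda>n. F.J f (X n)) \<longlonglongrightarrow> F.J_inf f"
      using F.minimizing_sequence by blast
    obtain u where "(u, (f - u) /\<^sub>R \<tau>) \<in> L"
      using minimizer_in_L[OF \<tau> _ X(2)] X(1) by blast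
    then show ?thesis using \<tau> by (intro exI[of _ u] exI[of _ "(f - u) /\<^sub>R \<tau>"]) auto
  qed
  show "closure (Domain L) = UNIV"
    using closure_mono[of D "Domain L"] dense S_subset_L by blast
qed

lemma minimizing_tendsto_resolvent:
  assumes \<tau>: "\<tau> > 0"
    and X: "\<And>n. X n \<in> D" "(\<lambda>n. psd_form.J (\<lambda>u v. \<tau> * Re (q u v)) f (X n)) \<longlonglongrightarrow> psd_form.J_inf D (\<lambda>u v. \<tau> * Re (q u v)) f"
  shows "X \<longlonglongrightarrow> J \<tau> f"
proof -
  obtain u where u: "X \<longlonglongrightarrow> u" "(u, (f - u) /\<^sub>R \<tau>) \<in> L"
    using minimizer_in_L[OF assms] by blast
  moreover have "J \<tau> f = u" using \<tau> by (intro J_eqI[OF \<tau> u(2)]) simp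
  ultimately show ?thesis by simp
qed

end

section \<open>Smooth functions on open sets\<close>

text \<open>Stripping the innermost derivative lets the sum, product and chain rules go by induction
  on \<open>k\<close> with the function arbitrary. Smoothness on an open subset is wanted for the
  vector potential, which is singular on the flux plane.\<close>

primrec C_on :: "nat \<Rightarrow> (real^4) set \<Rightarrow> (real^4 \<Rightarrow> complex) \<Rightarrow> bool" where
  "C_on 0 U f \<longleftrightarrow> True"
| "C_on (Suc k) U f \<longleftrightarrow> (\<forall>x\<in>U. f differentiable (at x)) \<and> (\<forall>j. C_on k U (partial_deriv j f))"

definition smooth_on :: "(real^4) set \<Rightarrow> (real^4 \<Rightarrow> complex) \<Rightarrow> bool" where
  "smooth_on U f \<longleftrightarrow> (\<forall>k. C_on k U f)"

lemma C_on_UNIV_iff: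
  "C_on k UNIV f \<longleftrightarrow> (\<forall>js x. length js < k \<longrightarrow> foldr partial_deriv js f differentiable (at x))"
proof (induction k arbitrary: f)
  case (Suc k)
  have "(\<forall>js x. length js < Suc k \<longrightarrow> foldr partial_deriv js f differentiable (at x)) \<longleftrightarrow>
     (\<forall>x. f differentiable (at x)) \<and> (\<forall>j js x. length js < k \<longrightarrow> foldr partial_deriv js (partial_deriv j f) differentiable (at x))" (is "?l \<longleftrightarrow> ?r")
  proof
    assume l: ?l
    have "foldr partial_deriv js (partial_deriv j f) differentiable (at x)" if "length js < k" for j js x
      using l[rule_format, of "js @ [j]" x] that by simp
    moreover have "f differentiable (at x)" for x using l[rule_format, of "[]" x] by simp
    ultimately show ?r by blast
  next
    assume r: ?r
    show ?l
    proof (intro allI impI)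
      fix js :: "4 list" and x assume js: "length js < Suc k"
      show "foldr partial_deriv js f differentiable (at x)"
        using r js by (cases js rule: rev_cases) auto
    qed
  qed
  then show ?case using Suc by simp
qed simp

lemma smooth_iff: "smooth f \<longleftrightarrow> smooth_on UNIV f"
  unfolding smooth_def smooth_on_def C_on_UNIV_iff by blast

lemma has_derivative_cong_open:
  assumes "open U" "x \<in> U" "\<And>y. y \<in> U \<Longrightarrow> f y = g y"
  shows "(f has_derivative D) (at x) \<longleftrightarrow> (g has_derivative D) (at x)"
proof
  assume "(f has_derivative D) (at x)"
  then show "(g has_derivative D) (at x)"
    using assms by (rule has_derivative_transform_within_open)
next
  assume "(g has_derivative D) (at x)"
  then show "(f has_derivative D) (at x)"
    using assms(1,2) assms(3)[symmetric] by (rule has_derivative_transform_within_open)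
qed

lemma partial_deriv_cong_open:
  assumes "open U" "x \<in> U" "\<And>y. y \<in> U \<Longrightarrow> f y = g y"
  shows "partial_deriv j f x = partial_deriv j g x"
proof -
  have "(\<lambda>D. (f has_derivative D) (at x)) = (\<lambda>D. (g has_derivative D) (at x))"
    by (rule ext) (rule has_derivative_cong_open[OF assms])
  then show ?thesis by (simp only: partial_deriv_def frechet_derivative_def)
qed

lemma C_on_cong:
  assumes "open U" "\<And>y. y \<in> U \<Longrightarrow> f y = g y"
  shows "C_on k U f \<longleftrightarrow> C_on k U g"
  using assms(2)
proof (induction k arbitrary: f g)
  case (Suc k)
  have "f differentiable (at x) \<longleftrightarrow> g differentiable (at x)" if "x \<in> U" for x
    unfolding differentiable_def using has_derivative_cong_open[OF assms(1) that Suc(2)] by simp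
  moreover have "C_on k U (partial_deriv j f) \<longleftrightarrow> C_on k U (partial_deriv j g)" for j
    by (rule Suc(1)) (rule partial_deriv_cong_open[OF assms(1) _ Suc(2)])
  ultimately show ?case by simp
qed simp

lemma smooth_on_cong:
  assumes "open U" "\<And>y. y \<in> U \<Longrightarrow> f y = g y"
  shows "smooth_on U f \<longleftrightarrow> smooth_on U g"
  unfolding smooth_on_def using C_on_cong[OF assms] by simp

lemma C_on_Suc: "C_on (Suc k) U f \<Longrightarrow> C_on k U f"
  by (induction k arbitrary: f) auto

lemma C_on_subset: "C_on k U f \<Longrightarrow> V \<subseteq> U \<Longrightarrow> C_on k V f"
  by (induction k arbitrary: f) auto

lemma C_on_Un: "C_on k U f \<Longrightarrow> C_on k V f \<Longrightarrow> C_on k (U \<union> V) f"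
  by (induction k arbitrary: f) auto

lemma smooth_on_subset: "smooth_on U f \<Longrightarrow> V \<subseteq> U \<Longrightarrow> smooth_on V f"
  and smooth_on_Un: "smooth_on U f \<Longrightarrow> smooth_on V f \<Longrightarrow> smooth_on (U \<union> V) f"
  by (auto simp: smooth_on_def intro: C_on_subset C_on_Un)

lemma smooth_on_differentiable: "smooth_on U f \<Longrightarrow> x \<in> U \<Longrightarrow> f differentiable (at x)"
  unfolding smooth_on_def using C_on.simps(2)[of 0 U f] by blast

lemma smooth_on_partial_deriv: "smooth_on U f \<Longrightarrow> smooth_on U (partial_deriv j f)"
  unfolding smooth_on_def using C_on.simps(2) by blast

lemma has_derivative_frechet: "f differentiable (at x) \<Longrightarrow> (f has_derivative frechet_derivative f (at x)) (at x)"
  by (simp add: frechet_derivative_works)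

lemma partial_deriv_eq: "(f has_derivative D) (at x) \<Longrightarrow> partial_deriv j f x = D (axis j 1)"
  unfolding partial_deriv_def using frechet_derivative_at by metis

lemma partial_deriv_add:
  assumes "f differentiable (at x)" "g differentiable (at x)"
  shows "partial_deriv j (\<lambda>x. f x + g x) x = partial_deriv j f x + partial_deriv j g x"
  using partial_deriv_eq[OF has_derivative_add[OF assms[THEN has_derivative_frechet]]]
  by (simp add: partial_deriv_def)

lemma partial_deriv_mult:
  assumes "f differentiable (at x)" "g differentiable (at x)"
  shows "partial_deriv j (\<lambda>x. f x * g x) x = f x * partial_deriv j g x + partial_deriv j f x * g x"
  using partial_deriv_eq[OF has_derivative_mult[OF assms[THEN has_derivative_frechet]]]
  by (simp add: partial_deriv_def)

lemma partial_deriv_cnj: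
  assumes "f differentiable (at x)"
  shows "partial_deriv j (\<lambda>x. cnj (f x)) x = cnj (partial_deriv j f x)"
  using partial_deriv_eq[OF bounded_linear.has_derivative[OF bounded_linear_cnj assms[THEN has_derivative_frechet]]]
  by (simp add: partial_deriv_def)

lemma partial_deriv_const [simp]: "partial_deriv j (\<lambda>x. c) = (\<lambda>x. 0)"
  using partial_deriv_eq[OF has_derivative_const] by fastforce

lemma partial_deriv_coord: "partial_deriv j (\<lambda>x. of_real (x $ i)) = (\<lambda>x. if i = j then 1 else 0)"
proof
  fix x :: "real^4"
  have "bounded_linear (\<lambda>x::real^4. complex_of_real (x $ i))"
    using bounded_linear_compose[OF bounded_linear_of_real bounded_linear_vec_nth] .
  then have "((\<lambda>x::real^4. complex_of_real (x $ i)) has_derivative (\<lambda>x. complex_of_real (x $ i))) (at x)"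
    by (rule bounded_linear_imp_has_derivative)
  from partial_deriv_eq[OF this, of j] show "partial_deriv j (\<lambda>x. of_real (x $ i)) x = (if i = j then 1 else 0)"
    by (simp add: axis_def)
qed

section \<open>Algebraic operations on smooth functions\<close>

lemma C_on_add: 
  assumes "open U" "C_on k U f" "C_on k U g"
  shows "C_on k U (\<lambda>x. f x + g x)"
  using assms(2,3)
proof (induction k arbitrary: f g)
  case (Suc k)
  have "C_on k U (partial_deriv j (\<lambda>x. f x + g x)) \<longleftrightarrow> C_on k U (\<lambda>x. partial_deriv j f x + partial_deriv j g x)" for j
    using Suc by (intro C_on_cong[OF assms(1)] partial_deriv_add) auto
  then show ?case using Suc by auto
qed simp

lemma C_on_mult: 
  assumes "open U" "C_on k U f" "C_on k U g"
  shows "C_on k U (\<lambda>x. f x * g x)"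
  using assms(2,3)
proof (induction k arbitrary: f g)
  case (Suc k)
  have "C_on k U (partial_deriv j (\<lambda>x. f x * g x)) \<longleftrightarrow> C_on k U (\<lambda>x. f x * partial_deriv j g x + partial_deriv j f x * g x)" for j
    using Suc by (intro C_on_cong[OF assms(1)] partial_deriv_mult) auto
  moreover have "C_on k U (\<lambda>x. f x * partial_deriv j g x + partial_deriv j f x * g x)" for j
    using Suc(2,3)[THEN C_on_Suc] Suc(2,3) by (intro C_on_add[OF assms(1)] Suc(1)) auto
  ultimately show ?case using Suc by auto
qed simp

lemma C_on_cnj:
  assumes "open U" "C_on k U f"
  shows "C_on k U (\<lambda>x. cnj (f x))"
  using assms(2)
proof (induction k arbitrary: f)
  case (Suc k)
  have "C_on k U (partial_deriv j (\<lambda>x. cnj (f x))) \<longleftrightarrow> C_on k U (\<lambda>x. cnj (partial_deriv j f x))" for j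
    using Suc by (intro C_on_cong[OF assms(1)] partial_deriv_cnj) auto
  moreover have "(\<lambda>x. cnj (f x)) differentiable (at x)" if "x \<in> U" for x
    using bounded_linear.has_derivative[OF bounded_linear_cnj has_derivative_frechet] Suc(2) that
    unfolding differentiable_def[of "\<lambda>x. cnj (f x)"] by auto
  ultimately show ?case using Suc by auto
qed simp

lemma C_on_const: "C_on k U (\<lambda>x. c)"
  by (induction k arbitrary: c) auto

lemma smooth_on_const: "smooth_on U (\<lambda>x. c)"
  by (simp add: smooth_on_def C_on_const)

lemma smooth_on_coord: "smooth_on U (\<lambda>x. of_real (x $ i))"
proof -
  have "C_on k U (\<lambda>x. of_real (x $ i))" for k
  proof (cases k)
    case (Suc m)
    have "(\<lambda>x::real^4. complex_of_real (x $ i)) differentiable (at x)" for x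
      using bounded_linear_imp_differentiable[OF bounded_linear_compose[OF bounded_linear_of_real bounded_linear_vec_nth]] .
    moreover have "C_on m U (partial_deriv j (\<lambda>x. of_real (x $ i)))" for j
      unfolding partial_deriv_coord by (rule C_on_const)
    ultimately show ?thesis using Suc by simp
  qed simp
  then show ?thesis by (simp add: smooth_on_def)
qed

lemma smooth_on_add: "open U \<Longrightarrow> smooth_on U f \<Longrightarrow> smooth_on U g \<Longrightarrow> smooth_on U (\<lambda>x. f x + g x)"
  and smooth_on_mult: "open U \<Longrightarrow> smooth_on U f \<Longrightarrow> smooth_on U g \<Longrightarrow> smooth_on U (\<lambda>x. f x * g x)"
  and smooth_on_cnj: "open U \<Longrightarrow> smooth_on U f \<Longrightarrow> smooth_on U (\<lambda>x. cnj (f x))"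
  by (auto simp: smooth_on_def intro: C_on_add C_on_mult C_on_cnj)

lemma smooth_on_diff: "open U \<Longrightarrow> smooth_on U f \<Longrightarrow> smooth_on U g \<Longrightarrow> smooth_on U (\<lambda>x. f x - g x)"
  using smooth_on_add[of U f "\<lambda>x. (-1) * g x"] smooth_on_mult[of U "\<lambda>x. -1" g] smooth_on_const[of U "-1"] by simp

lemma smooth_on_power: "open U \<Longrightarrow> smooth_on U f \<Longrightarrow> smooth_on U (\<lambda>x. f x ^ n)"
  by (induction n) (auto intro: smooth_on_mult smooth_on_const)

lemma smooth_on_sum: "open U \<Longrightarrow> (\<And>i. i \<in> A \<Longrightarrow> smooth_on U (f i)) \<Longrightarrow> smooth_on U (\<lambda>x. \<Sum>i\<in>A. f i x)"
  by (induction A rule: infinite_finite_induct) (auto intro: smooth_on_add smooth_on_const)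

lemma smooth_on_prod: "open U \<Longrightarrow> (\<And>i. i \<in> A \<Longrightarrow> smooth_on U (f i)) \<Longrightarrow> smooth_on U (\<lambda>x. \<Prod>i\<in>A. f i x)"
  by (induction A rule: infinite_finite_induct) (auto intro: smooth_on_mult smooth_on_const)

section \<open>Composition with functions of one real variable\<close>

lemma has_derivative_real_compose:
  fixes f :: "real^4 \<Rightarrow> real"
  assumes "(\<lambda>x. complex_of_real (f x)) differentiable (at x)" "(h has_real_derivative h') (at (f x))"
  shows "((\<lambda>x. complex_of_real (h (f x))) has_derivative
    (\<lambda>v. of_real h' * frechet_derivative (\<lambda>x. complex_of_real (f x)) (at x) v)) (at x)"
proof -
  define F' where "F' = frechet_derivative (\<lambda>x. complex_of_real (f x)) (at x)"
  have F': "((\<lambda>x. complex_of_real (f x)) has_derivative F') (at x)"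
    unfolding F'_def by (rule has_derivative_frechet[OF assms(1)])
  from bounded_linear.has_derivative[OF bounded_linear_Re this]
  have f': "(f has_derivative (\<lambda>v. Re (F' v))) (at x)" by simp
  from bounded_linear.has_derivative[OF bounded_linear_of_real this]
  have "((\<lambda>x. complex_of_real (f x)) has_derivative (\<lambda>v. of_real (Re (F' v)))) (at x)" .
  \<comment> \<open>The embedded function also has the embedded real part of \<open>F'\<close> as
    derivative, so \<open>F'\<close> takes real values.\<close>
  from has_derivative_unique[OF this F'] have eq: "of_real (Re (F' v)) = F' v" for v by metis
  have "((\<lambda>x. h (f x)) has_derivative (\<lambda>v. h' * Re (F' v))) (at x)"
    using has_derivative_compose[OF f' assms(2)[unfolded has_field_derivative_def]] by simp
  from bounded_linear.has_derivative[OF bounded_linear_of_real[where 'a = complex] this]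
  show ?thesis unfolding F'_def[symmetric] by (simp add: eq)
qed

text \<open>A family \<open>H\<close> closed under differentiation on \<open>I\<close> takes the
  place of higher chain rules: the derivative of \<open>h (f x)\<close> is a member of the family
  composed with \<open>f\<close>, times a derivative of \<open>f\<close>, so the induction stays
  within \<open>H\<close>.\<close>

lemma C_on_compose:
  fixes f :: "real^4 \<Rightarrow> real" and H :: "(real \<Rightarrow> real) set"
  assumes U: "open U" and f: "\<And>k. C_on k U (\<lambda>x. of_real (f x))" "\<And>x. x \<in> U \<Longrightarrow> f x \<in> I"
    and H: "\<And>h. h \<in> H \<Longrightarrow> \<exists>h'\<in>H. \<forall>r\<in>I. (h has_real_derivative h' r) (at r)"
    and h: "h \<in> H"
  shows "C_on k U (\<lambda>x. of_real (h (f x)))"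
  using h
proof (induction k arbitrary: h)
  case (Suc k)
  obtain h' where h': "h' \<in> H" "\<And>r. r \<in> I \<Longrightarrow> (h has_real_derivative h' r) (at r)" using H[OF Suc(2)] by blast
  have d: "(\<lambda>x. complex_of_real (f x)) differentiable (at x)" if "x \<in> U" for x
    using f(1)[of 1] that by simp
  have D: "((\<lambda>x. complex_of_real (h (f x))) has_derivative
    (\<lambda>v. of_real (h' (f x)) * frechet_derivative (\<lambda>x. complex_of_real (f x)) (at x) v)) (at x)" if "x \<in> U" for x
    by (rule has_derivative_real_compose[OF d[OF that] h'(2)[OF f(2)[OF that]]])
  have "C_on k U (partial_deriv j (\<lambda>x. complex_of_real (h (f x)))) 
     \<longleftrightarrow> C_on k U (\<lambda>x. of_real (h' (f x)) * partial_deriv j (\<lambda>x. complex_of_real (f x)) x)" for j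
    by (rule C_on_cong[OF U]) (simp only: partial_deriv_eq[OF D], simp only: partial_deriv_def)
  moreover have "C_on k U (partial_deriv j (\<lambda>x. complex_of_real (f x)))" for j
    using f(1)[of "Suc k"] by simp
  moreover have "\<forall>x\<in>U. (\<lambda>x. complex_of_real (h (f x))) differentiable (at x)"
    using D unfolding differentiable_def by blast
  ultimately show ?case
    using C_on_mult[OF U Suc(1)[OF h'(1)]] by simp
qed simp

lemma smooth_on_compose:
  fixes f :: "real^4 \<Rightarrow> real" and H :: "(real \<Rightarrow> real) set"
  assumes "open U" "smooth_on U (\<lambda>x. of_real (f x))" "\<And>x. x \<in> U \<Longrightarrow> f x \<in> I"
    and "\<And>h. h \<in> H \<Longrightarrow> \<exists>h'\<in>H. \<forall>r\<in>I. (h has_real_derivative h' r) (at r)" "h \<in> H"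
  shows "smooth_on U (\<lambda>x. of_real (h (f x)))"
  unfolding smooth_on_def
  by (intro allI C_on_compose[OF assms(1) _ assms(3,4,5)]) (use assms(2) in \<open>auto simp: smooth_on_def\<close>)

lemma smooth_on_powr:
  fixes f :: "real^4 \<Rightarrow> real"
  assumes "open U" "smooth_on U (\<lambda>x. of_real (f x))" "\<And>x. x \<in> U \<Longrightarrow> f x > 0"
  shows "smooth_on U (\<lambda>x. of_real (f x powr p))"
proof (rule smooth_on_compose[OF assms(1,2), where I = "{0<..}" and H = "{\<lambda>r. c * r powr p | c p. True}"])
  fix h :: "real \<Rightarrow> real" assume "h \<in> {\<lambda>r. c * r powr p | c p. True}"
  then obtain c p where h: "h = (\<lambda>r. c * r powr p)" by blast
  have "(h has_real_derivative (c * p) * r powr (p - 1)) (at r)" if "r \<in> {0<..}" for r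
    unfolding h using that by (auto intro!: derivative_eq_intros)
  then show "\<exists>h'\<in>{\<lambda>r. c * r powr p | c p. True}. \<forall>r\<in>{0<..}. (h has_real_derivative h' r) (at r)"
    by (intro bexI[of _ "\<lambda>r. (c * p) * r powr (p - 1)"]) auto
next
  show "(\<lambda>r. r powr p) \<in> {\<lambda>r. c * r powr p | c p. True}" by (rule CollectI, rule exI[of _ 1], rule exI[of _ p]) simp
qed (use assms(3) in auto)

lemma smooth_on_exp:
  fixes f :: "real^4 \<Rightarrow> real"
  assumes "open U" "smooth_on U (\<lambda>x. of_real (f x))"
  shows "smooth_on U (\<lambda>x. of_real (exp (f x)))"
  by (rule smooth_on_compose[OF assms, where I = UNIV and H = "{exp}"]) (auto intro: DERIV_exp)

section \<open>A flat function for cutoffs\<close>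

definition bump :: "real \<Rightarrow> real" where
  "bump r = (if r > 0 then exp (- (1 / r)) else 0)"

lemma poly_exp_tendsto_0: "((\<lambda>z. poly q z * exp (- z)) \<longlongrightarrow> (0::real)) at_top"
proof -
  have "((\<lambda>z. \<Sum>i\<le>degree q. coeff q i * (z ^ i / exp z)) \<longlongrightarrow> (\<Sum>i\<le>degree q. coeff q i * 0)) at_top"
    by (intro tendsto_intros tendsto_power_div_exp_0)
  then show ?thesis
    by (simp add: poly_altdef sum_distrib_right exp_minus divide_inverse mult.assoc)
qed

text \<open>Products of a polynomial in \<open>1 / r\<close> with \<open>exp (- (1 / r))\<close> are
  closed under differentiation; the factor \<open>monom 1 2\<close> comes from differentiating
  \<open>1 / r\<close>. At 0 the right difference quotient is
  \<open>z * poly q z * exp (- z)\<close> with \<open>z = 1 / r\<close>, and the left one is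
  0.\<close>

lemma flat_function_derivative:
  defines "g \<equiv> \<lambda>q r. if r > 0 then poly q (1 / r) * exp (- (1 / r)) else (0::real)"
  shows "(g q has_real_derivative g (monom 1 2 * (q - pderiv q)) r) (at r)"
proof -
  consider "r > 0" | "r < 0" | "r = 0" by linarith
  then show ?thesis
  proof cases
    case 1
    have "((\<lambda>r. poly q (1 / r) * exp (- (1 / r))) has_real_derivative g (monom 1 2 * (q - pderiv q)) r) (at r)"
      using 1 unfolding g_def
      by (auto intro!: derivative_eq_intros DERIV_chain2[OF poly_DERIV] simp: poly_monom power2_eq_square field_simps)
    then show ?thesis
      by (rule has_field_derivative_transform_within_open[where S = "{0<..}"]) (use 1 in \<open>auto simp: g_def\<close>)
  next
    case 2
    have "((\<lambda>r. 0) has_real_derivative g (monom 1 2 * (q - pderiv q)) r) (at r)"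
      using 2 by (simp add: g_def)
    then show ?thesis
      by (rule has_field_derivative_transform_within_open[where S = "{..<0}"]) (use 2 in \<open>auto simp: g_def\<close>)
  next
    case 3
    have "((\<lambda>y. g q y / y) \<longlongrightarrow> 0) (at_left 0)"
      by (rule tendsto_eventually) (auto simp: g_def eventually_at_filter)
    moreover have "((\<lambda>y. g q y / y) \<longlongrightarrow> 0) (at_right 0)"
    proof -
      have "((\<lambda>z. poly ([:0, 1:] * q) z * exp (- z)) \<longlongrightarrow> 0) at_top" by (rule poly_exp_tendsto_0)
      moreover have "\<forall>\<^sub>F z in at_top. poly ([:0, 1:] * q) z * exp (- z) = g q (inverse z) / inverse z"
        using eventually_gt_at_top[of "0::real"] by eventually_elim (simp add: g_def field_simps)
      ultimately have "((\<lambda>z. g q (inverse z) / inverse z) \<longlongrightarrow> 0) at_top"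
        by (simp add: tendsto_cong)
      then show ?thesis unfolding at_right_to_top filterlim_filtermap .
    qed
    ultimately have "((\<lambda>y. g q y / y) \<longlongrightarrow> 0) (at 0)" by (simp add: filterlim_split_at)
    then show ?thesis using 3 by (simp add: has_field_derivative_iff g_def)
  qed
qed

lemma smooth_on_bump:
  fixes f :: "real^4 \<Rightarrow> real"
  assumes "open U" "smooth_on U (\<lambda>x. of_real (f x))"
  shows "smooth_on U (\<lambda>x. of_real (bump (f x)))"
proof (rule smooth_on_compose[OF assms, where I = UNIV and H = "range (\<lambda>q r. if r > 0 then poly q (1 / r) * exp (- (1 / r)) else 0)"])
  show "bump \<in> range (\<lambda>q r. if r > 0 then poly q (1 / r) * exp (- (1 / r)) else 0)"
    by (rule range_eqI[of _ _ 1]) (auto simp: bump_def)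
next
  fix h :: "real \<Rightarrow> real"
  assume "h \<in> range (\<lambda>q r. if r > 0 then poly q (1 / r) * exp (- (1 / r)) else 0)"
  then obtain q where h: "h = (\<lambda>r. if r > 0 then poly q (1 / r) * exp (- (1 / r)) else 0)" by blast
  show "\<exists>h'\<in>range (\<lambda>q r. if r > 0 then poly q (1 / r) * exp (- (1 / r)) else 0). \<forall>r\<in>UNIV. (h has_real_derivative h' r) (at r)"
    unfolding h
    by (rule bexI[where x = "\<lambda>r. if r > 0 then poly (monom 1 2 * (q - pderiv q)) (1 / r) * exp (- (1 / r)) else 0"])
      (use flat_function_derivative[of q] in blast)+
qed simp

lemma bump_nonpos: "r \<le> 0 \<Longrightarrow> bump r = 0" 
  and bump_bounds: "0 \<le> bump r" "bump r \<le> 1"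
  by (auto simp: bump_def)

text \<open>\<open>bump\<close> tends to 1 at infinity, so a growing multiple of \<open>c\<close>
  inside it approximates the indicator of \<open>c > 0\<close>; the box cutoffs are products of such
  factors.\<close>

lemma bump_tendsto_1:
  assumes "c > 0"
  shows "(\<lambda>n. bump (real n * c - d)) \<longlonglongrightarrow> 1"
proof -
  have lim: "filterlim (\<lambda>n. real n * c - d) at_top sequentially"
    using filterlim_tendsto_add_at_top[OF tendsto_const[of "- d"] filterlim_tendsto_pos_mult_at_top[OF tendsto_const assms filterlim_real_sequentially]]
    by (simp add: mult.commute)
  have "(\<lambda>n. exp (- (1 / (real n * c - d)))) \<longlonglongrightarrow> exp (- 0)"
    by (intro tendsto_intros tendsto_divide_0[OF tendsto_const] filterlim_at_top_imp_at_infinity lim)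
  moreover have "\<forall>\<^sub>F n in sequentially. real n * c - d > 0"
    using lim unfolding filterlim_at_top_dense by blast
  then have "\<forall>\<^sub>F n in sequentially. bump (real n * c - d) = exp (- (1 / (real n * c - d)))"
    by eventually_elim (simp add: bump_def)
  ultimately show ?thesis by (simp add: tendsto_cong)
qed

section \<open>Functions with vanishing integrals\<close>

lemma AE_zero_of_borel_integrals:
  fixes f :: "'a::euclidean_space \<Rightarrow> complex"
  assumes int: "integrable lborel f" and z: "\<And>B. B \<in> sets borel \<Longrightarrow> (\<integral>x. indicator B x *\<^sub>R f x \<partial>lborel) = 0"
  shows "AE x in lborel. f x = 0"
proof -
  have real: "AE x in lborel. g x = 0"
    if g: "integrable lborel g" and gz: "\<And>B. B \<in> sets borel \<Longrightarrow> (\<integral>x. indicator B x * g x \<partial>lborel) = 0"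
    for g :: "'a \<Rightarrow> real"
  proof -
    have [measurable]: "g \<in> borel_measurable borel" using g by simp
    define P where "P = {x. g x > 0}"
    have P: "P \<in> sets borel" "- P \<in> sets borel" unfolding P_def by measurable
    have eq: "\<bar>g x\<bar> = indicator P x * g x - indicator (- P) x * g x" for x
      by (auto simp: P_def indicator_def)
    have "(\<integral>x. \<bar>g x\<bar> \<partial>lborel) = (\<integral>x. indicator P x * g x \<partial>lborel) - (\<integral>x. indicator (- P) x * g x \<partial>lborel)"
      unfolding eq using integrable_mult_indicator[of P lborel g] integrable_mult_indicator[of "- P" lborel g] g P
      by (intro Bochner_Integration.integral_diff) auto
    then have "(\<integral>x. \<bar>g x\<bar> \<partial>lborel) = 0" using gz P by simp
    then have "AE x in lborel. \<bar>g x\<bar> = 0"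
      using g by (subst (asm) integral_nonneg_eq_0_iff_AE) auto
    then show ?thesis by simp
  qed
  have ind: "integrable lborel (\<lambda>x. indicator B x *\<^sub>R f x)" if "B \<in> sets borel" for B
    using int that by (intro integrable_mult_indicator) auto
  have "AE x in lborel. Re (f x) = 0"
  proof (rule real)
    show "(\<integral>x. indicator B x * Re (f x) \<partial>lborel) = 0" if "B \<in> sets borel" for B
      using integral_Re[OF ind[OF that]] z[OF that] by simp
  qed (use int in simp)
  moreover have "AE x in lborel. Im (f x) = 0"
  proof (rule real)
    show "(\<integral>x. indicator B x * Im (f x) \<partial>lborel) = 0" if "B \<in> sets borel" for B
      using integral_Im[OF ind[OF that]] z[OF that] by simp
  qed (use int in simp)
  ultimately show ?thesis by eventually_elim (simp add: complex_eq_iff)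
qed

text \<open>\<open>f\<close> may fail to be globally integrable, so the Dynkin argument is run for
  \<open>f\<close> restricted to one set of \<open>G\<close> at a time, and countably many of these
  sets cover the space.\<close>

lemma AE_zero_of_pi_system:
  fixes f :: "'a::euclidean_space \<Rightarrow> complex"
  assumes G: "Int_stable G" "sets borel = sigma_sets UNIV G"
    and f: "f \<in> borel_measurable borel"
    and int: "\<And>A. A \<in> G \<Longrightarrow> integrable lborel (\<lambda>x. indicator A x *\<^sub>R f x)"
    and z: "\<And>A. A \<in> G \<Longrightarrow> (\<integral>x. indicator A x *\<^sub>R f x \<partial>lborel) = 0"
    and cover: "\<And>n::nat. A n \<in> G" "(\<Union>n. A n) = UNIV"
  shows "AE x in lborel. f x = 0"
proof -
  have GB: "X \<in> sets borel" if "X \<in> G" for X using that G(2) by auto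
  have *: "AE x in lborel. indicator X x *\<^sub>R f x = 0" if X: "X \<in> G" for X
  proof (rule AE_zero_of_borel_integrals[OF int[OF X]])
    fix B :: "'a set" assume "B \<in> sets borel"
    then have "B \<in> sigma_sets UNIV G" using G(2) by simp
    have ii: "integrable lborel (\<lambda>x. indicator B x *\<^sub>R (indicator X x *\<^sub>R f x))" if "B \<in> sets borel" for B
      using that by (intro integrable_mult_indicator int[OF X]) auto
    have "G \<subseteq> Pow UNIV" by simp
    from G(1) this \<open>B \<in> sigma_sets UNIV G\<close> show "(\<integral>x. indicator B x *\<^sub>R (indicator X x *\<^sub>R f x) \<partial>lborel) = 0"
    proof (induction rule: sigma_sets_induct_disjoint)
      case (basic C)
      have "(\<integral>x. indicator C x *\<^sub>R (indicator X x *\<^sub>R f x) \<partial>lborel) = (\<integral>x. indicator (C \<inter> X) x *\<^sub>R f x \<partial>lborel)"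
        by (simp add: indicator_inter_arith)
      also have "\<dots> = 0" using basic X G(1) by (intro z) (auto simp: Int_stable_def)
      finally show ?case .
    next
      case (compl C)
      then have C: "C \<in> sets borel" using G(2) by simp
      have "(\<integral>x. indicator (UNIV - C) x *\<^sub>R (indicator X x *\<^sub>R f x) \<partial>lborel)
         = (\<integral>x. indicator X x *\<^sub>R f x - indicator C x *\<^sub>R (indicator X x *\<^sub>R f x) \<partial>lborel)"
        by (intro Bochner_Integration.integral_cong) (auto simp: indicator_def)
      also have "\<dots> = 0"
        using int[OF X] ii[OF C] z[OF X] compl by (subst Bochner_Integration.integral_diff) auto
      finally show ?case .
    next
      case (union C)
      then have C: "C i \<in> sets borel" for i :: nat using G(2) by auto
      have "(LINT x:(\<Union>i. C i)|lborel. indicator X x *\<^sub>R f x) = (\<Sum>i. (LINT x:(C i)|lborel. indicator X x *\<^sub>R f x))"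
      proof (rule lebesgue_integral_countable_add)
        show "set_integrable lborel (\<Union>i. C i) (\<lambda>x. indicator X x *\<^sub>R f x)"
          unfolding set_integrable_def using C by (intro ii) auto
      qed (use C union(1) in \<open>auto simp: disjoint_family_on_def\<close>)
      also have "\<dots> = 0" using union(3) by (simp add: set_lebesgue_integral_def)
      finally show ?case by (simp add: set_lebesgue_integral_def)
    qed simp
  qed
  have "AE x in lborel. \<forall>n. indicator (A n) x *\<^sub>R f x = 0"
    unfolding AE_all_countable using * cover(1) by blast
  then show ?thesis
  proof eventually_elim
    case (elim x)
    obtain n where "x \<in> A n" using cover(2) by blast
    with elim[rule_format, of n] show ?case by simp
  qed
qed

section \<open>Test functions and integration by parts\<close>

abbreviation flux_plane :: "(real^4) set" where
  "flux_plane \<equiv> {x. x $ 1 = 0 \<and> x $ 2 = 0}"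

lemma closed_flux_plane: "closed flux_plane"
proof -
  have "closed {x::real^4. x $ 1 = 0}" "closed {x::real^4. x $ 2 = 0}"
    by (intro closed_Collect_eq continuous_intros)+
  then show ?thesis by (simp add: closed_Int Collect_conj_eq)
qed

lemma open_off_plane: "open (- flux_plane)"
  using closed_flux_plane by (simp only: open_closed double_complement)

lemma test_functions_support:
  assumes "\<phi> \<in> test_functions"
  obtains K where "compact K" "K \<inter> flux_plane = {}" "\<And>x. x \<notin> K \<Longrightarrow> \<phi> x = 0"
proof
  show "compact (closure {x. \<phi> x \<noteq> 0})" "closure {x. \<phi> x \<noteq> 0} \<inter> flux_plane = {}"
    using assms by (auto simp: test_functions_def)
  show "\<phi> x = 0" if "x \<notin> closure {x. \<phi> x \<noteq> 0}" for x
    using that closure_subset[of "{x. \<phi> x \<noteq> 0}"] by auto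
qed

lemma test_functions_smooth: "\<phi> \<in> test_functions \<Longrightarrow> smooth_on UNIV \<phi>"
  by (simp add: test_functions_def smooth_iff)

lemma test_functionsI:
  assumes "smooth_on UNIV \<phi>" "compact K" "K \<inter> flux_plane = {}" "\<And>x. x \<notin> K \<Longrightarrow> \<phi> x = 0"
  shows "\<phi> \<in> test_functions"
proof -
  have sub: "closure {x. \<phi> x \<noteq> 0} \<subseteq> K"
    using assms(4) compact_imp_closed[OF assms(2)] by (intro closure_minimal) auto
  have "compact (K \<inter> closure {x. \<phi> x \<noteq> 0})" using assms(2) by (intro compact_Int_closed closed_closure)
  then have "compact (closure {x. \<phi> x \<noteq> 0})" using sub by (simp add: inf_absorb2)
  with sub assms(1,3) show ?thesis by (auto simp: test_functions_def smooth_iff)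
qed

text \<open>\<open>g\<close> may be singular on the flux plane. The product is smooth off the plane
  and vanishes off the support of \<open>\<phi>\<close>; since the support avoids the plane, these
  two open sets cover the space.\<close>

lemma test_mult_local:
  assumes "\<phi> \<in> test_functions" "smooth_on (- flux_plane) g"
  shows "(\<lambda>x. g x * \<phi> x) \<in> test_functions"
proof -
  obtain K where K: "compact K" "K \<inter> flux_plane = {}" "\<And>x. x \<notin> K \<Longrightarrow> \<phi> x = 0"
    using test_functions_support[OF assms(1)] by blast
  have oK: "open (- K)" using K(1) by (simp add: compact_imp_closed open_Compl)
  have "smooth_on (- K) (\<lambda>x. g x * \<phi> x) \<longleftrightarrow> smooth_on (- K) (\<lambda>x. 0)"
    by (rule smooth_on_cong[OF oK]) (simp add: K)
  then have 1: "smooth_on (- K) (\<lambda>x. g x * \<phi> x)" by (simp add: smooth_on_const)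
  have 2: "smooth_on (- flux_plane) (\<lambda>x. g x * \<phi> x)"
    using assms by (intro smooth_on_mult open_off_plane) (auto intro: smooth_on_subset[OF test_functions_smooth])
  have "- K \<union> - flux_plane = UNIV" using K(2) by blast
  with smooth_on_Un[OF 1 2] have "smooth_on UNIV (\<lambda>x. g x * \<phi> x)" by simp
  then show ?thesis by (rule test_functionsI[OF _ K(1,2)]) (simp add: K)
qed

lemma test_mult:
  assumes "\<phi> \<in> test_functions" "smooth_on UNIV g"
  shows "(\<lambda>x. g x * \<phi> x) \<in> test_functions"
  using assms by (intro test_mult_local) (auto intro: smooth_on_subset)

lemma test_add:
  assumes "\<phi> \<in> test_functions" "\<psi> \<in> test_functions"
  shows "(\<lambda>x. \<phi> x + \<psi> x) \<in> test_functions"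
proof -
  obtain K where K: "compact K" "K \<inter> flux_plane = {}" "\<And>x. x \<notin> K \<Longrightarrow> \<phi> x = 0"
    using test_functions_support[OF assms(1)] by blast
  obtain K' where K': "compact K'" "K' \<inter> flux_plane = {}" "\<And>x. x \<notin> K' \<Longrightarrow> \<psi> x = 0"
    using test_functions_support[OF assms(2)] by blast
  show ?thesis
    by (rule test_functionsI[where K = "K \<union> K'"])
      (use K K' in \<open>auto intro: smooth_on_add[OF open_UNIV test_functions_smooth[OF assms(1)] test_functions_smooth[OF assms(2)]]\<close>)
qed

lemma test_cmult: "\<phi> \<in> test_functions \<Longrightarrow> (\<lambda>x. c * \<phi> x) \<in> test_functions"
  by (intro test_mult smooth_on_const)

lemma test_cnj: 
  assumes "\<phi> \<in> test_functions"
  shows "(\<lambda>x. cnj (\<phi> x)) \<in> test_functions"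
proof -
  obtain K where K: "compact K" "K \<inter> flux_plane = {}" "\<And>x. x \<notin> K \<Longrightarrow> \<phi> x = 0"
    using test_functions_support[OF assms(1)] by blast
  show ?thesis
    by (rule test_functionsI[where K = K]) (use K in \<open>auto intro: smooth_on_cnj[OF open_UNIV test_functions_smooth[OF assms]]\<close>)
qed

lemma test_zero: "(\<lambda>x. 0) \<in> test_functions"
  by (rule test_functionsI[where K = "{}"]) (auto intro: smooth_on_const)

lemma test_sum: "(\<And>i. i \<in> A \<Longrightarrow> f i \<in> test_functions) \<Longrightarrow> (\<lambda>x. \<Sum>i\<in>A. f i x) \<in> test_functions"
  by (induction A rule: infinite_finite_induct) (auto intro: test_zero test_add)

lemma test_partial_deriv:
  assumes "\<phi> \<in> test_functions"
  shows "partial_deriv j \<phi> \<in> test_functions"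
proof -
  obtain K where K: "compact K" "K \<inter> flux_plane = {}" "\<And>x. x \<notin> K \<Longrightarrow> \<phi> x = 0"
    using test_functions_support[OF assms(1)] by blast
  have oK: "open (- K)" using K(1) by (simp add: compact_imp_closed open_Compl)
  have "partial_deriv j \<phi> x = 0" if "x \<notin> K" for x
    using partial_deriv_cong_open[OF oK, of x \<phi> "\<lambda>x. 0" j] that K(3) by simp
  then show ?thesis
    by (intro test_functionsI[OF smooth_on_partial_deriv[OF test_functions_smooth[OF assms]] K(1,2)])
qed

lemma test_differentiable: "\<phi> \<in> test_functions \<Longrightarrow> \<phi> differentiable (at x)"
  using smooth_on_differentiable[OF test_functions_smooth] by blast

lemma test_continuous: "\<phi> \<in> test_functions \<Longrightarrow> continuous_on A \<phi>"
  by (meson continuous_at_imp_continuous_on differentiable_imp_continuous_within test_differentiable)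

lemma test_measurable: "\<phi> \<in> test_functions \<Longrightarrow> \<phi> \<in> borel_measurable borel"
  by (intro borel_measurable_continuous_onI test_continuous)

lemma continuous_test_integrable:
  fixes g :: "real^4 \<Rightarrow> complex"
  assumes "\<phi> \<in> test_functions" "continuous_on UNIV g" "\<And>x. \<phi> x = 0 \<Longrightarrow> g x = 0"
  shows "integrable lborel g"
proof -
  obtain K where K: "compact K" "K \<inter> flux_plane = {}" "\<And>x. x \<notin> K \<Longrightarrow> \<phi> x = 0"
    using test_functions_support[OF assms(1)] by blast
  have "integrable lborel (\<lambda>x. indicator K x *\<^sub>R g x)"
    using assms(2) by (intro borel_integrable_compact K(1)) (auto intro: continuous_on_subset)
  also have "(\<lambda>x. indicator K x *\<^sub>R g x) = g"
    using K(3) assms(3) by (force simp: indicator_def)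
  finally show ?thesis .
qed

lemma test_integrable: "\<phi> \<in> test_functions \<Longrightarrow> integrable lborel \<phi>"
  by (rule continuous_test_integrable) (auto intro: test_continuous)

lemma test_mult_test: "\<phi> \<in> test_functions \<Longrightarrow> \<psi> \<in> test_functions \<Longrightarrow> (\<lambda>x. \<phi> x * \<psi> x) \<in> test_functions"
  by (intro test_mult test_functions_smooth)

lemma test_square_integrable: 
  assumes "\<phi> \<in> test_functions"
  shows "square_integrable \<phi>"
proof -
  have "integrable lborel (\<lambda>x. Re (\<phi> x * cnj (\<phi> x)))"
    by (intro integrable_Re test_integrable test_mult_test test_cnj assms)
  moreover have "Re (\<phi> x * cnj (\<phi> x)) = (cmod (\<phi> x))\<^sup>2" for x
    by (simp add: complex_mult_cnj cmod_power2)
  ultimately show ?thesis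
    using test_measurable[OF assms] by (simp only: square_integrable_def simp_thms)
qed

lemma test_bounded:
  assumes "\<phi> \<in> test_functions"
  shows "\<exists>B\<ge>0. \<forall>x. cmod (\<phi> x) \<le> B"
proof -
  obtain K where K: "compact K" "K \<inter> flux_plane = {}" "\<And>x. x \<notin> K \<Longrightarrow> \<phi> x = 0"
    using test_functions_support[OF assms(1)] by blast
  have "bounded (\<phi> ` K)" by (intro compact_imp_bounded compact_continuous_image test_continuous assms K(1))
  then obtain B where "\<And>x. x \<in> K \<Longrightarrow> cmod (\<phi> x) \<le> B" by (auto simp: bounded_iff)
  then have "cmod (\<phi> x) \<le> \<bar>B\<bar>" for x using K(3)[of x] by (cases "x \<in> K") force+
  then show ?thesis by (intro exI[of _ "\<bar>B\<bar>"]) auto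
qed

section \<open>Integrals of partial derivatives\<close>

lemma has_vector_derivative_partial:
  assumes "f differentiable (at (x + t *\<^sub>R axis j 1))"
  shows "((\<lambda>t. f (x + t *\<^sub>R axis j 1)) has_derivative (\<lambda>s. s *\<^sub>R partial_deriv j f (x + t *\<^sub>R axis j 1))) (at t within S)"
proof -
  define F' where "F' = frechet_derivative f (at (x + t *\<^sub>R axis j 1))"
  have F': "(f has_derivative F') (at (x + t *\<^sub>R axis j 1))"
    unfolding F'_def by (rule has_derivative_frechet[OF assms])
  interpret bounded_linear F' using F' by (rule has_derivative_bounded_linear)
  have "((\<lambda>t. x + t *\<^sub>R axis j 1) has_derivative (\<lambda>s. s *\<^sub>R axis j 1)) (at t within S)"
    by (auto intro!: derivative_eq_intros)
  from has_derivative_compose[OF this F'] show ?thesis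
    by (simp add: scaleR partial_deriv_def flip: F'_def)
qed

text \<open>Difference quotients have integral zero by translation invariance, and dominated
  convergence passes to the derivative. The mean value bound supplies the majorant on a ball, whose
  radius exceeds a bound for the support by 1 because \<open>h n \<le> 1\<close>.\<close>

lemma integral_partial_deriv_zero:
  assumes "F \<in> test_functions"
  shows "(\<integral>x. partial_deriv j F x \<partial>lborel) = 0"
proof -
  define e :: "real^4" where "e = axis j 1"
  have ne: "norm e = 1" by (simp add: e_def)
  obtain K where K: "compact K" "K \<inter> flux_plane = {}" "\<And>x. x \<notin> K \<Longrightarrow> F x = 0"
    using test_functions_support[OF assms(1)] by blast
  obtain R where R: "\<And>x. x \<in> K \<Longrightarrow> norm x \<le> R" using compact_imp_bounded[OF K(1)] by (auto simp: bounded_iff)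
  obtain B where B: "B \<ge> 0" "\<And>x. cmod (partial_deriv j F x) \<le> B"
    using test_bounded[OF test_partial_deriv[OF assms]] by blast
  define h where "h n = inverse (real (Suc n))" for n
  have h: "0 < h n" "h n \<le> 1" for n by (auto simp: h_def field_simps)
  have h0: "h \<longlonglongrightarrow> 0" unfolding h_def by (rule LIMSEQ_inverse_real_of_nat)
  define g where "g n x = (F (x + h n *\<^sub>R e) - F x) /\<^sub>R h n" for n x
  have Fm [measurable]: "F \<in> borel_measurable borel" by (rule test_measurable[OF assms])
  have "(\<integral>x. g n x \<partial>lborel) = 0" for n
  proof -
    have d: "distr lborel borel ((+) (h n *\<^sub>R e)) = (lborel :: (real^4) measure)" by (rule lborel_distr_plus)
    have i: "integrable lborel (\<lambda>x. F (x + h n *\<^sub>R e))"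
      using integrable_distr[of "(+) (h n *\<^sub>R e)" lborel borel F] d test_integrable[OF assms] by (simp add: add.commute)
    have "(\<integral>x. F (x + h n *\<^sub>R e) \<partial>lborel) = (\<integral>x. F x \<partial>lborel)"
      using integral_distr[of "(+) (h n *\<^sub>R e)" lborel borel F] d by (simp add: add.commute)
    then show ?thesis unfolding g_def using i test_integrable[OF assms] by simp
  qed
  moreover have "(\<lambda>n. \<integral>x. g n x \<partial>lborel) \<longlonglongrightarrow> (\<integral>x. partial_deriv j F x \<partial>lborel)"
  proof (rule integral_dominated_convergence[where w = "\<lambda>x. indicator (cball 0 (\<bar>R\<bar> + 1)) x *\<^sub>R B"])
    show "partial_deriv j F \<in> borel_measurable lborel"
      using test_measurable[OF test_partial_deriv[OF assms]] by simp
    show "g n \<in> borel_measurable lborel" for n unfolding g_def by measurable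
    show "integrable lborel (\<lambda>x::real^4. indicator (cball 0 (\<bar>R\<bar> + 1)) x *\<^sub>R B)"
      by (intro borel_integrable_compact continuous_intros compact_cball)
    show "AE x in lborel. (\<lambda>n. g n x) \<longlonglongrightarrow> partial_deriv j F x"
    proof (rule AE_I2)
      fix x
      have "((\<lambda>t. F (x + t *\<^sub>R e)) has_derivative (\<lambda>s. s *\<^sub>R partial_deriv j F x)) (at 0)"
        using has_vector_derivative_partial[of F x 0 j UNIV] test_differentiable[OF assms] by (simp add: e_def)
      then have "((\<lambda>t. norm (F (x + t *\<^sub>R e) - F x - t *\<^sub>R partial_deriv j F x) / norm t) \<longlongrightarrow> 0) (at 0)"
        unfolding has_derivative_at by simp
      moreover have "\<forall>\<^sub>F t in at (0::real). norm (F (x + t *\<^sub>R e) - F x - t *\<^sub>R partial_deriv j F x) / norm t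
          = norm ((F (x + t *\<^sub>R e) - F x) /\<^sub>R t - partial_deriv j F x)"
        unfolding eventually_at_filter
      proof (intro always_eventually allI impI)
        fix t :: real assume "t \<noteq> 0"
        then have "(F (x + t *\<^sub>R e) - F x) /\<^sub>R t - partial_deriv j F x = (F (x + t *\<^sub>R e) - F x - t *\<^sub>R partial_deriv j F x) /\<^sub>R t"
          by (simp add: scaleR_right_diff_distrib)
        then show "norm (F (x + t *\<^sub>R e) - F x - t *\<^sub>R partial_deriv j F x) / norm t
          = norm ((F (x + t *\<^sub>R e) - F x) /\<^sub>R t - partial_deriv j F x)"
          by (simp add: divide_inverse mult.commute)
      qed
      ultimately have "((\<lambda>t. norm ((F (x + t *\<^sub>R e) - F x) /\<^sub>R t - partial_deriv j F x)) \<longlongrightarrow> 0) (at 0)"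
        by (simp add: tendsto_cong)
      then have "((\<lambda>t. (F (x + t *\<^sub>R e) - F x) /\<^sub>R t) \<longlongrightarrow> partial_deriv j F x) (at 0)"
        by (rule LIM_zero_cancel[OF tendsto_norm_zero_cancel])
      moreover have "filterlim h (at 0) sequentially"
        using h(1) by (intro filterlim_atI h0) (auto simp: less_imp_neq[symmetric])
      ultimately show "(\<lambda>n. g n x) \<longlonglongrightarrow> partial_deriv j F x"
        unfolding g_def by (rule filterlim_compose)
    qed
    show "AE x in lborel. norm (g n x) \<le> indicator (cball 0 (\<bar>R\<bar> + 1)) x *\<^sub>R B" for n
    proof (rule AE_I2)
      fix x
      show "norm (g n x) \<le> indicator (cball 0 (\<bar>R\<bar> + 1)) x *\<^sub>R B"
      proof (cases "x \<in> cball 0 (\<bar>R\<bar> + 1)")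
        case False
        then have x: "norm x > \<bar>R\<bar> + 1" by simp
        have "norm x \<le> norm (x + h n *\<^sub>R e) + h n"
          using norm_triangle_ineq4[of "x + h n *\<^sub>R e" "h n *\<^sub>R e"] h(1)[of n] ne by simp
        then have "norm (x + h n *\<^sub>R e) > R" using x h(2)[of n] by linarith
        then have "x + h n *\<^sub>R e \<notin> K" "x \<notin> K" using R[of "x + h n *\<^sub>R e"] R[of x] x by force+
        then show ?thesis using K(3) B(1) by (simp add: g_def)
      next
        case True
        have "norm (F (x + h n *\<^sub>R e) - F (x + 0 *\<^sub>R e)) \<le> B * norm (h n - 0)"
        proof (rule differentiable_bound[where S = UNIV and f' = "\<lambda>t s. s *\<^sub>R partial_deriv j F (x + t *\<^sub>R e)"])
          show "((\<lambda>t. F (x + t *\<^sub>R e)) has_derivative (\<lambda>s. s *\<^sub>R partial_deriv j F (x + t *\<^sub>R e))) (at t)" for t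
            unfolding e_def by (rule has_vector_derivative_partial[OF test_differentiable[OF assms]])
          show "onorm (\<lambda>s. s *\<^sub>R partial_deriv j F (x + t *\<^sub>R e)) \<le> B" for t :: real
          proof (rule onorm_le)
            show "norm (s *\<^sub>R partial_deriv j F (x + t *\<^sub>R e)) \<le> B * norm s" for s :: real
              using mult_left_mono[OF B(2)[of "x + t *\<^sub>R e"], of "\<bar>s\<bar>"] by (simp add: mult.commute)
          qed
        qed auto
        then have "norm (g n x) \<le> B"
        proof -
          have "norm (g n x) = norm (F (x + h n *\<^sub>R e) - F x) / h n"
            using h(1)[of n] by (simp add: g_def divide_inverse mult.commute)
          with \<open>norm (F (x + h n *\<^sub>R e) - F (x + 0 *\<^sub>R e)) \<le> B * norm (h n - 0)\<close> h(1)[of n]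
          show ?thesis by (simp add: pos_divide_le_eq)
        qed
        then show ?thesis using True by simp
      qed
    qed
  qed
  ultimately show ?thesis by (simp add: LIMSEQ_const_iff)
qed

section \<open>The Aharonov--Bohm operator on test functions\<close>

lemma smooth_on_if:
  "(P \<Longrightarrow> smooth_on U f) \<Longrightarrow> (\<not> P \<Longrightarrow> smooth_on U g) \<Longrightarrow> smooth_on U (\<lambda>x. if P then f x else g x)"
  by (cases P) auto

lemma smooth_vector_potential: "smooth_on (- flux_plane) (\<lambda>x. of_real (vector_potential \<alpha> x $ j))"
proof -
  define r where "r x = (x $ 1)\<^sup>2 + (x $ 2)\<^sup>2" for x :: "real^4"
  have pos: "r x > 0" if "x \<in> - flux_plane" for x
    using that by (auto simp: r_def sum_power2_gt_zero_iff)
  note o = open_off_plane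
  have "smooth_on (- flux_plane) (\<lambda>x. of_real (r x))"
    unfolding r_def of_real_add of_real_power by (intro smooth_on_add smooth_on_power smooth_on_coord o)
  then have inv: "smooth_on (- flux_plane) (\<lambda>x. of_real (r x powr (-1)))"
    using pos by (intro smooth_on_powr o)
  define c where "c x = (if j = 1 then - of_real \<alpha> * (of_real (x $ 2) * complex_of_real (r x powr (-1))) 
     else if j = 2 then of_real \<alpha> * (of_real (x $ 1) * complex_of_real (r x powr (-1))) else 0)" for x
  have "smooth_on (- flux_plane) c"
    unfolding c_def by (intro smooth_on_if smooth_on_mult smooth_on_const smooth_on_coord o inv)
  moreover have eq: "c x = of_real (vector_potential \<alpha> x $ j)" if "x \<in> - flux_plane" for x
    using pos[OF that] by (auto simp: c_def vector_potential_def powr_minus divide_inverse r_def)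
  moreover have "smooth_on (- flux_plane) c \<longleftrightarrow> smooth_on (- flux_plane) (\<lambda>x. of_real (vector_potential \<alpha> x $ j))"
    by (rule smooth_on_cong[OF o eq])
  ultimately show ?thesis by blast
qed

lemma magnetic_deriv_test:
  assumes "\<phi> \<in> test_functions"
  shows "magnetic_deriv \<alpha> j \<phi> \<in> test_functions"
proof -
  have "(\<lambda>x. - \<i> * partial_deriv j \<phi> x + of_real (vector_potential \<alpha> x $ j) * \<phi> x) \<in> test_functions"
    by (rule test_add[OF test_cmult[OF test_partial_deriv[OF assms]] test_mult_local[OF assms smooth_vector_potential]])
  then show ?thesis unfolding magnetic_deriv_def[abs_def] .
qed

lemma magnetic_deriv_add:
  assumes "\<phi> \<in> test_functions" "\<psi> \<in> test_functions"
  shows "magnetic_deriv \<alpha> j (\<lambda>x. \<phi> x + \<psi> x) = (\<lambda>x. magnetic_deriv \<alpha> j \<phi> x + magnetic_deriv \<alpha> j \<psi> x)"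
  unfolding magnetic_deriv_def using assms[THEN test_differentiable]
  by (auto simp: partial_deriv_add algebra_simps)

lemma magnetic_deriv_cmult:
  assumes "\<phi> \<in> test_functions"
  shows "magnetic_deriv \<alpha> j (\<lambda>x. c * \<phi> x) = (\<lambda>x. c * magnetic_deriv \<alpha> j \<phi> x)"
  unfolding magnetic_deriv_def using assms[THEN test_differentiable]
  by (auto simp: partial_deriv_mult algebra_simps)

text \<open>The integrands differ by \<open>- \<i>\<close> times the partial derivative of
  \<open>\<eta> x * cnj (\<phi> x)\<close>: the potential, being real, drops out.\<close>

lemma magnetic_deriv_adjoint:
  assumes "\<eta> \<in> test_functions" "\<phi> \<in> test_functions"
  shows "(\<integral>x. magnetic_deriv \<alpha> j \<eta> x * cnj (\<phi> x) \<partial>lborel) = (\<integral>x. \<eta> x * cnj (magnetic_deriv \<alpha> j \<phi> x) \<partial>lborel)"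
proof -
  define F where "F x = \<eta> x * cnj (\<phi> x)" for x
  have F: "F \<in> test_functions" unfolding F_def using assms by (intro test_mult_test test_cnj)
  have "magnetic_deriv \<alpha> j \<eta> x * cnj (\<phi> x) - \<eta> x * cnj (magnetic_deriv \<alpha> j \<phi> x) = - \<i> * partial_deriv j F x" for x
    using assms[THEN test_differentiable, of x] test_cnj[OF assms(2), THEN test_differentiable, of x]
    unfolding F_def magnetic_deriv_def
    by (subst partial_deriv_mult) (auto simp: partial_deriv_cnj algebra_simps)
  moreover have "integrable lborel (\<lambda>x. magnetic_deriv \<alpha> j \<eta> x * cnj (\<phi> x))" "integrable lborel (\<lambda>x. \<eta> x * cnj (magnetic_deriv \<alpha> j \<phi> x))"
    by (intro test_integrable test_mult_test test_cnj magnetic_deriv_test assms)+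
  ultimately have "(\<integral>x. magnetic_deriv \<alpha> j \<eta> x * cnj (\<phi> x) \<partial>lborel) - (\<integral>x. \<eta> x * cnj (magnetic_deriv \<alpha> j \<phi> x) \<partial>lborel)
     = (\<integral>x. - \<i> * partial_deriv j F x \<partial>lborel)"
    by (subst Bochner_Integration.integral_diff[symmetric]) auto
  also have "\<dots> = 0" by (simp add: integral_partial_deriv_zero[OF F])
  finally show ?thesis by simp
qed

definition AB_square :: "real \<Rightarrow> (real^4 \<Rightarrow> complex) \<Rightarrow> real^4 \<Rightarrow> complex" where
  "AB_square \<alpha> \<phi> x = (\<Sum>j\<in>UNIV. magnetic_deriv \<alpha> j (magnetic_deriv \<alpha> j \<phi>) x)"

lemma AB_square_test: "\<phi> \<in> test_functions \<Longrightarrow> AB_square \<alpha> \<phi> \<in> test_functions"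
  unfolding AB_square_def[abs_def] by (intro test_sum magnetic_deriv_test)

lemma AB_square_cinner:
  assumes "\<phi> \<in> test_functions" "\<psi> \<in> test_functions"
  shows "cinner_L2 (abs_L2 (AB_square \<alpha> \<phi>)) (abs_L2 \<psi>)
    = (\<Sum>j\<in>UNIV. \<integral>x. magnetic_deriv \<alpha> j \<phi> x * cnj (magnetic_deriv \<alpha> j \<psi> x) \<partial>lborel)"
proof -
  have i: "integrable lborel (\<lambda>x. magnetic_deriv \<alpha> j (magnetic_deriv \<alpha> j \<phi>) x * cnj (\<psi> x))" for j
    by (intro test_integrable test_mult_test test_cnj magnetic_deriv_test assms)
  have "cinner_L2 (abs_L2 (AB_square \<alpha> \<phi>)) (abs_L2 \<psi>) = (\<integral>x. AB_square \<alpha> \<phi> x * cnj (\<psi> x) \<partial>lborel)"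
    by (intro cinner_abs_L2 test_square_integrable AB_square_test assms)
  also have "\<dots> = (\<Sum>j\<in>UNIV. \<integral>x. magnetic_deriv \<alpha> j (magnetic_deriv \<alpha> j \<phi>) x * cnj (\<psi> x) \<partial>lborel)"
    unfolding AB_square_def sum_distrib_right by (intro Bochner_Integration.integral_sum i)
  also have "\<dots> = (\<Sum>j\<in>UNIV. \<integral>x. magnetic_deriv \<alpha> j \<phi> x * cnj (magnetic_deriv \<alpha> j \<psi> x) \<partial>lborel)"
    by (intro sum.cong refl magnetic_deriv_adjoint magnetic_deriv_test assms)
  finally show ?thesis .
qed

lemma minimal_AB_iff:
  "(u, w) \<in> minimal_AB_operator \<alpha> \<longleftrightarrow> (\<exists>\<phi>\<in>test_functions. u = abs_L2 \<phi> \<and> w = abs_L2 (AB_square \<alpha> \<phi>))"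
  unfolding minimal_AB_operator_def AB_square_def[abs_def] by blast

text \<open>For \<open>a \<le> b\<close> in every coordinate the product vanishes outside the box
  (without this order two negative factors would give a positive argument). The last factor vanishes
  near the flux plane, where \<open>n\<close> times the squared distance to the plane is at most 1.
  Off the plane the limit in \<open>n\<close> is the indicator of the open box.\<close>

definition box_cutoff :: "real^4 \<Rightarrow> real^4 \<Rightarrow> nat \<Rightarrow> real^4 \<Rightarrow> real" where
  "box_cutoff a b n x = (\<Prod>i\<in>UNIV. bump (real n * ((x $ i - a $ i) * (b $ i - x $ i)))) 
     * bump (real n * ((x $ 1)\<^sup>2 + (x $ 2)\<^sup>2) - 1)"

lemma bump_box_zero:
  assumes "x \<notin> cbox a b" "\<And>i. a $ i \<le> b $ i" shows "box_cutoff a b n x = 0"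
proof -
  obtain i where "\<not> (a $ i \<le> x $ i \<and> x $ i \<le> b $ i)" using assms(1) by (auto simp: mem_box_cart)
  then have "(x $ i - a $ i) * (b $ i - x $ i) \<le> 0"
    using assms(2)[of i] by (auto simp: mult_le_0_iff not_le)
  then have "bump (real n * ((x $ i - a $ i) * (b $ i - x $ i))) = 0"
    by (intro bump_nonpos) (simp add: mult_nonneg_nonpos)
  then have "(\<Prod>i\<in>UNIV. bump (real n * ((x $ i - a $ i) * (b $ i - x $ i)))) = 0"
    by (intro prod_zero) auto
  then show ?thesis by (simp add: box_cutoff_def)
qed

lemma box_cutoff_bounds: "0 \<le> box_cutoff a b n x" "box_cutoff a b n x \<le> 1"
  unfolding box_cutoff_def using bump_bounds by (auto intro!: mult_nonneg_nonneg prod_nonneg mult_le_one prod_le_1)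

lemma box_cutoff_test:
  assumes "\<And>i. a $ i \<le> b $ i"
  shows "(\<lambda>x. of_real (box_cutoff a b n x)) \<in> test_functions"
proof -
  define r where "r x = (x $ 1)\<^sup>2 + (x $ 2)\<^sup>2" for x :: "real^4"
  define K where "K = cbox a b \<inter> {x. real n * r x \<ge> 1}"
  have "closed {x. real n * r x \<ge> 1}" unfolding r_def by (intro closed_Collect_le continuous_intros)
  then have "compact K" unfolding K_def by (intro compact_Int_closed compact_cbox)
  moreover have "K \<inter> flux_plane = {}" by (auto simp: K_def r_def)
  moreover have "complex_of_real (box_cutoff a b n x) = 0" if "x \<notin> K" for x
  proof (cases "x \<in> cbox a b")
    case True
    then have "bump (real n * r x - 1) = 0" using that by (intro bump_nonpos) (auto simp: K_def)
    then show ?thesis by (simp add: box_cutoff_def r_def)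
  qed (simp add: bump_box_zero[OF _ assms])
  moreover have "smooth_on UNIV (\<lambda>x. complex_of_real (box_cutoff a b n x))"
    unfolding box_cutoff_def of_real_mult of_real_prod
    by (intro smooth_on_mult smooth_on_prod smooth_on_bump open_UNIV)
      (simp_all add: smooth_on_mult smooth_on_diff smooth_on_add smooth_on_power smooth_on_coord smooth_on_const)
  ultimately show ?thesis by (intro test_functionsI)
qed

lemma box_cutoff_tendsto:
  assumes "x \<notin> flux_plane" "\<And>i. a $ i \<le> b $ i"
  shows "(\<lambda>n. box_cutoff a b n x) \<longlonglongrightarrow> indicator (box a b) x"
proof (cases "x \<in> box a b")
  case True
  then have "(x $ i - a $ i) * (b $ i - x $ i) > 0" for i by (auto simp: mem_box_cart)
  then have 1: "(\<lambda>n. bump (real n * ((x $ i - a $ i) * (b $ i - x $ i)))) \<longlonglongrightarrow> 1" for i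
    using bump_tendsto_1[of _ 0] by simp
  have "(x $ 1)\<^sup>2 + (x $ 2)\<^sup>2 > 0" using assms(1) by (auto simp: sum_power2_gt_zero_iff)
  then have 2: "(\<lambda>n. bump (real n * ((x $ 1)\<^sup>2 + (x $ 2)\<^sup>2) - 1)) \<longlonglongrightarrow> 1" by (rule bump_tendsto_1)
  have "(\<lambda>n. box_cutoff a b n x) \<longlonglongrightarrow> (\<Prod>i\<in>(UNIV::4 set). 1) * 1"
    unfolding box_cutoff_def by (intro tendsto_mult tendsto_prod 1 2)
  then show ?thesis using True by simp
next
  case False
  then obtain i where "\<not> (a $ i < x $ i \<and> x $ i < b $ i)" by (auto simp: mem_box_cart)
  then have "(x $ i - a $ i) * (b $ i - x $ i) \<le> 0"
    using assms(2)[of i] by (auto simp: mult_le_0_iff not_less)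
  then have "bump (real n * ((x $ i - a $ i) * (b $ i - x $ i))) = 0" for n
    by (intro bump_nonpos) (simp add: mult_nonneg_nonpos)
  then have "(\<Prod>i\<in>UNIV. bump (real n * ((x $ i - a $ i) * (b $ i - x $ i)))) = 0" for n
    by (intro prod_zero) auto
  then have "box_cutoff a b n x = 0" for n by (simp only: box_cutoff_def mult_zero_left)
  then show ?thesis using False by simp
qed

lemma AE_off_plane: "AE x in lborel. x \<notin> flux_plane"
proof -
  have "negligible {x::real^4. x $ 1 = 0}" by (rule negligible_standard_hyperplane_cart)
  then have "negligible flux_plane" by (rule negligible_subset) auto
  moreover have "flux_plane \<in> sets lborel" using closed_flux_plane by (simp add: borel_closed)
  ultimately have "flux_plane \<in> null_sets lborel"
    by (simp add: negligible_iff_null_sets null_sets_completion_iff)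
  then show ?thesis by (rule AE_not_in)
qed

lemma square_integrable_indicator:
  assumes "A \<in> sets borel" "emeasure lborel A < \<infinity>"
  shows "square_integrable (indicator A)"
proof -
  have "(\<lambda>x. (cmod (indicator A x))\<^sup>2) = (indicator A :: _ \<Rightarrow> real)"
    by (auto simp: indicator_def)
  moreover have "integrable lborel (indicator A :: _ \<Rightarrow> real)"
    using assms by (intro integrable_real_indicator) auto
  ultimately show ?thesis using assms(1) by (simp add: square_integrable_def)
qed

text \<open>The flux plane is a null set, so indicators of boxes are almost everywhere limits of
  test functions. A function orthogonal to all of these has zero integral over every box, and boxes
  form a generating \<pi>-system.\<close>

lemma test_functions_dense:
  assumes "\<And>\<phi>. \<phi> \<in> test_functions \<Longrightarrow> inner f (abs_L2 \<phi>) = 0"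
  shows "f = 0"
proof -
  define F where "F = rep_L2 f"
  have Fm [measurable]: "F \<in> borel_measurable borel" by (simp add: F_def)
  have sqF: "square_integrable F" by (simp add: F_def square_integrable_rep_L2)
  have zero: "(\<integral>x. F x * cnj (\<phi> x) \<partial>lborel) = 0" if \<phi>: "\<phi> \<in> test_functions" for \<phi>
  proof -
    have eq: "cinner_L2 f (abs_L2 \<phi>) = (\<integral>x. F x * cnj (\<phi> x) \<partial>lborel)"
      using cinner_abs_L2[OF sqF test_square_integrable[OF \<phi>]] by (simp add: F_def abs_rep_L2)
    have "cscale_L2 \<i> (abs_L2 \<phi>) = abs_L2 (\<lambda>x. \<i> * \<phi> x)"
      by (rule abs_L2_cscale[OF test_square_integrable[OF \<phi>]])
    then have "Im (cinner_L2 f (abs_L2 \<phi>)) = 0"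
      using assms[OF test_cmult[OF \<phi>, of \<i>]] cinner_cscale_right[of f \<i> "abs_L2 \<phi>"] by (simp add: inner_L2_def)
    moreover have "Re (cinner_L2 f (abs_L2 \<phi>)) = 0" using assms[OF \<phi>] by (simp add: inner_L2_def)
    ultimately show ?thesis using eq by (simp add: complex_eq_iff)
  qed
  have boxint: "integrable lborel (\<lambda>x. indicator (cbox a b) x *\<^sub>R F x)" for a b
  proof -
    have "square_integrable (indicator (cbox a b) :: real^4 \<Rightarrow> complex)"
      by (intro square_integrable_indicator) (auto simp: emeasure_lborel_cbox_eq)
    from square_integrable_mult_cnj[OF sqF this]
    have "integrable lborel (\<lambda>x. F x * cnj (indicator (cbox a b) x))" .
    also have "(\<lambda>x. F x * cnj (indicator (cbox a b) x)) = (\<lambda>x. indicator (cbox a b) x *\<^sub>R F x)"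
      by (auto simp: indicator_def)
    finally show ?thesis .
  qed
  have bint: "integrable lborel (\<lambda>x. indicator (box a b) x *\<^sub>R F x)" for a b
  proof -
    have "integrable lborel (\<lambda>x. indicator (box a b) x *\<^sub>R (indicator (cbox a b) x *\<^sub>R F x))"
      by (intro integrable_mult_indicator boxint) auto
    also have "(\<lambda>x. indicator (box a b) x *\<^sub>R (indicator (cbox a b) x *\<^sub>R F x)) = (\<lambda>x. indicator (box a b) x *\<^sub>R F x)"
      using box_subset_cbox[of a b] by (auto simp: indicator_def fun_eq_iff)
    finally show ?thesis .
  qed
  have bzero: "(\<integral>x. indicator (box a b) x *\<^sub>R F x \<partial>lborel) = 0" for a b
  proof (cases "\<forall>i. a $ i \<le> b $ i")
    case False
    then obtain i where "b $ i < a $ i" by (auto simp: not_le)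
    then have "x \<notin> box a b" for x by (auto simp: mem_box_cart intro!: exI[of _ i])
    then have "box a b = {}" by blast
    then show ?thesis by simp
  next
    case True
    have "(\<lambda>n. \<integral>x. F x * cnj (of_real (box_cutoff a b n x)) \<partial>lborel) \<longlonglongrightarrow> (\<integral>x. indicator (box a b) x *\<^sub>R F x \<partial>lborel)"
    proof (rule integral_dominated_convergence[where w = "\<lambda>x. norm (indicator (cbox a b) x *\<^sub>R F x)"])
      show "(\<lambda>x. F x * cnj (of_real (box_cutoff a b n x))) \<in> borel_measurable lborel" for n
        using test_measurable[OF box_cutoff_test, of a b n] True by simp
      show "AE x in lborel. (\<lambda>n. F x * cnj (of_real (box_cutoff a b n x))) \<longlonglongrightarrow> indicator (box a b) x *\<^sub>R F x"
        using AE_off_plane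
      proof eventually_elim
        case (elim x)
        have "(\<lambda>n. F x * of_real (box_cutoff a b n x)) \<longlonglongrightarrow> F x * of_real (indicator (box a b) x)"
          using True elim by (intro tendsto_intros box_cutoff_tendsto) auto
        then show ?case by (simp add: scaleR_conv_of_real mult.commute)
      qed
      show "AE x in lborel. norm (F x * cnj (of_real (box_cutoff a b n x))) \<le> norm (indicator (cbox a b) x *\<^sub>R F x)" for n
      proof (rule AE_I2)
        fix x
        show "norm (F x * cnj (of_real (box_cutoff a b n x))) \<le> norm (indicator (cbox a b) x *\<^sub>R F x)"
          using box_cutoff_bounds[where a = a and b = b and n = n and x = x] bump_box_zero[of x a b n] True
          by (cases "x \<in> cbox a b") (auto simp: norm_mult intro: mult_left_le)
      qed
      show "integrable lborel (\<lambda>x. norm (indicator (cbox a b) x *\<^sub>R F x))"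
        by (rule integrable_norm[OF boxint])
    qed auto
    then show ?thesis
      using zero[OF box_cutoff_test] True by (simp add: LIMSEQ_const_iff)
  qed
  have "AE x in lborel. F x = 0"
  proof (rule AE_zero_of_pi_system[where G = "range (\<lambda>(a, b). box a b)" and A = "\<lambda>n. box (- (real n *\<^sub>R One)) (real n *\<^sub>R One)"])
    show "Int_stable (range (\<lambda>(a, b). box a b :: (real^4) set))" by (auto simp: Int_stable_def box_Int_box)
    show "sets borel = sigma_sets UNIV (range (\<lambda>(a, b). box a b :: (real^4) set))"
      by (subst borel_eq_box) (simp add: sets_measure_of)
  qed (auto simp: bint bzero UN_box_eq_UNIV)
  with rep_L2_zero[where 'a = "real^4"] have "AE x in lborel. rep_L2 f x = rep_L2 0 x"
    by eventually_elim (simp add: F_def)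
  then show ?thesis by (rule L2_eqI_AE)
qed

text \<open>Integration by parts writes the form as a sum of inner products of magnetic derivatives,
  from which symmetry and nonnegativity are visible.\<close>

lemma nonneg_symmetric_AB: "nonneg_symmetric (minimal_AB_operator \<alpha>)"
proof
  fix u w u' w' c
  assume uw: "(u, w) \<in> minimal_AB_operator \<alpha>"
  then obtain \<phi> where \<phi>: "\<phi> \<in> test_functions" "u = abs_L2 \<phi>" "w = abs_L2 (AB_square \<alpha> \<phi>)"
    by (auto simp: minimal_AB_iff)
  note sq = test_square_integrable
  show "(cscale_L2 c u, cscale_L2 c w) \<in> minimal_AB_operator \<alpha>"
  proof -
    have "AB_square \<alpha> (\<lambda>x. c * \<phi> x) = (\<lambda>x. c * AB_square \<alpha> \<phi> x)"
      by (simp add: AB_square_def[abs_def] magnetic_deriv_cmult[OF \<phi>(1)] magnetic_deriv_cmult[OF magnetic_deriv_test[OF \<phi>(1)]] sum_distrib_left)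
    then show ?thesis
      unfolding minimal_AB_iff \<phi>(2,3) abs_L2_cscale[OF sq[OF \<phi>(1)]] abs_L2_cscale[OF sq[OF AB_square_test[OF \<phi>(1)]]]
      using test_cmult[OF \<phi>(1), of c] by (intro bexI[of _ "\<lambda>x. c * \<phi> x"]) auto
  qed
  show "Re (cinner_L2 w u) \<ge> 0"
  proof -
    have "Re (\<integral>x. magnetic_deriv \<alpha> j \<phi> x * cnj (magnetic_deriv \<alpha> j \<phi> x) \<partial>lborel) \<ge> 0" for j
      unfolding complex_norm_square[symmetric] of_real_power[symmetric] integral_complex_of_real by simp
    then show ?thesis unfolding \<phi>(2,3) AB_square_cinner[OF \<phi>(1) \<phi>(1)] by (simp add: sum_nonneg)
  qed
  assume "(u', w') \<in> minimal_AB_operator \<alpha>"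
  then obtain \<psi> where \<psi>: "\<psi> \<in> test_functions" "u' = abs_L2 \<psi>" "w' = abs_L2 (AB_square \<alpha> \<psi>)"
    by (auto simp: minimal_AB_iff)
  show "(u + u', w + w') \<in> minimal_AB_operator \<alpha>"
  proof -
    have "AB_square \<alpha> (\<lambda>x. \<phi> x + \<psi> x) = (\<lambda>x. AB_square \<alpha> \<phi> x + AB_square \<alpha> \<psi> x)"
      by (simp add: AB_square_def[abs_def] magnetic_deriv_add[OF \<phi>(1) \<psi>(1)] 
          magnetic_deriv_add[OF magnetic_deriv_test[OF \<phi>(1)] magnetic_deriv_test[OF \<psi>(1)]] sum.distrib)
    then show ?thesis
      unfolding minimal_AB_iff \<phi>(2,3) \<psi>(2,3) abs_L2_add[OF sq[OF \<phi>(1)] sq[OF \<psi>(1)]] abs_L2_add[OF sq[OF AB_square_test[OF \<phi>(1)]] sq[OF AB_square_test[OF \<psi>(1)]]]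
      using test_add[OF \<phi>(1) \<psi>(1)] by (intro bexI[of _ "\<lambda>x. \<phi> x + \<psi> x"]) auto
  qed
  show "cinner_L2 w u' = cinner_L2 u w'"
  proof -
    have "cinner_L2 u w' = cnj (cinner_L2 w' u)" by (rule cinner_commute)
    also have "\<dots> = cinner_L2 w u'"
      unfolding \<phi>(2,3) \<psi>(2,3) AB_square_cinner[OF \<phi>(1) \<psi>(1)] AB_square_cinner[OF \<psi>(1) \<phi>(1)]
      by (simp add: mult.commute flip: Bochner_Integration.integral_cnj)
    finally show ?thesis ..
  qed
next
  have "subspace (Domain (minimal_AB_operator \<alpha>))"
    unfolding subspace_def
  proof (intro conjI ballI allI)
    have D: "u \<in> Domain (minimal_AB_operator \<alpha>) \<longleftrightarrow> (\<exists>\<phi>\<in>test_functions. u = abs_L2 \<phi>)" for u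
      unfolding Domain_iff minimal_AB_iff by blast
    note sq = test_square_integrable
    show "0 \<in> Domain (minimal_AB_operator \<alpha>)"
      unfolding D by (rule bexI[OF _ test_zero]) (simp add: abs_L2_zero)
    fix u assume "u \<in> Domain (minimal_AB_operator \<alpha>)"
    then obtain \<phi> where \<phi>: "\<phi> \<in> test_functions" "u = abs_L2 \<phi>" unfolding D by blast
    show "c *\<^sub>R u \<in> Domain (minimal_AB_operator \<alpha>)" for c
      unfolding D \<phi>(2) abs_L2_scaleR[OF sq[OF \<phi>(1)]] using test_cmult[OF \<phi>(1)] by blast
    fix v assume "v \<in> Domain (minimal_AB_operator \<alpha>)"
    then obtain \<psi> where \<psi>: "\<psi> \<in> test_functions" "v = abs_L2 \<psi>" unfolding D by blast
    show "u + v \<in> Domain (minimal_AB_operator \<alpha>)"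
      unfolding D \<phi>(2) \<psi>(2) abs_L2_add[OF sq[OF \<phi>(1)] sq[OF \<psi>(1)]] using test_add[OF \<phi>(1) \<psi>(1)] by blast
  qed
  then show "closure (Domain (minimal_AB_operator \<alpha>)) = UNIV"
  proof (rule dense_if_orthogonal_trivial)
    fix f assume f: "\<And>\<psi>. \<psi> \<in> Domain (minimal_AB_operator \<alpha>) \<Longrightarrow> inner f \<psi> = 0"
    show "f = 0"
    proof (rule test_functions_dense)
      fix \<phi> :: "real^4 \<Rightarrow> complex" assume "\<phi> \<in> test_functions"
      then have "(abs_L2 \<phi>, abs_L2 (AB_square \<alpha> \<phi>)) \<in> minimal_AB_operator \<alpha>" unfolding minimal_AB_iff by blast
      then show "inner f (abs_L2 \<phi>) = 0" by (intro f) blast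
    qed
  qed
qed

section \<open>Truncation\<close>

text \<open>\<open>\<psi> \<mapsto> soft_cutoff k \<bar>\<psi>\<bar>\<^sup>2 \<psi>\<close> is a smooth contraction into the unit disc which tends to
  the metric projection onto it as \<open>k \<rightarrow> \<infinity>\<close>.\<close>

definition soft_cutoff :: "nat \<Rightarrow> real \<Rightarrow> real" where
  "soft_cutoff k s = (1 + s ^ k) powr (- 1 / (2 * real k))"

lemma soft_cutoff_bounds:
  assumes "s \<ge> 0" shows "0 < soft_cutoff k s" "soft_cutoff k s \<le> 1"
proof -
  have 1: "1 \<le> 1 + s ^ k" using assms by simp
  then show "0 < soft_cutoff k s" by (simp add: soft_cutoff_def)
  have "(1 + s ^ k) powr (- 1 / (2 * real k)) \<le> (1 + s ^ k) powr 0"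
    using 1 by (intro powr_mono) auto
  then show "soft_cutoff k s \<le> 1" using 1 by (simp add: soft_cutoff_def)
qed

lemma power_powr_root:
  assumes "r \<ge> 0" "k > 0" shows "((r\<^sup>2) ^ k) powr (1 / (2 * real k)) = r"
proof (cases "r = 0")
  case False
  then have "r > 0" using assms by simp
  have "((r\<^sup>2) ^ k) powr (1 / (2 * real k)) = (r powr (real (2 * k))) powr (1 / (2 * real k))"
    using \<open>r > 0\<close> by (subst powr_realpow) (auto simp: power_mult)
  also have "\<dots> = r" using \<open>r > 0\<close> assms(2) by (simp add: powr_powr)
  finally show ?thesis .
qed (use assms in simp)

lemma soft_cutoff_inverse: "s \<ge> 0 \<Longrightarrow> soft_cutoff k s * (1 + s ^ k) powr (1 / (2 * real k)) = 1"
proof -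
  assume "s \<ge> 0"
  then have "1 + s ^ k > 0" using zero_le_power[of s k] by linarith
  then show ?thesis by (simp add: soft_cutoff_def flip: powr_add)
qed

lemma soft_cutoff_le_1:
  assumes "r \<ge> 0" "k > 0" shows "r * soft_cutoff k (r\<^sup>2) \<le> 1"
proof -
  have "r = ((r\<^sup>2) ^ k) powr (1 / (2 * real k))" using power_powr_root[OF assms] by simp
  also have "\<dots> \<le> (1 + (r\<^sup>2) ^ k) powr (1 / (2 * real k))" by (intro powr_mono2) auto
  finally have "r * soft_cutoff k (r\<^sup>2) \<le> (1 + (r\<^sup>2) ^ k) powr (1 / (2 * real k)) * soft_cutoff k (r\<^sup>2)"
    using soft_cutoff_bounds[of "r\<^sup>2" k] by (intro mult_right_mono) auto
  then show ?thesis using soft_cutoff_inverse[of "r\<^sup>2" k] by (simp add: mult.commute)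
qed

lemma soft_cutoff_lower:
  assumes "r \<ge> 0" "k > 0"
  shows "r \<le> 1 \<Longrightarrow> 2 powr (- 1 / (2 * real k)) \<le> soft_cutoff k (r\<^sup>2)"
    and "r \<ge> 1 \<Longrightarrow> 2 powr (- 1 / (2 * real k)) \<le> r * soft_cutoff k (r\<^sup>2)"
proof -
  define p where "p = 1 / (2 * real k)"
  have p: "p > 0" using assms by (simp add: p_def)
  show "2 powr (- 1 / (2 * real k)) \<le> soft_cutoff k (r\<^sup>2)" if "r \<le> 1"
  proof -
    have "(r\<^sup>2) ^ k \<le> 1" using that assms by (intro power_le_one) auto
    then show ?thesis unfolding soft_cutoff_def
      using zero_le_power[of "r\<^sup>2" k] by (intro powr_mono2') (auto simp: add_pos_nonneg)
  qed
  show "2 powr (- 1 / (2 * real k)) \<le> r * soft_cutoff k (r\<^sup>2)" if "r \<ge> 1"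
  proof -
    have "(r\<^sup>2) ^ k \<ge> 1" using that by simp
    then have "(1 + (r\<^sup>2) ^ k) powr p \<le> (2 * (r\<^sup>2) ^ k) powr p"
      using p by (intro powr_mono2) auto
    also have "\<dots> = 2 powr p * r" using power_powr_root[OF assms] by (simp add: powr_mult p_def)
    finally have le: "(1 + (r\<^sup>2) ^ k) powr p \<le> 2 powr p * r" .
    have "2 powr (- p) = 2 powr (- p) * (soft_cutoff k (r\<^sup>2) * (1 + (r\<^sup>2) ^ k) powr p)"
      using soft_cutoff_inverse[of "r\<^sup>2" k] by (simp add: p_def)
    also have "\<dots> \<le> 2 powr (- p) * (soft_cutoff k (r\<^sup>2) * (2 powr p * r))"
      using le soft_cutoff_bounds[of "r\<^sup>2" k] by (intro mult_left_mono) auto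
    also have "\<dots> = r * soft_cutoff k (r\<^sup>2)" by (simp add: powr_minus)
    finally show ?thesis by (simp add: p_def)
  qed
qed

text \<open>\<open>2 powr (- 1 / (2 * real k))\<close> is the value of the soft cutoff on the unit
  circle, where the truncation is farthest from the metric projection onto the disc.\<close>

definition cutoff_error :: "nat \<Rightarrow> real" where
  "cutoff_error k = 2 * (1 - 2 powr (- 1 / (2 * real k)))"

lemma cutoff_error_tendsto: "(\<lambda>n. cutoff_error (Suc n)) \<longlonglongrightarrow> 0"
proof -
  have e: "(\<lambda>n. - (1/2) * inverse (real (Suc n))) \<longlonglongrightarrow> - (1/2) * 0"
    by (intro tendsto_mult tendsto_const LIMSEQ_inverse_real_of_nat)
  have "(\<lambda>n. 2 * (1 - (2::real) powr (- (1/2) * inverse (real (Suc n))))) \<longlonglongrightarrow> 2 * (1 - 2 powr (- (1/2) * 0))"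
    by (intro tendsto_mult[OF tendsto_const] tendsto_diff tendsto_powr tendsto_const e) auto
  moreover have "- 1 / (2 * real (Suc n)) = - (1/2) * inverse (real (Suc n))" for n
    by (simp add: field_simps)
  then have "cutoff_error (Suc n) = 2 * (1 - (2::real) powr (- (1/2) * inverse (real (Suc n))))" for n
    by (simp only: cutoff_error_def)
  moreover have "2 * (1 - (2::real) powr (- (1/2) * 0)) = 0" by simp
  ultimately show ?thesis by (simp only:)
qed

text \<open>The left side is the increase of \<open>r^2 - 2 * r\<close> when \<open>r\<close> is
  replaced by \<open>r * \<theta>\<close>, and this parabola is minimal at 1. For
  \<open>r \<le> 1\<close> the loss \<open>r - r * \<theta>\<close>, and for
  \<open>r \<ge> 1\<close> the overshoot \<open>1 - r * \<theta>\<close>, is at most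
  \<open>1 - \<kappa>\<close>.\<close>

lemma truncated_potential_bound:
  assumes "r \<ge> 0" "k > 0"
  defines "\<theta> \<equiv> soft_cutoff k (r\<^sup>2)"
  shows "(r - r * \<theta>) * (2 - r - r * \<theta>) \<le> cutoff_error k"
proof -
  define \<kappa> :: real where "\<kappa> = 2 powr (- 1 / (2 * real k))"
  have \<theta>: "0 < \<theta>" "\<theta> \<le> 1" "r * \<theta> \<le> 1"
    using soft_cutoff_bounds[of "r\<^sup>2" k] soft_cutoff_le_1[OF assms(1,2)] by (auto simp: \<theta>_def)
  have \<kappa>: "\<kappa> \<le> 1" using powr_mono[of "- 1 / (2 * real k)" 0 "2::real"] by (simp add: \<kappa>_def)
  have d: "0 \<le> r - r * \<theta>" using \<theta> assms(1) by (simp add: mult_left_le)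
  have "(r - r * \<theta>) * (2 - r - r * \<theta>) \<le> (1 - \<kappa>) * 2"
  proof (cases "r \<le> 1")
    case True
    have "\<kappa> \<le> \<theta>" unfolding \<kappa>_def \<theta>_def by (rule soft_cutoff_lower(1)[OF assms(1,2) True])
    have "r - r * \<theta> = r * (1 - \<theta>)" by (simp add: algebra_simps)
    also have "\<dots> \<le> 1 * (1 - \<theta>)" using True \<theta> by (intro mult_right_mono) auto
    finally have "r - r * \<theta> \<le> 1 - \<kappa>" using \<open>\<kappa> \<le> \<theta>\<close> by simp
    moreover have "2 - r - r * \<theta> \<le> 2"
    proof -
      have "0 \<le> r * \<theta>" using assms(1) \<theta> by simp
      then show ?thesis using assms(1) by linarith
    qed
    moreover have "0 \<le> 2 - r - r * \<theta>" using \<theta>(3) True by linarith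
    ultimately show ?thesis using d \<kappa> by (intro mult_mono) auto
  next
    case False
    have k: "\<kappa> \<le> r * \<theta>" unfolding \<kappa>_def \<theta>_def using False by (intro soft_cutoff_lower(2)[OF assms(1,2)]) auto
    show ?thesis
    proof (cases "2 - r - r * \<theta> \<le> 0")
      case True
      then have "(r - r * \<theta>) * (2 - r - r * \<theta>) \<le> 0" using d by (simp add: mult_nonneg_nonpos)
      then show ?thesis using \<kappa> by (smt (verit) mult_nonneg_nonneg)
    next
      case nf: False
      define t where "t = r * \<theta>"
      have "r - t \<le> 2 - 2 * \<kappa>" using k nf unfolding t_def[symmetric] by linarith
      then have "r - r * \<theta> \<le> 2 * (1 - \<kappa>)" by (simp add: t_def)
      moreover have "2 - r - r * \<theta> \<le> 1" using False \<theta> assms(1) by (smt (verit) mult_nonneg_nonneg)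
      ultimately have "(r - r * \<theta>) * (2 - r - r * \<theta>) \<le> (2 * (1 - \<kappa>)) * 1"
        using d nf \<kappa> by (intro mult_mono) auto
      then show ?thesis by simp
    qed
  qed
  then show ?thesis by (simp add: cutoff_error_def \<kappa>_def mult.commute)
qed

text \<open>\<open>Im (X * cnj \<psi>)\<close> is the real inner product of \<open>X\<close> with
  \<open>\<i> * \<psi>\<close>, so the subtraction multiplies the component of \<open>X\<close>
  along \<open>\<i> * \<psi>\<close> by \<open>1 - c * (cmod \<psi>)^2\<close>, which lies in the
  unit interval.\<close>

lemma radial_contraction:
  fixes X \<psi> :: complex
  assumes "0 \<le> c" "c * (cmod \<psi>)\<^sup>2 \<le> 1"
  shows "cmod (X - \<i> * of_real (c * Im (X * cnj \<psi>)) * \<psi>) \<le> cmod X"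
proof (rule power2_le_imp_le)
  define \<rho> where "\<rho> = Im (X * cnj \<psi>)"
  have "(cmod (X - \<i> * of_real (c * \<rho>) * \<psi>))\<^sup>2 = (cmod X)\<^sup>2 - c * \<rho>\<^sup>2 * (2 - c * (cmod \<psi>)\<^sup>2)"
    unfolding cmod_power2 \<rho>_def by (simp add: power2_eq_square algebra_simps)
  moreover have "0 \<le> c * \<rho>\<^sup>2 * (2 - c * (cmod \<psi>)\<^sup>2)" using assms by simp
  ultimately show "(cmod (X - \<i> * of_real (c * Im (X * cnj \<psi>)) * \<psi>))\<^sup>2 \<le> (cmod X)\<^sup>2"
    by (simp add: \<rho>_def)
qed simp

section \<open>Truncation of test functions\<close>

definition truncate :: "nat \<Rightarrow> (real^4 \<Rightarrow> complex) \<Rightarrow> real^4 \<Rightarrow> complex" where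
  "truncate k \<psi> x = of_real (soft_cutoff k ((cmod (\<psi> x))\<^sup>2)) * \<psi> x"

lemma smooth_soft_cutoff:
  assumes "\<psi> \<in> test_functions"
  shows "smooth_on UNIV (\<lambda>x. of_real (soft_cutoff k ((cmod (\<psi> x))\<^sup>2)))"
  unfolding soft_cutoff_def
proof (rule smooth_on_powr)
  have "smooth_on UNIV (\<lambda>x. 1 + (\<psi> x * cnj (\<psi> x)) ^ k)"
    by (intro smooth_on_add smooth_on_const smooth_on_power smooth_on_mult smooth_on_cnj test_functions_smooth open_UNIV assms)
  moreover have "complex_of_real (1 + ((cmod z)\<^sup>2) ^ k) = 1 + (z * cnj z) ^ k" for z
    unfolding of_real_add of_real_1 complex_norm_square[symmetric] of_real_power ..
  ultimately show "smooth_on UNIV (\<lambda>x. complex_of_real (1 + ((cmod (\<psi> x))\<^sup>2) ^ k))"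
    by simp
  show "0 < 1 + ((cmod (\<psi> x))\<^sup>2) ^ k" for x by (simp add: add_pos_nonneg)
qed simp

lemma truncate_test: "\<psi> \<in> test_functions \<Longrightarrow> truncate k \<psi> \<in> test_functions"
  unfolding truncate_def[abs_def] by (rule test_mult[OF _ smooth_soft_cutoff])

lemma cmod_truncate: "k > 0 \<Longrightarrow> cmod (truncate k \<psi> x) \<le> 1"
  using soft_cutoff_le_1[of "cmod (\<psi> x)" k] soft_cutoff_bounds[of "(cmod (\<psi> x))\<^sup>2" k]
  by (simp add: truncate_def norm_mult mult.commute)

text \<open>A smooth diamagnetic inequality. The cutoff depends on the modulus of
  \<open>\<psi>\<close> alone, whose derivative does not see the potential:
  \<open>Re (P * cnj (\<psi> x))\<close> equals \<open>- Im (X * cnj (\<psi> x))\<close> because the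
  potential contributes a real number to \<open>X * cnj (\<psi> x)\<close>. Hence the new derivative
  is \<open>\<theta>\<close> times a radial contraction of \<open>X\<close>.\<close>

lemma magnetic_deriv_truncate:
  assumes "\<psi> \<in> test_functions" "k > 0"
  shows "cmod (magnetic_deriv \<alpha> j (truncate k \<psi>) x) \<le> cmod (magnetic_deriv \<alpha> j \<psi> x)"
proof -
  define s where "s = (cmod (\<psi> x))\<^sup>2"
  define \<theta> where "\<theta> = soft_cutoff k s"
  define P where "P = partial_deriv j \<psi> x"
  define X where "X = magnetic_deriv \<alpha> j \<psi> x"
  \<comment> \<open>\<open>- c / 2\<close> is the logarithmic derivative of the soft cutoff at
    \<open>s\<close>; the radial contraction applies since \<open>c * s = s^k / (1 + s^k)\<close> is
    at most 1.\<close>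
  define c where "c = s ^ (k - 1) / (1 + s ^ k)"
  have s: "s \<ge> 0" by (simp add: s_def)
  have pos: "1 + s ^ k > 0" using zero_le_power[OF s, of k] by linarith
  have dsq: "(\<lambda>x. complex_of_real ((cmod (\<psi> x))\<^sup>2)) differentiable (at x)"
    and dsq': "partial_deriv j (\<lambda>x. complex_of_real ((cmod (\<psi> x))\<^sup>2)) x = of_real (2 * Re (P * cnj (\<psi> x)))"
  proof -
    note d = test_differentiable[OF assms(1), of x] test_differentiable[OF test_cnj[OF assms(1)], of x]
    show "(\<lambda>x. complex_of_real ((cmod (\<psi> x))\<^sup>2)) differentiable (at x)"
      unfolding complex_norm_square using d by (rule differentiable_mult)
    show "partial_deriv j (\<lambda>x. complex_of_real ((cmod (\<psi> x))\<^sup>2)) x = of_real (2 * Re (P * cnj (\<psi> x)))"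
      unfolding complex_norm_square partial_deriv_mult[OF d] partial_deriv_cnj[OF d(1)] P_def[symmetric]
      by (simp add: complex_eq_iff)
  qed
  have "(soft_cutoff k has_real_derivative (- (1/2) * s ^ (k - 1) * (1 + s ^ k) powr (- 1 / (2 * real k) - 1))) (at s)"
    unfolding soft_cutoff_def[abs_def] using pos assms(2)
    by (auto intro!: derivative_eq_intros simp: field_simps)
  then have "(soft_cutoff k has_real_derivative (- (1/2) * c * \<theta>)) (at s)"
    using pos by (simp add: c_def \<theta>_def soft_cutoff_def powr_diff field_simps)
  from has_derivative_real_compose[OF dsq this[unfolded s_def]]
  have D: "((\<lambda>x. complex_of_real (soft_cutoff k ((cmod (\<psi> x))\<^sup>2))) has_derivative
     (\<lambda>v. of_real (- (1/2) * c * \<theta>) * frechet_derivative (\<lambda>x. complex_of_real ((cmod (\<psi> x))\<^sup>2)) (at x) v)) (at x)"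
    by simp
  have d\<theta>: "partial_deriv j (\<lambda>x. complex_of_real (soft_cutoff k ((cmod (\<psi> x))\<^sup>2))) x = of_real (- \<theta> * c * Re (P * cnj (\<psi> x)))"
    unfolding partial_deriv_eq[OF D] using dsq' by (simp add: partial_deriv_def)
  have "(\<lambda>x. complex_of_real (soft_cutoff k ((cmod (\<psi> x))\<^sup>2))) differentiable (at x)"
    using D by (auto simp: differentiable_def)
  then have T: "partial_deriv j (truncate k \<psi>) x = of_real \<theta> * P + of_real (- \<theta> * c * Re (P * cnj (\<psi> x))) * \<psi> x"
    unfolding truncate_def[abs_def] using test_differentiable[OF assms(1), of x] d\<theta>
    by (simp add: partial_deriv_mult P_def \<theta>_def s_def)
  define a where "a = complex_of_real (vector_potential \<alpha> x $ j)"
  have X: "X = - \<i> * P + a * \<psi> x" by (simp add: X_def magnetic_deriv_def P_def a_def)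
  have R: "Re (P * cnj (\<psi> x)) = - Im (X * cnj (\<psi> x))"
    unfolding X a_def by (simp add: algebra_simps)
  define \<rho> where "\<rho> = Im (X * cnj (\<psi> x))"
  have "magnetic_deriv \<alpha> j (truncate k \<psi>) x = - \<i> * (of_real \<theta> * P + of_real (- \<theta> * c * (- \<rho>)) * \<psi> x) + a * (of_real \<theta> * \<psi> x)"
    unfolding magnetic_deriv_def T R \<rho>_def a_def by (simp only: truncate_def \<theta>_def s_def)
  also have "\<dots> = of_real \<theta> * (X - \<i> * of_real (c * \<rho>) * \<psi> x)"
    unfolding X by (simp add: algebra_simps)
  finally have "magnetic_deriv \<alpha> j (truncate k \<psi>) x = of_real \<theta> * (X - \<i> * of_real (c * Im (X * cnj (\<psi> x))) * \<psi> x)"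
    unfolding \<rho>_def .
  moreover have "cmod (X - \<i> * of_real (c * Im (X * cnj (\<psi> x))) * \<psi> x) \<le> cmod X"
  proof (rule radial_contraction)
    show "0 \<le> c" using s pos by (simp add: c_def)
    have "s ^ (k - 1) * s = s ^ k" using assms(2) by (metis power_minus_mult)
    then have "c * s = s ^ k / (1 + s ^ k)" by (simp add: c_def)
    also have "\<dots> \<le> 1" using pos by (simp add: divide_le_eq)
    finally show "c * (cmod (\<psi> x))\<^sup>2 \<le> 1" by (simp add: s_def)
  qed
  moreover have "0 < \<theta>" "\<theta> \<le> 1" using soft_cutoff_bounds[OF s] by (auto simp: \<theta>_def)
  ultimately show ?thesis unfolding X_def by (simp add: norm_mult mult_le_one order_trans[OF mult_left_le_one_le])
qed

section \<open>Domination of the resolvents\<close>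

text \<open>\<open>lap\<close> is the Laplacian of \<open>w\<close> as a real function. Weights need
  not be integrable: those used later are Gaussians plus a constant.\<close>

locale positive_weight =
  fixes w :: "real^4 \<Rightarrow> real" and lap :: "real^4 \<Rightarrow> real"
  assumes smooth_w: "smooth_on UNIV (\<lambda>x. of_real (w x))" and w_pos: "w x > 0"
    and lap: "of_real (lap x) = (\<Sum>j\<in>UNIV. partial_deriv j (partial_deriv j (\<lambda>x. complex_of_real (w x))) x)"
begin

abbreviation W :: "real^4 \<Rightarrow> complex" where
  "W \<equiv> \<lambda>x. complex_of_real (w x)"

lemma dW_real: "cnj (partial_deriv j W x) = partial_deriv j W x"
  using partial_deriv_cnj[of W x j] smooth_on_differentiable[OF smooth_w] by simp

text \<open>The ground state substitution. With \<open>V\<close> the partial derivative of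
  \<open>W\<close>, the cross term is \<open>W * V\<close> times the derivative of the squared
  modulus of \<open>\<psi>\<close>; together with the \<open>V * V\<close> term it makes up the
  derivative of \<open>F\<close> minus the term with the second derivative of \<open>W\<close>. The
  potential cancels from the cross term since it is real.\<close>

lemma ground_state_pointwise:
  fixes j :: 4
  assumes "\<psi> \<in> test_functions"
  defines "\<phi> \<equiv> \<lambda>x. W x * \<psi> x" and "F \<equiv> \<lambda>x. (W x * partial_deriv j W x) * (\<psi> x * cnj (\<psi> x))"
  shows "magnetic_deriv \<alpha> j \<phi> x * cnj (magnetic_deriv \<alpha> j \<phi> x)
    = (W x)\<^sup>2 * (magnetic_deriv \<alpha> j \<psi> x * cnj (magnetic_deriv \<alpha> j \<psi> x))
      - W x * partial_deriv j (partial_deriv j W) x * (\<psi> x * cnj (\<psi> x)) + partial_deriv j F x"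
proof -
  note dW = smooth_on_differentiable[OF smooth_w UNIV_I, of x]
  note ddW = smooth_on_differentiable[OF smooth_on_partial_deriv[OF smooth_w] UNIV_I, of j x]
  note d\<psi> = test_differentiable[OF assms(1), of x]
  note dc = test_differentiable[OF test_cnj[OF assms(1)], of x]
  define P where "P = partial_deriv j \<psi> x"
  define a where "a = complex_of_real (vector_potential \<alpha> x $ j)"
  define V where "V = partial_deriv j W x"
  define VV where "VV = partial_deriv j (partial_deriv j W) x"
  have F': "partial_deriv j F x = (W x * V) * (\<psi> x * cnj P + P * cnj (\<psi> x)) + (W x * VV + V * V) * (\<psi> x * cnj (\<psi> x))"
    unfolding F_def
    by (simp add: partial_deriv_mult[OF differentiable_mult[OF dW ddW] differentiable_mult[OF d\<psi> dc]]
        partial_deriv_mult[OF dW ddW] partial_deriv_mult[OF d\<psi> dc] partial_deriv_cnj[OF d\<psi>] P_def V_def VV_def)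
  have V: "cnj V = V" unfolding V_def by (rule dW_real)
  have M\<psi>: "magnetic_deriv \<alpha> j \<psi> x = - \<i> * P + a * \<psi> x" by (simp add: magnetic_deriv_def P_def a_def)
  have "partial_deriv j \<phi> x = W x * P + V * \<psi> x"
    unfolding \<phi>_def partial_deriv_mult[OF dW d\<psi>] P_def V_def ..
  then have "magnetic_deriv \<alpha> j \<phi> x = - \<i> * (W x * P + V * \<psi> x) + a * (W x * \<psi> x)"
    by (simp only: magnetic_deriv_def a_def) (simp add: \<phi>_def)
  then have M\<phi>: "magnetic_deriv \<alpha> j \<phi> x = W x * (- \<i> * P + a * \<psi> x) - \<i> * V * \<psi> x"
    by (simp add: algebra_simps)
  have a: "cnj a = a" by (simp add: a_def)
  show ?thesis
    unfolding M\<psi> M\<phi> F' VV_def[symmetric]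
    by (simp add: V a algebra_simps power2_eq_square)
qed

lemma weight_test: "\<psi> \<in> test_functions \<Longrightarrow> (\<lambda>x. W x * \<psi> x) \<in> test_functions"
  by (rule test_mult[OF _ smooth_w])

lemma lap_continuous: "continuous_on UNIV w" "continuous_on UNIV lap"
proof -
  have c: "continuous_on UNIV (\<lambda>x. complex_of_real (w x))"
    by (intro continuous_at_imp_continuous_on ballI differentiable_imp_continuous_within smooth_on_differentiable[OF smooth_w UNIV_I])
  from continuous_on_Re[OF c] show "continuous_on UNIV w" by simp
  have "continuous_on UNIV (\<lambda>x. \<Sum>j\<in>UNIV. partial_deriv j (partial_deriv j W) x)"
    by (intro continuous_on_sum continuous_at_imp_continuous_on ballI differentiable_imp_continuous_within 
        smooth_on_differentiable[OF smooth_on_partial_deriv[OF smooth_on_partial_deriv[OF smooth_w]] UNIV_I])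
  from continuous_on_Re[OF this] show "continuous_on UNIV lap" unfolding lap[symmetric] by simp
qed

lemma integrable_cmod_sq_test: "\<phi> \<in> test_functions \<Longrightarrow> continuous_on UNIV g \<Longrightarrow> integrable lborel (\<lambda>x. g x * (cmod (\<phi> x))\<^sup>2)"
proof -
  assume \<phi>: "\<phi> \<in> test_functions" and g: "continuous_on UNIV g"
  have "integrable lborel (\<lambda>x. complex_of_real (g x * (cmod (\<phi> x))\<^sup>2))"
    using \<phi> by (rule continuous_test_integrable) (auto intro!: continuous_intros g test_continuous[OF \<phi>])
  then show ?thesis using integrable_Re by fastforce
qed

lemma ground_state_representation:
  assumes "\<psi> \<in> test_functions"
  shows "(\<Sum>j\<in>UNIV. \<integral>x. (cmod (magnetic_deriv \<alpha> j (\<lambda>x. W x * \<psi> x) x))\<^sup>2 \<partial>lborel)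
    = (\<integral>x. (\<Sum>j\<in>UNIV. (w x)\<^sup>2 * (cmod (magnetic_deriv \<alpha> j \<psi> x))\<^sup>2) - w x * lap x * (cmod (\<psi> x))\<^sup>2 \<partial>lborel)"
proof -
  define \<phi> where "\<phi> x = W x * \<psi> x" for x
  define F where "F j x = (W x * partial_deriv j W x) * (\<psi> x * cnj (\<psi> x))" for j x
  have F: "F j \<in> test_functions" for j
    unfolding F_def[abs_def]
    by (intro test_mult[OF _ smooth_on_mult[OF open_UNIV smooth_w smooth_on_partial_deriv[OF smooth_w]]] test_mult_test[OF assms test_cnj[OF assms]])
  have iF: "integrable lborel (\<lambda>x. Re (partial_deriv j (F j) x))" for j
    by (intro integrable_Re test_integrable test_partial_deriv F)
  have zF: "(\<integral>x. Re (partial_deriv j (F j) x) \<partial>lborel) = 0" for j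
    using integral_Re[OF test_integrable[OF test_partial_deriv[OF F]], of j j] integral_partial_deriv_zero[OF F, of j j] by simp
  have L: "lap x = (\<Sum>j\<in>UNIV. Re (partial_deriv j (partial_deriv j W) x))" for x
    using arg_cong[OF lap[of x], of Re] by simp
  have pt: "(\<Sum>j\<in>UNIV. (cmod (magnetic_deriv \<alpha> j \<phi> x))\<^sup>2)
     = ((\<Sum>j\<in>UNIV. (w x)\<^sup>2 * (cmod (magnetic_deriv \<alpha> j \<psi> x))\<^sup>2) - w x * lap x * (cmod (\<psi> x))\<^sup>2) + (\<Sum>j\<in>UNIV. Re (partial_deriv j (F j) x))" for x
  proof -
    have "(cmod (magnetic_deriv \<alpha> j \<phi> x))\<^sup>2 = (w x)\<^sup>2 * (cmod (magnetic_deriv \<alpha> j \<psi> x))\<^sup>2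
        - w x * Re (partial_deriv j (partial_deriv j W) x) * (cmod (\<psi> x))\<^sup>2 + Re (partial_deriv j (F j) x)" for j
    proof -
      have n: "z * cnj z = complex_of_real ((cmod z)\<^sup>2)" for z by (rule complex_norm_square[symmetric])
      have "complex_of_real ((cmod (magnetic_deriv \<alpha> j \<phi> x))\<^sup>2) = (W x)\<^sup>2 * complex_of_real ((cmod (magnetic_deriv \<alpha> j \<psi> x))\<^sup>2)
        - W x * partial_deriv j (partial_deriv j W) x * complex_of_real ((cmod (\<psi> x))\<^sup>2) + partial_deriv j (F j) x"
        using ground_state_pointwise[OF assms, of \<alpha> j x] unfolding n \<phi>_def[abs_def] F_def[abs_def] .
      then have "Re (complex_of_real ((cmod (magnetic_deriv \<alpha> j \<phi> x))\<^sup>2)) = Re ((W x)\<^sup>2 * complex_of_real ((cmod (magnetic_deriv \<alpha> j \<psi> x))\<^sup>2)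
        - W x * partial_deriv j (partial_deriv j W) x * complex_of_real ((cmod (\<psi> x))\<^sup>2) + partial_deriv j (F j) x)"
        by (rule arg_cong)
      then show ?thesis by (simp flip: of_real_power of_real_mult)
    qed
    then show ?thesis unfolding L by (simp add: sum.distrib sum_subtractf sum_distrib_left sum_distrib_right mult_ac)
  qed
  have i\<phi>: "integrable lborel (\<lambda>x. (cmod (magnetic_deriv \<alpha> j \<phi> x))\<^sup>2)" for j
    using integrable_cmod_sq_test[OF magnetic_deriv_test[OF weight_test[OF assms]], of "\<lambda>_. 1" \<alpha> j] by (simp add: \<phi>_def[abs_def])
  have iE: "integrable lborel (\<lambda>x. (\<Sum>j\<in>UNIV. (w x)\<^sup>2 * (cmod (magnetic_deriv \<alpha> j \<psi> x))\<^sup>2) - w x * lap x * (cmod (\<psi> x))\<^sup>2)"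
    by (intro Bochner_Integration.integrable_diff Bochner_Integration.integrable_sum integrable_cmod_sq_test magnetic_deriv_test assms continuous_intros lap_continuous)
  have "(\<Sum>j\<in>UNIV. \<integral>x. (cmod (magnetic_deriv \<alpha> j \<phi> x))\<^sup>2 \<partial>lborel) = (\<integral>x. (\<Sum>j\<in>UNIV. (cmod (magnetic_deriv \<alpha> j \<phi> x))\<^sup>2) \<partial>lborel)"
    by (intro Bochner_Integration.integral_sum[symmetric] i\<phi>)
  also have "\<dots> = (\<integral>x. (\<Sum>j\<in>UNIV. (w x)\<^sup>2 * (cmod (magnetic_deriv \<alpha> j \<psi> x))\<^sup>2) - w x * lap x * (cmod (\<psi> x))\<^sup>2 \<partial>lborel)
      + (\<integral>x. (\<Sum>j\<in>UNIV. Re (partial_deriv j (F j) x)) \<partial>lborel)"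
    unfolding pt by (intro Bochner_Integration.integral_add iE Bochner_Integration.integrable_sum iF)
  also have "(\<integral>x. (\<Sum>j\<in>UNIV. Re (partial_deriv j (F j) x)) \<partial>lborel) = 0"
    using iF zF by (subst Bochner_Integration.integral_sum) auto
  finally show ?thesis by (simp add: \<phi>_def[abs_def])
qed

text \<open>Up to the constant \<open>(norm f)^2\<close> its integral is the resolvent functional at
  \<open>W x * \<psi> x\<close>, with the kinetic part rewritten by the ground state representation.
  The coefficient of the squared modulus is \<open>w\<close> times \<open>w - \<tau> * lap\<close>,
  the function by which \<open>F\<close> will be dominated.\<close>

definition energy_density :: "real \<Rightarrow> real \<Rightarrow> (real^4 \<Rightarrow> complex) \<Rightarrow> (real^4 \<Rightarrow> complex) \<Rightarrow> real^4 \<Rightarrow> real" where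
  "energy_density \<alpha> \<tau> F \<psi> x = \<tau> * (\<Sum>j\<in>UNIV. (w x)\<^sup>2 * (cmod (magnetic_deriv \<alpha> j \<psi> x))\<^sup>2)
     + w x * (w x - \<tau> * lap x) * (cmod (\<psi> x))\<^sup>2 - 2 * w x * Re (\<psi> x * cnj (F x))"

lemma integrable_energy_density:
  assumes "\<psi> \<in> test_functions" "square_integrable F"
  shows "integrable lborel (energy_density \<alpha> \<tau> F \<psi>)"
proof -
  have "integrable lborel (\<lambda>x. (W x * \<psi> x) * cnj (F x))"
    by (rule square_integrable_mult_cnj[OF test_square_integrable[OF weight_test[OF assms(1)]] assms(2)])
  then have 1: "integrable lborel (\<lambda>x. 2 * Re ((W x * \<psi> x) * cnj (F x)))"
    by (intro integrable_mult_right integrable_Re)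
  have 2: "integrable lborel (\<lambda>x. w x * (w x - \<tau> * lap x) * (cmod (\<psi> x))\<^sup>2)"
    by (intro integrable_cmod_sq_test assms continuous_intros lap_continuous)
  have 3: "integrable lborel (\<lambda>x. \<tau> * (\<Sum>j\<in>UNIV. (w x)\<^sup>2 * (cmod (magnetic_deriv \<alpha> j \<psi> x))\<^sup>2))"
    by (intro integrable_mult_right Bochner_Integration.integrable_sum integrable_cmod_sq_test magnetic_deriv_test assms continuous_intros lap_continuous)
  have eq: "energy_density \<alpha> \<tau> F \<psi> = (\<lambda>x. \<tau> * (\<Sum>j\<in>UNIV. (w x)\<^sup>2 * (cmod (magnetic_deriv \<alpha> j \<psi> x))\<^sup>2)
     + w x * (w x - \<tau> * lap x) * (cmod (\<psi> x))\<^sup>2 - 2 * Re ((W x * \<psi> x) * cnj (F x)))"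
    by (simp add: energy_density_def fun_eq_iff algebra_simps)
  show ?thesis unfolding eq by (intro Bochner_Integration.integrable_add Bochner_Integration.integrable_diff 1 2 3)
qed

lemma energy_eq:
  assumes \<tau>: "\<tau> \<ge> 0" and \<psi>: "\<psi> \<in> test_functions"
  shows "psd_form.J (\<lambda>u v. \<tau> * Re (quadratic_form (minimal_AB_operator \<alpha>) u v)) f (abs_L2 (\<lambda>x. W x * \<psi> x))
    = (norm f)\<^sup>2 + (\<integral>x. energy_density \<alpha> \<tau> (rep_L2 f) \<psi> x \<partial>lborel)"
proof -
  interpret S: nonneg_symmetric "minimal_AB_operator \<alpha>" by (rule nonneg_symmetric_AB)
  define \<phi> where "\<phi> x = W x * \<psi> x" for x
  have \<phi>: "\<phi> \<in> test_functions" unfolding \<phi>_def[abs_def] by (rule weight_test[OF \<psi>])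
  note sq = test_square_integrable[OF \<phi>]
  have M: "integrable lborel (\<lambda>x. (\<Sum>j\<in>UNIV. (w x)\<^sup>2 * (cmod (magnetic_deriv \<alpha> j \<psi> x))\<^sup>2) - w x * lap x * (cmod (\<psi> x))\<^sup>2)"
    by (intro Bochner_Integration.integrable_diff Bochner_Integration.integrable_sum integrable_cmod_sq_test magnetic_deriv_test \<psi> continuous_intros lap_continuous)
  have "(abs_L2 \<phi>, abs_L2 (AB_square \<alpha> \<phi>)) \<in> minimal_AB_operator \<alpha>" using \<phi> by (auto simp: minimal_AB_iff)
  then have "quadratic_form (minimal_AB_operator \<alpha>) (abs_L2 \<phi>) (abs_L2 \<phi>) = cinner_L2 (abs_L2 (AB_square \<alpha> \<phi>)) (abs_L2 \<phi>)"
    by (rule S.q_eq)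
  also have "\<dots> = (\<Sum>j\<in>UNIV. \<integral>x. magnetic_deriv \<alpha> j \<phi> x * cnj (magnetic_deriv \<alpha> j \<phi> x) \<partial>lborel)"
    by (rule AB_square_cinner[OF \<phi> \<phi>])
  also have "\<dots> = of_real (\<Sum>j\<in>UNIV. \<integral>x. (cmod (magnetic_deriv \<alpha> j \<phi> x))\<^sup>2 \<partial>lborel)"
    unfolding complex_norm_square[symmetric] integral_complex_of_real by simp
  finally have q: "Re (quadratic_form (minimal_AB_operator \<alpha>) (abs_L2 \<phi>) (abs_L2 \<phi>))
     = (\<integral>x. (\<Sum>j\<in>UNIV. (w x)\<^sup>2 * (cmod (magnetic_deriv \<alpha> j \<psi> x))\<^sup>2) - w x * lap x * (cmod (\<psi> x))\<^sup>2 \<partial>lborel)"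
    using ground_state_representation[OF \<psi>, of \<alpha>] by (simp add: \<phi>_def[abs_def])
  have n: "(norm (abs_L2 \<phi>))\<^sup>2 = (\<integral>x. (w x)\<^sup>2 * (cmod (\<psi> x))\<^sup>2 \<partial>lborel)"
    unfolding norm_abs_L2_sq[OF sq] by (simp add: \<phi>_def norm_mult power_mult_distrib)
  define R where "R x = Re (\<phi> x * cnj (rep_L2 f x))" for x
  have c: "inner (abs_L2 \<phi>) f = (\<integral>x. R x \<partial>lborel)"
  proof -
    have "cinner_L2 (abs_L2 \<phi>) f = (\<integral>x. \<phi> x * cnj (rep_L2 f x) \<partial>lborel)"
      using cinner_abs_L2[OF sq square_integrable_rep_L2[of f]] by (simp add: abs_rep_L2)
    then show ?thesis
      unfolding R_def integral_Re[OF square_integrable_mult_cnj[OF sq square_integrable_rep_L2[of f]]] by (simp add: inner_L2_def)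
  qed
  have ic: "integrable lborel R"
    unfolding R_def[abs_def] by (intro integrable_Re square_integrable_mult_cnj sq square_integrable_rep_L2)
  have inr: "integrable lborel (\<lambda>x. (w x)\<^sup>2 * (cmod (\<psi> x))\<^sup>2)"
    by (intro integrable_cmod_sq_test \<psi> continuous_intros lap_continuous)
  have "psd_form.J (\<lambda>u v. \<tau> * Re (quadratic_form (minimal_AB_operator \<alpha>) u v)) f (abs_L2 \<phi>)
     = \<tau> * Re (quadratic_form (minimal_AB_operator \<alpha>) (abs_L2 \<phi>) (abs_L2 \<phi>)) + (norm (abs_L2 \<phi> - f))\<^sup>2"
    using psd_form.J_def[OF S.psd_form_q[OF \<tau>]] by simp
  also have "(norm (abs_L2 \<phi> - f))\<^sup>2 = (norm (abs_L2 \<phi>))\<^sup>2 - 2 * inner (abs_L2 \<phi>) f + (norm f)\<^sup>2"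
    unfolding power2_norm_eq_inner by (simp add: inner_diff inner_commute)
  finally have "psd_form.J (\<lambda>u v. \<tau> * Re (quadratic_form (minimal_AB_operator \<alpha>) u v)) f (abs_L2 \<phi>) - (norm f)\<^sup>2
     = \<tau> * (\<integral>x. (\<Sum>j\<in>UNIV. (w x)\<^sup>2 * (cmod (magnetic_deriv \<alpha> j \<psi> x))\<^sup>2) - w x * lap x * (cmod (\<psi> x))\<^sup>2 \<partial>lborel)
       + ((\<integral>x. (w x)\<^sup>2 * (cmod (\<psi> x))\<^sup>2 \<partial>lborel) - 2 * (\<integral>x. R x \<partial>lborel))"
    unfolding q n c by simp
  also have "\<dots> = (\<integral>x. \<tau> * ((\<Sum>j\<in>UNIV. (w x)\<^sup>2 * (cmod (magnetic_deriv \<alpha> j \<psi> x))\<^sup>2) - w x * lap x * (cmod (\<psi> x))\<^sup>2)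
       + ((w x)\<^sup>2 * (cmod (\<psi> x))\<^sup>2 - 2 * R x) \<partial>lborel)"
    using M inr ic by (subst Bochner_Integration.integral_add) auto
  also have "\<dots> = (\<integral>x. energy_density \<alpha> \<tau> (rep_L2 f) \<psi> x \<partial>lborel)"
    by (rule Bochner_Integration.integral_cong) (auto simp: energy_density_def \<phi>_def R_def algebra_simps power2_eq_square)
  finally show ?thesis by (simp add: \<phi>_def[abs_def])
qed

text \<open>The kinetic part decreases by the diamagnetic inequality. In the rest, the worst case
  under the bound on \<open>F\<close> is \<open>F\<close> parallel to \<open>\<psi>\<close> with
  modulus \<open>G\<close>, and the change becomes \<open>w * G\<close> times that of
  \<open>r^2 - 2 * r\<close>. The error is confined to the set where \<open>\<psi>\<close> is
  nonzero so that it can be integrated.\<close>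

lemma energy_density_truncate:
  assumes "\<psi> \<in> test_functions" "k > 0" "\<tau> \<ge> 0" "cmod (F x) \<le> w x - \<tau> * lap x"
  shows "energy_density \<alpha> \<tau> F (truncate k \<psi>) x
    \<le> energy_density \<alpha> \<tau> F \<psi> x + cutoff_error k * (w x * (w x - \<tau> * lap x) * (if \<psi> x = 0 then 0 else 1))"
proof -
  define G where "G = w x - \<tau> * lap x"
  define r where "r = cmod (\<psi> x)"
  define \<theta> where "\<theta> = soft_cutoff k (r\<^sup>2)"
  have \<theta>: "0 < \<theta>" "\<theta> \<le> 1" using soft_cutoff_bounds[of "r\<^sup>2" k] by (auto simp: \<theta>_def)
  have G: "cmod (F x) \<le> G" "0 \<le> G" using assms(4) norm_ge_zero[of "F x"] unfolding G_def by linarith+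
  have tr: "truncate k \<psi> x = of_real \<theta> * \<psi> x" by (simp add: truncate_def \<theta>_def r_def)
  have 1: "\<tau> * (\<Sum>j\<in>UNIV. (w x)\<^sup>2 * (cmod (magnetic_deriv \<alpha> j (truncate k \<psi>) x))\<^sup>2)
     \<le> \<tau> * (\<Sum>j\<in>UNIV. (w x)\<^sup>2 * (cmod (magnetic_deriv \<alpha> j \<psi> x))\<^sup>2)"
    using assms(3) by (intro mult_left_mono sum_mono power_mono magnetic_deriv_truncate assms(1,2)) auto
  have e: "Re (\<psi> x * cnj (F x)) \<le> r * G"
  proof -
    have "Re (\<psi> x * cnj (F x)) \<le> cmod (\<psi> x * cnj (F x))" by (rule complex_Re_le_cmod)
    also have "\<dots> \<le> r * G" unfolding norm_mult complex_mod_cnj r_def using G by (intro mult_left_mono) auto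
    finally show ?thesis .
  qed
  have "w x * G * (cmod (truncate k \<psi> x))\<^sup>2 - 2 * w x * Re (truncate k \<psi> x * cnj (F x))
      - (w x * G * (cmod (\<psi> x))\<^sup>2 - 2 * w x * Re (\<psi> x * cnj (F x)))
     = w x * (G * (r\<^sup>2 * \<theta>\<^sup>2 - r\<^sup>2) + 2 * (1 - \<theta>) * Re (\<psi> x * cnj (F x)))"
    unfolding tr r_def[symmetric] using \<theta> 
    by (simp add: norm_mult power_mult_distrib r_def algebra_simps)
  also have "\<dots> \<le> w x * (G * (r\<^sup>2 * \<theta>\<^sup>2 - r\<^sup>2) + 2 * (1 - \<theta>) * (r * G))"
    using e \<theta> w_pos[of x] by (intro mult_left_mono add_left_mono) auto
  also have "\<dots> = w x * G * ((r - r * \<theta>) * (2 - r - r * \<theta>))"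
    by (simp add: algebra_simps power2_eq_square)
  also have "\<dots> \<le> cutoff_error k * (w x * G * (if \<psi> x = 0 then 0 else 1))"
  proof (cases "\<psi> x = 0")
    case False
    have "(r - r * \<theta>) * (2 - r - r * \<theta>) \<le> cutoff_error k"
      unfolding \<theta>_def by (rule truncated_potential_bound) (auto simp: r_def assms)
    then have "w x * G * ((r - r * \<theta>) * (2 - r - r * \<theta>)) \<le> w x * G * cutoff_error k"
      using w_pos[of x] G by (intro mult_left_mono) auto
    then show ?thesis using False by (simp add: mult.commute)
  qed (simp add: r_def)
  finally show ?thesis using 1 unfolding energy_density_def G_def[symmetric] by linarith
qed

theorem resolvent_dominated:
  assumes \<tau>: "\<tau> > 0" and f: "AE x in lborel. cmod (rep_L2 f x) \<le> w x - \<tau> * lap x"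
  shows "AE x in lborel. cmod (rep_L2 (accretive.J (friedrichs_extension (minimal_AB_operator \<alpha>)) \<tau> f) x) \<le> w x"
proof -
  interpret S: nonneg_symmetric "minimal_AB_operator \<alpha>" by (rule nonneg_symmetric_AB)
  let ?b = "\<lambda>u v. \<tau> * Re (quadratic_form (minimal_AB_operator \<alpha>) u v)"
  interpret F: psd_form "Domain (minimal_AB_operator \<alpha>)" ?b using \<tau> by (intro S.psd_form_q) simp
  obtain X where X: "\<And>n. X n \<in> Domain (minimal_AB_operator \<alpha>)" "(\<lambda>n. F.J f (X n)) \<longlonglongrightarrow> F.J_inf f"
    using F.minimizing_sequence by blast
  have "\<exists>\<phi>\<in>test_functions. X n = abs_L2 \<phi>" for n
    using X(1)[of n] unfolding Domain_iff minimal_AB_iff by blast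
  then obtain \<phi> where \<phi>: "\<And>n. \<phi> n \<in> test_functions" "\<And>n. X n = abs_L2 (\<phi> n)" by metis
  define \<psi> where "\<psi> n x = of_real (w x powr (-1)) * \<phi> n x" for n x
  have \<psi>: "\<psi> n \<in> test_functions" for n
    unfolding \<psi>_def[abs_def] using w_pos by (intro test_mult \<phi> smooth_on_powr smooth_w) auto
  have \<phi>\<psi>: "\<phi> n = (\<lambda>x. W x * \<psi> n x)" for n
  proof
    fix x
    have "w x powr (-1) = inverse (w x)" using w_pos[of x] by (simp add: powr_minus)
    then show "\<phi> n x = W x * \<psi> n x" using w_pos[of x] by (simp add: \<psi>_def)
  qed
  define C where "C n = (\<integral>x. w x * (w x - \<tau> * lap x) * (if \<psi> n x = 0 then 0 else 1) \<partial>lborel)" for n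
  have iC: "integrable lborel (\<lambda>x. w x * (w x - \<tau> * lap x) * (if \<psi> n x = 0 then 0 else 1))" for n
  proof -
    obtain K where K: "compact K" "K \<inter> flux_plane = {}" "\<And>x. x \<notin> K \<Longrightarrow> \<psi> n x = 0"
      using test_functions_support[OF \<psi>] by blast
    have [measurable]: "\<psi> n \<in> borel_measurable borel" by (rule test_measurable[OF \<psi>])
    have "continuous_on UNIV (\<lambda>x. w x * (w x - \<tau> * lap x))"
      by (intro continuous_intros lap_continuous)
    then have iK: "integrable lborel (\<lambda>x. indicator K x *\<^sub>R (w x * (w x - \<tau> * lap x)))"
      by (intro borel_integrable_compact K(1)) (rule continuous_on_subset[OF _ subset_UNIV])
    have S: "{x. \<psi> n x \<noteq> 0} \<in> sets lborel" by simp
    have "integrable lborel (\<lambda>x. indicator {x. \<psi> n x \<noteq> 0} x *\<^sub>R (indicator K x *\<^sub>R (w x * (w x - \<tau> * lap x))))"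
      by (rule integrable_mult_indicator[OF S iK])
    also have "(\<lambda>x. indicator {x. \<psi> n x \<noteq> 0} x *\<^sub>R (indicator K x *\<^sub>R (w x * (w x - \<tau> * lap x))))
       = (\<lambda>x. w x * (w x - \<tau> * lap x) * (if \<psi> n x = 0 then 0 else 1))"
      using K(3) by (force simp: indicator_def)
    finally show ?thesis .
  qed
  \<comment> \<open>The cutoff is sharpened depending on \<open>n\<close>, as \<open>C n\<close>
    depends on the support of \<open>\<psi> n\<close> and no bound uniform in \<open>n\<close> is at
    hand; with this choice the truncated sequence is again minimizing.\<close>
  have "\<exists>m. cutoff_error (Suc m) * C n \<le> inverse (real (Suc n))" for n
  proof -
    have "(\<lambda>m. cutoff_error (Suc m) * C n) \<longlonglongrightarrow> 0 * C n"
      by (intro tendsto_mult tendsto_const cutoff_error_tendsto)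
    then have "\<forall>\<^sub>F m in sequentially. cutoff_error (Suc m) * C n < inverse (real (Suc n))"
      by (intro order_tendstoD(2)) auto
    then show ?thesis by (auto simp: eventually_sequentially intro: less_imp_le)
  qed
  then obtain k where k: "\<And>n. cutoff_error (Suc (k n)) * C n \<le> inverse (real (Suc n))" by metis
  define \<eta> where "\<eta> n = truncate (Suc (k n)) (\<psi> n)" for n
  have \<eta>: "\<eta> n \<in> test_functions" for n unfolding \<eta>_def by (rule truncate_test[OF \<psi>])
  define Y where "Y n = abs_L2 (\<lambda>x. W x * \<eta> n x)" for n
  have YD: "Y n \<in> Domain (minimal_AB_operator \<alpha>)" for n
    unfolding Domain_iff minimal_AB_iff Y_def using weight_test[OF \<eta>[of n]] by blast
  have JY: "F.J f (Y n) \<le> F.J f (X n) + inverse (real (Suc n))" for n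
  proof -
    have "(\<integral>x. energy_density \<alpha> \<tau> (rep_L2 f) (\<eta> n) x \<partial>lborel)
      \<le> (\<integral>x. energy_density \<alpha> \<tau> (rep_L2 f) (\<psi> n) x
          + cutoff_error (Suc (k n)) * (w x * (w x - \<tau> * lap x) * (if \<psi> n x = 0 then 0 else 1)) \<partial>lborel)"
    proof (rule integral_mono_AE)
      show "AE x in lborel. energy_density \<alpha> \<tau> (rep_L2 f) (\<eta> n) x \<le> energy_density \<alpha> \<tau> (rep_L2 f) (\<psi> n) x
          + cutoff_error (Suc (k n)) * (w x * (w x - \<tau> * lap x) * (if \<psi> n x = 0 then 0 else 1))"
        using f
      proof eventually_elim
        case (elim x)
        show ?case unfolding \<eta>_def using \<tau> by (intro energy_density_truncate \<psi> elim) auto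
      qed
    qed (intro Bochner_Integration.integrable_add integrable_energy_density \<eta> \<psi> square_integrable_rep_L2 integrable_mult_right iC)+
    also have "\<dots> = (\<integral>x. energy_density \<alpha> \<tau> (rep_L2 f) (\<psi> n) x \<partial>lborel) + cutoff_error (Suc (k n)) * C n"
      unfolding C_def
      by (subst Bochner_Integration.integral_add) 
        (intro integrable_energy_density \<psi> square_integrable_rep_L2 integrable_mult_right iC | simp)+
    also have "\<dots> \<le> (\<integral>x. energy_density \<alpha> \<tau> (rep_L2 f) (\<psi> n) x \<partial>lborel) + inverse (real (Suc n))"
      using k by simp
    finally show ?thesis
      unfolding Y_def energy_eq[OF less_imp_le[OF \<tau>] \<eta>] \<phi>(2) \<phi>\<psi> energy_eq[OF less_imp_le[OF \<tau>] \<psi>] by simp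
  qed
  have "(\<lambda>n. F.J f (Y n)) \<longlonglongrightarrow> F.J_inf f"
  proof (rule tendsto_sandwich)
    show "\<forall>\<^sub>F n in sequentially. F.J_inf f \<le> F.J f (Y n)"
      by (intro always_eventually allI F.J_inf_le YD)
    show "\<forall>\<^sub>F n in sequentially. F.J f (Y n) \<le> F.J f (X n) + inverse (real (Suc n))"
      by (intro always_eventually allI JY)
    show "(\<lambda>n. F.J f (X n) + inverse (real (Suc n))) \<longlonglongrightarrow> F.J_inf f"
      using tendsto_add[OF X(2) LIMSEQ_inverse_real_of_nat] by simp
  qed simp
  from S.minimizing_tendsto_resolvent[OF \<tau> YD this]
  have lim: "Y \<longlonglongrightarrow> S.J \<tau> f" .
  show ?thesis
  proof (rule AE_bound_L2_limit[OF lim, where w = "\<lambda>n x. w x"])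
    fix n
    have "AE x in lborel. rep_L2 (Y n) x = W x * \<eta> n x"
      unfolding Y_def by (rule rep_abs_L2[OF test_square_integrable[OF weight_test[OF \<eta>]]])
    then show "AE x in lborel. cmod (rep_L2 (Y n) x) \<le> w x"
    proof eventually_elim
      case (elim x)
      have "cmod (\<eta> n x) \<le> 1" unfolding \<eta>_def by (rule cmod_truncate) simp
      then show ?case using w_pos[of x] by (simp add: elim norm_mult mult_left_le)
    qed
  qed simp
qed

end

section \<open>Gaussian domination of the semigroup\<close>

text \<open>The heat kernel of the Laplacian in dimension four at time \<open>s\<close>, without the
  factor \<open>1 / (4 * pi)^2\<close>.\<close>

definition gauss :: "real \<Rightarrow> real^4 \<Rightarrow> real" where
  "gauss s z = exp (- (z \<bullet> z) / (4 * s)) / s\<^sup>2"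

lemma gauss_pos: "s > 0 \<Longrightarrow> gauss s z > 0"
  by (simp add: gauss_def)

lemma sq_exp_le: "z \<ge> 0 \<Longrightarrow> z\<^sup>2 * exp (- z) \<le> (2::real)"
  using exp_lower_Taylor_quadratic[of z] by (simp add: exp_minus divide_simps)

text \<open>With \<open>z = r / u\<close> the bracket is \<open>6 - 6 * z + z^2\<close> up to the
  power of \<open>u\<close>; the middle term is dropped and \<open>z^2 * exp (- z) \<le> 2\<close>.
  The bound is free of \<open>r\<close>, which makes the Euler error uniform in space.\<close>

lemma gauss_profile_second_derivative_le:
  fixes r u :: real
  assumes "r \<ge> 0" "u > 0"
  shows "(6 / u^4 - 6 * r / u^5 + r\<^sup>2 / u^6) * exp (- r / u) \<le> 8 / u^4"
proof -
  define z where "z = r / u"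
  have z: "z \<ge> 0" using assms by (simp add: z_def)
  have "(6 / u^4 - 6 * r / u^5 + r\<^sup>2 / u^6) * exp (- r / u) = (6 * exp (- z) - 6 * z * exp (- z) + z\<^sup>2 * exp (- z)) / u^4"
    using assms(2) by (simp add: z_def field_simps eval_nat_numeral)
  also have "\<dots> \<le> (6 - 0 + 2) / u^4"
    using z sq_exp_le[OF z] assms by (intro divide_right_mono add_mono diff_mono) auto
  finally show ?thesis by simp
qed

text \<open>Second order Taylor bound: \<open>u \<mapsto> exp (- r / u) / u\<^sup>2\<close> minus a multiple of \<open>u\<^sup>2\<close> is
  concave, hence below its tangents.\<close>

lemma gauss_profile_step:
  fixes r s \<delta> \<tau> :: real
  assumes "r \<ge> 0" "\<delta> > 0" "s \<ge> \<delta>" "\<tau> > 0"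
  shows "exp (- r / s) / s\<^sup>2 \<le> exp (- r / (s + \<tau>)) / (s + \<tau>)\<^sup>2
    - \<tau> * ((- 2 / (s + \<tau>)^3 + r / (s + \<tau>)^4) * exp (- r / (s + \<tau>))) + 4 * \<tau>\<^sup>2 / \<delta>^4"
proof -
  define p where "p u = exp (- r / u) / u\<^sup>2" for u
  define p' where "p' u = (- 2 / u^3 + r / u^4) * exp (- r / u)" for u
  define p'' where "p'' u = (6 / u^4 - 6 * r / u^5 + r\<^sup>2 / u^6) * exp (- r / u)" for u
  define K where "K = 4 / \<delta>^4"
  have dp: "(p has_real_derivative p' u) (at u)" if "u > 0" for u
    unfolding p_def p'_def using that
    by (auto intro!: derivative_eq_intros simp: field_simps eval_nat_numeral)
  have dp': "(p' has_real_derivative p'' u) (at u)" if "u > 0" for u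
    unfolding p'_def p''_def using that
    by (auto intro!: derivative_eq_intros simp: field_simps eval_nat_numeral)
  have dc: "((\<lambda>u. K * u\<^sup>2 - p u) has_real_derivative 2 * K * u - p' u) (at u)" if "u > 0" for u
    using that by (auto intro!: derivative_eq_intros dp)
  have cvx: "convex_on {\<delta>..} (\<lambda>u. K * u\<^sup>2 - p u)"
  proof (rule f''_ge0_imp_convex)
    show "((\<lambda>u. K * u\<^sup>2 - p u) has_real_derivative 2 * K * u - p' u) (at u)" if "u \<in> {\<delta>..}" for u
      using that assms by (intro dc) auto
    show "((\<lambda>u. 2 * K * u - p' u) has_real_derivative 2 * K - p'' u) (at u)" if "u \<in> {\<delta>..}" for u
      using that assms by (auto intro!: derivative_eq_intros dp')
    show "2 * K - p'' u \<ge> 0" if "u \<in> {\<delta>..}" for u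
    proof -
      have "p'' u \<le> 8 / u^4" unfolding p''_def using that assms by (intro gauss_profile_second_derivative_le) auto
      also have "\<dots> \<le> 8 / \<delta>^4" using that assms by (intro divide_left_mono power_mono) auto
      finally show ?thesis by (simp add: K_def)
    qed
  qed simp
  have "(K * s\<^sup>2 - p s) - (K * (s + \<tau>)\<^sup>2 - p (s + \<tau>)) \<ge> (2 * K * (s + \<tau>) - p' (s + \<tau>)) * (s - (s + \<tau>))"
  proof (rule convex_on_imp_above_tangent[OF cvx])
    show "((\<lambda>u. K * u\<^sup>2 - p u) has_real_derivative 2 * K * (s + \<tau>) - p' (s + \<tau>)) (at (s + \<tau>) within {\<delta>..})"
      using assms by (intro has_field_derivative_at_within[OF dc]) auto
  qed (use assms in \<open>auto simp: interior_real_atLeast\<close>)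
  then have "p s \<le> p (s + \<tau>) - \<tau> * p' (s + \<tau>) + K * \<tau>\<^sup>2"
    by (simp add: power2_eq_square algebra_simps)
  then show ?thesis by (simp add: p_def p'_def K_def)
qed

section \<open>Gaussians as weights\<close>

context
  fixes c a s :: real and y :: "real^4"
  assumes c: "c > 0" and a: "a \<ge> 0" and s: "s > 0"
begin

lemma gauss_partial_deriv:
  "((\<lambda>x. complex_of_real (c * (gauss s (x - y) + a))) has_derivative
     (\<lambda>v. of_real (- c / (2 * s) * ((x - y) \<bullet> v) * gauss s (x - y)))) (at x)"
  unfolding gauss_def using s
  by (auto intro!: derivative_eq_intros simp: inner_commute field_simps)

lemma gauss_partial_deriv2:
  "((\<lambda>x. complex_of_real (- c / (2 * s) * ((x - y) \<bullet> e) * gauss s (x - y))) has_derivative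
     (\<lambda>v. of_real (- c / (2 * s) * ((v \<bullet> e) - ((x - y) \<bullet> e) * ((x - y) \<bullet> v) / (2 * s)) * gauss s (x - y)))) (at x)"
  unfolding gauss_def using s
  by (auto intro!: derivative_eq_intros simp: inner_commute field_simps)

text \<open>By the heat equation the Laplacian is \<open>c\<close> times the derivative of the
  Gaussian in \<open>s\<close>; it is written in that form to meet the Taylor bound in time.\<close>

lemma positive_weight_gauss:
  "positive_weight (\<lambda>x. c * (gauss s (x - y) + a))
     (\<lambda>x. c * ((- 2 / s + ((x - y) \<bullet> (x - y)) / (4 * s\<^sup>2)) * gauss s (x - y)))"
proof
  show "0 < c * (gauss s (x - y) + a)" for x
    using gauss_pos[OF s, of "x - y"] a c by (simp add: add_pos_nonneg)
  have in4: "(x - y) \<bullet> (x - y) = (\<Sum>j\<in>UNIV. (x $ j - y $ j)\<^sup>2)" for x :: "real^4"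
    by (simp add: inner_vec_def power2_eq_square)
  show "smooth_on UNIV (\<lambda>x. complex_of_real (c * (gauss s (x - y) + a)))"
  proof -
    have "smooth_on UNIV (\<lambda>x. complex_of_real (- 1 / (4 * s) * ((x - y) \<bullet> (x - y))))"
      unfolding in4 of_real_mult of_real_sum of_real_power of_real_diff
      by (intro smooth_on_mult smooth_on_sum smooth_on_power smooth_on_diff smooth_on_const smooth_on_coord open_UNIV)
    then have "smooth_on UNIV (\<lambda>x. complex_of_real (exp (- 1 / (4 * s) * ((x - y) \<bullet> (x - y)))))"
      by (intro smooth_on_exp) auto
    then have "smooth_on UNIV (\<lambda>x. of_real c * (of_real (1 / s\<^sup>2) * complex_of_real (exp (- 1 / (4 * s) * ((x - y) \<bullet> (x - y)))) + of_real a))"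
      by (intro smooth_on_mult smooth_on_add smooth_on_const open_UNIV)
    then show ?thesis by (simp add: gauss_def)
  qed
  fix x :: "real^4"
  have d1: "partial_deriv j (\<lambda>x. complex_of_real (c * (gauss s (x - y) + a)))
     = (\<lambda>x. of_real (- c / (2 * s) * ((x - y) \<bullet> axis j 1) * gauss s (x - y)))" for j
    using partial_deriv_eq[OF gauss_partial_deriv] by blast
  have "(\<Sum>j\<in>UNIV. partial_deriv j (partial_deriv j (\<lambda>x. complex_of_real (c * (gauss s (x - y) + a)))) x)
     = (\<Sum>j\<in>UNIV. of_real (- c / (2 * s) * (1 - (x $ j - y $ j)\<^sup>2 / (2 * s)) * gauss s (x - y)))"
    unfolding d1 partial_deriv_eq[OF gauss_partial_deriv2]
    by (simp add: inner_axis power2_eq_square)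
  also have "\<dots> = of_real (\<Sum>j\<in>UNIV. - c / (2 * s) * (1 - (x $ j - y $ j)\<^sup>2 / (2 * s)) * gauss s (x - y))"
    by simp
  also have "(\<Sum>j\<in>(UNIV::4 set). - c / (2 * s) * (1 - (x $ j - y $ j)\<^sup>2 / (2 * s)) * gauss s (x - y))
     = - c / (2 * s) * (4 - ((x - y) \<bullet> (x - y)) / (2 * s)) * gauss s (x - y)"
    unfolding in4 sum_4 by (simp add: algebra_simps diff_divide_distrib add_divide_distrib)
  also have "\<dots> = c * ((- 2 / s + ((x - y) \<bullet> (x - y)) / (4 * s\<^sup>2)) * gauss s (x - y))"
    using s by (simp add: field_simps power2_eq_square)
  finally show "complex_of_real (c * ((- 2 / s + ((x - y) \<bullet> (x - y)) / (4 * s\<^sup>2)) * gauss s (x - y)))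
     = (\<Sum>j\<in>UNIV. partial_deriv j (partial_deriv j (\<lambda>x. complex_of_real (c * (gauss s (x - y) + a)))) x)" ..
qed

end

text \<open>The supersolution property for one implicit Euler step: the Laplacian of the Gaussian is
  its time derivative, so the Taylor bound for the profile applies with \<open>r\<close> a quarter
  of the squared length of \<open>z\<close>. The additive constant in the weight has zero Laplacian
  and absorbs the remainder.\<close>

lemma gauss_step:
  assumes "c > 0" "a \<ge> 0" "\<delta> > 0" "s \<ge> \<delta>" "\<tau> > 0"
  shows "c * (gauss s z + a) \<le> c * (gauss (s + \<tau>) z + (a + 4 * \<tau>\<^sup>2 / \<delta>^4))
    - \<tau> * (c * ((- 2 / (s + \<tau>) + (z \<bullet> z) / (4 * (s + \<tau>)\<^sup>2)) * gauss (s + \<tau>) z))"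
proof -
  define r where "r = (z \<bullet> z) / 4"
  define u where "u = s + \<tau>"
  have u: "u > 0" using assms by (simp add: u_def)
  have g: "gauss v z = exp (- r / v) / v\<^sup>2" for v
    by (simp add: gauss_def r_def)
  have "(- 2 / u + (z \<bullet> z) / (4 * u\<^sup>2)) * gauss u z = (- 2 / u^3 + r / u^4) * exp (- r / u)"
    unfolding g using u by (simp add: r_def field_simps eval_nat_numeral)
  moreover have "gauss s z \<le> gauss u z - \<tau> * ((- 2 / u^3 + r / u^4) * exp (- r / u)) + 4 * \<tau>\<^sup>2 / \<delta>^4"
    unfolding g u_def using assms by (intro gauss_profile_step) (auto simp: r_def)
  ultimately have "gauss s z + a \<le> gauss u z + (a + 4 * \<tau>\<^sup>2 / \<delta>^4) - \<tau> * ((- 2 / u + (z \<bullet> z) / (4 * u\<^sup>2)) * gauss u z)"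
    by simp
  then have "c * (gauss s z + a) \<le> c * (gauss u z + (a + 4 * \<tau>\<^sup>2 / \<delta>^4) - \<tau> * ((- 2 / u + (z \<bullet> z) / (4 * u\<^sup>2)) * gauss u z))"
    using assms(1) by (intro mult_left_mono) auto
  then show ?thesis unfolding u_def by (simp add: algebra_simps)
qed

lemma gauss_continuous: "s > 0 \<Longrightarrow> isCont (\<lambda>s. gauss s z) s"
  unfolding gauss_def by (intro continuous_intros) auto

theorem semigroup_gauss_bound:
  assumes c: "c > 0" and \<delta>: "\<delta> > 0" and t: "t \<ge> 0"
    and f: "AE x in lborel. cmod (rep_L2 f x) \<le> c * gauss \<delta> (x - y)"
  shows "AE x in lborel. cmod (rep_L2 (exp_semigroup (AB_operator \<alpha>) t f) x) \<le> c * gauss (\<delta> + t) (x - y)"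
proof -
  interpret S: nonneg_symmetric "minimal_AB_operator \<alpha>" by (rule nonneg_symmetric_AB)
  have step: "AE x in lborel. cmod (rep_L2 (S.Jn \<tau> n f) x) \<le> c * (gauss (\<delta> + real n * \<tau>) (x - y) + real n * (4 * \<tau>\<^sup>2 / \<delta>^4))"
    if \<tau>: "\<tau> > 0" for \<tau> n
  proof (induction n)
    case 0
    then show ?case using f by simp
  next
    case (Suc n)
    define s where "s = \<delta> + real n * \<tau>"
    define a where "a = real n * (4 * \<tau>\<^sup>2 / \<delta>^4)"
    have s: "s \<ge> \<delta>" using \<tau> by (simp add: s_def)
    have a: "a \<ge> 0" using \<delta> by (simp add: a_def)
    interpret positive_weight "\<lambda>x. c * (gauss (s + \<tau>) (x - y) + (a + 4 * \<tau>\<^sup>2 / \<delta>^4))"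
      "\<lambda>x. c * ((- 2 / (s + \<tau>) + ((x - y) \<bullet> (x - y)) / (4 * (s + \<tau>)\<^sup>2)) * gauss (s + \<tau>) (x - y))"
      using c a s \<tau> \<delta> by (intro positive_weight_gauss) auto
    have "AE x in lborel. cmod (rep_L2 (S.J \<tau> (S.Jn \<tau> n f)) x) \<le> c * (gauss (s + \<tau>) (x - y) + (a + 4 * \<tau>\<^sup>2 / \<delta>^4))"
    proof (rule resolvent_dominated[OF \<tau>])
      show "AE x in lborel. cmod (rep_L2 (S.Jn \<tau> n f) x) \<le> c * (gauss (s + \<tau>) (x - y) + (a + 4 * \<tau>\<^sup>2 / \<delta>^4))
        - \<tau> * (c * ((- 2 / (s + \<tau>) + ((x - y) \<bullet> (x - y)) / (4 * (s + \<tau>)\<^sup>2)) * gauss (s + \<tau>) (x - y)))"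
        using Suc
      proof eventually_elim
        case (elim x)
        then show ?case
          using gauss_step[OF c a \<delta> s \<tau>, of "x - y"] unfolding s_def[symmetric] a_def[symmetric] by linarith
      qed
    qed
    moreover have "\<delta> + real (Suc n) * \<tau> = s + \<tau>" by (simp add: s_def algebra_simps)
    moreover have "real (Suc n) * (4 * \<tau>\<^sup>2 / \<delta>^4) = a + 4 * \<tau>\<^sup>2 / \<delta>^4" by (simp only: a_def of_nat_Suc distrib_right mult_1)
    ultimately show ?case by (simp only: S.Jn_Suc)
  qed
  define n where "n k = nat \<lfloor>t * 2^k\<rfloor>" for k
  define h :: "nat \<Rightarrow> real" where "h k = (1/2)^k" for k
  have nh: "(\<lambda>k. real (n k) * h k) \<longlonglongrightarrow> t" unfolding n_def h_def by (rule S.steps_tendsto[OF t])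
  have h0: "h \<longlonglongrightarrow> 0" unfolding h_def[abs_def] by (rule LIMSEQ_power_zero) simp
  have "AE x in lborel. cmod (rep_L2 (S.T t f) x) \<le> c * (gauss (\<delta> + t) (x - y) + 0)"
  proof (rule AE_bound_L2_limit[OF S.E_tendsto[OF t], 
        where w = "\<lambda>k x. c * (gauss (\<delta> + real (n k) * h k) (x - y) + real (n k) * (4 * (h k)\<^sup>2 / \<delta>^4))"])
    show "AE x in lborel. cmod (rep_L2 (S.E k t f) x) \<le> c * (gauss (\<delta> + real (n k) * h k) (x - y) + real (n k) * (4 * (h k)\<^sup>2 / \<delta>^4))" for k
      unfolding S.E_def n_def[symmetric] h_def[symmetric] by (rule step) (simp add: h_def)
    show "AE x in lborel. (\<lambda>k. c * (gauss (\<delta> + real (n k) * h k) (x - y) + real (n k) * (4 * (h k)\<^sup>2 / \<delta>^4)))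
        \<longlonglongrightarrow> c * (gauss (\<delta> + t) (x - y) + 0)"
    proof (rule AE_I2)
      fix x
      have "(\<lambda>k. gauss (\<delta> + real (n k) * h k) (x - y)) \<longlonglongrightarrow> gauss (\<delta> + t) (x - y)"
        using \<delta> t by (intro isCont_tendsto_compose[OF gauss_continuous] tendsto_add tendsto_const nh) auto
      \<comment> \<open>The accumulated error is a multiple of \<open>n * h^2 = (n * h) * h\<close>,
        where \<open>n * h\<close> tends to \<open>t\<close> and \<open>h\<close> to 0.\<close>
      moreover have "(\<lambda>k. (real (n k) * h k) * h k * (4 / \<delta>^4)) \<longlonglongrightarrow> t * 0 * (4 / \<delta>^4)"
        by (intro tendsto_intros nh h0)
      then have "(\<lambda>k. real (n k) * (4 * (h k)\<^sup>2 / \<delta>^4)) \<longlonglongrightarrow> 0"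
        by (simp add: power2_eq_square mult_ac)
      ultimately show "(\<lambda>k. c * (gauss (\<delta> + real (n k) * h k) (x - y) + real (n k) * (4 * (h k)\<^sup>2 / \<delta>^4)))
        \<longlonglongrightarrow> c * (gauss (\<delta> + t) (x - y) + 0)"
        by (intro tendsto_mult tendsto_const tendsto_add)
    qed
  qed
  then show ?thesis unfolding AB_operator_def S.exp_semigroup_eq[OF t] by simp
qed

section \<open>Dyadic cells\<close>

text \<open>Rounding down makes the cells half-open cubes, so that each level is an exact partition
  and the levels are nested; integer labels keep the cells countable.\<close>

definition dyadic :: "nat \<Rightarrow> real^4 \<Rightarrow> int^4" where
  "dyadic n x = (\<chi> i. \<lfloor>2^n * x $ i\<rfloor>)"

definition cell :: "nat \<Rightarrow> int^4 \<Rightarrow> (real^4) set" where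
  "cell n z = {x. dyadic n x = z}"

definition cell_center :: "nat \<Rightarrow> int^4 \<Rightarrow> real^4" where
  "cell_center n z = (\<chi> i. (of_int (z $ i) + 1/2) / 2^n)"

definition subcells :: "int^4 \<Rightarrow> (int^4) set" where
  "subcells z = {z'. \<forall>i. z' $ i div 2 = z $ i}"

lemma dyadic_coarser:
  assumes "n \<le> m"
  shows "dyadic n x = (\<chi> i. dyadic m x $ i div 2^(m - n))"
proof -
  have "\<lfloor>2^n * x $ i\<rfloor> = \<lfloor>2^m * x $ i\<rfloor> div 2^(m - n)" for i
  proof -
    have "(2::real)^m = 2^n * 2^(m - n)" using assms by (simp flip: power_add)
    then have "2^n * x $ i = (2^m * x $ i) / of_int (2^(m - n))" by simp
    then show ?thesis using floor_divide_real_eq_div[of "2^(m - n)" "2^m * x $ i"] by simp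
  qed
  then show ?thesis by (simp add: dyadic_def)
qed

lemma dyadic_coarser_cong: "n \<le> m \<Longrightarrow> dyadic m x = dyadic m y \<Longrightarrow> dyadic n x = dyadic n y"
  by (simp add: dyadic_coarser[of n m])

lemma dyadic_subcells: "dyadic n x = z \<longleftrightarrow> dyadic (Suc n) x \<in> subcells z"
  using dyadic_coarser[of n "Suc n" x] by (auto simp: subcells_def vec_eq_iff)

lemma finite_subcells: "finite (subcells z)"
proof (rule finite_subset)
  show "subcells z \<subseteq> vec_lambda ` (\<Pi>\<^sub>E i\<in>UNIV. {2 * z $ i, 2 * z $ i + 1})"
  proof
    fix z' assume z': "z' \<in> subcells z"
    have "z' $ i = 2 * z $ i \<or> z' $ i = 2 * z $ i + 1" for i
    proof -
      have "z' $ i div 2 = z $ i" using z' by (simp add: subcells_def)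
      then show ?thesis by linarith
    qed
    then have "vec_nth z' \<in> (\<Pi>\<^sub>E i\<in>UNIV. {2 * z $ i, 2 * z $ i + 1})" by auto
    then show "z' \<in> vec_lambda ` (\<Pi>\<^sub>E i\<in>UNIV. {2 * z $ i, 2 * z $ i + 1})"
      by (intro image_eqI[of _ _ "vec_nth z'"]) auto
  qed
qed (intro finite_imageI finite_PiE, auto)

lemma cell_eq: "cell n z = {x. \<forall>i. of_int (z $ i) \<le> 2^n * x $ i \<and> 2^n * x $ i < of_int (z $ i) + 1}"
  by (auto simp: cell_def dyadic_def vec_eq_iff floor_eq_iff)

lemma cell_sets [measurable]: "cell n z \<in> sets borel"
  unfolding cell_eq by measurable

lemma measurable_dyadic [measurable]: "dyadic n \<in> borel \<rightarrow>\<^sub>M count_space UNIV"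
proof -
  have "dyadic n -` {z} \<inter> space borel = cell n z" for z by (auto simp: cell_def)
  then show ?thesis by (simp add: measurable_count_space_eq2_countable)
qed

lemma emeasure_cell: "emeasure lborel (cell n z) = ennreal ((1/16)^n)"
proof -
  define a b :: "real^4" where "a = (\<chi> i. of_int (z $ i) / 2^n)" and "b = (\<chi> i. (of_int (z $ i) + 1) / 2^n)"
  have ab: "(b - a) \<bullet> e = (1/2)^n" "a \<bullet> e \<le> b \<bullet> e" if e: "e \<in> Basis" for e
  proof -
    from e obtain i where "e = axis i 1" by (auto simp: Basis_vec_def)
    then show 1: "(b - a) \<bullet> e = (1/2)^n" "a \<bullet> e \<le> b \<bullet> e"
      by (auto simp: a_def b_def inner_axis power_divide diff_divide_distrib[symmetric] divide_right_mono)
  qed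
  have vol: "(\<Prod>e\<in>Basis. (b - a) \<bullet> e) = (1/16)^n"
  proof -
    have "(\<Prod>e\<in>Basis. (b - a) \<bullet> e) = ((1/2)^n)^4" using ab by simp
    also have "\<dots> = ((1/2)^4)^n" by (simp only: power_mult[symmetric] mult.commute)
    also have "\<dots> = (1/16)^n" by (simp add: eval_nat_numeral)
    finally show ?thesis .
  qed
  have sub: "box a b \<subseteq> cell n z" "cell n z \<subseteq> cbox a b"
  proof -
    show "box a b \<subseteq> cell n z"
      by (auto simp: cell_eq a_def b_def mem_box_cart pos_divide_less_eq pos_less_divide_eq mult.commute less_imp_le)
    show "cell n z \<subseteq> cbox a b"
      by (auto simp: cell_eq a_def b_def mem_box_cart pos_divide_le_eq pos_le_divide_eq mult.commute less_imp_le)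
  qed
  have "emeasure lborel (box a b) \<le> emeasure lborel (cell n z)" "emeasure lborel (cell n z) \<le> emeasure lborel (cbox a b)"
    using sub by (auto intro!: emeasure_mono)
  moreover have "emeasure lborel (box a b) = ennreal ((1/16)^n)" "emeasure lborel (cbox a b) = ennreal ((1/16)^n)"
    using emeasure_lborel_box[OF ab(2)] emeasure_lborel_cbox[OF ab(2)] unfolding vol by auto
  ultimately show ?thesis by (simp add: antisym)
qed

lemma measure_cell: "measure lborel (cell n z) = (1/16)^n"
  by (simp add: measure_def emeasure_cell)

text \<open>Each coordinate is off by at most half a side, and four coordinates give
  \<open>4 * ((1/2) / 2^n)^2 = (1/4)^n\<close>, the value of \<open>\<delta>\<close> that is matched
  to level \<open>n\<close>.\<close>

lemma cell_center_dist:
  assumes "x \<in> cell n z"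
  shows "(x - cell_center n z) \<bullet> (x - cell_center n z) \<le> (1/4)^n"
proof -
  have "(x $ i - cell_center n z $ i)\<^sup>2 \<le> ((1/2) / 2^n)\<^sup>2" for i
  proof -
    have i: "of_int (z $ i) \<le> 2^n * x $ i" "2^n * x $ i < of_int (z $ i) + 1"
      using assms by (auto simp: cell_eq)
    define d where "d = x $ i - cell_center n z $ i"
    have "2^n * d = 2^n * x $ i - (of_int (z $ i) + 1/2)"
      by (simp add: d_def cell_center_def right_diff_distrib)
    then have "\<bar>2^n * d\<bar> \<le> 1/2" using i by linarith
    then have "2^n * \<bar>d\<bar> \<le> 1/2" by (simp add: abs_mult)
    then have "\<bar>d\<bar> \<le> (1/2) / 2^n" by (simp add: pos_le_divide_eq mult.commute)
    then have "\<bar>d\<bar>\<^sup>2 \<le> ((1/2) / 2^n)\<^sup>2" by (rule power_mono) simp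
    then show ?thesis by (simp add: d_def)
  qed
  then have "(\<Sum>i\<in>UNIV. (x $ i - cell_center n z $ i)\<^sup>2) \<le> (\<Sum>i\<in>(UNIV::4 set). ((1/2) / 2^n)\<^sup>2)"
    by (intro sum_mono)
  also have "\<dots> = (1/4)^n" by (simp add: power_divide power2_eq_square flip: power_mult_distrib)
  finally show ?thesis by (simp add: inner_vec_def power2_eq_square)
qed

lemma cell_dist:
  assumes "x \<in> cell n z" "y \<in> cell n z"
  shows "norm (x - y) \<le> 2 * (1/2)^n"
proof -
  have "norm (w - cell_center n z) \<le> (1/2)^n" if "w \<in> cell n z" for w
  proof (rule power2_le_imp_le)
    show "(norm (w - cell_center n z))\<^sup>2 \<le> ((1/2)^n)\<^sup>2"
    proof -
      have "((1/2)^n)\<^sup>2 = ((1/4)^n :: real)" by (simp add: power2_eq_square flip: power_mult_distrib)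
      then show ?thesis unfolding power2_norm_eq_inner using cell_center_dist[OF that] by simp
    qed
  qed simp
  from this[OF assms(1)] this[OF assms(2)] show ?thesis
    using norm_triangle_ineq4[of "x - cell_center n z" "y - cell_center n z"] by simp
qed

text \<open>Two cells are nested or disjoint; the empty set is added to close the family under
  intersection.\<close>

definition cells :: "(real^4) set set" where
  "cells = insert {} (range (\<lambda>(n, z). cell n z))"

lemma Int_stable_cells: "Int_stable cells"
proof -
  have *: "cell n z \<inter> cell m z' \<in> cells" if "n \<le> m" for n m z z'
  proof (cases "cell n z \<inter> cell m z' = {}")
    case False
    then obtain x where x: "x \<in> cell n z" "x \<in> cell m z'" by blast
    have "cell m z' \<subseteq> cell n z"
    proof
      fix y assume "y \<in> cell m z'"
      then have "dyadic m y = dyadic m x" using x(2) by (simp add: cell_def)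
      then have "dyadic n y = dyadic n x" by (rule dyadic_coarser_cong[OF that])
      then show "y \<in> cell n z" using x(1) by (simp add: cell_def)
    qed
    then show ?thesis by (auto simp: cells_def Int_absorb1)
  qed (simp add: cells_def)
  have "cell n z \<inter> cell m z' \<in> cells" for n m z z'
    using *[of n m z z'] *[of m n z' z] by (cases "n \<le> m") (auto simp: Int_commute)
  then show ?thesis by (auto simp: Int_stable_def cells_def)
qed

lemma sigma_sets_cells: "sets borel = sigma_sets UNIV cells"
proof
  show "sigma_sets UNIV cells \<subseteq> sets borel"
  proof -
    have "cells \<subseteq> sets borel" by (auto simp: cells_def)
    from sets.sigma_sets_subset[OF this] show ?thesis by simp
  qed
  have "U \<in> sigma_sets UNIV cells" if oU: "open U" for U
  proof -
    define I where "I = {p :: nat \<times> (int^4). cell (fst p) (snd p) \<subseteq> U}"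
    have "U = (\<Union>p\<in>I. cell (fst p) (snd p))"
    proof
      show "U \<subseteq> (\<Union>p\<in>I. cell (fst p) (snd p))"
      proof
        fix x assume "x \<in> U"
        then obtain r where r: "r > 0" "ball x r \<subseteq> U" using oU by (auto simp: open_contains_ball)
        obtain n where n: "(1/2)^n < r / 2" using real_arch_pow_inv[of "r/2" "1/2"] r(1) by auto
        have "cell n (dyadic n x) \<subseteq> ball x r"
        proof
          fix y assume "y \<in> cell n (dyadic n x)"
          then have "norm (x - y) \<le> 2 * (1/2)^n" by (intro cell_dist[of x n "dyadic n x"]) (auto simp: cell_def)
          then show "y \<in> ball x r" using n by (simp add: dist_norm)
        qed
        then have "(n, dyadic n x) \<in> I" using r by (auto simp: I_def)
        moreover have "x \<in> cell n (dyadic n x)" by (simp add: cell_def)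
        ultimately show "x \<in> (\<Union>p\<in>I. cell (fst p) (snd p))" by force
      qed
    qed (auto simp: I_def)
    moreover have "(\<Union>p\<in>I. cell (fst p) (snd p)) \<in> sigma_sets UNIV cells"
      by (rule sigma_sets_UNION) (auto simp: cells_def intro!: sigma_sets.Basic)
    ultimately show ?thesis by simp
  qed
  then have "sigma_sets UNIV {S :: (real^4) set. open S} \<subseteq> sigma_sets UNIV cells"
    by (intro sigma_sets_mono) auto
  then show "sets borel \<subseteq> sigma_sets UNIV cells"
    by (simp add: borel_def sets_measure_of)
qed

lemma cell_preimage: "{y. to_nat (dyadic n y) = i} \<in> cells"
proof (cases "\<exists>z::int^4. to_nat z = i")
  case True
  then obtain z :: "int^4" where "to_nat z = i" by blast
  then have "{y. to_nat (dyadic n y) = i} = cell n z" by (auto simp: cell_def)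
  then show ?thesis by (auto simp: cells_def)
next
  case False
  then have "{y. to_nat (dyadic n y) = i} = {}" by auto
  then show ?thesis by (simp add: cells_def)
qed

lemma AE_zero_of_cells:
  fixes f :: "real^4 \<Rightarrow> complex"
  assumes "f \<in> borel_measurable borel" "\<And>n z. integrable lborel (\<lambda>x. indicator (cell n z) x *\<^sub>R f x)"
    and "\<And>n z. (\<integral>x. indicator (cell n z) x *\<^sub>R f x \<partial>lborel) = 0"
  shows "AE x in lborel. f x = 0"
proof (rule AE_zero_of_pi_system[OF Int_stable_cells sigma_sets_cells assms(1)])
  show "{y. to_nat (dyadic 0 y) = i} \<in> cells" for i by (rule cell_preimage)
qed (use assms(2,3) in \<open>auto simp: cells_def\<close>)

text \<open>A single level suffices because its cells partition the space; global integrability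
  allows summation over them.\<close>

lemma integral_zero_of_cells:
  fixes f :: "real^4 \<Rightarrow> complex"
  assumes int: "integrable lborel f" and z: "\<And>z. (\<integral>x. indicator (cell n z) x *\<^sub>R f x \<partial>lborel) = 0"
  shows "(\<integral>x. f x \<partial>lborel) = 0"
proof -
  define A where "A i = {y. to_nat (dyadic n y) = i}" for i
  have A: "A i \<in> sets borel" for i unfolding A_def by measurable
  have U: "(\<Union>i. A i) = UNIV" by (auto simp: A_def)
  have "(LINT x:(\<Union>i. A i)|lborel. f x) = (\<Sum>i. (LINT x:(A i)|lborel. f x))"
    by (rule lebesgue_integral_countable_add) (use A int in \<open>auto simp: A_def U set_integrable_def\<close>)
  also have "(\<lambda>i. LINT x:(A i)|lborel. f x) = (\<lambda>i. 0)"
    unfolding set_lebesgue_integral_def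
  proof
    fix i
    show "(\<integral>x. indicator (A i) x *\<^sub>R f x \<partial>lborel) = 0"
  proof (cases "\<exists>z::int^4. to_nat z = i")
    case True
    then obtain w :: "int^4" where "to_nat w = i" by blast
    then have "A i = cell n w" by (auto simp: cell_def A_def)
    then show "(\<integral>x. indicator (A i) x *\<^sub>R f x \<partial>lborel) = 0" using z by simp
  next
    case False
    then have "A i = {}" by (auto simp: A_def)
    then show "(\<integral>x. indicator (A i) x *\<^sub>R f x \<partial>lborel) = 0" by simp
  qed
  qed
  finally show ?thesis by (simp add: U set_lebesgue_integral_def)
qed

lemma indicator_cell_subcells:
  "indicator (cell n z) x = (\<Sum>z'\<in>subcells z. indicator (cell (Suc n) z') x :: 'a::semiring_1)"
proof -
  have "(\<Sum>z'\<in>subcells z. indicator (cell (Suc n) z') x :: 'a) = (\<Sum>z'\<in>subcells z. if z' = dyadic (Suc n) x then 1 else 0)"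
    by (intro sum.cong) (auto simp: cell_def indicator_def)
  also have "\<dots> = (if dyadic (Suc n) x \<in> subcells z then 1 else 0)"
    using finite_subcells by (simp add: sum.delta')
  also have "\<dots> = indicator (cell n z) x"
    by (simp add: indicator_def cell_def dyadic_subcells)
  finally show ?thesis ..
qed

lemma square_integrable_cell: "square_integrable (indicator (cell n z))"
  by (intro square_integrable_indicator) (auto simp: emeasure_cell)

text \<open>A square integrable positive weight that is constant on the cells of every level, so that
  multiplying by it preserves the martingale property.\<close>

definition cell_weight :: "real^4 \<Rightarrow> real" where
  "cell_weight y = (1/2) ^ to_nat (dyadic 0 y)"

lemma cell_weight_pos: "cell_weight y > 0"
  by (simp add: cell_weight_def)

lemma measurable_cell_weight [measurable]: "cell_weight \<in> borel_measurable borel"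
proof -
  have "(\<lambda>z::int^4. (1/2::real) ^ to_nat z) \<in> count_space UNIV \<rightarrow>\<^sub>M borel" by simp
  from measurable_compose[OF measurable_dyadic this] show ?thesis
    by (simp add: cell_weight_def[abs_def])
qed

text \<open>The cells of level 0 have volume one and are enumerated by \<open>to_nat\<close>, so a
  geometric series bounds the integral; numbers that are not codes contribute empty sets.\<close>

lemma integrable_cell_weight_sq: "integrable lborel (\<lambda>y. (cell_weight y)\<^sup>2)"
proof -
  define A where "A i = {y. to_nat (dyadic 0 y) = i}" for i
  have A [measurable]: "A i \<in> sets borel" for i unfolding A_def by measurable
  have eA: "emeasure lborel (A i) \<le> 1" for i
    using cell_preimage[of 0 i] unfolding A_def[symmetric] by (auto simp: cells_def emeasure_cell power_le_one)
  have "ennreal ((cell_weight y)\<^sup>2) = (\<Sum>i. ennreal ((1/4)^i) * indicator (A i) y)" for y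
  proof -
    have "(\<Sum>i. ennreal ((1/4)^i) * indicator (A i) y) = (\<Sum>i\<in>{to_nat (dyadic 0 y)}. ennreal ((1/4)^i) * indicator (A i) y)"
      by (intro suminf_finite) (auto simp: A_def)
    also have "\<dots> = ennreal ((cell_weight y)\<^sup>2)"
      by (simp add: A_def cell_weight_def power2_eq_square flip: power_mult_distrib)
    finally show ?thesis ..
  qed
  then have "(\<integral>\<^sup>+y. ennreal ((cell_weight y)\<^sup>2) \<partial>lborel) = (\<integral>\<^sup>+y. (\<Sum>i. ennreal ((1/4)^i) * indicator (A i) y) \<partial>lborel)"
    by simp
  also have "\<dots> = (\<Sum>i. \<integral>\<^sup>+y. ennreal ((1/4)^i) * indicator (A i) y \<partial>lborel)"
    by (rule nn_integral_suminf) measurable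
  also have "\<dots> \<le> (\<Sum>i. ennreal ((1/4)^i))"
  proof (rule suminf_le)
    show "(\<integral>\<^sup>+y. ennreal ((1/4)^i) * indicator (A i) y \<partial>lborel) \<le> ennreal ((1/4)^i)" for i
      using mult_left_mono[OF eA[of i], of "ennreal ((1/4)^i)"] by (simp add: nn_integral_cmult_indicator)
  qed auto
  also have "\<dots> = ennreal (\<Sum>i. (1/4)^i)"
    by (rule suminf_ennreal2) (auto intro: summable_geometric)
  also have "\<dots> < \<infinity>" by simp
  finally show ?thesis by (intro integrableI_nonneg) auto
qed

section \<open>Square integrability of Gaussians\<close>

text \<open>The shell \<open>i \<le> norm z < i + 1\<close> lies in a cube of side
  \<open>2 * (i + 1)\<close>, and the values there are at most \<open>exp (- c * i^2)\<close>.
  Square integrability in \<open>y\<close> is what makes the action of the kernel an inner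
  product.\<close>

lemma integrable_gauss_sq:
  assumes t: "t > 0"
  shows "integrable lborel (\<lambda>y. (gauss t (x - y))\<^sup>2)"
proof -
  define c where "c = 1 / (2 * t)"
  have c: "c > 0" using t by (simp add: c_def)
  define g :: "real^4 \<Rightarrow> real" where "g z = exp (- c * (norm z)\<^sup>2)" for z
  have gm [measurable]: "g \<in> borel_measurable borel" unfolding g_def by measurable
  define A :: "nat \<Rightarrow> (real^4) set" where "A i = {z. nat \<lfloor>norm z\<rfloor> = i}" for i
  have A [measurable]: "A i \<in> sets borel" for i unfolding A_def by measurable
  have eA: "emeasure lborel (A i) \<le> ennreal ((2 * (real i + 1))^4)" for i
  proof -
    define b :: "real^4" where "b = (\<chi> j. real i + 1)"
    have "A i \<subseteq> cbox (- b) b"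
    proof
      fix z assume "z \<in> A i"
      then have "norm z < real i + 1" unfolding A_def by simp linarith
      then have "- real i - 1 \<le> z $ j \<and> z $ j \<le> real i + 1" for j using component_le_norm_cart[of z j] by linarith
      then show "z \<in> cbox (- b) b" by (simp add: mem_box_cart b_def)
    qed
    then have "emeasure lborel (A i) \<le> emeasure lborel (cbox (- b) b)" by (intro emeasure_mono) auto
    also have "\<dots> = ennreal (\<Prod>e\<in>Basis. (b - - b) \<bullet> e)"
      by (rule emeasure_lborel_cbox) (auto simp: Basis_vec_def inner_axis b_def)
    also have "(\<Prod>e\<in>Basis. (b - - b) \<bullet> e) = (\<Prod>e\<in>(Basis::(real^4) set). 2 * (real i + 1))"
      by (intro prod.cong) (auto simp: Basis_vec_def inner_axis b_def)
    finally show ?thesis by simp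
  qed
  have gA: "g z \<le> exp (- c * (real i)\<^sup>2)" if "z \<in> A i" for z i
  proof -
    have "real i \<le> norm z" using that unfolding A_def by (auto simp: of_nat_nat)
    then have "(real i)\<^sup>2 \<le> (norm z)\<^sup>2" by (intro power_mono) auto
    then show ?thesis using c by (simp add: g_def)
  qed
  have sm: "summable (\<lambda>i. exp (- c * (real i)\<^sup>2) * (2 * (real i + 1))^4)"
  proof (rule summable_comparison_test_bigo)
    show "summable (\<lambda>i. norm (1 / real i ^ 2))"
      using inverse_power_summable[of 2, where 'a = real] by (simp add: divide_inverse power_inverse)
    show "(\<lambda>i. exp (- c * (real i)\<^sup>2) * (2 * (real i + 1))^4) \<in> O(\<lambda>i. 1 / real i ^ 2)"
      using c by real_asymp
  qed
  have "(\<integral>\<^sup>+z. ennreal (g z) \<partial>lborel) \<le> (\<integral>\<^sup>+z. (\<Sum>i. ennreal (exp (- c * (real i)\<^sup>2)) * indicator (A i) z) \<partial>lborel)"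
  proof (rule nn_integral_mono)
    fix z :: "real^4"
    have "(\<Sum>i. ennreal (exp (- c * (real i)\<^sup>2)) * indicator (A i) z) = (\<Sum>i\<in>{nat \<lfloor>norm z\<rfloor>}. ennreal (exp (- c * (real i)\<^sup>2)) * indicator (A i) z)"
      by (intro suminf_finite) (auto simp: A_def)
    also have "\<dots> = ennreal (exp (- c * (real (nat \<lfloor>norm z\<rfloor>))\<^sup>2))" by (simp add: A_def)
    also have "\<dots> \<ge> ennreal (g z)" by (intro ennreal_leI gA) (simp add: A_def)
    finally show "ennreal (g z) \<le> (\<Sum>i. ennreal (exp (- c * (real i)\<^sup>2)) * indicator (A i) z)" .
  qed
  also have "\<dots> = (\<Sum>i. \<integral>\<^sup>+z. ennreal (exp (- c * (real i)\<^sup>2)) * indicator (A i) z \<partial>lborel)"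
    by (rule nn_integral_suminf) measurable
  also have "\<dots> \<le> (\<Sum>i. ennreal (exp (- c * (real i)\<^sup>2) * (2 * (real i + 1))^4))"
  proof (rule suminf_le)
    fix i
    show "(\<integral>\<^sup>+z. ennreal (exp (- c * (real i)\<^sup>2)) * indicator (A i) z \<partial>lborel) \<le> ennreal (exp (- c * (real i)\<^sup>2) * (2 * (real i + 1))^4)"
      using mult_left_mono[OF eA[of i], of "ennreal (exp (- c * (real i)\<^sup>2))"]
      by (simp add: nn_integral_cmult_indicator ennreal_mult)
  qed auto
  also have "\<dots> = ennreal (\<Sum>i. exp (- c * (real i)\<^sup>2) * (2 * (real i + 1))^4)"
    by (rule suminf_ennreal2[OF _ sm]) simp
  also have "\<dots> < \<infinity>" by simp
  finally have "integrable lborel g" by (intro integrableI_nonneg) (auto simp: g_def)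
  then have 1: "integrable (distr lborel borel ((+) (- x))) (\<lambda>z. g z)"
    by (simp add: lborel_distr_plus)
  have "integrable lborel (\<lambda>y. g (- x + y))"
    using 1 by (subst (asm) integrable_distr_eq) (auto simp: g_def)
  then have "integrable lborel (\<lambda>y. (1 / t^4) * g (- x + y))" by (rule integrable_mult_right)
  also have "(\<lambda>y. (1 / t^4) * g (- x + y)) = (\<lambda>y. (gauss t (x - y))\<^sup>2)"
  proof
    fix y
    have "norm (- x + y) = norm (x - y)" by (metis add.commute norm_minus_commute uminus_add_conv_diff)
    then have "(1 / t^4) * g (- x + y) = exp (2 * (- ((x - y) \<bullet> (x - y)) / (4 * t))) / t^4"
      by (simp add: g_def c_def power2_norm_eq_inner)
    also have "\<dots> = (gauss t (x - y))\<^sup>2"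
      unfolding gauss_def exp_double power_divide by simp
    finally show "(1 / t^4) * g (- x + y) = (gauss t (x - y))\<^sup>2" .
  qed
  finally show ?thesis .
qed

section \<open>Integral kernels of Gaussian dominated operators\<close>

lemma abs_L2_sum:
  assumes "\<And>i. i \<in> A \<Longrightarrow> square_integrable (f i)"
  shows "square_integrable (\<lambda>x. \<Sum>i\<in>A. f i x) \<and> (\<Sum>i\<in>A. abs_L2 (f i)) = abs_L2 (\<lambda>x. \<Sum>i\<in>A. f i x)"
  using assms
  by (induction A rule: infinite_finite_induct)
    (simp_all add: abs_L2_zero square_integrable_zero square_integrable_add abs_L2_add)

lemma rep_L2_sum: 
  "AE x in lborel. rep_L2 (\<Sum>i\<in>A. f i) x = (\<Sum>i\<in>A. rep_L2 (f i) x)"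
proof -
  have s: "square_integrable (\<lambda>x. \<Sum>i\<in>A. rep_L2 (f i) x)"
    and eq: "(\<Sum>i\<in>A. f i) = abs_L2 (\<lambda>x. \<Sum>i\<in>A. rep_L2 (f i) x)"
    using abs_L2_sum[of A "\<lambda>i. rep_L2 (f i)"] square_integrable_rep_L2 by (auto simp: abs_rep_L2)
  show ?thesis unfolding eq by (rule rep_abs_L2[OF s])
qed

lemma gauss_tendsto:
  assumes "s \<longlonglongrightarrow> S" "z \<longlonglongrightarrow> Z" "S > 0"
  shows "(\<lambda>n. gauss (s n) (z n)) \<longlonglongrightarrow> gauss S Z"
  unfolding gauss_def using assms by (intro tendsto_intros) auto

lemma gauss_le: "s > 0 \<Longrightarrow> gauss s z \<le> 1 / s\<^sup>2"
  unfolding gauss_def by (intro divide_right_mono) (auto simp: divide_nonneg_pos)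

lemma measurable_gauss [measurable]: 
  "(\<lambda>x. gauss s (f x)) \<in> borel_measurable M" if "f \<in> borel_measurable M"
  using that unfolding gauss_def by measurable

lemma cell_center_tendsto: "(\<lambda>n. cell_center n (dyadic n y)) \<longlonglongrightarrow> y"
proof -
  have "norm (cell_center n (dyadic n y) - y) \<le> (1/2)^n" for n
  proof (rule power2_le_imp_le)
    have "((1/2)^n)\<^sup>2 = ((1/4)^n :: real)" by (simp add: power2_eq_square flip: power_mult_distrib)
    then show "(norm (cell_center n (dyadic n y) - y))\<^sup>2 \<le> ((1/2)^n)\<^sup>2"
      unfolding norm_minus_commute[of _ y] power2_norm_eq_inner
      using cell_center_dist[of y n "dyadic n y"] by (simp add: cell_def)
  qed simp
  then have "(\<lambda>n. cell_center n (dyadic n y) - y) \<longlonglongrightarrow> 0"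
    by (intro Lim_null_comparison[OF always_eventually LIMSEQ_power_zero[of "1/2::real"]]) auto
  then show ?thesis by (rule LIM_zero_cancel)
qed

text \<open>The semigroup enters the construction of its kernel through these properties alone;
  \<open>dom\<close> covers every scale and every centre.\<close>

locale gauss_dominated =
  fixes T :: "(real^4) L2 \<Rightarrow> (real^4) L2" and t :: real
  assumes t: "t > 0" and lin: "bounded_linear T" 
    and clin: "T (cscale_L2 c f) = cscale_L2 c (T f)"
    and dom: "a > 0 \<Longrightarrow> \<delta> > 0 \<Longrightarrow> AE x in lborel. cmod (rep_L2 f x) \<le> a * gauss \<delta> (x - y) \<Longrightarrow>
       AE x in lborel. cmod (rep_L2 (T f) x) \<le> a * gauss (\<delta> + t) (x - y)"
begin

definition I :: "nat \<Rightarrow> int^4 \<Rightarrow> (real^4) L2" where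
  "I n z = abs_L2 (indicator (cell n z))"

lemma rep_I: "AE x in lborel. rep_L2 (I n z) x = indicator (cell n z) x"
  unfolding I_def by (rule rep_abs_L2[OF square_integrable_cell])

definition bd :: "nat \<Rightarrow> int^4 \<Rightarrow> real^4 \<Rightarrow> real" where
  "bd n z x = (exp (1/4) * (1/16)^n) * gauss ((1/4)^n + t) (x - cell_center n z)"

text \<open>With \<open>\<delta> = (1/4)^n\<close> the cell volume \<open>(1/16)^n\<close> is
  \<open>\<delta>^2\<close>, and on the cell the squared distance to the centre is at most
  \<open>\<delta>\<close>. So \<open>exp (1/4) * \<delta>^2 * gauss \<delta>\<close> is at least 1
  there, and domination applies to the indicator.\<close>

lemma T_I_bound: "AE x in lborel. cmod (rep_L2 (T (I n z)) x) \<le> bd n z x"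
  unfolding bd_def
proof (rule dom)
  show "AE x in lborel. cmod (rep_L2 (I n z) x) \<le> (exp (1/4) * (1/16)^n) * gauss ((1/4)^n) (x - cell_center n z)"
    using rep_I[of n z]
  proof eventually_elim
    case (elim x)
    define \<delta> :: real where "\<delta> = (1/4)^n"
    have \<delta>: "\<delta> > 0" by (simp add: \<delta>_def)
    have d2: "(1/16)^n = \<delta>\<^sup>2" by (simp add: \<delta>_def power2_eq_square flip: power_mult_distrib)
    have g: "(exp (1/4) * (1/16)^n) * gauss ((1/4)^n) (x - cell_center n z) 
       = exp (1/4 + - ((x - cell_center n z) \<bullet> (x - cell_center n z)) / (4 * \<delta>))"
      unfolding d2 \<delta>_def[symmetric] gauss_def exp_add using \<delta> by simp
    show ?case
    proof (cases "x \<in> cell n z")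
      case True
      have "(x - cell_center n z) \<bullet> (x - cell_center n z) / (4 * \<delta>) \<le> 1/4"
        using cell_center_dist[OF True] \<delta> by (simp add: \<delta>_def pos_divide_le_eq)
      then show ?thesis using True elim unfolding g by simp
    next
      case False
      then show ?thesis using elim unfolding g by simp
    qed
  qed
qed simp_all

lemma T_I_sub: "AE x in lborel. rep_L2 (T (I n z)) x = (\<Sum>z'\<in>subcells z. rep_L2 (T (I (Suc n) z')) x)"
proof -
  have "I n z = abs_L2 (\<lambda>x. \<Sum>z'\<in>subcells z. indicator (cell (Suc n) z') x)"
    unfolding I_def by (rule arg_cong[where f = abs_L2]) (rule ext, rule indicator_cell_subcells)
  also have "\<dots> = (\<Sum>z'\<in>subcells z. I (Suc n) z')"
    using abs_L2_sum[of "subcells z" "\<lambda>z'. indicator (cell (Suc n) z')"] square_integrable_cell by (simp add: I_def)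
  finally have "T (I n z) = (\<Sum>z'\<in>subcells z. T (I (Suc n) z'))"
    using linear_sum[OF bounded_linear.linear[OF lin]] by simp
  then show ?thesis using rep_L2_sum by simp
qed

text \<open>Countably many almost everywhere properties are gathered into one measurable set of full
  measure. On its complement \<open>R\<close> is put to 0, which keeps both the bounds and the
  additivity over subcells, so that these hold at every point.\<close>

definition good :: "real^4 \<Rightarrow> bool" where
  "good x \<longleftrightarrow> (\<forall>n z. cmod (rep_L2 (T (I n z)) x) \<le> bd n z x \<and>
     rep_L2 (T (I n z)) x = (\<Sum>z'\<in>subcells z. rep_L2 (T (I (Suc n) z')) x))"

lemma AE_good: "AE x in lborel. good x"
  unfolding good_def using T_I_bound T_I_sub by (simp add: AE_all_countable)

lemma measurable_good [measurable]: "Measurable.pred borel good"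
  unfolding good_def bd_def by measurable

definition R :: "nat \<Rightarrow> int^4 \<Rightarrow> real^4 \<Rightarrow> complex" where
  "R n z x = (if good x then rep_L2 (T (I n z)) x else 0)"

lemma measurable_R [measurable]: "R n z \<in> borel_measurable borel"
  unfolding R_def by measurable

lemma bd_nonneg: "bd n z x \<ge> 0"
  using gauss_pos[of "(1/4)^n + t"] t by (simp add: bd_def less_imp_le add_nonneg_pos)

lemma R_bound: "cmod (R n z x) \<le> bd n z x"
proof (cases "good x")
  case True
  then have "cmod (rep_L2 (T (I n z)) x) \<le> bd n z x" unfolding good_def by blast
  with True show ?thesis by (simp only: R_def if_True)
qed (simp add: R_def bd_nonneg)

lemma R_sub: "R n z x = (\<Sum>z'\<in>subcells z. R (Suc n) z' x)"
proof (cases "good x")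
  case True
  then have "rep_L2 (T (I n z)) x = (\<Sum>z'\<in>subcells z. rep_L2 (T (I (Suc n) z')) x)" unfolding good_def by blast
  with True show ?thesis by (simp only: R_def if_True)
qed (simp add: R_def)

lemma R_AE: "AE x in lborel. \<forall>n z. R n z x = rep_L2 (T (I n z)) x"
  using AE_good by eventually_elim (simp add: R_def)

text \<open>\<open>R n z x\<close> plays the role of the integral of the sought kernel over a cell
  in the second variable; division by the cell volume turns it into an average.\<close>

definition kn :: "nat \<Rightarrow> real^4 \<Rightarrow> real^4 \<Rightarrow> complex" where
  "kn n x y = 16^n * R n (dyadic n y) x"

lemma measurable_kn [measurable]:
  assumes [measurable]: "f \<in> M \<rightarrow>\<^sub>M borel" "g \<in> M \<rightarrow>\<^sub>M borel"
  shows "(\<lambda>p. kn n (f p) (g p)) \<in> borel_measurable M"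
proof -
  have "(\<lambda>p. R n (dyadic n (g p)) (f p)) \<in> borel_measurable M"
    by (rule measurable_compose_countable[where g = "\<lambda>p. dyadic n (g p)" and f = "\<lambda>z p. R n z (f p)"]) measurable
  then show ?thesis unfolding kn_def by measurable
qed

lemma kn_bound: "cmod (kn n x y) \<le> exp (1/4) * gauss ((1/4)^n + t) (x - cell_center n (dyadic n y))"
proof -
  have "cmod (kn n x y) \<le> 16^n * bd n (dyadic n y) x"
    unfolding kn_def norm_mult using R_bound by (intro mult_mono) (auto simp: norm_power)
  also have "\<dots> = (16 * (1/16))^n * (exp (1/4) * gauss ((1/4)^n + t) (x - cell_center n (dyadic n y)))"
    unfolding bd_def power_mult_distrib by (simp only: mult_ac)
  finally show ?thesis by simp
qed

definition M :: real where "M = exp (1/4) * (1 / t\<^sup>2)"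

lemma M_nonneg: "M \<ge> 0" by (simp add: M_def)

lemma kn_le_M: "cmod (kn n x y) \<le> M"
proof -
  have s: "(1/4)^n + t > 0" using t by (simp add: add_nonneg_pos)
  have "cmod (kn n x y) \<le> exp (1/4) * (1 / ((1/4)^n + t)\<^sup>2)"
    by (rule order_trans[OF kn_bound mult_left_mono[OF gauss_le[OF s]]]) simp
  also have "\<dots> \<le> exp (1/4) * (1 / t\<^sup>2)"
  proof -
    have "t\<^sup>2 \<le> ((1/4)^n + t)\<^sup>2" using t by (intro power_mono) auto
    then have "1 / ((1/4)^n + t)\<^sup>2 \<le> 1 / t\<^sup>2" using s t by (intro divide_left_mono mult_pos_pos) auto
    then show ?thesis by (intro mult_left_mono) auto
  qed
  finally show ?thesis by (simp add: M_def)
qed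

lemma integrable_cell_bounded:
  fixes h :: "real^4 \<Rightarrow> complex"
  assumes "h \<in> borel_measurable borel" "\<And>y. cmod (h y) \<le> B"
  shows "integrable lborel (\<lambda>y. indicator (cell n z) y *\<^sub>R h y)"
proof (rule Bochner_Integration.integrable_bound)
  show "integrable lborel (\<lambda>y. B * indicator (cell n z) y)"
    by (intro integrable_mult_right integrable_real_indicator) (auto simp: emeasure_cell)
  show "AE y in lborel. norm (indicator (cell n z) y *\<^sub>R h y) \<le> norm (B * indicator (cell n z) y)"
    using assms(2) by (intro AE_I2) (auto simp: indicator_def intro: order_trans[OF _ abs_ge_self])
qed (use assms(1) in measurable)

text \<open>The martingale property: a cell is split into subcells until level \<open>n + d\<close>
  is reached, where \<open>kn\<close> is constant on each cell, and additivity of \<open>R\<close>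
  reassembles the pieces.\<close>

lemma cell_integral_kn: "(\<integral>y. indicator (cell n z) y *\<^sub>R kn (n + d) x y \<partial>lborel) = R n z x"
proof (induction d arbitrary: n z)
  case 0
  have "(\<integral>y. indicator (cell n z) y *\<^sub>R kn n x y \<partial>lborel) = (\<integral>y. indicator (cell n z) y *\<^sub>R (16^n * R n z x) \<partial>lborel)"
    by (rule Bochner_Integration.integral_cong) (auto simp: kn_def cell_def indicator_def)
  also have "\<dots> = (1/16)^n *\<^sub>R (16^n * R n z x)"
    by (subst integral_scaleR_left) (auto simp: emeasure_cell measure_cell)
  also have "\<dots> = R n z x"
    by (simp add: scaleR_conv_of_real power_divide)
  finally show ?case by simp
next
  case (Suc d)
  have "(\<integral>y. indicator (cell n z) y *\<^sub>R kn (n + Suc d) x y \<partial>lborel)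
    = (\<integral>y. (\<Sum>z'\<in>subcells z. indicator (cell (Suc n) z') y *\<^sub>R kn (Suc n + d) x y) \<partial>lborel)"
    unfolding indicator_cell_subcells[of n z] by (simp add: scaleR_left.sum)
  also have "\<dots> = (\<Sum>z'\<in>subcells z. \<integral>y. indicator (cell (Suc n) z') y *\<^sub>R kn (Suc n + d) x y \<partial>lborel)"
    by (intro Bochner_Integration.integral_sum integrable_cell_bounded[where B = M] kn_le_M) measurable
  also have "\<dots> = R n z x" unfolding Suc R_sub[of n z] ..
  finally show ?case .
qed

lemma cell_integral_kn': "n \<le> m \<Longrightarrow> (\<integral>y. indicator (cell n z) y *\<^sub>R kn m x y \<partial>lborel) = R n z x"
  using cell_integral_kn[of n z "m - n" x] by simp

section \<open>The weighted averages as a martingale in the product space\<close>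

abbreviation cw :: "real^4 \<Rightarrow> real" where "cw \<equiv> cell_weight"

text \<open>The averages are uniformly bounded but need not be square integrable jointly in both
  variables, so a weight is applied in each.\<close>

definition F :: "nat \<Rightarrow> (real^4) \<times> (real^4) \<Rightarrow> complex" where
  "F n p = of_real (cw (fst p) * cw (snd p)) * kn n (fst p) (snd p)"

lemma measurable_F [measurable]: "F n \<in> borel_measurable borel"
  unfolding F_def borel_prod[symmetric] by measurable

lemma F_bound: "cmod (F n p) \<le> M * (cw (fst p) * cw (snd p))"
proof -
  have "0 < cw (fst p) * cw (snd p)" using cell_weight_pos by (intro mult_pos_pos)
  then have "cmod (F n p) = (cw (fst p) * cw (snd p)) * cmod (kn n (fst p) (snd p))"
    unfolding F_def norm_mult norm_of_real by (simp only: abs_of_pos)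
  also have "\<dots> \<le> (cw (fst p) * cw (snd p)) * M"
    using \<open>0 < cw (fst p) * cw (snd p)\<close> by (intro mult_left_mono kn_le_M less_imp_le)
  finally show ?thesis by (simp only: mult.commute)
qed

lemma F_bound_nonneg: "0 \<le> M * (cw x * cw y)"
  by (simp add: M_nonneg less_imp_le[OF cell_weight_pos])

lemma F_bound_mult: "norm (F m (x, y) * cnj (F n (x, y))) \<le> norm ((M\<^sup>2 * (cw x)\<^sup>2) * (cw y)\<^sup>2)"
proof -
  have "norm (F m (x, y) * cnj (F n (x, y))) \<le> (M * (cw x * cw y)) * (M * (cw x * cw y))"
    unfolding norm_mult complex_mod_cnj using F_bound[of m "(x, y)"] F_bound[of n "(x, y)"] F_bound_nonneg
    by (intro mult_mono) auto
  also have "\<dots> = norm ((M\<^sup>2 * (cw x)\<^sup>2) * (cw y)\<^sup>2)" by (simp add: power2_eq_square)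
  finally show ?thesis .
qed

lemma integrable_weights: "integrable lborel (\<lambda>p. (cw (fst p))\<^sup>2 * (cw (snd p))\<^sup>2)"
proof -
  have "integrable (lborel \<Otimes>\<^sub>M lborel) (\<lambda>p. (cw (fst p))\<^sup>2 * (cw (snd p))\<^sup>2)"
  proof (rule lborel_pair.Fubini_integrable)
    show "integrable lborel (\<lambda>x. \<integral>y. norm ((cw (fst (x, y)))\<^sup>2 * (cw (snd (x, y)))\<^sup>2) \<partial>lborel)"
      by (simp add: abs_mult integrable_cell_weight_sq)
    show "AE x in lborel. integrable lborel (\<lambda>y. (cw (fst (x, y)))\<^sup>2 * (cw (snd (x, y)))\<^sup>2)"
      by (simp add: integrable_cell_weight_sq)
  qed measurable
  then show ?thesis by (simp add: lborel_prod)
qed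

lemma integrable_FF: "integrable lborel (\<lambda>p. F m p * cnj (F n p))"
proof (rule Bochner_Integration.integrable_bound)
  show "integrable lborel (\<lambda>p. M\<^sup>2 * ((cw (fst p))\<^sup>2 * (cw (snd p))\<^sup>2))"
    by (intro integrable_mult_right integrable_weights)
  show "AE p in lborel. norm (F m p * cnj (F n p)) \<le> norm (M\<^sup>2 * ((cw (fst p))\<^sup>2 * (cw (snd p))\<^sup>2))"
  proof (rule AE_I2)
    fix p :: "(real^4) \<times> (real^4)"
    show "norm (F m p * cnj (F n p)) \<le> norm (M\<^sup>2 * ((cw (fst p))\<^sup>2 * (cw (snd p))\<^sup>2))"
      using F_bound_mult[of m "fst p" "snd p" n] by (simp add: mult.assoc)
  qed
qed measurable

lemma square_integrable_F: "square_integrable (F n)"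
proof -
  have "integrable lborel (\<lambda>p. Re (F n p * cnj (F n p)))" by (intro integrable_Re integrable_FF)
  moreover have "Re (F n p * cnj (F n p)) = (cmod (F n p))\<^sup>2" for p by (simp add: complex_mult_cnj cmod_power2)
  ultimately show ?thesis by (simp only: square_integrable_def measurable_F simp_thms)
qed

text \<open>On a cell of level \<open>n\<close> both \<open>F n\<close> and the weight are constant
  in \<open>y\<close>, as the cell lies in a cell of level 0. They can be pulled out, and the
  integrals of \<open>kn m\<close> and \<open>kn n\<close> over the cell coincide.\<close>

lemma martingale_section:
  assumes "n \<le> m"
  shows "(\<integral>y. F m (x, y) * cnj (F n (x, y)) \<partial>lborel) = (\<integral>y. F n (x, y) * cnj (F n (x, y)) \<partial>lborel)"
proof -
  have i: "integrable lborel (\<lambda>y. F j (x, y) * cnj (F n (x, y)))" for j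
  proof (rule Bochner_Integration.integrable_bound)
    show "integrable lborel (\<lambda>y. (M\<^sup>2 * (cw x)\<^sup>2) * (cw y)\<^sup>2)"
      by (intro integrable_mult_right integrable_cell_weight_sq)
    show "AE y in lborel. norm (F j (x, y) * cnj (F n (x, y))) \<le> norm ((M\<^sup>2 * (cw x)\<^sup>2) * (cw y)\<^sup>2)"
      by (intro AE_I2 F_bound_mult)
    have [measurable]: "(\<lambda>y. kn m x y) \<in> borel_measurable borel" for m
      by (rule measurable_kn) auto
    show "(\<lambda>y. F j (x, y) * cnj (F n (x, y))) \<in> borel_measurable lborel"
      unfolding F_def fst_conv snd_conv by measurable
  qed
  have "(\<integral>y. F m (x, y) * cnj (F n (x, y)) - F n (x, y) * cnj (F n (x, y)) \<partial>lborel) = 0"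
  proof (rule integral_zero_of_cells[where n = n])
    fix z
    obtain a where a: "\<And>y. y \<in> cell n z \<Longrightarrow> of_real (cw x * cw y) * cnj (F n (x, y)) = a"
    proof (cases "\<exists>y. y \<in> cell n z")
      case True
      then obtain y0 where y0: "dyadic n y0 = z" by (auto simp: cell_def)
      have "of_real (cw x * cw y) * cnj (F n (x, y)) = of_real (cw x * cw y0) * cnj (F n (x, y0))" if "y \<in> cell n z" for y
      proof -
        have y: "dyadic n y = dyadic n y0" using that y0 by (simp add: cell_def)
        have "dyadic 0 y = dyadic 0 y0" by (rule dyadic_coarser_cong[OF le0 y])
        with y show ?thesis by (simp add: F_def kn_def cell_weight_def)
      qed
      then show ?thesis using that by blast
    next
      case False
      then show ?thesis using that[of 0] by blast
    qed
    have "(\<integral>y. indicator (cell n z) y *\<^sub>R (F m (x, y) * cnj (F n (x, y)) - F n (x, y) * cnj (F n (x, y))) \<partial>lborel)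
      = (\<integral>y. (indicator (cell n z) y *\<^sub>R kn m x y - indicator (cell n z) y *\<^sub>R kn n x y) * a \<partial>lborel)"
    proof (rule Bochner_Integration.integral_cong)
      fix y
      show "indicator (cell n z) y *\<^sub>R (F m (x, y) * cnj (F n (x, y)) - F n (x, y) * cnj (F n (x, y)))
        = (indicator (cell n z) y *\<^sub>R kn m x y - indicator (cell n z) y *\<^sub>R kn n x y) * a"
      proof (cases "y \<in> cell n z")
        case True
        have "F j (x, y) * cnj (F n (x, y)) = kn j x y * a" for j
          unfolding a[OF True, symmetric] by (simp add: F_def[of j] mult_ac)
        then show ?thesis using True by (simp add: left_diff_distrib)
      qed simp
    qed simp
    also have "\<dots> = (\<integral>y. indicator (cell n z) y *\<^sub>R kn m x y - indicator (cell n z) y *\<^sub>R kn n x y \<partial>lborel) * a"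
      by (rule integral_mult_left_zero)
    also have "(\<integral>y. indicator (cell n z) y *\<^sub>R kn m x y - indicator (cell n z) y *\<^sub>R kn n x y \<partial>lborel) = R n z x - R n z x"
    proof (subst Bochner_Integration.integral_diff)
      show "integrable lborel (\<lambda>y. indicator (cell n z) y *\<^sub>R kn j x y)" for j
        by (rule integrable_cell_bounded[where B = M]) (measurable, rule kn_le_M)
      then show "integrable lborel (\<lambda>y. indicator (cell n z) y *\<^sub>R kn n x y)" .
    qed (simp add: cell_integral_kn' assms)
    finally show "(\<integral>y. indicator (cell n z) y *\<^sub>R (F m (x, y) * cnj (F n (x, y)) - F n (x, y) * cnj (F n (x, y))) \<partial>lborel) = 0" by simp
  qed (intro Bochner_Integration.integrable_diff i)
  then show ?thesis using i by simp
qed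

definition K :: "nat \<Rightarrow> ((real^4) \<times> (real^4)) L2" where
  "K n = abs_L2 (F n)"

lemma cinner_K:
  assumes "n \<le> m" shows "cinner_L2 (K m) (K n) = of_real ((norm (K n))\<^sup>2)"
proof -
  have fub: "cinner_L2 (K j) (K n) = (\<integral>x. \<integral>y. F j (x, y) * cnj (F n (x, y)) \<partial>lborel \<partial>lborel)" for j
  proof -
    have "cinner_L2 (K j) (K n) = (\<integral>p. F j p * cnj (F n p) \<partial>lborel)"
      unfolding K_def by (rule cinner_abs_L2[OF square_integrable_F square_integrable_F])
    also have "\<dots> = (\<integral>p. F j p * cnj (F n p) \<partial>(lborel \<Otimes>\<^sub>M lborel))" by (simp only: lborel_prod)
    also have "\<dots> = (\<integral>x. \<integral>y. F j (x, y) * cnj (F n (x, y)) \<partial>lborel \<partial>lborel)"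
      by (rule lborel_pair.integral_fst'[symmetric]) (simp only: lborel_prod integrable_FF)
    finally show ?thesis .
  qed
  show ?thesis unfolding cinner_self[symmetric] fub martingale_section[OF assms] ..
qed

lemma norm_K_diff:
  assumes "n \<le> m" shows "(norm (K m - K n))\<^sup>2 = (norm (K m))\<^sup>2 - (norm (K n))\<^sup>2"
proof -
  have "inner (K m) (K n) = (norm (K n))\<^sup>2" using cinner_K[OF assms] by (simp add: inner_L2_def)
  then show ?thesis unfolding power2_norm_eq_inner by (simp add: inner_diff inner_commute)
qed

text \<open>Increments are orthogonal to earlier terms, so squared distances are differences of
  squared norms; these norms increase and are bounded.\<close>

lemma Cauchy_K: "Cauchy K"
proof -
  define B where "B = (\<integral>p. M\<^sup>2 * ((cw (fst p))\<^sup>2 * (cw (snd p))\<^sup>2) \<partial>(lborel :: ((real^4) \<times> (real^4)) measure))"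
  have "(norm (K n))\<^sup>2 \<le> B" for n
    unfolding K_def norm_abs_L2_sq[OF square_integrable_F] B_def
  proof (rule integral_mono)
    show "integrable lborel (\<lambda>p. (cmod (F n p))\<^sup>2)" using square_integrable_F[of n] by (simp add: square_integrable_def)
    show "integrable lborel (\<lambda>p. M\<^sup>2 * ((cw (fst p))\<^sup>2 * (cw (snd p))\<^sup>2))"
      by (intro integrable_mult_right integrable_weights)
    show "(cmod (F n p))\<^sup>2 \<le> M\<^sup>2 * ((cw (fst p))\<^sup>2 * (cw (snd p))\<^sup>2)" for p
      using power_mono[OF F_bound[of n p], of 2] by (simp add: power_mult_distrib)
  qed
  moreover have "incseq (\<lambda>n. (norm (K n))\<^sup>2)"
  proof (rule incseq_SucI)
    show "(norm (K n))\<^sup>2 \<le> (norm (K (Suc n)))\<^sup>2" for n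
      using norm_K_diff[of n "Suc n"] zero_le_power2[of "norm (K (Suc n) - K n)"] by simp
  qed
  ultimately obtain L where "(\<lambda>n. (norm (K n))\<^sup>2) \<longlonglongrightarrow> L"
    using incseq_convergent[of "\<lambda>n. (norm (K n))\<^sup>2" B] by blast
  then have c: "Cauchy (\<lambda>n. (norm (K n))\<^sup>2)" by (rule LIMSEQ_imp_Cauchy)
  show ?thesis
  proof (rule metric_CauchyI)
    fix e :: real assume "e > 0"
    then have "e\<^sup>2 > 0" by simp
    from metric_CauchyD[OF c this] obtain N where N: "\<And>m n. m \<ge> N \<Longrightarrow> n \<ge> N \<Longrightarrow> dist ((norm (K m))\<^sup>2) ((norm (K n))\<^sup>2) < e\<^sup>2"
      by blast
    have *: "dist (K m) (K n) < e" if "n \<le> m" "n \<ge> N" for m n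
    proof (rule power2_less_imp_less)
      have "(dist (K m) (K n))\<^sup>2 = (norm (K m))\<^sup>2 - (norm (K n))\<^sup>2"
        unfolding dist_norm by (rule norm_K_diff[OF that(1)])
      also have "\<dots> < e\<^sup>2" using N[of m n] that unfolding dist_real_def by simp
      finally show "(dist (K m) (K n))\<^sup>2 < e\<^sup>2" .
    qed (use \<open>e > 0\<close> in simp)
    have "dist (K m) (K n) < e" if "m \<ge> N" "n \<ge> N" for m n
      using *[of n m] *[of m n] that by (cases "n \<le> m") (auto simp: dist_commute)
    then show "\<exists>N. \<forall>m\<ge>N. \<forall>n\<ge>N. dist (K m) (K n) < e" by blast
  qed
qed

text \<open>A subsequence converging almost everywhere is enough here in place of full martingale
  convergence; the weights are positive and can be divided out.\<close>

lemma kn_convergent_subseq: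
  "\<exists>r::nat \<Rightarrow> nat. strict_mono r \<and> (AE p in lborel \<Otimes>\<^sub>M lborel. convergent (\<lambda>m. kn (r m) (fst p) (snd p)))"
proof -
  obtain r :: "nat \<Rightarrow> nat" where r: "strict_mono r" and ae: "AE p in lborel. convergent (\<lambda>m. rep_L2 (K (r m)) p)"
    using Cauchy_L2_AE_subseq[OF Cauchy_K] by auto
  have "AE p in lborel. \<forall>n. rep_L2 (K n) p = F n p"
    unfolding AE_all_countable K_def by (intro allI rep_abs_L2 square_integrable_F)
  with ae have "AE p in lborel. convergent (\<lambda>m. kn (r m) (fst p) (snd p))"
  proof eventually_elim
    case (elim p)
    define a where "a = complex_of_real (cw (fst p) * cw (snd p))"
    have a: "a \<noteq> 0" using cell_weight_pos[of "fst p"] cell_weight_pos[of "snd p"] by (simp add: a_def)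
    have "convergent (\<lambda>m. F (r m) p)" using elim by simp
    then have "convergent (\<lambda>m. a * kn (r m) (fst p) (snd p))" by (simp only: F_def a_def)
    then show ?case using convergent_mult_const_iff[OF a] by simp
  qed
  with r show ?thesis unfolding lborel_prod by blast
qed

section \<open>Construction of the kernel\<close>

lemma section_square_integrable:
  fixes k :: "real^4 \<Rightarrow> real^4 \<Rightarrow> complex"
  assumes "(\<lambda>y. k x y) \<in> borel_measurable borel" "\<And>y. cmod (k x y) \<le> exp (1/4) * gauss t (x - y)"
  shows "square_integrable (\<lambda>y. k x y)"
proof -
  have "integrable lborel (\<lambda>y. (cmod (k x y))\<^sup>2)"
  proof (rule Bochner_Integration.integrable_bound)
    show "integrable lborel (\<lambda>y. (exp (1/4))\<^sup>2 * (gauss t (x - y))\<^sup>2)"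
      by (intro integrable_mult_right integrable_gauss_sq t)
    show "AE y in lborel. norm ((cmod (k x y))\<^sup>2) \<le> norm ((exp (1/4))\<^sup>2 * (gauss t (x - y))\<^sup>2)"
      using power_mono[OF assms(2) norm_ge_zero, where n = 2] by (intro AE_I2) (simp add: power_mult_distrib)
  qed (use assms(1) in measurable)
  then show ?thesis using assms(1) by (simp add: square_integrable_def)
qed

lemma kernel_exists_cells:
  "\<exists>k. (\<lambda>(x, y). k x y) \<in> borel_measurable (borel \<Otimes>\<^sub>M borel) \<and>
     (\<forall>x y. cmod (k x y) \<le> exp (1/4) * gauss t (x - y)) \<and>
     (\<forall>n z. AE x in lborel. rep_L2 (T (I n z)) x = (\<integral>y. indicator (cell n z) y *\<^sub>R k x y \<partial>lborel))"
proof -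
  obtain r :: "nat \<Rightarrow> nat" where r: "strict_mono r" 
    and ae: "AE p in lborel \<Otimes>\<^sub>M lborel. convergent (\<lambda>m. kn (r m) (fst p) (snd p))"
    using kn_convergent_subseq by blast
  define l where "l x y = lim (\<lambda>m. kn (r m) x y)" for x y
  \<comment> \<open>Values violating the bound, as \<open>lim\<close> may take where there is no
    convergence, are replaced by 0, so the bound holds everywhere. Where the averages converge
    nothing changes: their bounds tend to the required one since the cell centres tend to
    \<open>y\<close>.\<close>
  define k where "k x y = (if cmod (l x y) \<le> exp (1/4) * gauss t (x - y) then l x y else 0)" for x y
  have lm: "(\<lambda>p. l (fst p) (snd p)) \<in> borel_measurable (borel \<Otimes>\<^sub>M borel)"
    unfolding l_def by (intro borel_measurable_lim_metric measurable_kn) measurable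
  have km: "(\<lambda>(x, y). k x y) \<in> borel_measurable (borel \<Otimes>\<^sub>M borel)"
    unfolding k_def case_prod_beta' using lm by measurable
  have kb: "cmod (k x y) \<le> exp (1/4) * gauss t (x - y)" for x y
    using gauss_pos[OF t, of "x - y"] by (simp add: k_def less_imp_le)
  have lim: "(\<lambda>m. kn (r m) x y) \<longlonglongrightarrow> k x y" if "convergent (\<lambda>m. kn (r m) x y)" for x y
  proof -
    have l: "(\<lambda>m. kn (r m) x y) \<longlonglongrightarrow> l x y" using that by (simp add: l_def convergent_LIMSEQ_iff)
    have "(\<lambda>n. (1/4)^n + t) \<longlonglongrightarrow> 0 + t" by (intro tendsto_intros LIMSEQ_power_zero) simp
    then have "(\<lambda>n. exp (1/4) * gauss ((1/4)^n + t) (x - cell_center n (dyadic n y))) \<longlonglongrightarrow> exp (1/4) * gauss t (x - y)"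
      using t by (intro tendsto_mult tendsto_const gauss_tendsto tendsto_diff cell_center_tendsto) auto
    from LIMSEQ_subseq_LIMSEQ[OF this r]
    have "(\<lambda>m. exp (1/4) * gauss ((1/4)^r m + t) (x - cell_center (r m) (dyadic (r m) y))) \<longlonglongrightarrow> exp (1/4) * gauss t (x - y)"
      by (simp add: o_def)
    from LIMSEQ_le[OF tendsto_norm[OF l] this] kn_bound
    have "cmod (l x y) \<le> exp (1/4) * gauss t (x - y)" by blast
    with l show ?thesis by (simp add: k_def)
  qed
  have "AE x in lborel. AE y in lborel. convergent (\<lambda>m. kn (r m) x y)"
    using lborel_pair.AE_pair[OF ae] by simp
  then have conv: "AE x in lborel. AE y in lborel. (\<lambda>m. kn (r m) x y) \<longlonglongrightarrow> k x y"
    by eventually_elim (auto elim!: eventually_mono intro: lim)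
  have "AE x in lborel. rep_L2 (T (I n z)) x = (\<integral>y. indicator (cell n z) y *\<^sub>R k x y \<partial>lborel)" for n z
    using conv R_AE
  proof eventually_elim
    case (elim x)
    have kx: "(\<lambda>y. k x y) \<in> borel_measurable borel" using measurable_compose[OF measurable_Pair1' km, of x] by simp
    have "(\<lambda>m. \<integral>y. indicator (cell n z) y *\<^sub>R kn (r m) x y \<partial>lborel) \<longlonglongrightarrow> (\<integral>y. indicator (cell n z) y *\<^sub>R k x y \<partial>lborel)"
    proof (rule integral_dominated_convergence[where w = "\<lambda>y. M * indicator (cell n z) y"])
      show "(\<lambda>y. indicator (cell n z) y *\<^sub>R k x y) \<in> borel_measurable lborel" using kx by measurable
      show "integrable lborel (\<lambda>y. M * indicator (cell n z) y)"
        by (intro integrable_mult_right integrable_real_indicator) (auto simp: emeasure_cell)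
      show "AE y in lborel. (\<lambda>m. indicator (cell n z) y *\<^sub>R kn (r m) x y) \<longlonglongrightarrow> indicator (cell n z) y *\<^sub>R k x y"
        using elim(1) by eventually_elim (intro tendsto_intros)
      show "AE y in lborel. norm (indicator (cell n z) y *\<^sub>R kn (r m) x y) \<le> M * indicator (cell n z) y" for m
        using kn_le_M by (intro AE_I2) (auto simp: indicator_def)
    qed measurable
    \<comment> \<open>By the martingale property the sequence is constant as soon as
      \<open>r m\<close> has reached level \<open>n\<close>.\<close>
    moreover have "(\<lambda>m. \<integral>y. indicator (cell n z) y *\<^sub>R kn (r m) x y \<partial>lborel) \<longlonglongrightarrow> R n z x"
    proof (rule tendsto_eventually, rule eventually_sequentiallyI[of n])
      fix m assume "n \<le> m"
      then have "n \<le> r m" using seq_suble[OF r, of m] by simp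
      then show "(\<integral>y. indicator (cell n z) y *\<^sub>R kn (r m) x y \<partial>lborel) = R n z x" by (rule cell_integral_kn')
    qed
    ultimately show ?case using LIMSEQ_unique elim(2) by fastforce
  qed
  with km kb show ?thesis by blast
qed

end

section \<open>Representation on the whole space, uniqueness and the bound\<close>

context gauss_dominated
begin

context
  fixes k :: "real^4 \<Rightarrow> real^4 \<Rightarrow> complex"
  assumes km: "(\<lambda>(x, y). k x y) \<in> borel_measurable (borel \<Otimes>\<^sub>M borel)"
    and kb: "\<And>x y. cmod (k x y) \<le> exp (1/4) * gauss t (x - y)"
    and kc: "\<And>n z. AE x in lborel. rep_L2 (T (I n z)) x = (\<integral>y. indicator (cell n z) y *\<^sub>R k x y \<partial>lborel)"
begin

lemma section_measurable: "(\<lambda>y. k x y) \<in> borel_measurable borel"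
  using measurable_compose[OF measurable_Pair1' km, of x] by simp

text \<open>The conjugate compensates for the antilinearity of \<open>cinner_L2\<close> in its
  second argument; the action of the kernel at a fixed \<open>x\<close> becomes a continuous
  functional of \<open>f\<close>.\<close>

definition section_cnj :: "real^4 \<Rightarrow> (real^4) L2" where
  "section_cnj x = abs_L2 (\<lambda>y. cnj (k x y))"

lemma sq_section_cnj: "square_integrable (\<lambda>y. cnj (k x y))"
  by (rule section_square_integrable[of "\<lambda>x y. cnj (k x y)"]) (use section_measurable kb in auto)

lemma kernel_action:
  assumes "square_integrable g"
  shows "integrable lborel (\<lambda>y. k x y * g y)" "(\<integral>y. k x y * g y \<partial>lborel) = cinner_L2 (abs_L2 g) (section_cnj x)"
  using square_integrable_mult_cnj[OF assms sq_section_cnj[of x]] 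
    cinner_abs_L2[OF assms sq_section_cnj[of x]]
  by (simp_all add: section_cnj_def mult.commute)

text \<open>The exceptional null set may depend on \<open>f\<close>, so the representation is
  extended from cells by showing that this set is a closed subspace, rather than by an argument at a
  fixed \<open>x\<close>.\<close>

definition represented :: "(real^4) L2 set" where
  "represented = {f. AE x in lborel. rep_L2 (T f) x = cinner_L2 f (section_cnj x)}"

lemma represented_add: "f \<in> represented \<Longrightarrow> g \<in> represented \<Longrightarrow> f + g \<in> represented"
  unfolding represented_def mem_Collect_eq
proof -
  assume "AE x in lborel. rep_L2 (T f) x = cinner_L2 f (section_cnj x)"
    "AE x in lborel. rep_L2 (T g) x = cinner_L2 g (section_cnj x)"
  moreover have "T (f + g) = T f + T g" using lin by (rule bounded_linear.linear[THEN linear_add])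
  then have "AE x in lborel. rep_L2 (T (f + g)) x = rep_L2 (T f) x + rep_L2 (T g) x"
    using rep_L2_add[of "T f" "T g"] by simp
  ultimately show "AE x in lborel. rep_L2 (T (f + g)) x = cinner_L2 (f + g) (section_cnj x)"
    by eventually_elim (simp add: cinner_add_left)
qed

lemma represented_cscale: "f \<in> represented \<Longrightarrow> cscale_L2 c f \<in> represented"
  unfolding represented_def mem_Collect_eq
proof -
  assume "AE x in lborel. rep_L2 (T f) x = cinner_L2 f (section_cnj x)"
  moreover have "AE x in lborel. rep_L2 (T (cscale_L2 c f)) x = c * rep_L2 (T f) x"
    unfolding clin by (rule rep_L2_cscale)
  ultimately show "AE x in lborel. rep_L2 (T (cscale_L2 c f)) x = cinner_L2 (cscale_L2 c f) (section_cnj x)"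
    by eventually_elim (simp add: cinner_cscale_left)
qed

lemma represented_cell: "I n z \<in> represented"
  unfolding represented_def mem_Collect_eq
  using kc[of n z]
proof eventually_elim
  case (elim x)
  have "cinner_L2 (I n z) (section_cnj x) = (\<integral>y. k x y * indicator (cell n z) y \<partial>lborel)"
    unfolding I_def by (rule kernel_action(2)[OF square_integrable_cell, symmetric])
  also have "\<dots> = (\<integral>y. indicator (cell n z) y *\<^sub>R k x y \<partial>lborel)"
    by (rule Bochner_Integration.integral_cong) (auto simp: indicator_def)
  finally show ?case using elim by simp
qed

text \<open>On the left a subsequence converging almost everywhere is extracted; the right side
  converges at every \<open>x\<close>, being an inner product with a fixed vector.\<close>

lemma represented_closed:
  assumes "\<And>n. X n \<in> represented" "X \<longlonglongrightarrow> f"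
  shows "f \<in> represented"
proof -
  have "(\<lambda>n. T (X n)) \<longlonglongrightarrow> T f" by (rule bounded_linear.tendsto[OF lin assms(2)])
  then obtain r :: "nat \<Rightarrow> nat" where r: "strict_mono r"
    and ae: "AE x in lborel. (\<lambda>n. rep_L2 (T (X (r n))) x) \<longlonglongrightarrow> rep_L2 (T f) x"
    using L2_tendsto_AE_subseq[of "\<lambda>n. T (X n)" "T f"] by blast
  have "AE x in lborel. \<forall>n. rep_L2 (T (X n)) x = cinner_L2 (X n) (section_cnj x)"
    unfolding AE_all_countable using assms(1) by (simp add: represented_def)
  with ae show ?thesis
    unfolding represented_def mem_Collect_eq
  proof eventually_elim
    case (elim x)
    have "(\<lambda>n. X (r n)) \<longlonglongrightarrow> f" using LIMSEQ_subseq_LIMSEQ[OF assms(2) r] by (simp add: o_def)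
    then have "(\<lambda>n. cinner_L2 (X (r n)) (section_cnj x)) \<longlonglongrightarrow> cinner_L2 f (section_cnj x)"
      by (intro cinner_tendsto tendsto_const)
    with elim show ?case using LIMSEQ_unique by simp
  qed
qed

lemma represented_UNIV: "represented = UNIV"
proof -
  have "closure represented = UNIV"
  proof (rule dense_if_orthogonal_trivial)
    show "subspace represented"
      unfolding subspace_def
    proof (intro conjI ballI allI)
      show "0 \<in> represented" using represented_cscale[OF represented_cell, of "of_real 0"] unfolding cscale_of_real by simp
      show "u + v \<in> represented" if "u \<in> represented" "v \<in> represented" for u v using represented_add that .
      show "c *\<^sub>R u \<in> represented" if "u \<in> represented" for c u
        using represented_cscale[OF that, of "of_real c"] unfolding cscale_of_real .
    qed
    fix f assume f: "\<And>\<psi>. \<psi> \<in> represented \<Longrightarrow> inner f \<psi> = 0"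
    have i: "integrable lborel (\<lambda>y. indicator (cell n z) y *\<^sub>R rep_L2 f y)" 
      and zero: "(\<integral>y. indicator (cell n z) y *\<^sub>R rep_L2 f y \<partial>lborel) = 0" for n z
    proof -
      have eq: "rep_L2 f y * cnj (indicator (cell n z) y) = indicator (cell n z) y *\<^sub>R rep_L2 f y" for y
        by (simp add: indicator_def)
      show "integrable lborel (\<lambda>y. indicator (cell n z) y *\<^sub>R rep_L2 f y)"
        using square_integrable_mult_cnj[OF square_integrable_rep_L2[of f] square_integrable_cell[of n z]] unfolding eq .
      have "cinner_L2 f (I n z) = (\<integral>y. indicator (cell n z) y *\<^sub>R rep_L2 f y \<partial>lborel)"
        using cinner_abs_L2[OF square_integrable_rep_L2[of f] square_integrable_cell[of n z]] unfolding eq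
        by (simp add: I_def abs_rep_L2)
      moreover have "Re (cinner_L2 f (I n z)) = 0" using f[OF represented_cell] by (simp add: inner_L2_def)
      moreover have "Im (cinner_L2 f (I n z)) = 0"
        using f[OF represented_cscale[OF represented_cell, of \<i>]] by (simp add: inner_L2_def cinner_cscale_right)
      ultimately show "(\<integral>y. indicator (cell n z) y *\<^sub>R rep_L2 f y \<partial>lborel) = 0" by (simp add: complex_eq_iff)
    qed
    have "AE y in lborel. rep_L2 f y = 0" by (rule AE_zero_of_cells[OF borel_measurable_rep_L2 i zero])
    with rep_L2_zero[where 'a = "real^4"] have "AE y in lborel. rep_L2 f y = rep_L2 0 y"
      by eventually_elim simp
    then show "f = 0" by (rule L2_eqI_AE)
  qed
  then have "f \<in> represented" for f
    using closure_sequential[of f represented] represented_closed by blast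
  then show ?thesis by blast
qed

lemma is_integral_kernel_k: "is_integral_kernel T k"
  unfolding is_integral_kernel_def
proof (intro conjI allI km)
  fix f
  have eq: "(\<integral>y. k x y * rep_L2 f y \<partial>lborel) = cinner_L2 f (section_cnj x)" for x
    using kernel_action(2)[OF square_integrable_rep_L2[of f], of x] by (simp add: abs_rep_L2)
  have "AE x in lborel. rep_L2 (T f) x = cinner_L2 f (section_cnj x)"
    using represented_UNIV by (auto simp: represented_def)
  then show "AE x in lborel. integrable lborel (\<lambda>y. k x y * rep_L2 f y) \<and> rep_L2 (T f) x = (\<integral>y. k x y * rep_L2 f y \<partial>lborel)"
    by eventually_elim (simp add: eq kernel_action(1)[OF square_integrable_rep_L2])
qed

text \<open>Both kernels are compared on the countably many cells: for almost every \<open>x\<close>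
  their sections have the same integral over each cell. Integrability of the unknown section over
  cells is part of its being a kernel.\<close>

lemma kernel_unique:
  assumes k': "is_integral_kernel T k'"
  shows "AE x in lborel. AE y in lborel. k' x y = k x y"
proof -
  have m': "(\<lambda>(x, y). k' x y) \<in> borel_measurable (borel \<Otimes>\<^sub>M borel)"
    using k' by (simp add: is_integral_kernel_def)
  have "AE x in lborel. \<forall>n z. integrable lborel (\<lambda>y. k' x y * rep_L2 (I n z) y) \<and>
        rep_L2 (T (I n z)) x = (\<integral>y. k' x y * rep_L2 (I n z) y \<partial>lborel)"
    using k' by (simp add: is_integral_kernel_def AE_all_countable)
  moreover have "AE x in lborel. \<forall>n z. rep_L2 (T (I n z)) x = (\<integral>y. indicator (cell n z) y *\<^sub>R k x y \<partial>lborel)"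
    using kc by (simp add: AE_all_countable)
  ultimately show ?thesis
  proof eventually_elim
    case (elim x)
    have mx [measurable]: "(\<lambda>y. k' x y) \<in> borel_measurable borel"
      using measurable_compose[OF measurable_Pair1' m', of x] by simp
    have [measurable]: "(\<lambda>y. k x y) \<in> borel_measurable borel" by (rule section_measurable)
    have ae: "AE y in lborel. k' x y * rep_L2 (I n z) y = indicator (cell n z) y *\<^sub>R k' x y" for n z
      using rep_I[of n z] by eventually_elim (simp add: indicator_def)
    have i': "integrable lborel (\<lambda>y. indicator (cell n z) y *\<^sub>R k' x y)" for n z
      using elim(1) by (subst integrable_cong_AE[OF _ _ ae[of n z], symmetric]) auto
    have e': "(\<integral>y. k' x y * rep_L2 (I n z) y \<partial>lborel) = (\<integral>y. indicator (cell n z) y *\<^sub>R k' x y \<partial>lborel)" for n z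
      by (rule integral_cong_AE[OF _ _ ae]) auto
    have i: "integrable lborel (\<lambda>y. indicator (cell n z) y *\<^sub>R k x y)" for n z
    proof -
      have "integrable lborel (\<lambda>y. k x y * indicator (cell n z) y)" by (rule kernel_action(1)[OF square_integrable_cell])
      also have "(\<lambda>y. k x y * indicator (cell n z) y) = (\<lambda>y. indicator (cell n z) y *\<^sub>R k x y)"
        by (auto simp: indicator_def)
      finally show ?thesis .
    qed
    have "AE y in lborel. k' x y - k x y = 0"
    proof (rule AE_zero_of_cells)
      show "integrable lborel (\<lambda>y. indicator (cell n z) y *\<^sub>R (k' x y - k x y))" for n z
        unfolding scaleR_right_diff_distrib by (rule Bochner_Integration.integrable_diff[OF i' i])
      show "(\<integral>y. indicator (cell n z) y *\<^sub>R (k' x y - k x y) \<partial>lborel) = 0" for n z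
        unfolding scaleR_right_diff_distrib Bochner_Integration.integral_diff[OF i' i]
        using elim by (simp add: e')
    qed measurable
    then show ?case by eventually_elim simp
  qed
qed

text \<open>Joint measurability of both sides turns the iterated almost everywhere statement into
  one for the product measure.\<close>

lemma kernel_bound:
  assumes k': "is_integral_kernel T k'"
  shows "AE (x, y) in lborel \<Otimes>\<^sub>M lborel. cmod (k' x y) \<le> exp (1/4) * gauss t (x - y)"
proof -
  have m' [measurable]: "(\<lambda>p. k' (fst p) (snd p)) \<in> borel_measurable (lborel \<Otimes>\<^sub>M lborel)"
    using k' by (simp add: is_integral_kernel_def case_prod_beta' cong: measurable_cong_sets)
  have "AE x in lborel. AE y in lborel. cmod (k' x y) \<le> exp (1/4) * gauss t (x - y)"
    using kernel_unique[OF k']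
  proof eventually_elim
    case (elim x)
    then show ?case by eventually_elim (simp add: kb)
  qed
  moreover have "{p \<in> space (lborel \<Otimes>\<^sub>M lborel). cmod (k' (fst p) (snd p)) \<le> exp (1/4) * gauss t (fst p - snd p)} \<in> sets (lborel \<Otimes>\<^sub>M lborel)"
    by measurable
  ultimately have "AE p in lborel \<Otimes>\<^sub>M lborel. cmod (k' (fst p) (snd p)) \<le> exp (1/4) * gauss t (fst p - snd p)"
    by (intro lborel_pair.AE_pair_measure) simp_all
  then show ?thesis by (simp add: case_prod_beta')
qed

end

theorem gauss_dominated_kernel:
  "(\<exists>k. is_integral_kernel T k) \<and>
   (\<forall>k. is_integral_kernel T k \<longrightarrow> (AE (x, y) in lborel \<Otimes>\<^sub>M lborel. cmod (k x y) \<le> exp (1/4) * gauss t (x - y)))"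
  using kernel_exists_cells is_integral_kernel_k kernel_bound by blast

end

text \<open>The witness \<open>exp (1/4)\<close> depends on neither \<open>t\<close> nor
  \<open>\<alpha>\<close>. Existence of a kernel is part of the claim, so the bound is not
  vacuous.\<close>

theorem theorem1p7:
  fixes \<alpha> :: real
  shows "\<exists>C::real. \<forall>t>0.
    (\<exists>k. is_integral_kernel (exp_semigroup (AB_operator \<alpha>) t) k) \<and>
    (\<forall>k. is_integral_kernel (exp_semigroup (AB_operator \<alpha>) t) k \<longrightarrow>
      (AE (x, y) in lborel \<Otimes>\<^sub>M lborel.
        cmod (k x y) \<le> C * t powi (-2) * exp (- (norm (x - y))\<^sup>2 / (4 * t))))"
proof (rule exI[of _ "exp (1/4)"], intro allI impI)
  fix t :: real assume t: "t > 0"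
  interpret S: nonneg_symmetric "minimal_AB_operator \<alpha>" by (rule nonneg_symmetric_AB)
  have eq: "exp_semigroup (AB_operator \<alpha>) t = S.T t"
    unfolding AB_operator_def using t by (intro ext S.exp_semigroup_eq) simp
  interpret gauss_dominated "exp_semigroup (AB_operator \<alpha>) t" t
  proof (rule gauss_dominated.intro)
    show "bounded_linear (exp_semigroup (AB_operator \<alpha>) t)" unfolding eq using t by (intro S.T_linear) simp
    show "exp_semigroup (AB_operator \<alpha>) t (cscale_L2 c f) = cscale_L2 c (exp_semigroup (AB_operator \<alpha>) t f)" for c f
      unfolding eq using t by (intro S.T_cscale) simp
  qed (use t semigroup_gauss_bound in auto)
  have p: "t powi (-2) = 1 / t\<^sup>2" by (simp add: power_int_minus divide_inverse)
  have b: "exp (1/4) * t powi (-2) * exp (- (norm (x - y))\<^sup>2 / (4 * t)) = exp (1/4) * gauss t (x - y)" for x y :: "real^4"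
    unfolding gauss_def power2_norm_eq_inner p by simp
  show "(\<exists>k. is_integral_kernel (exp_semigroup (AB_operator \<alpha>) t) k) \<and>
    (\<forall>k. is_integral_kernel (exp_semigroup (AB_operator \<alpha>) t) k \<longrightarrow>
      (AE (x, y) in lborel \<Otimes>\<^sub>M lborel.
        cmod (k x y) \<le> exp (1/4) * t powi (-2) * exp (- (norm (x - y))\<^sup>2 / (4 * t))))"
    unfolding b by (rule gauss_dominated_kernel)
qed

end
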